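(* If a $2$-nondegenerate CR structure of hypersurface type (with constant CR symbol $\mathfrak g^0$) has a constant modified symbol $\mathfrak g^{0,\mathrm{mod}}$, then the CR structure has a regular CR symbol and the modified symbol equals the CR symbol, i.e. $\mathfrak g^{0,\mathrm{mod}}=\mathfrak g^0=\mathfrak g_-\oplus\mathfrak g_{0,-2}\oplus\mathfrak g_{0,2}\oplus\mathfrak g_{0,0}$ as subspaces of $\mathfrak g_-\rtimes\mathfrak{csp}(\mathfrak g_{-1})$.
   Context: CR structures. All objects are real-analytic and all considerations are local. A CR structure of hypersurface type on a $(2n+1)$-dimensional real manifold $M$ is a complex rank $n$ subbundle $H\subset\mathbb{C}TM$ with $[H,H]\subset H$, $H\cap\overline H=0$. $K$ is the kernel of the Levi form $\mathcal L(X_p,Y_p)=\frac i2[X,\overline Y]_p\bmod H_p\oplus\overline H_p$, assumed of constant rank $r$. For $v\in K_p$, $\mathrm{ad}_v:\overline H_p/\overline K_p\to H_p/K_p$ is $y\mapsto[V,Y]_p\bmod K_p\oplus\overline H_p$ ($V\in\Gamma(K)$, $Y\in\Gamma(\overline H)$ extending $v,y$); for $v\in\overline K_p$, $\mathrm{ad}_v:H_p/K_p\to\overline H_p/\overline K_p$ is defined analogously. $2$-nondegenerate: $K\ne0$ and $\mathrm{ad}_v\neq0$ for all $0\ne v\in K_p$ and all $p$. Complexification. Locally $M$ is the fixed point set of an antiholomorphic involution $\tau$ of a complexification $\mathbb CM$; $H,K$ extend holomorphically to $\mathbb CM$, $\overline H:=\tau_*H$, $\overline K:=\tau_*K$. $\mathcal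 N=\mathbb CM/\mathrm{Fol}(K\oplus\overline K)$ is the Levi leaf space, $\pi:\mathbb CM\to\mathcal N$, and $\mathcal D=\pi_*(H\oplus\overline H)$ is a contact distribution. For $p\in\mathbb CM$, $\gamma=\pi(p)$: $\mathfrak g_{-1}(p)=\mathcal D_\gamma$, $\mathfrak g_{-2}(p)=T_\gamma\mathcal N/\mathcal D_\gamma$, $\mathfrak g_-(p)=\mathfrak g_{-2}(p)\oplus\mathfrak g_{-1}(p)$ is the Heisenberg algebra with bracket induced by Lie bracket of sections of $\mathcal D$; $\mathfrak g_{-1,1}(p)=\pi_*H_p\cong H_p/K_p$, $\mathfrak g_{-1,-1}(p)=\pi_*\overline H_p\cong\overline H_p/\overline K_p$; $\mathfrak g_{0,2}(p)=\{\mathrm{ad}_v:v\in K_p\}$, $\mathfrak g_{0,-2}(p)=\{\mathrm{ad}_v:v\in\overline K_p\}$, extended by zero on the other summand, as subspaces of $\mathfrak{csp}(\mathfrak g_{-1}(p))$. CR symbol. A CR symbol (with involution) is given by: a $2(n-r)$-dimensional complex conformal symplectic space $\mathfrak g_{-1}$ with antilinear involution $\sigma$; a splitting $\mathfrak g_{-1}=\mathfrak g_{-1,-1}\oplus\mathfrak g_{-1,1}$ into Lagrangian subspaces with $\sigma(\mathfrak g_{-1,-1})=\mathfrak g_{-1,1}$; $r$-dimensional subspaces $\mathfrak g_{0,\pm2}\subset\mathfrak{csp}(\mathfrak g_{-1})$, where elements of $\mathfrak g_{0,\pm2}$ map $\mathfrak g_{-1,\mp1}$ to $\mathfrak g_{-1,\pm1}$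 and vanish on $\mathfrak g_{-1,\pm1}$, interchanged by $\varphi\mapsto\sigma\varphi\sigma$. $\mathfrak g_-=\mathfrak g_{-2}\oplus\mathfrak g_{-1}$ is the Heisenberg algebra of $\mathfrak g_{-1}$, on which $\mathfrak{csp}(\mathfrak g_{-1})$ acts by degree-zero derivations. $\mathfrak g_{0,0}$ is the maximal subalgebra of $\mathfrak{csp}(\mathfrak g_{-1})$ preserving $\mathfrak g_{-1,\pm1}$ and with $[\mathfrak g_{0,0},\mathfrak g_{0,\pm2}]\subset\mathfrak g_{0,\pm2}$; $\mathfrak g^0=\mathfrak g_-\oplus\mathfrak g_{0,-2}\oplus\mathfrak g_{0,0}\oplus\mathfrak g_{0,2}$. The symbol is regular if $[\mathfrak g_{0,-2},\mathfrak g_{0,2}]\subset\mathfrak g_{0,0}$, equivalently $\mathfrak g^0$ is a Lie subalgebra of $\mathfrak g_-\rtimes\mathfrak{csp}(\mathfrak g_{-1})$. The CR structure has constant symbol $\mathfrak g^0$ if at every point $p$ the data $\mathfrak g_-(p),\mathfrak g_{-1,\pm1}(p),\mathfrak g_{0,\pm2}(p)$ are isomorphic to those of $\mathfrak g^0$ (compatibly with the involutions for $p\in M$). Frames and modified symbols. $\mathrm{pr}:P^0\to\mathbb CM$ has fiber over $p$ consisting of all graded Lie algebra isomorphisms $\varphi:\mathfrak g_-\to\mathfrak g_-(p)$ with $\varphi(\mathfrak g_{-1,\pm1})=\mathfrak g_{-1,\pm1}(p)$ and $\varphi^{-1}\mathfrak g_{0,\pm2}(p)\varphi=\mathfrak g_{0,\pm2}$.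 For $\gamma\in\mathcal N$ let $(P^0)_\gamma=(\pi\circ\mathrm{pr})^{-1}(\gamma)$; its elements are maps into the fixed space $\mathcal D_\gamma\oplus T_\gamma\mathcal N/\mathcal D_\gamma$, and for a curve $\psi(t)$ in $(P^0)_\gamma$ put $\theta_0(\psi'(0))=\psi(0)^{-1}\circ\frac{d}{dt}\big|_{t=0}\psi(t)\in\mathfrak{csp}(\mathfrak g_{-1})$. The modified symbol at $\psi\in(P^0)_\gamma$ is $\mathfrak g^{0,\mathrm{mod}}(\psi)=\mathfrak g_-\oplus\mathfrak g_0^{\mathrm{mod}}(\psi)$ with $\mathfrak g_0^{\mathrm{mod}}(\psi)=\theta_0(T_\psi(P^0)_\gamma)$. The structure has constant modified symbol $\mathfrak g^{0,\mathrm{mod}}$ if $\mathfrak g^{0,\mathrm{mod}}(\psi)=\mathfrak g^{0,\mathrm{mod}}$ for every $\psi\in P^0$. *)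

theory Defs
  imports
    "HOL-Analysis.Analysis"
    "HOL-Library.Set_Algebras"
    "HOL-Library.Function_Algebras"
begin

text \<open>
  Everything is local, so \<open>M\<close> is an open subset of \<open>real ^ 'n\<close>, its complexified tangent spaces
  are all \<open>complex ^ 'n\<close>, and a complexification of \<open>M\<close> is an open subset of \<open>complex ^ 'n\<close> whose
  antiholomorphic involution is the componentwise conjugation.  Quotient spaces \<open>V / Q\<close> are
  represented by cosets \<open>v +o Q\<close>; the zero coset is \<open>Q\<close> itself.
\<close>

section \<open>Fields and subbundles\<close>

definition cvec :: "real ^ 'n \<Rightarrow> complex ^ 'n"
  where "cvec x = (\<chi> i. complex_of_real (x $ i))"

definition cnjv :: "complex ^ 'n \<Rightarrow> complex ^ 'n"
  where "cnjv v = (\<chi> i. cnj (v $ i))"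

definition Rev :: "complex ^ 'n \<Rightarrow> real ^ 'n"
  where "Rev v = (\<chi> i. Re (v $ i))"

definition Imv :: "complex ^ 'n \<Rightarrow> real ^ 'n"
  where "Imv v = (\<chi> i. Im (v $ i))"

abbreviation clinear :: "(complex ^ 'a \<Rightarrow> complex ^ 'b) \<Rightarrow> bool"
  where "clinear \<equiv> Vector_Spaces.linear (*s) (*s)"

definition holo_on :: "(complex ^ 'a \<Rightarrow> complex ^ 'b) \<Rightarrow> (complex ^ 'a) set \<Rightarrow> bool"
  where "holo_on f U \<longleftrightarrow>
    open U \<and> (\<forall>p\<in>U. \<exists>A. (f has_derivative A) (at p) \<and> clinear A)"

text \<open>Real-analytic means: locally the restriction of a holomorphic map, just as \<open>analytic_on\<close>
  is defined through holomorphy on a neighbourhood.\<close>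

definition ranalytic_on :: "(real ^ 'a \<Rightarrow> complex ^ 'b) \<Rightarrow> (real ^ 'a) set \<Rightarrow> bool"
  where "ranalytic_on f W \<longleftrightarrow>
    open W \<and> (\<forall>p\<in>W. \<exists>V F. cvec p \<in> V \<and> holo_on F V \<and>
      (\<forall>q\<in>W. cvec q \<in> V \<longrightarrow> f q = F (cvec q)))"

definition ranalytic_subbundle ::
    "nat \<Rightarrow> (real ^ 'n) set \<Rightarrow> (real ^ 'n \<Rightarrow> (complex ^ 'n) set) \<Rightarrow> bool"
  where "ranalytic_subbundle k M E \<longleftrightarrow>
    (\<forall>p\<in>M. \<exists>W X. p \<in> W \<and> W \<subseteq> M \<and> (\<forall>i<k. ranalytic_on (X i) W) \<and> open W \<and>
      (\<forall>q\<in>W. vec.span ((\<lambda>i::nat. X i q) ` {..<k}) = E q \<and> vec.dim (E q) = k))"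

definition holo_subbundle ::
    "nat \<Rightarrow> (complex ^ 'n) set \<Rightarrow> (complex ^ 'n \<Rightarrow> (complex ^ 'n) set) \<Rightarrow> bool"
  where "holo_subbundle k U E \<longleftrightarrow>
    (\<forall>p\<in>U. \<exists>V X. p \<in> V \<and> V \<subseteq> U \<and> (\<forall>i<k. holo_on (X i) V) \<and> open V \<and>
      (\<forall>q\<in>V. vec.span ((\<lambda>i::nat. X i q) ` {..<k}) = E q \<and> vec.dim (E q) = k))"

text \<open>Local sections defined near a point.\<close>

definition rsections ::
    "(real ^ 'n) set \<Rightarrow> (real ^ 'n \<Rightarrow> (complex ^ 'n) set) \<Rightarrow> real ^ 'n \<Rightarrow> (real ^ 'n \<Rightarrow> complex ^ 'n) set"
  where "rsections M E p =
    {X. \<exists>W. p \<in> W \<and> W \<subseteq> M \<and> ranalytic_on X W \<and> (\<forall>q\<in>W. X q \<in> E q)}"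

definition hsections ::
    "(complex ^ 'n) set \<Rightarrow> (complex ^ 'n \<Rightarrow> (complex ^ 'n) set) \<Rightarrow> complex ^ 'n
      \<Rightarrow> (complex ^ 'n \<Rightarrow> complex ^ 'n) set"
  where "hsections U E p =
    {X. \<exists>V. p \<in> V \<and> V \<subseteq> U \<and> holo_on X V \<and> (\<forall>q\<in>V. X q \<in> E q)}"

text \<open>A complex tangent vector \<open>v\<close> of \<open>real ^ 'n\<close> differentiates as \<open>Re v + i Im v\<close>.\<close>

definition rderiv :: "(real ^ 'n \<Rightarrow> complex ^ 'n) \<Rightarrow> real ^ 'n \<Rightarrow> complex ^ 'n \<Rightarrow> complex ^ 'n"
  where "rderiv X p v =
    frechet_derivative X (at p) (Rev v) + \<i> *s frechet_derivative X (at p) (Imv v)"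

definition rbracket ::
    "(real ^ 'n \<Rightarrow> complex ^ 'n) \<Rightarrow> (real ^ 'n \<Rightarrow> complex ^ 'n) \<Rightarrow> real ^ 'n \<Rightarrow> complex ^ 'n"
  where "rbracket X Y p = rderiv Y p (X p) - rderiv X p (Y p)"

definition hbracket ::
    "(complex ^ 'n \<Rightarrow> complex ^ 'n) \<Rightarrow> (complex ^ 'n \<Rightarrow> complex ^ 'n) \<Rightarrow> complex ^ 'n \<Rightarrow> complex ^ 'n"
  where "hbracket X Y p =
    frechet_derivative Y (at p) (X p) - frechet_derivative X (at p) (Y p)"

text \<open>The class of \<open>br V Y p\<close> modulo \<open>Q\<close>, for sections \<open>V\<close>, \<open>Y\<close> extending the vectors \<open>v\<close>, \<open>y\<close>
  at \<open>p\<close>.  In all uses below this class does not depend on the extensions.\<close>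

definition bracket_class ::
    "(('x \<Rightarrow> 'v) \<Rightarrow> ('x \<Rightarrow> 'v) \<Rightarrow> 'x \<Rightarrow> 'v) \<Rightarrow> ('x \<Rightarrow> 'v) set \<Rightarrow> ('x \<Rightarrow> 'v) set \<Rightarrow> 'v set
      \<Rightarrow> 'x \<Rightarrow> 'v \<Rightarrow> 'v \<Rightarrow> 'v::plus set"
  where "bracket_class br \<Gamma>1 \<Gamma>2 Q p v y =
    (THE c. \<exists>V\<in>\<Gamma>1. \<exists>Y\<in>\<Gamma>2. V p = v \<and> Y p = y \<and> c = br V Y p +o Q)"


section \<open>CR structures of hypersurface type\<close>

definition conj_bundle :: "(real ^ 'n \<Rightarrow> (complex ^ 'n) set) \<Rightarrow> real ^ 'n \<Rightarrow> (complex ^ 'n) set"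
  where "conj_bundle E p = cnjv ` E p"

definition cr_structure ::
    "nat \<Rightarrow> (real ^ 'n) set \<Rightarrow> (real ^ 'n \<Rightarrow> (complex ^ 'n) set) \<Rightarrow> bool"
  where "cr_structure n M H \<longleftrightarrow>
    CARD('n) = 2 * n + 1 \<and> open M \<and> M \<noteq> {} \<and> ranalytic_subbundle n M H \<and>
    (\<forall>p\<in>M. \<forall>X\<in>rsections M H p. \<forall>Y\<in>rsections M H p. rbracket X Y p \<in> H p) \<and>
    (\<forall>p\<in>M. H p \<inter> conj_bundle H p = {0})"

text \<open>The Levi form at \<open>p\<close>, with values in the quotient by \<open>H p + conj_bundle H p\<close>.\<close>

definition levi_form ::
    "(real ^ 'n) set \<Rightarrow> (real ^ 'n \<Rightarrow> (complex ^ 'n) set) \<Rightarrow> real ^ 'n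
      \<Rightarrow> complex ^ 'n \<Rightarrow> complex ^ 'n \<Rightarrow> (complex ^ 'n) set"
  where "levi_form M H p =
    bracket_class (\<lambda>X Y q. (\<i> / 2) *s rbracket X (\<lambda>x. cnjv (Y x)) q)
      (rsections M H p) (rsections M H p) (H p + conj_bundle H p) p"

definition levi_kernel ::
    "(real ^ 'n) set \<Rightarrow> (real ^ 'n \<Rightarrow> (complex ^ 'n) set) \<Rightarrow> real ^ 'n \<Rightarrow> (complex ^ 'n) set"
  where "levi_kernel M H p =
    {v \<in> H p. \<forall>w\<in>H p. levi_form M H p v w = H p + conj_bundle H p}"

definition levi_kernel_rank ::
    "nat \<Rightarrow> (real ^ 'n) set \<Rightarrow> (real ^ 'n \<Rightarrow> (complex ^ 'n) set) \<Rightarrow> bool"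
  where "levi_kernel_rank r M H \<longleftrightarrow> (\<forall>p\<in>M. vec.dim (levi_kernel M H p) = r)"

text \<open>\<open>ad\<^sub>v\<close> for \<open>v\<close> in the Levi kernel, as a function of a representative \<open>y\<close> of a class in
  \<open>conj H / conj K\<close>.  The target \<open>H / K\<close> is identified with \<open>(H + conj H) / (K + conj H)\<close>.\<close>

definition ad_real ::
    "(real ^ 'n) set \<Rightarrow> (real ^ 'n \<Rightarrow> (complex ^ 'n) set) \<Rightarrow> real ^ 'n
      \<Rightarrow> complex ^ 'n \<Rightarrow> complex ^ 'n \<Rightarrow> (complex ^ 'n) set"
  where "ad_real M H p =
    bracket_class rbracket (rsections M (levi_kernel M H) p) (rsections M (conj_bundle H) p)
      (levi_kernel M H p + conj_bundle H p) p"

definition two_nondegenerate ::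
    "(real ^ 'n) set \<Rightarrow> (real ^ 'n \<Rightarrow> (complex ^ 'n) set) \<Rightarrow> bool"
  where "two_nondegenerate M H \<longleftrightarrow>
    (\<forall>p\<in>M. levi_kernel M H p \<noteq> {0} \<and>
      (\<forall>v\<in>levi_kernel M H p. v \<noteq> 0 \<longrightarrow>
        (\<exists>y\<in>conj_bundle H p. ad_real M H p v y \<noteq> levi_kernel M H p + conj_bundle H p)))"


section \<open>Complexification and Levi leaf space\<close>

text \<open>\<open>cmfd\<close> is the complexified manifold, \<open>holH\<close> and \<open>holK\<close> are the holomorphic extensions of
  \<open>H\<close> and of the Levi kernel, and \<open>leafproj\<close> is the projection to the Levi leaf space, which is
  coordinatised as an open subset of \<open>complex ^ 'm\<close>.\<close>

record ('n, 'm) complexified =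
  cmfd :: "(complex ^ ('n::finite)) set"
  holH :: "complex ^ 'n \<Rightarrow> (complex ^ 'n) set"
  holK :: "complex ^ 'n \<Rightarrow> (complex ^ 'n) set"
  leafproj :: "complex ^ 'n \<Rightarrow> complex ^ ('m::finite)"

text \<open>The push-forward of a distribution under the involution \<open>cnjv\<close>.\<close>

definition tau_push :: "(complex ^ 'n \<Rightarrow> (complex ^ 'n) set) \<Rightarrow> complex ^ 'n \<Rightarrow> (complex ^ 'n) set"
  where "tau_push E p = cnjv ` E (cnjv p)"

abbreviation holHbar :: "('n::finite, 'm::finite) complexified \<Rightarrow> complex ^ 'n \<Rightarrow> (complex ^ 'n) set"
  where "holHbar C \<equiv> tau_push (holH C)"

abbreviation holKbar :: "('n::finite, 'm::finite) complexified \<Rightarrow> complex ^ 'n \<Rightarrow> (complex ^ 'n) set"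
  where "holKbar C \<equiv> tau_push (holK C)"

text \<open>Every component of the complexification meets \<open>M\<close>, so that the extensions are determined by
  their restrictions to \<open>M\<close>.\<close>

definition complexification ::
    "nat \<Rightarrow> nat \<Rightarrow> (real ^ 'n) set \<Rightarrow> (real ^ 'n \<Rightarrow> (complex ^ 'n) set)
      \<Rightarrow> ('n::finite, 'm::finite) complexified \<Rightarrow> bool"
  where "complexification n r M H C \<longleftrightarrow>
    open (cmfd C) \<and> cnjv ` cmfd C = cmfd C \<and> cvec -` cmfd C = M \<and>
    (\<forall>B\<in>components (cmfd C). B \<inter> cvec ` M \<noteq> {}) \<and>
    holo_subbundle n (cmfd C) (holH C) \<and> (\<forall>p\<in>M. holH C (cvec p) = H p) \<and>
    holo_subbundle r (cmfd C) (holK C) \<and> (\<forall>p\<in>M. holK C (cvec p) = levi_kernel M H p) \<and>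
    (\<forall>p\<in>cmfd C. holH C p \<inter> holHbar C p = {0})"

abbreviation dproj ::
    "('n::finite, 'm::finite) complexified \<Rightarrow> complex ^ 'n \<Rightarrow> complex ^ 'n \<Rightarrow> complex ^ 'm"
  where "dproj C p \<equiv> frechet_derivative (leafproj C) (at p)"

text \<open>\<open>leafproj\<close> is a holomorphic submersion whose (connected) fibres are exactly the leaves of
  \<open>K + Kbar\<close>; its image is the leaf space.\<close>

definition levi_leaf_space :: "('n::finite, 'm::finite) complexified \<Rightarrow> bool"
  where "levi_leaf_space C \<longleftrightarrow>
    holo_on (leafproj C) (cmfd C) \<and>
    (\<forall>p\<in>cmfd C. surj (dproj C p) \<and> {v. dproj C p v = 0} = holK C p + holKbar C p) \<and>
    (\<forall>\<gamma>. connected {p \<in> cmfd C. leafproj C p = \<gamma>})"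

definition contactD :: "('n::finite, 'm::finite) complexified \<Rightarrow> complex ^ 'm \<Rightarrow> (complex ^ 'm) set"
  where "contactD C \<gamma> =
    (\<Union>p\<in>{p \<in> cmfd C. leafproj C p = \<gamma>}. dproj C p ` (holH C p + holHbar C p))"

text \<open>The Heisenberg bracket on \<open>contactD C \<gamma>\<close> with values in the quotient by \<open>contactD C \<gamma>\<close>.\<close>

definition heis_bracket ::
    "('n::finite, 'm::finite) complexified \<Rightarrow> complex ^ 'm \<Rightarrow> complex ^ 'm \<Rightarrow> complex ^ 'm
      \<Rightarrow> (complex ^ 'm) set"
  where "heis_bracket C \<gamma> =
    bracket_class hbracket
      (hsections (leafproj C ` cmfd C) (contactD C) \<gamma>) (hsections (leafproj C ` cmfd C) (contactD C) \<gamma>)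
      (contactD C \<gamma>) \<gamma>"

definition gm1_pos_at :: "('n::finite, 'm::finite) complexified \<Rightarrow> complex ^ 'n \<Rightarrow> (complex ^ 'm) set"
  where "gm1_pos_at C p = dproj C p ` holH C p"

definition gm1_neg_at :: "('n::finite, 'm::finite) complexified \<Rightarrow> complex ^ 'n \<Rightarrow> (complex ^ 'm) set"
  where "gm1_neg_at C p = dproj C p ` holHbar C p"

text \<open>For \<open>(A, B, K) = (H, Hbar, K)\<close>, respectively \<open>(Hbar, H, Kbar)\<close>, and \<open>v \<in> K p\<close> this is the map
  \<open>ad\<^sub>v : B / Kbar \<rightarrow> A / K\<close>, respectively \<open>B / K \<rightarrow> A / Kbar\<close>, transported by \<open>dproj C p\<close> and extended
  by zero on the image of \<open>A\<close>: the value at \<open>dproj a + dproj b\<close> is \<open>dproj a'\<close>, where \<open>a' \<in> A p\<close>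
  represents the class of the bracket in \<open>(A + B) / (K + B) = A / K\<close>.  Only the values on
  \<open>contactD\<close> are meaningful.\<close>

definition ad_leaf ::
    "('n::finite, 'm::finite) complexified \<Rightarrow> (complex ^ 'n \<Rightarrow> (complex ^ 'n) set)
      \<Rightarrow> (complex ^ 'n \<Rightarrow> (complex ^ 'n) set) \<Rightarrow> (complex ^ 'n \<Rightarrow> (complex ^ 'n) set)
      \<Rightarrow> complex ^ 'n \<Rightarrow> complex ^ 'n \<Rightarrow> complex ^ 'm \<Rightarrow> complex ^ 'm"
  where "ad_leaf C A B K p v x =
    (THE u. \<exists>a\<in>A p. \<exists>b\<in>B p. \<exists>a'\<in>A p.
      x = dproj C p a + dproj C p b \<and> u = dproj C p a' \<and>
      a' \<in> bracket_class hbracket (hsections (cmfd C) K p) (hsections (cmfd C) B p)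
              (K p + B p) p v b)"

definition g0_pos_at ::
    "('n::finite, 'm::finite) complexified \<Rightarrow> complex ^ 'n \<Rightarrow> (complex ^ 'm \<Rightarrow> complex ^ 'm) set"
  where "g0_pos_at C p = ad_leaf C (holH C) (holHbar C) (holK C) p ` holK C p"

definition g0_neg_at ::
    "('n::finite, 'm::finite) complexified \<Rightarrow> complex ^ 'n \<Rightarrow> (complex ^ 'm \<Rightarrow> complex ^ 'm) set"
  where "g0_neg_at C p = ad_leaf C (holHbar C) (holH C) (holKbar C) p ` holKbar C p"


section \<open>CR symbols\<close>

text \<open>The underlying space of degree -1 is \<open>complex ^ 's\<close>; \<open>form\<close> is a representative of its
  conformal symplectic structure.  The Heisenberg algebra is \<open>complex \<times> (complex ^ 's)\<close> with degree
  -2 part \<open>complex\<close> and bracket \<open>form\<close>.\<close>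

record 's symbol_data =
  form :: "complex ^ ('s::finite) \<Rightarrow> complex ^ 's \<Rightarrow> complex"
  invol :: "complex ^ 's \<Rightarrow> complex ^ 's"
  gm1_pos :: "(complex ^ 's) set"
  gm1_neg :: "(complex ^ 's) set"
  g0_pos :: "(complex ^ 's \<Rightarrow> complex ^ 's) set"
  g0_neg :: "(complex ^ 's \<Rightarrow> complex ^ 's) set"

definition symplectic_form :: "(complex ^ 's \<Rightarrow> complex ^ 's \<Rightarrow> complex) \<Rightarrow> bool"
  where "symplectic_form \<omega> \<longleftrightarrow>
    (\<forall>y. Vector_Spaces.linear (*s) (*) (\<lambda>x. \<omega> x y)) \<and>
    (\<forall>x. Vector_Spaces.linear (*s) (*) (\<omega> x)) \<and>
    (\<forall>x. \<omega> x x = 0) \<and> (\<forall>x. x \<noteq> 0 \<longrightarrow> (\<exists>y. \<omega> x y \<noteq> 0))"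

definition csp :: "(complex ^ 's \<Rightarrow> complex ^ 's \<Rightarrow> complex) \<Rightarrow> (complex ^ 's \<Rightarrow> complex ^ 's) set"
  where "csp \<omega> = {A. clinear A \<and> (\<exists>c. \<forall>x y. \<omega> (A x) y + \<omega> x (A y) = c * \<omega> x y)}"

definition lagrangian ::
    "(complex ^ 's \<Rightarrow> complex ^ 's \<Rightarrow> complex) \<Rightarrow> (complex ^ 's) set \<Rightarrow> bool"
  where "lagrangian \<omega> L \<longleftrightarrow> vec.subspace L \<and> {x. \<forall>y\<in>L. \<omega> x y = 0} = L"

text \<open>Antilinear involutions respecting the conformal class of \<open>\<omega>\<close>.\<close>

definition conformal_involution ::
    "(complex ^ 's \<Rightarrow> complex ^ 's \<Rightarrow> complex) \<Rightarrow> (complex ^ 's \<Rightarrow> complex ^ 's) \<Rightarrow> bool"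
  where "conformal_involution \<omega> \<sigma> \<longleftrightarrow>
    (\<forall>x y. \<sigma> (x + y) = \<sigma> x + \<sigma> y) \<and> (\<forall>c x. \<sigma> (c *s x) = cnj c *s \<sigma> x) \<and>
    (\<forall>x. \<sigma> (\<sigma> x) = x) \<and>
    (\<exists>c. c \<noteq> 0 \<and> (\<forall>x y. \<omega> (\<sigma> x) (\<sigma> y) = c * cnj (\<omega> x y)))"

abbreviation endo_scale ::
    "complex \<Rightarrow> (complex ^ 's \<Rightarrow> complex ^ 's) \<Rightarrow> complex ^ 's \<Rightarrow> complex ^ 's"
  where "endo_scale c A \<equiv> (\<lambda>x. c *s A x)"

definition cr_symbol :: "nat \<Rightarrow> nat \<Rightarrow> ('s::finite) symbol_data \<Rightarrow> bool"
  where "cr_symbol n r S \<longleftrightarrow>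
    CARD('s) + 2 * r = 2 * n \<and>
    symplectic_form (form S) \<and> conformal_involution (form S) (invol S) \<and>
    lagrangian (form S) (gm1_pos S) \<and> lagrangian (form S) (gm1_neg S) \<and>
    gm1_pos S \<inter> gm1_neg S = {0} \<and> gm1_neg S + gm1_pos S = UNIV \<and>
    invol S ` gm1_neg S = gm1_pos S \<and>
    module.subspace endo_scale (g0_pos S) \<and> vector_space.dim endo_scale (g0_pos S) = r \<and>
    module.subspace endo_scale (g0_neg S) \<and> vector_space.dim endo_scale (g0_neg S) = r \<and>
    g0_pos S \<subseteq> csp (form S) \<and> g0_neg S \<subseteq> csp (form S) \<and>
    (\<forall>A\<in>g0_pos S. A ` gm1_neg S \<subseteq> gm1_pos S \<and> (\<forall>x\<in>gm1_pos S. A x = 0)) \<and>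
    (\<forall>A\<in>g0_neg S. A ` gm1_pos S \<subseteq> gm1_neg S \<and> (\<forall>x\<in>gm1_neg S. A x = 0)) \<and>
    (\<lambda>A. invol S \<circ> A \<circ> invol S) ` g0_pos S = g0_neg S"

definition commutator ::
    "(complex ^ 's \<Rightarrow> complex ^ 's) \<Rightarrow> (complex ^ 's \<Rightarrow> complex ^ 's) \<Rightarrow> complex ^ 's \<Rightarrow> complex ^ 's"
  where "commutator A B x = A (B x) - B (A x)"

text \<open>The set of all elements satisfying the defining conditions is a subalgebra, hence the maximal
  one.\<close>

definition g00 :: "('s::finite) symbol_data \<Rightarrow> (complex ^ 's \<Rightarrow> complex ^ 's) set"
  where "g00 S = {A \<in> csp (form S).
    A ` gm1_pos S \<subseteq> gm1_pos S \<and> A ` gm1_neg S \<subseteq> gm1_neg S \<and>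
    (\<forall>B\<in>g0_pos S. commutator A B \<in> g0_pos S) \<and> (\<forall>B\<in>g0_neg S. commutator A B \<in> g0_neg S)}"

text \<open>The symbol as a subset of the space underlying the semidirect product of the Heisenberg algebra
  with \<open>csp\<close>.  The sum of sets of endomorphisms is pointwise.\<close>

definition symbol_algebra ::
    "('s::finite) symbol_data \<Rightarrow> ((complex \<times> (complex ^ 's)) \<times> (complex ^ 's \<Rightarrow> complex ^ 's)) set"
  where "symbol_algebra S = UNIV \<times> (g0_neg S + g0_pos S + g00 S)"

definition regular_symbol :: "('s::finite) symbol_data \<Rightarrow> bool"
  where "regular_symbol S \<longleftrightarrow> (\<forall>A\<in>g0_neg S. \<forall>B\<in>g0_pos S. commutator A B \<in> g00 S)"


section \<open>Frames and modified symbols\<close>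

text \<open>A graded linear map from the Heisenberg algebra to \<open>T N / D \<oplus> D\<close>, as the pair of its
  components of degree -2 and -1.\<close>

type_synonym ('m, 's) frame = "(complex \<Rightarrow> (complex ^ 'm) set) \<times> (complex ^ 's \<Rightarrow> complex ^ 'm)"

definition heis_iso ::
    "('n::finite, 'm::finite) complexified \<Rightarrow> ('s::finite) symbol_data \<Rightarrow> complex ^ 'm
      \<Rightarrow> ('m, 's) frame \<Rightarrow> bool"
  where "heis_iso C S \<gamma> \<phi> \<longleftrightarrow>
    (\<exists>t. \<forall>z. fst \<phi> z = (z *s t) +o contactD C \<gamma>) \<and>
    bij_betw (fst \<phi>) UNIV (range (\<lambda>v. v +o contactD C \<gamma>)) \<and>
    clinear (snd \<phi>) \<and> bij_betw (snd \<phi>) UNIV (contactD C \<gamma>) \<and>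
    (\<forall>x y. fst \<phi> (form S x y) = heis_bracket C \<gamma> (snd \<phi> x) (snd \<phi> y))"

definition symbol_iso ::
    "('n::finite, 'm::finite) complexified \<Rightarrow> ('s::finite) symbol_data \<Rightarrow> complex ^ 'n
      \<Rightarrow> ('m, 's) frame \<Rightarrow> bool"
  where "symbol_iso C S p \<phi> \<longleftrightarrow>
    heis_iso C S (leafproj C p) \<phi> \<and>
    snd \<phi> ` gm1_pos S = gm1_pos_at C p \<and> snd \<phi> ` gm1_neg S = gm1_neg_at C p \<and>
    (\<lambda>A. inv (snd \<phi>) \<circ> A \<circ> snd \<phi>) ` g0_pos_at C p = g0_pos S \<and>
    (\<lambda>A. inv (snd \<phi>) \<circ> A \<circ> snd \<phi>) ` g0_neg_at C p = g0_neg S"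

text \<open>At real points the involution of \<open>contactD\<close> is \<open>dproj v \<mapsto> dproj (cnjv v)\<close>.\<close>

definition invol_compatible ::
    "('n::finite, 'm::finite) complexified \<Rightarrow> ('s::finite) symbol_data \<Rightarrow> complex ^ 'n
      \<Rightarrow> ('m, 's) frame \<Rightarrow> bool"
  where "invol_compatible C S p \<phi> \<longleftrightarrow>
    (\<forall>x. \<forall>v \<in> holH C p + holHbar C p.
      snd \<phi> x = dproj C p v \<longrightarrow> snd \<phi> (invol S x) = dproj C p (cnjv v))"

definition constant_symbol ::
    "('n::finite, 'm::finite) complexified \<Rightarrow> ('s::finite) symbol_data \<Rightarrow> bool"
  where "constant_symbol C S \<longleftrightarrow>
    (\<forall>p\<in>cmfd C. \<exists>\<phi>. symbol_iso C S p \<phi> \<and> (cnjv p = p \<longrightarrow> invol_compatible C S p \<phi>))"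

definition P0 ::
    "('n::finite, 'm::finite) complexified \<Rightarrow> ('s::finite) symbol_data
      \<Rightarrow> ((complex ^ 'n) \<times> ('m, 's) frame) set"
  where "P0 C S = {(p, \<phi>). p \<in> cmfd C \<and> symbol_iso C S p \<phi>}"

definition P0_over ::
    "('n::finite, 'm::finite) complexified \<Rightarrow> ('s::finite) symbol_data \<Rightarrow> complex ^ 'm
      \<Rightarrow> ((complex ^ 'n) \<times> ('m, 's) frame) set"
  where "P0_over C S \<gamma> = {\<psi> \<in> P0 C S. leafproj C (fst \<psi>) = \<gamma>}"

text \<open>Continuously differentiable curves in \<open>P0_over C S \<gamma>\<close>.  The degree -2 component of a frame is
  determined by the degree -1 component through the bracket, so only the base point and the degree -1
  component carry a differentiability condition.\<close>

definition P0_curve ::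
    "('n::finite, 'm::finite) complexified \<Rightarrow> ('s::finite) symbol_data \<Rightarrow> complex ^ 'm
      \<Rightarrow> (real \<Rightarrow> (complex ^ 'n) \<times> ('m, 's) frame) \<Rightarrow> bool"
  where "P0_curve C S \<gamma> \<psi> \<longleftrightarrow>
    (\<exists>\<epsilon>>0. (\<forall>t\<in>{-\<epsilon><..<\<epsilon>}. \<psi> t \<in> P0_over C S \<gamma>) \<and>
      (\<lambda>t. fst (\<psi> t)) C1_differentiable_on {-\<epsilon><..<\<epsilon>} \<and>
      (\<forall>x. (\<lambda>t. snd (snd (\<psi> t)) x) C1_differentiable_on {-\<epsilon><..<\<epsilon>}))"

text \<open>The value of \<open>\<theta>\<^sub>0\<close> on the velocity of \<open>\<psi>\<close> at time 0, as an endomorphism of the degree -1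
  part.\<close>

definition theta0 ::
    "(real \<Rightarrow> (complex ^ 'n) \<times> ('m::finite, 's::finite) frame) \<Rightarrow> complex ^ 's \<Rightarrow> complex ^ 's"
  where "theta0 \<psi> x =
    inv (snd (snd (\<psi> 0))) (vector_derivative (\<lambda>t. snd (snd (\<psi> t)) x) (at 0))"

definition g0_mod ::
    "('n::finite, 'm::finite) complexified \<Rightarrow> ('s::finite) symbol_data
      \<Rightarrow> (complex ^ 'n) \<times> ('m, 's) frame \<Rightarrow> (complex ^ 's \<Rightarrow> complex ^ 's) set"
  where "g0_mod C S \<psi>\<^sub>0 = theta0 ` {\<psi>. P0_curve C S (leafproj C (fst \<psi>\<^sub>0)) \<psi> \<and> \<psi> 0 = \<psi>\<^sub>0}"

definition modified_symbol ::
    "('n::finite, 'm::finite) complexified \<Rightarrow> ('s::finite) symbol_data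
      \<Rightarrow> (complex ^ 'n) \<times> ('m, 's) frame
      \<Rightarrow> ((complex \<times> (complex ^ 's)) \<times> (complex ^ 's \<Rightarrow> complex ^ 's)) set"
  where "modified_symbol C S \<psi> = UNIV \<times> g0_mod C S \<psi>"

definition constant_modified_symbol ::
    "('n::finite, 'm::finite) complexified \<Rightarrow> ('s::finite) symbol_data
      \<Rightarrow> ((complex \<times> (complex ^ 's)) \<times> (complex ^ 's \<Rightarrow> complex ^ 's)) set \<Rightarrow> bool"
  where "constant_modified_symbol C S g \<longleftrightarrow> (\<forall>\<psi>\<in>P0 C S. modified_symbol C S \<psi> = g)"

end

theory Submission
  imports Defs "HOL-Complex_Analysis.Complex_Analysis"
begin

text \<open>
  Fix a point and identify the contact space at its leaf with the symbol.  Along the leaf, the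
  splitting of the contact space becomes a moving involution \<open>J\<close>, and the off-diagonal part
  \<open>g0_neg + g0_pos\<close> of the symbol at a point is exactly the image of the derivative of \<open>J\<close> there, so a
  frame is a conformal symplectic map that carries a model pair \<open>(J0, G0)\<close> to \<open>J\<close> and the image of
  its derivative.  If \<open>g\<close> is a frame, then so is \<open>g J0\<close>; as the modified symbol does not depend on the
  frame, it is invariant under conjugation by \<open>J0\<close> and splits into its diagonal and off-diagonal parts.
  The diagonal part stabilises \<open>G0\<close>, hence lies in \<open>g00\<close>, and the off-diagonal part is \<open>G0\<close>.
  The same invariance expresses the second derivative of \<open>J\<close>, modulo the image of the first one,
  by products of first derivatives.  Differentiating this identity once more and antisymmetrising
  gives \<open>[[G0, G0], G0] \<subseteq> G0\<close>, which is regularity.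
\<close>

section \<open>Linear algebra and linear differential equations\<close>

text \<open>Constancy of the symbol provides a frame at every point of a leaf, but no regularity of
  any choice of frames, whereas the modified symbol is read from C1 curves of frames. The main
  obstacle is to produce such a curve over a given direction. On a line, the points with a frame of
  norm at most \<open>k\<close> and inverse of norm at most \<open>k\<close> form a closed set, so
  Baire's theorem bounds frames over a subinterval. Compactness turns almost minimal frame changes
  into infinitesimal ones, the infinitesimal change of least norm depends continuously on the point,
  and a linear differential equation integrates it. The second-order identity obtained in this way
  holds on a dense set of every line and extends by closedness. Holomorphy enters twice: it
  transports integrability from \<open>M\<close> to the complexification, and it supplies the third
  derivatives and their symmetry. Since \<open>J0\<close> reverses the sign of the symplectic form,
  the argument depends on frames being conformal symplectic and not symplectic.\<close>

lemma matrix_add_rdistrib: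
  fixes A B :: "'a::semiring_1 ^ 'n ^ 'm"
  shows "(A + B) ** C = A ** C + B ** C"
  by (vector matrix_matrix_mult_def sum.distrib[symmetric] field_simps)

lemma bounded_bilinear_matrix_mult:
  "bounded_bilinear ((**) :: complex ^ 'n ^ 'm \<Rightarrow> complex ^ 'p ^ 'n \<Rightarrow> complex ^ 'p ^ 'm)"
proof -
  have "bilinear ((**) :: complex ^ 'n ^ 'm \<Rightarrow> complex ^ 'p ^ 'n \<Rightarrow> complex ^ 'p ^ 'm)"
    unfolding bilinear_def
    by (auto intro!: linearI simp: matrix_add_ldistrib matrix_add_rdistrib matrix_scalar_ac
        scalar_matrix_assoc)
  then show ?thesis
    by (simp add: bilinear_conv_bounded_bilinear)
qed

lemma bounded_bilinear_matrix_vector_mult: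
  "bounded_bilinear ((*v) :: complex ^ 'n ^ 'm \<Rightarrow> complex ^ 'n \<Rightarrow> complex ^ 'm)"
proof -
  have "bilinear ((*v) :: complex ^ 'n ^ 'm \<Rightarrow> complex ^ 'n \<Rightarrow> complex ^ 'm)"
    unfolding bilinear_def
    by (auto intro!: linearI simp: matrix_vector_mult_add_rdistrib matrix_vector_right_distrib
         matrix_vector_mult_def vec_eq_iff sum_distrib_left sum.distrib algebra_simps
         scaleR_sum_right)
  then show ?thesis
    by (simp add: bilinear_conv_bounded_bilinear)
qed

lemmas tendsto_matrix_mult [tendsto_intros] = bounded_bilinear.tendsto[OF bounded_bilinear_matrix_mult]
lemmas continuous_on_matrix_mult [continuous_intros] =
  bounded_bilinear.continuous_on[OF bounded_bilinear_matrix_mult]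
lemmas has_derivative_matrix_mult = bounded_bilinear.FDERIV[OF bounded_bilinear_matrix_mult]
lemmas has_vector_derivative_matrix_mult =
  bounded_bilinear.has_vector_derivative[OF bounded_bilinear_matrix_mult]
lemmas tendsto_matrix_vector_mult [tendsto_intros] =
  bounded_bilinear.tendsto[OF bounded_bilinear_matrix_vector_mult]
lemmas continuous_on_matrix_vector_mult [continuous_intros] =
  bounded_bilinear.continuous_on[OF bounded_bilinear_matrix_vector_mult]
lemmas has_vector_derivative_matrix_vector_mult =
  bounded_bilinear.has_vector_derivative[OF bounded_bilinear_matrix_vector_mult]
lemmas has_derivative_matrix_vector_mult =
  bounded_bilinear.FDERIV[OF bounded_bilinear_matrix_vector_mult]

lemmas matrix_minus_simps =
  bounded_bilinear.minus_left[OF bounded_bilinear_matrix_mult]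
  bounded_bilinear.minus_right[OF bounded_bilinear_matrix_mult]
lemmas matrix_diff_simps =
  bounded_bilinear.diff_left[OF bounded_bilinear_matrix_mult]
  bounded_bilinear.diff_right[OF bounded_bilinear_matrix_mult]
lemmas matrix_scaleR_simps =
  bounded_bilinear.scaleR_left[OF bounded_bilinear_matrix_mult]
  bounded_bilinear.scaleR_right[OF bounded_bilinear_matrix_mult]
lemmas matrix_expand = matrix_add_ldistrib matrix_add_rdistrib matrix_minus_simps matrix_diff_simps
  matrix_scaleR_simps matrix_mul_assoc

text \<open>Constancy of the rank turns pointwise preimages into locally bounded ones.\<close>

lemma uniform_preimages:
  fixes T :: "'t::metric_space \<Rightarrow> 'e::euclidean_space \<Rightarrow> 'f::euclidean_space"
  assumes lin: "\<And>t. t \<in> A \<Longrightarrow> linear (T t)"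
    and cont: "\<And>\<eta>. continuous (at t0 within A) (\<lambda>t. T t \<eta>)"
    and t0: "t0 \<in> A"
    and dim: "\<And>t. t \<in> A \<Longrightarrow> dim (range (T t)) = dim (range (T t0))"
  obtains c d where "c > 0" "d > 0"
    "\<And>t z. t \<in> A \<Longrightarrow> dist t t0 < d \<Longrightarrow> z \<in> range (T t) \<Longrightarrow> \<exists>\<eta>. T t \<eta> = z \<and> norm \<eta> \<le> c * norm z"
proof -
  define N where "N = {\<eta>. T t0 \<eta> = 0}"
  define N1 where "N1 = {y. \<forall>x\<in>N. orthogonal y x}"
  have sN: "subspace N"
    unfolding N_def using linear_subspace_kernel[OF lin[OF t0]] by simp
  have sN1: "subspace N1"
    unfolding N1_def by (auto simp: subspace_def orthogonal_clauses)
  have split: "\<exists>y\<in>N1. T t0 x = T t0 y" for x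
  proof -
    obtain a b where ab: "a \<in> span N" "\<And>w. w \<in> span N \<Longrightarrow> orthogonal b w" "x = a + b"
      using orthogonal_subspace_decomp_exists[of N x] by metis
    have "b \<in> N1" unfolding N1_def using ab(2) span_base by blast
    moreover have "T t0 a = 0" using ab(1) sN unfolding N_def by (simp add: span_eq_iff[THEN iffD2])
    ultimately show ?thesis
      using ab(3) linear_add[OF lin[OF t0]] by auto
  qed
  have inj0: "x = 0" if "x \<in> N1" "T t0 x = 0" for x
    using that unfolding N1_def N_def by (auto simp: orthogonal_self)
  obtain e where e: "e > 0" "\<And>x. x \<in> N1 \<Longrightarrow> norm (T t0 x) \<ge> e * norm x"
    using injective_imp_isometric[OF closed_subspace[OF sN1] sN1, of "T t0"] inj0
      linear_conv_bounded_linear lin[OF t0] by blast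
  have range0: "range (T t0) = T t0 ` N1"
    using split by blast
  have "((\<lambda>t. \<Sum>b\<in>Basis. norm (T t b - T t0 b)) \<longlongrightarrow> (\<Sum>b\<in>Basis. norm (T t0 b - T t0 b))) (at t0 within A)"
    using cont unfolding continuous_within by (intro tendsto_intros) auto
  then have "\<forall>\<^sub>F t in at t0 within A. (\<Sum>b\<in>Basis. norm (T t b - T t0 b)) < e / 2"
    using e(1) by (intro order_tendstoD(2)[where a="e/2"]) auto
  then obtain d where d: "d > 0"
    "\<And>t. t \<in> A \<Longrightarrow> dist t t0 < d \<Longrightarrow> t \<noteq> t0 \<Longrightarrow> (\<Sum>b\<in>Basis. norm (T t b - T t0 b)) < e / 2"
    unfolding eventually_at by blast
  have d': "(\<Sum>b\<in>Basis. norm (T t b - T t0 b)) \<le> e / 2" if "t \<in> A" "dist t t0 < d" for t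
    using d(2)[OF that] e(1) by (cases "t = t0") auto
  have expand: "T t x = (\<Sum>b\<in>Basis. (x \<bullet> b) *\<^sub>R T t b)" if "t \<in> A" for t x
  proof -
    interpret linear "T t" by (rule lin[OF that])
    have "T t x = T t (\<Sum>b\<in>Basis. (x \<bullet> b) *\<^sub>R b)"
      by (simp only: euclidean_representation)
    then show ?thesis by (simp only: sum scale)
  qed
  have close: "norm (T t x - T t0 x) \<le> e / 2 * norm x" if t: "t \<in> A" "dist t t0 < d" for t x
  proof -
    have "T t x - T t0 x = (\<Sum>b\<in>Basis. (x \<bullet> b) *\<^sub>R (T t b - T t0 b))"
      using expand[OF t(1), of x] expand[OF t0, of x] by (simp add: sum_subtractf scaleR_diff_right)
    also have "norm \<dots> \<le> (\<Sum>b\<in>Basis. norm x * norm (T t b - T t0 b))"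
      by (intro sum_norm_le) (simp add: mult_right_mono Basis_le_norm)
    also have "\<dots> \<le> norm x * (e / 2)"
      unfolding sum_distrib_left[symmetric] using d'[OF t] by (intro mult_left_mono) auto
    finally show ?thesis by (simp add: mult.commute)
  qed
  have low: "norm (T t x) \<ge> e / 2 * norm x" if t: "t \<in> A" "dist t t0 < d" and x: "x \<in> N1" for t x
    using close[OF t, of x] e(2)[OF x] norm_triangle_ineq2[of "T t0 x" "T t0 x - T t x"]
    by (simp add: norm_minus_commute)
  \<comment> \<open>The lower bound makes \<open>T t\<close> injective on \<open>N1\<close>, so its
    image there has the dimension of \<open>range (T t0)\<close>; by constancy of the rank it
    exhausts \<open>range (T t)\<close>.\<close>
  have full: "range (T t) = T t ` N1" if t: "t \<in> A" "dist t t0 < d" for t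
  proof -
    have inj: "inj_on (T t) N1" if s: "s = t \<or> s = t0" "s = t" for s
    proof -
      have "x = 0" if "x \<in> N1" "T t x = 0" for x
        using low[OF t that(1)] that(2) e(1) by (simp add: mult_le_0_iff)
      then show ?thesis
        using linear_inj_on_iff_eq_0 lin[OF t(1)] sN1 linear_injective_on_subspace_0 by blast
    qed
    have inj0': "inj_on (T t0) N1"
      using inj0 linear_injective_on_subspace_0[OF lin[OF t0] sN1] by blast
    have "dim (T t ` N1) = dim N1"
      using inj lin[OF t(1)] sN1 by (intro dim_image_eq) (auto simp: span_eq_iff[THEN iffD2])
    also have "\<dots> = dim (T t0 ` N1)"
      using inj0' lin[OF t0] sN1 by (intro dim_image_eq[symmetric]) (auto simp: span_eq_iff[THEN iffD2])
    also have "\<dots> = dim (range (T t))"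
      using range0 dim[OF t(1)] by simp
    finally have "dim (T t ` N1) = dim (range (T t))" .
    then show ?thesis
      using lin[OF t(1)] sN1
      by (intro subspace_dim_equal[symmetric] linear_subspace_image) (auto simp: subspace_UNIV)
  qed
  show ?thesis
  proof (rule that[of "2 / e" d])
    fix t z assume t: "t \<in> A" "dist t t0 < d" and z: "z \<in> range (T t)"
    obtain \<eta> where \<eta>: "\<eta> \<in> N1" "z = T t \<eta>" using z full[OF t] by blast
    have "norm \<eta> \<le> 2 / e * norm z" using low[OF t \<eta>(1)] e(1) \<eta>(2) by (simp add: field_simps)
    then show "\<exists>\<eta>. T t \<eta> = z \<and> norm \<eta> \<le> 2 / e * norm z" using \<eta> by blast
  qed (use e d in auto)
qed

text \<open>Multiplication by \<open>exp (- C * s)\<close> makes \<open>f\<close> nonincreasing to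
  the right of \<open>u\<close>, multiplication by \<open>exp (C * s)\<close> makes it nondecreasing
  to the left; in both cases a nonnegative function is squeezed below its value 0 at
  \<open>u\<close>.\<close>

lemma gronwall_zero:
  fixes f f' :: "real \<Rightarrow> real"
  assumes der: "\<And>t. t \<in> {a<..<b} \<Longrightarrow> (f has_real_derivative f' t) (at t)"
    and bd: "\<And>t. t \<in> {a<..<b} \<Longrightarrow> \<bar>f' t\<bar> \<le> C * f t"
    and nn: "\<And>t. f t \<ge> 0" and u: "u \<in> {a<..<b}" "f u = 0" and t: "t \<in> {a<..<b}"
  shows "f t = 0"
proof (cases "u \<le> t")
  case True
  define g where "g s = f s * exp (- C * s)" for s
  have "g t \<le> g u"
  proof (rule DERIV_nonpos_imp_nonincreasing[OF True])
    fix s assume "u \<le> s" "s \<le> t"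
    then have s: "s \<in> {a<..<b}" using u t by auto
    have "(g has_real_derivative (f' s - C * f s) * exp (- C * s)) (at s)"
      unfolding g_def by (rule derivative_eq_intros der[OF s] refl | simp add: algebra_simps)+
    moreover have "(f' s - C * f s) * exp (- C * s) \<le> 0"
      using bd[OF s] by (intro mult_nonpos_nonneg) auto
    ultimately show "\<exists>y. (g has_real_derivative y) (at s) \<and> y \<le> 0" by blast
  qed
  then have "f t * exp (- C * t) \<le> 0" by (simp add: g_def u)
  then show ?thesis using nn[of t] by (simp add: mult_le_0_iff antisym)
next
  case False
  define g where "g s = f s * exp (C * s)" for s
  have "g t \<le> g u"
  proof (rule DERIV_nonneg_imp_nondecreasing[where f = g and a = t and b = u])
    show "t \<le> u" using False by simp
    fix s assume "t \<le> s" "s \<le> u"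
    then have s: "s \<in> {a<..<b}" using u t by auto
    have "(g has_real_derivative (f' s + C * f s) * exp (C * s)) (at s)"
      unfolding g_def by (rule derivative_eq_intros der[OF s] refl | simp add: algebra_simps)+
    moreover have "(f' s + C * f s) * exp (C * s) \<ge> 0"
      using bd[OF s] by (intro mult_nonneg_nonneg) auto
    ultimately show "\<exists>y. (g has_real_derivative y) (at s) \<and> y \<ge> 0" by blast
  qed
  then have "f t * exp (C * t) \<le> 0" by (simp add: g_def u)
  then show ?thesis using nn[of t] by (simp add: mult_le_0_iff antisym)
qed

text \<open>Gronwall for the sum of squares. The hypothesis bounds the derivatives instead of naming
  the coefficients of a system, because in \<open>flow_carries\<close> these coefficients come from
  preimages chosen point by point and carry no continuity in \<open>t\<close>.\<close>

lemma linear_system_zero: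
  fixes D D' :: "'i \<Rightarrow> real \<Rightarrow> 'e::real_inner"
  assumes fin: "finite I"
    and der: "\<And>i t. i \<in> I \<Longrightarrow> t \<in> {a<..<b} \<Longrightarrow> (D i has_vector_derivative D' i t) (at t)"
    and bd: "\<And>i t. i \<in> I \<Longrightarrow> t \<in> {a<..<b} \<Longrightarrow> norm (D' i t) \<le> K * (\<Sum>j\<in>I. norm (D j t))"
    and u: "u \<in> {a<..<b}" "\<And>i. i \<in> I \<Longrightarrow> D i u = 0" and t: "t \<in> {a<..<b}" and i: "i \<in> I"
  shows "D i t = 0"
proof -
  define f where "f s = (\<Sum>i\<in>I. D i s \<bullet> D i s)" for s
  define f' where "f' s = (\<Sum>i\<in>I. D i s \<bullet> D' i s + D' i s \<bullet> D i s)" for s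
  have "f t = 0"
  \<comment> \<open>The constant combines the two equal inner products in the derivative of a square
    with the Cauchy-Schwarz bound of the squared sum of norms by \<open>card I\<close> times
    \<open>f\<close>.\<close>
  proof (rule gronwall_zero[where f = f and t = t and f' = f' and C = "2 * \<bar>K\<bar> * card I" and u = u and a = a and b = b])
    fix s assume s: "s \<in> {a<..<b}"
    show "(f has_real_derivative f' s) (at s)"
      unfolding f_def f'_def has_real_derivative_iff_has_vector_derivative
      by (intro has_vector_derivative_sum bounded_bilinear.has_vector_derivative[OF bounded_bilinear_inner]
          der s)
    let ?S = "\<Sum>j\<in>I. norm (D j s)"
    have "\<bar>f' s\<bar> \<le> (\<Sum>i\<in>I. 2 * (norm (D i s) * (\<bar>K\<bar> * ?S)))"
      unfolding f'_def
    proof (rule order_trans[OF sum_abs], rule sum_mono)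
      fix i assume i: "i \<in> I"
      have "norm (D' i s) \<le> \<bar>K\<bar> * ?S"
        by (rule order_trans[OF bd[OF i s]], rule mult_right_mono) (auto intro: sum_nonneg)
      moreover have "\<bar>D i s \<bullet> D' i s\<bar> \<le> norm (D i s) * norm (D' i s)"
        by (rule Cauchy_Schwarz_ineq2)
      moreover have "\<bar>D i s \<bullet> D' i s + D' i s \<bullet> D i s\<bar> = 2 * \<bar>D i s \<bullet> D' i s\<bar>"
        by (simp add: inner_commute)
      ultimately show "\<bar>D i s \<bullet> D' i s + D' i s \<bullet> D i s\<bar> \<le> 2 * (norm (D i s) * (\<bar>K\<bar> * ?S))"
        by (smt (verit) mult_left_mono norm_ge_zero)
    qed
    also have "\<dots> = 2 * \<bar>K\<bar> * ?S\<^sup>2"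
      by (simp add: sum_distrib_left[symmetric] sum_distrib_right[symmetric] power2_eq_square)
    also have "?S\<^sup>2 \<le> card I * (\<Sum>i\<in>I. (norm (D i s))\<^sup>2)"
      using Cauchy_Schwarz_ineq_sum[of "\<lambda>_. 1" "\<lambda>j. norm (D j s)" I] by simp
    then have "2 * \<bar>K\<bar> * ?S\<^sup>2 \<le> 2 * \<bar>K\<bar> * (card I * (\<Sum>i\<in>I. (norm (D i s))\<^sup>2))"
      by (intro mult_left_mono) auto
    also have "\<dots> = 2 * \<bar>K\<bar> * card I * f s"
      by (simp add: f_def power2_norm_eq_inner)
    finally show "\<bar>f' s\<bar> \<le> 2 * \<bar>K\<bar> * card I * f s" .
  qed (use u t in \<open>auto simp: f_def intro: sum_nonneg\<close>)
  then show ?thesis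
    using fin i by (simp add: f_def sum_nonneg_eq_0_iff)
qed

lemma vector_derivative_bound:
  fixes f :: "real \<Rightarrow> 'b::real_normed_vector"
  assumes "convex S" "\<And>x. x \<in> S \<Longrightarrow> (f has_vector_derivative f' x) (at x within S)"
    "\<And>x. x \<in> S \<Longrightarrow> norm (f' x) \<le> B" "x \<in> S" "y \<in> S"
  shows "norm (f x - f y) \<le> B * norm (x - y)"
  using assms
  by (intro differentiable_bound[where f' = "\<lambda>x h. h *\<^sub>R f' x" and S = S])
    (auto simp: has_vector_derivative_def onorm_scaleR_left onorm_id)

lemma vector_derivative_zero_constant:
  fixes f :: "real \<Rightarrow> 'b::real_normed_vector"
  assumes "\<And>x. x \<in> {a<..<b} \<Longrightarrow> (f has_vector_derivative 0) (at x)"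
    and "s \<in> {a<..<b}" "t \<in> {a<..<b}"
  shows "f s = f t"
  using vector_derivative_bound[of "{a<..<b}" f "\<lambda>_. 0" 0 s t] assms
  by (auto intro: has_vector_derivative_at_within)

text \<open>Picard iteration: on a short interval the integral operator contracts by 1/2. Its fixed
  point is sought among the bounded continuous functions on the whole line, a complete space, with
  times outside the interval clamped to its end points.\<close>

lemma linear_ode_local_solution:
  fixes B :: "'x::real_normed_vector \<Rightarrow> 'e::euclidean_space \<Rightarrow> 'e" and X :: "real \<Rightarrow> 'x"
  assumes bb: "bounded_bilinear B" and cont: "continuous_on {a<..<b} X" and t0: "t0 \<in> {a<..<b}"
  obtains \<delta> y where "\<delta> > 0" "{t0 - \<delta><..<t0 + \<delta>} \<subseteq> {a<..<b}" "y t0 = y0"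
    "\<And>t. t \<in> {t0 - \<delta><..<t0 + \<delta>} \<Longrightarrow> (y has_vector_derivative B (X t) (y t)) (at t)"
proof -
  obtain d where d: "d > 0" "cball t0 d \<subseteq> {a<..<b}"
    using open_contains_cball[of "{a<..<b}"] t0 open_greaterThanLessThan by blast
  have "compact (X ` cball t0 d)"
    using cont d by (intro compact_continuous_image continuous_on_subset[OF cont]) auto
  then obtain m where m: "\<And>t. t \<in> cball t0 d \<Longrightarrow> norm (X t) \<le> m"
    using compact_imp_bounded bounded_iff by (metis imageI)
  obtain k where k: "k > 0" "\<And>x y. norm (B x y) \<le> norm x * norm y * k"
    using bounded_bilinear.pos_bounded[OF bb] by blast
  \<comment> \<open>The summand 1 keeps \<open>K\<close> positive, so that the radius
    \<open>1 / (2 * K)\<close> below makes sense and yields the contraction constant 1/2.\<close>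
  define K where "K = \<bar>m\<bar> * k + 1"
  have K: "K > 0" unfolding K_def using k(1) by (intro add_nonneg_pos) auto
  have BK: "norm (B (X t) y) \<le> K * norm y" if "t \<in> cball t0 d" for t y
  proof -
    have "norm (B (X t) y) \<le> norm (X t) * norm y * k" by (rule k(2))
    also have "\<dots> \<le> \<bar>m\<bar> * norm y * k"
      using m[OF that] k(1) by (intro mult_right_mono) auto
    also have "\<dots> \<le> K * norm y" by (simp add: K_def algebra_simps)
    finally show ?thesis .
  qed
  define \<delta> where "\<delta> = min d (1 / (2 * K))"
  have \<delta>: "\<delta> > 0" "\<delta> \<le> d" "K * \<delta> \<le> 1 / 2"
    using d K by (auto simp: \<delta>_def field_simps min_def)
  let ?lo = "t0 - \<delta>" and ?hi = "t0 + \<delta>"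
  have sub: "{?lo..?hi} \<subseteq> cball t0 d" using \<delta> by (auto simp: dist_real_def)
  define F where "F u t = B (X t) (u t)" for u t
  \<comment> \<open>As \<open>t0\<close> is interior, the integral from \<open>t0\<close> to
    \<open>s\<close> is written as a difference of two integrals from the left end point.\<close>
  define Y where "Y u s = y0 + (integral {?lo..s} (F u) - integral {?lo..t0} (F u))" for u s
  have contF: "continuous_on {?lo..?hi} (F u)" if "continuous_on {?lo..?hi} u" for u
    unfolding F_def using that sub d
    by (intro bounded_bilinear.continuous_on[OF bb] continuous_on_subset[OF cont]) auto
  have derY: "(Y u has_vector_derivative F u s) (at s within {?lo..?hi})"
    if "continuous_on {?lo..?hi} u" "s \<in> {?lo..?hi}" for u s
    unfolding Y_def
    using integral_has_vector_derivative[OF contF[OF that(1)] that(2)]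
    by (auto intro!: derivative_eq_intros)
  have contY: "continuous_on {?lo..?hi} (Y u)" if "continuous_on {?lo..?hi} u" for u
    using derY[OF that] has_vector_derivative_continuous continuous_on_eq_continuous_within by blast
  define \<Phi> where "\<Phi> u = Bcontfun (\<lambda>s. Y (apply_bcontfun u) (clamp ?lo ?hi s))" for u :: "real \<Rightarrow>\<^sub>C 'e"
  have \<Phi>: "apply_bcontfun (\<Phi> u) s = Y (apply_bcontfun u) (clamp ?lo ?hi s)" for u s
  proof -
    have "continuous_on {?lo..?hi} (Y (apply_bcontfun u))" by (intro contY) auto
    then have c: "continuous_on (cbox ?lo ?hi) (Y (apply_bcontfun u))" by simp
    have "(\<lambda>s. Y (apply_bcontfun u) (clamp ?lo ?hi s)) \<in> bcontfun"
      unfolding bcontfun_def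
      using clamp_continuous_on[OF c] clamp_bounded[of "Y (apply_bcontfun u)" ?lo ?hi]
        compact_imp_bounded[OF compact_continuous_image[OF c compact_cbox]] by auto
    then show ?thesis unfolding \<Phi>_def by (simp add: Bcontfun_inverse)
  qed
  have "dist (\<Phi> u) (\<Phi> v) \<le> 1 / 2 * dist u v" for u v
  proof (rule dist_bound)
    fix s
    let ?s = "clamp ?lo ?hi s" and ?u = "apply_bcontfun u" and ?v = "apply_bcontfun v"
    have s: "?s \<in> {?lo..?hi}" using clamp_in_interval[of ?lo ?hi s] \<delta> by simp
    have "norm ((Y ?u ?s - Y ?v ?s) - (Y ?u t0 - Y ?v t0)) \<le> (K * dist u v) * norm (?s - t0)"
    proof (rule vector_derivative_bound[where S = "{?lo..?hi}"
            and f = "\<lambda>s. Y ?u s - Y ?v s" and f' = "\<lambda>s. F ?u s - F ?v s"])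
      fix x assume x: "x \<in> {?lo..?hi}"
      show "((\<lambda>s. Y ?u s - Y ?v s) has_vector_derivative F ?u x - F ?v x) (at x within {?lo..?hi})"
        by (intro has_vector_derivative_diff derY x) auto
      have "F ?u x - F ?v x = B (X x) (?u x - ?v x)"
        by (simp add: F_def bounded_bilinear.diff_right[OF bb])
      also have "norm \<dots> \<le> K * norm (?u x - ?v x)" using BK sub x by blast
      also have "\<dots> \<le> K * dist u v"
        using dist_bounded[of u x v] K by (simp add: dist_norm)
      finally show "norm (F ?u x - F ?v x) \<le> K * dist u v" .
    qed (use s \<delta> in auto)
    also have "Y ?u t0 - Y ?v t0 = 0" by (simp add: Y_def)
    also have "K * dist u v * norm (?s - t0) \<le> K * dist u v * \<delta>"
      using s K by (intro mult_left_mono) auto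
    also have "\<dots> \<le> 1 / 2 * dist u v"
      using \<delta>(3) mult_right_mono[OF \<delta>(3), of "dist u v"] by (simp add: algebra_simps)
    finally show "dist (apply_bcontfun (\<Phi> u) s) (apply_bcontfun (\<Phi> v) s) \<le> 1 / 2 * dist u v"
      by (simp add: \<Phi> dist_norm)
  qed
  then obtain u where u: "\<Phi> u = u"
    using banach_fix_type[of "1/2" \<Phi>] by auto
  let ?u = "apply_bcontfun u"
  have eq: "?u s = Y ?u s" if "s \<in> {?lo..?hi}" for s
    using \<Phi>[of u s] u that by simp
  show ?thesis
  proof (rule that[of \<delta> "Y ?u"])
    show "Y ?u t0 = y0" by (simp add: Y_def)
    show "{t0 - \<delta><..<t0 + \<delta>} \<subseteq> {a<..<b}" using sub d(2) by (meson greaterThanLessThan_subseteq_atLeastAtMost_iff order_refl subset_trans)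
    fix t assume t: "t \<in> {t0 - \<delta><..<t0 + \<delta>}"
    have "(Y ?u has_vector_derivative F ?u t) (at t within {?lo..?hi})"
      using t by (intro derY) auto
    then have "(Y ?u has_vector_derivative F ?u t) (at t)"
      using t at_within_Icc_at[of ?lo t ?hi] by auto
    moreover have "F ?u t = B (X t) (Y ?u t)" using eq t by (simp add: F_def)
    ultimately show "(Y ?u has_vector_derivative B (X t) (Y ?u t)) (at t)" by simp
  qed (use \<delta> in auto)
qed

text \<open>The inverse solves an equation of its own: with \<open>g' = X g\<close> and
  \<open>h' = - h X\<close> the product \<open>h ** g\<close> has derivative 0 and keeps its initial
  value \<open>mat 1\<close>; for square matrices a left inverse is a right inverse.\<close>

lemma matrix_ode_local_solution:
  fixes X :: "real \<Rightarrow> complex ^ 's ^ 's"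
  assumes cont: "continuous_on {a<..<b} X" and t0: "t0 \<in> {a<..<b}"
  obtains \<delta> g h where "\<delta> > 0" "{t0 - \<delta><..<t0 + \<delta>} \<subseteq> {a<..<b}" "g t0 = mat 1" "h t0 = mat 1"
    "\<And>t. t \<in> {t0 - \<delta><..<t0 + \<delta>} \<Longrightarrow> (g has_vector_derivative X t ** g t) (at t)"
    "\<And>t. t \<in> {t0 - \<delta><..<t0 + \<delta>} \<Longrightarrow> (h has_vector_derivative - (h t ** X t)) (at t)"
    "\<And>t. t \<in> {t0 - \<delta><..<t0 + \<delta>} \<Longrightarrow> g t ** h t = mat 1"
    "\<And>t. t \<in> {t0 - \<delta><..<t0 + \<delta>} \<Longrightarrow> h t ** g t = mat 1"
proof -
  obtain d1 g where g: "d1 > 0" "{t0 - d1<..<t0 + d1} \<subseteq> {a<..<b}" "g t0 = mat 1"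
    "\<And>t. t \<in> {t0 - d1<..<t0 + d1} \<Longrightarrow> (g has_vector_derivative X t ** g t) (at t)"
    using linear_ode_local_solution[OF bounded_bilinear_matrix_mult cont t0, of "mat 1"] by blast
  have bb: "bounded_bilinear (\<lambda>A B. - (B ** A) :: complex ^ 's ^ 's)"
    using bounded_bilinear.comp1[OF bounded_bilinear.flip[OF bounded_bilinear_matrix_mult]
      bounded_linear_minus[OF bounded_linear_ident]] by (simp add: matrix_minus_simps)
  obtain d2 h where h: "d2 > 0" "{t0 - d2<..<t0 + d2} \<subseteq> {a<..<b}" "h t0 = mat 1"
    "\<And>t. t \<in> {t0 - d2<..<t0 + d2} \<Longrightarrow> (h has_vector_derivative - (h t ** X t)) (at t)"
    using linear_ode_local_solution[OF bb cont t0, of "mat 1"] by blast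
  define \<delta> where "\<delta> = min d1 d2"
  have hg: "h t ** g t = mat 1" if t: "t \<in> {t0 - \<delta><..<t0 + \<delta>}" for t
  proof -
    have "h t ** g t = h t0 ** g t0"
    proof (rule vector_derivative_zero_constant)
      fix s assume s: "s \<in> {t0 - \<delta><..<t0 + \<delta>}"
      have "((\<lambda>t. h t ** g t) has_vector_derivative (h s ** (X s ** g s) + - (h s ** X s) ** g s)) (at s)"
        using s by (intro has_vector_derivative_matrix_mult g h) (auto simp: \<delta>_def)
      then show "((\<lambda>t. h t ** g t) has_vector_derivative 0) (at s)"
        by (simp add: matrix_expand)
    qed (use t g h in \<open>auto simp: \<delta>_def\<close>)
    then show ?thesis using g(3) h(3) by simp
  qed
  show ?thesis
  proof (rule that[of \<delta> g h])
    fix t assume t: "t \<in> {t0 - \<delta><..<t0 + \<delta>}"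
    then have t': "t \<in> {t0 - d1<..<t0 + d1}" "t \<in> {t0 - d2<..<t0 + d2}" by (auto simp: \<delta>_def)
    show "(g has_vector_derivative X t ** g t) (at t)"
      "(h has_vector_derivative - (h t ** X t)) (at t)"
      by (rule g(4)[OF t'(1)], rule h(4)[OF t'(2)])
    show "h t ** g t = mat 1" by (rule hg[OF t])
    then show "g t ** h t = mat 1" using matrix_left_right_inverse by blast
  next
    have "{t0 - \<delta><..<t0 + \<delta>} \<subseteq> {t0 - d1<..<t0 + d1}" by (auto simp: \<delta>_def)
    then show "{t0 - \<delta><..<t0 + \<delta>} \<subseteq> {a<..<b}" using g(2) by blast
  qed (use g h in \<open>auto simp: \<delta>_def\<close>)
qed

section \<open>Conformal symplectic matrices and moving flags\<close>

definition csp_mat :: "(complex ^ 's \<Rightarrow> complex ^ 's \<Rightarrow> complex) \<Rightarrow> (complex ^ 's ^ 's) set"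
  where "csp_mat \<omega> = {X. \<exists>c. \<forall>x y. \<omega> (X *v x) y + \<omega> x (X *v y) = c * \<omega> x y}"

definition csp_group :: "(complex ^ 's \<Rightarrow> complex ^ 's \<Rightarrow> complex) \<Rightarrow> (complex ^ 's ^ 's) set"
  where "csp_group \<omega> = {g. \<exists>c. c \<noteq> 0 \<and> (\<forall>x y. \<omega> (g *v x) (g *v y) = c * \<omega> x y)}"

text \<open>The inverse \<open>h\<close> of \<open>g\<close> is carried along, so that no inversion has to be differentiated.\<close>

definition carries :: "(complex ^ 's \<Rightarrow> complex ^ 's \<Rightarrow> complex) \<Rightarrow> complex ^ 's ^ 's \<Rightarrow> complex ^ 's ^ 's
    \<Rightarrow> complex ^ 's ^ 's \<Rightarrow> (complex ^ 's ^ 's) set \<Rightarrow> complex ^ 's ^ 's \<Rightarrow> (complex ^ 's ^ 's) set \<Rightarrow> bool"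
  where "carries \<omega> g h J V J' V' \<longleftrightarrow>
    g ** h = mat 1 \<and> h ** g = mat 1 \<and> g \<in> csp_group \<omega> \<and>
    g ** J ** h = J' \<and> (\<lambda>B. g ** B ** h) ` V = V'"

text \<open>The infinitesimal symmetries of the pair. Commuting with \<open>J\<close> encodes
  preservation of its two eigenspaces, and for the model pair \<open>g00_matrix\<close> below
  identifies this set with \<open>g00\<close>.\<close>

definition stab :: "(complex ^ 's \<Rightarrow> complex ^ 's \<Rightarrow> complex) \<Rightarrow> complex ^ 's ^ 's
    \<Rightarrow> (complex ^ 's ^ 's) set \<Rightarrow> (complex ^ 's ^ 's) set"
  where "stab \<omega> J V = {X \<in> csp_mat \<omega>. X ** J = J ** X \<and> (\<forall>B\<in>V. X ** B - B ** X \<in> V)}"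

lemma matrix_cancel:
  fixes g h A :: "complex ^ 's ^ 's"
  assumes "g ** h = mat 1"
  shows "A ** g ** h = A" "g ** (h ** A) = A"
  using assms by (simp_all add: matrix_mul_assoc[symmetric], simp add: matrix_mul_assoc)

lemma linear_conj: "linear (\<lambda>B. g ** B ** (h :: complex ^ 's ^ 's))"
  by (intro linearI) (simp_all add: matrix_expand)

context
  fixes \<omega> :: "complex ^ 's \<Rightarrow> complex ^ 's \<Rightarrow> complex"
  assumes symp: "symplectic_form \<omega>"
begin

lemma symp_add: "\<omega> (x + x') y = \<omega> x y + \<omega> x' y" "\<omega> y (x + x') = \<omega> y x + \<omega> y x'"
  and symp_scale: "\<omega> (c *s x) y = c * \<omega> x y" "\<omega> y (c *s x) = c * \<omega> y x"
  using symp unfolding symplectic_form_def Vector_Spaces.linear_iff by metis+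

lemma symp_scaleR: "\<omega> (r *\<^sub>R x) y = r *\<^sub>R \<omega> x y" "\<omega> y (r *\<^sub>R x) = r *\<^sub>R \<omega> y x"
proof -
  have "r *\<^sub>R x = complex_of_real r *s x"
    by (simp add: vec_eq_iff) (simp add: scaleR_conv_of_real)
  then show "\<omega> (r *\<^sub>R x) y = r *\<^sub>R \<omega> x y" "\<omega> y (r *\<^sub>R x) = r *\<^sub>R \<omega> y x"
    by (simp_all add: symp_scale scaleR_conv_of_real)
qed

lemma bounded_bilinear_symp: "bounded_bilinear \<omega>"
proof -
  have "bilinear \<omega>"
    unfolding bilinear_def by (auto intro!: linearI simp: symp_add symp_scaleR)
  then show ?thesis by (simp add: bilinear_conv_bounded_bilinear)
qed

lemmas symp_tendsto = bounded_bilinear.tendsto[OF bounded_bilinear_symp]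
lemmas symp_diff = bounded_bilinear.diff_left[OF bounded_bilinear_symp]
  bounded_bilinear.diff_right[OF bounded_bilinear_symp]
lemmas symp_zero = bounded_bilinear.zero_left[OF bounded_bilinear_symp]
  bounded_bilinear.zero_right[OF bounded_bilinear_symp]

text \<open>A normalised pair turns the conformal factor, which the definitions only assert to
  exist, into the value at this pair. In this form it can be bounded, differentiated and passed to
  limits.\<close>

lemma symp_unit_pair: obtains x0 y0 where "\<omega> x0 y0 = 1"
proof -
  obtain x y where xy: "\<omega> x y \<noteq> 0"
  proof -
    have "axis undefined 1 \<noteq> (0 :: complex ^ 's)" by (simp add: axis_eq_0_iff)
    then show thesis using symp that unfolding symplectic_form_def by metis
  qed
  have "\<omega> ((1 / \<omega> x y) *s x) y = 1" using xy by (simp add: symp_scale)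
  then show thesis using that by blast
qed

lemma csp_mat_iff:
  assumes "\<omega> x0 y0 = 1"
  shows "X \<in> csp_mat \<omega> \<longleftrightarrow>
    (\<forall>x y. \<omega> (X *v x) y + \<omega> x (X *v y) = (\<omega> (X *v x0) y0 + \<omega> x0 (X *v y0)) * \<omega> x y)"
  unfolding csp_mat_def mem_Collect_eq using assms by (metis mult.right_neutral)

lemma subspace_csp_mat: "subspace (csp_mat \<omega>)"
proof (rule subspaceI)
  show "0 \<in> csp_mat \<omega>" unfolding csp_mat_def by (auto simp: symp_zero intro!: exI[of _ 0])
next
  fix X Y assume "X \<in> csp_mat \<omega>" "Y \<in> csp_mat \<omega>"
  then obtain c d where "\<forall>x y. \<omega> (X *v x) y + \<omega> x (X *v y) = c * \<omega> x y"
    "\<forall>x y. \<omega> (Y *v x) y + \<omega> x (Y *v y) = d * \<omega> x y" unfolding csp_mat_def by blast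
  then have "\<forall>x y. \<omega> ((X + Y) *v x) y + \<omega> x ((X + Y) *v y) = (c + d) * \<omega> x y"
    by (simp add: matrix_vector_mult_add_rdistrib symp_add distrib_right) (metis add.assoc add.left_commute)
  then show "X + Y \<in> csp_mat \<omega>" unfolding csp_mat_def by blast
next
  fix X and r :: real assume "X \<in> csp_mat \<omega>"
  then obtain c where "\<forall>x y. \<omega> (X *v x) y + \<omega> x (X *v y) = c * \<omega> x y" unfolding csp_mat_def by blast
  then have "\<forall>x y. \<omega> ((r *\<^sub>R X) *v x) y + \<omega> x ((r *\<^sub>R X) *v y) = (r *\<^sub>R c) * \<omega> x y"
    by (simp add: bounded_bilinear.scaleR_left[OF bounded_bilinear_matrix_vector_mult] symp_scaleR
        scaleR_right_distrib[symmetric])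
  then show "r *\<^sub>R X \<in> csp_mat \<omega>" unfolding csp_mat_def by blast
qed

lemma csp_group_mult: "g \<in> csp_group \<omega> \<Longrightarrow> g' \<in> csp_group \<omega> \<Longrightarrow> g ** g' \<in> csp_group \<omega>"
  unfolding csp_group_def mem_Collect_eq
proof (elim exE conjE)
  fix c c' assume "c \<noteq> 0" "\<forall>x y. \<omega> (g *v x) (g *v y) = c * \<omega> x y"
    "c' \<noteq> 0" "\<forall>x y. \<omega> (g' *v x) (g' *v y) = c' * \<omega> x y"
  then show "\<exists>c. c \<noteq> 0 \<and> (\<forall>x y. \<omega> ((g ** g') *v x) ((g ** g') *v y) = c * \<omega> x y)"
    by (intro exI[of _ "c * c'"]) (simp add: matrix_vector_mul_assoc[symmetric])
qed

lemma csp_group_inverse: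
  assumes "g \<in> csp_group \<omega>" "g ** h = mat 1"
  shows "h \<in> csp_group \<omega>"
proof -
  obtain c where c: "c \<noteq> 0" "\<And>x y. \<omega> (g *v x) (g *v y) = c * \<omega> x y"
    using assms unfolding csp_group_def by blast
  have "\<omega> (h *v x) (h *v y) = (1 / c) * \<omega> x y" for x y
    using c(2)[of "h *v x" "h *v y"] c(1) assms(2) by (simp add: matrix_vector_mul_assoc)
  then show ?thesis
    unfolding csp_group_def using c(1) by (intro CollectI exI[of _ "1 / c"]) simp
qed

lemma csp_mat_conj:
  assumes X: "X \<in> csp_mat \<omega>" and g: "g \<in> csp_group \<omega>" "g ** h = mat 1"
  shows "g ** X ** h \<in> csp_mat \<omega>"
proof -
  obtain c where c: "\<And>x y. \<omega> (X *v x) y + \<omega> x (X *v y) = c * \<omega> x y"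
    using X unfolding csp_mat_def by blast
  obtain k where k: "k \<noteq> 0" "\<And>x y. \<omega> (g *v x) (g *v y) = k * \<omega> x y"
    using g unfolding csp_group_def by blast
  have gh: "g *v (h *v x) = x" for x using g(2) by (simp add: matrix_vector_mul_assoc)
  have "\<omega> ((g ** X ** h) *v x) y + \<omega> x ((g ** X ** h) *v y) = c * \<omega> x y" for x y
    using k(2)[of "X *v (h *v x)" "h *v y"] k(2)[of "h *v x" "X *v (h *v y)"]
      c[of "h *v x" "h *v y"] k(2)[of "h *v x" "h *v y"]
    by (simp add: gh matrix_vector_mul_assoc[symmetric] algebra_simps)
      (metis (no_types) distrib_left mult.left_commute)
  then show ?thesis unfolding csp_mat_def by blast
qed

lemma carries_sym:
  assumes c: "carries \<omega> g h J V J' V'"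
  shows "carries \<omega> h g J' V' J V"
proof -
  have gh: "g ** h = mat 1" "h ** g = mat 1" "g \<in> csp_group \<omega>" and J': "J' = g ** J ** h"
    and V': "V' = (\<lambda>B. g ** B ** h) ` V"
    using c unfolding carries_def by auto
  have id: "h ** (g ** B ** h) ** g = B" for B
    by (simp add: matrix_mul_assoc gh(2) matrix_cancel(1)[OF gh(2)])
  show ?thesis
    unfolding carries_def J' V' image_image id
    using gh csp_group_inverse by auto
qed

lemma carries_trans:
  assumes "carries \<omega> g h J V J' V'" "carries \<omega> g' h' J' V' J'' V''"
  shows "carries \<omega> (g' ** g) (h ** h') J V J'' V''"
proof -
  have "(\<lambda>B. g' ** g ** B ** (h ** h')) ` V = (\<lambda>B. g' ** B ** h') ` (\<lambda>B. g ** B ** h) ` V"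
    by (simp add: image_image matrix_mul_assoc)
  moreover have "g' ** g ** (h ** h') = mat 1" "h ** h' ** (g' ** g) = mat 1"
    using assms unfolding carries_def by (metis matrix_cancel(1) matrix_mul_assoc)+
  ultimately show ?thesis
    using assms csp_group_mult unfolding carries_def by (auto simp: matrix_mul_assoc)
qed

lemma carries_stab:
  assumes c: "carries \<omega> g h J V J' V'" and X: "X \<in> stab \<omega> J V"
  shows "g ** X ** h \<in> stab \<omega> J' V'"
proof -
  have gh: "g ** h = mat 1" "h ** g = mat 1" "g \<in> csp_group \<omega>" and J': "J' = g ** J ** h"
    and V': "V' = (\<lambda>B. g ** B ** h) ` V"
    using c unfolding carries_def by auto
  have "(g ** X ** h) ** (g ** B ** h) - (g ** B ** h) ** (g ** X ** h) = g ** (X ** B - B ** X) ** h" for B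
    by (simp add: matrix_expand matrix_cancel[OF gh(2)])
  moreover have "(g ** X ** h) ** (g ** J ** h) = (g ** J ** h) ** (g ** X ** h)"
    using X unfolding stab_def by (simp add: matrix_mul_assoc matrix_cancel[OF gh(2)])
      (simp add: matrix_mul_assoc[symmetric])
  ultimately show ?thesis
    using X csp_mat_conj[of X g h] gh unfolding stab_def J' V' by auto
qed

lemma subspace_stab:
  assumes V: "subspace V" shows "subspace (stab \<omega> J V)"
proof (rule subspaceI)
  show "0 \<in> stab \<omega> J V"
    using subspace_0[OF subspace_csp_mat] subspace_0[OF V] by (simp add: stab_def)
next
  fix X Y assume XY: "X \<in> stab \<omega> J V" "Y \<in> stab \<omega> J V"
  have "(X + Y) ** B - B ** (X + Y) = (X ** B - B ** X) + (Y ** B - B ** Y)" for B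
    by (simp add: matrix_expand)
  moreover have "(X + Y) ** J = J ** (X + Y)"
    using XY by (simp add: stab_def matrix_add_ldistrib matrix_add_rdistrib)
  ultimately show "X + Y \<in> stab \<omega> J V"
    using XY subspace_add[OF subspace_csp_mat] subspace_add[OF V] unfolding stab_def by simp
next
  fix X and r :: real assume X: "X \<in> stab \<omega> J V"
  have "(r *\<^sub>R X) ** B - B ** (r *\<^sub>R X) = r *\<^sub>R (X ** B - B ** X)" for B
    by (simp add: matrix_expand scaleR_diff_right)
  then show "r *\<^sub>R X \<in> stab \<omega> J V"
    using X subspace_scale[OF subspace_csp_mat] subspace_scale[OF V] unfolding stab_def
    by (simp add: matrix_scaleR_simps)
qed

text \<open>Along a solution of \<open>g' = X g\<close> the conjugates of the frame satisfy a linear system modulo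
  the initial subspace, so that they cannot leave it.\<close>

lemma flow_carries:
  fixes T T' :: "real \<Rightarrow> 'e::euclidean_space \<Rightarrow> complex ^ 's ^ 's" and X J :: "real \<Rightarrow> complex ^ 's ^ 's"
  assumes X: "continuous_on {a<..<b} X" "\<And>t. t \<in> {a<..<b} \<Longrightarrow> X t \<in> csp_mat \<omega>"
    and t0: "t0 \<in> {a<..<b}"
    and J: "\<And>t. t \<in> {a<..<b} \<Longrightarrow> (J has_vector_derivative (X t ** J t - J t ** X t)) (at t)"
    and lin: "\<And>t. t \<in> {a<..<b} \<Longrightarrow> linear (T t)"
    and T: "\<And>t \<eta>. t \<in> {a<..<b} \<Longrightarrow> ((\<lambda>t. T t \<eta>) has_vector_derivative T' t \<eta>) (at t)"
    and T'c: "\<And>\<eta>. continuous_on {a<..<b} (\<lambda>t. T' t \<eta>)"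
    and dimT: "\<And>t. t \<in> {a<..<b} \<Longrightarrow> dim (range (T t)) = dim (range (T t0))"
    and tang: "\<And>t \<eta>. t \<in> {a<..<b} \<Longrightarrow> T' t \<eta> - (X t ** T t \<eta> - T t \<eta> ** X t) \<in> range (T t)"
  obtains \<delta> g h where "\<delta> > 0" "{t0 - \<delta><..<t0 + \<delta>} \<subseteq> {a<..<b}" "g t0 = mat 1" "h t0 = mat 1"
    "\<And>t. t \<in> {t0 - \<delta><..<t0 + \<delta>} \<Longrightarrow> (g has_vector_derivative X t ** g t) (at t)"
    "\<And>t. t \<in> {t0 - \<delta><..<t0 + \<delta>} \<Longrightarrow>
      carries \<omega> (g t) (h t) (J t0) (range (T t0)) (J t) (range (T t))"
proof -
  obtain d1 g h where d1: "d1 > 0" "{t0 - d1<..<t0 + d1} \<subseteq> {a<..<b}" and g0: "g t0 = mat 1" "h t0 = mat 1"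
    and dg: "\<And>t. t \<in> {t0 - d1<..<t0 + d1} \<Longrightarrow> (g has_vector_derivative X t ** g t) (at t)"
    and dh: "\<And>t. t \<in> {t0 - d1<..<t0 + d1} \<Longrightarrow> (h has_vector_derivative - (h t ** X t)) (at t)"
    and gh: "\<And>t. t \<in> {t0 - d1<..<t0 + d1} \<Longrightarrow> g t ** h t = mat 1"
    and hg: "\<And>t. t \<in> {t0 - d1<..<t0 + d1} \<Longrightarrow> h t ** g t = mat 1"
    by (rule matrix_ode_local_solution[OF X(1) t0]) blast
  have Tc: "continuous (at t0 within {a<..<b}) (\<lambda>t. T t \<eta>)" for \<eta>
    using has_vector_derivative_continuous[OF T[OF t0, of \<eta>]] continuous_at_imp_continuous_at_within
    by blast
  obtain c d2 where c: "c > 0" "d2 > 0"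
    "\<And>t z. t \<in> {a<..<b} \<Longrightarrow> dist t t0 < d2 \<Longrightarrow> z \<in> range (T t) \<Longrightarrow> \<exists>\<eta>. T t \<eta> = z \<and> norm \<eta> \<le> c * norm z"
    using uniform_preimages[OF lin Tc t0 dimT] by metis
  obtain x0 y0 where u0: "\<omega> x0 y0 = 1" by (rule symp_unit_pair)
  define mu where "mu t = \<omega> (X t *v x0) y0 + \<omega> x0 (X t *v y0)" for t
  define \<delta> where "\<delta> = min d1 d2 / 2"
  have \<delta>: "\<delta> > 0" "\<delta> < d1" "\<delta> < d2" using d1 c by (auto simp: \<delta>_def)
  let ?I = "{t0 - \<delta><..<t0 + \<delta>}" and ?C = "{t0 - \<delta>..t0 + \<delta>}"
  have CI: "?C \<subseteq> {t0 - d1<..<t0 + d1}" "?C \<subseteq> {a<..<b}" "?I \<subseteq> ?C" using \<delta> d1(2) by auto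
  have inI: "t \<in> {t0 - d1<..<t0 + d1}" "t \<in> {a<..<b}" "t \<in> ?C" if "t \<in> ?I" for t
    using CI that by blast+
  \<comment> \<open>The tangency defect: it lies in \<open>range (T t)\<close> by
    \<open>tang\<close>, and it is what remains when \<open>h ** T \<eta> ** g\<close> is
    differentiated.\<close>
  define z where "z t \<eta> = T' t \<eta> - (X t ** T t \<eta> - T t \<eta> ** X t)" for t \<eta>
  have Tc': "continuous_on {a<..<b} (\<lambda>t. T t \<eta>)" for \<eta>
    using T has_vector_derivative_continuous continuous_at_imp_continuous_on by blast
  have "continuous_on {a<..<b} (\<lambda>t. z t \<eta>)" for \<eta>
    unfolding z_def by (intro continuous_intros T'c X Tc')
  then have "bounded ((\<lambda>t. z t \<eta>) ` ?C)" for \<eta>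
    using CI(2) by (intro compact_imp_bounded compact_continuous_image) (auto intro: continuous_on_subset)
  then have "\<exists>m. \<forall>t\<in>?C. norm (z t \<eta>) \<le> m" for \<eta> by (auto simp: bounded_iff)
  then obtain m where m: "\<And>t \<eta>. t \<in> ?C \<Longrightarrow> norm (z t \<eta>) \<le> m \<eta>" by metis
  \<comment> \<open>Some preimage of \<open>z s b\<close> under \<open>T s\<close> has norm at most
    \<open>c * \<bar>m b\<bar>\<close>; the sum over the basis makes one constant serve for all
    basis vectors.\<close>
  define K where "K = c * (\<Sum>b\<in>Basis. \<bar>m b\<bar>)"
  define V0 where "V0 = range (T t0)"
  have sV0: "subspace V0" unfolding V0_def using lin[OF t0] by (intro linear_subspace_image) auto
  have conjder: "((\<lambda>t. h t ** T t \<eta> ** g t) has_vector_derivative h t ** z t \<eta> ** g t) (at t)"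
    if t: "t \<in> ?I" for t \<eta>
  proof -
    have t': "t \<in> {t0 - d1<..<t0 + d1}" "t \<in> {a<..<b}" using inI[OF t] by blast+
    show ?thesis
      by (rule has_vector_derivative_eq_rhs, (rule has_vector_derivative_matrix_mult dg[OF t'(1)] dh[OF t'(1)] T[OF t'(2)])+)
        (simp add: z_def matrix_expand)
  qed
  have inV0: "h t ** T t \<eta> ** g t \<in> V0" if t: "t \<in> ?I" for t \<eta>
  proof -
    \<comment> \<open>Membership in \<open>V0\<close> is tested against vectors \<open>w\<close>
      orthogonal to \<open>V0\<close>: the numbers obtained from all basis vectors satisfy one
      homogeneous linear system and vanish at \<open>t0\<close>.\<close>
    have orth: "w \<bullet> (h t ** T t b ** g t) = 0" if w: "\<And>v. v \<in> V0 \<Longrightarrow> w \<bullet> v = 0" and b: "b \<in> Basis" for w b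
    proof (rule linear_system_zero[where I = Basis and D = "\<lambda>b t. w \<bullet> (h t ** T t b ** g t)"
          and D' = "\<lambda>b t. w \<bullet> (h t ** z t b ** g t)" and u = t0 and a = "t0 - \<delta>" and b = "t0 + \<delta>" and K = K and i = b and t = t])
      fix b :: 'e and s assume b: "b \<in> Basis" and s: "s \<in> ?I"
      show "((\<lambda>t. w \<bullet> (h t ** T t b ** g t)) has_vector_derivative w \<bullet> (h s ** z s b ** g s)) (at s)"
        using bounded_linear.has_vector_derivative[OF bounded_linear_inner_right conjder[OF s]] .
      have zr: "z s b \<in> range (T s)" unfolding z_def using tang inI[OF s] by blast
      have "\<bar>s - t0\<bar> < \<delta>" using s by auto
      then have ds: "dist s t0 < d2" using \<delta> by (simp add: dist_real_def)
      then obtain \<eta> where \<eta>: "T s \<eta> = z s b" "norm \<eta> \<le> c * norm (z s b)"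
        using c(3)[OF inI(2)[OF s] ds zr] by blast
      have "norm \<eta> \<le> K"
      proof -
        have "norm (z s b) \<le> \<bar>m b\<bar>" using m[of s b] s by force
        also have "\<dots> \<le> (\<Sum>b\<in>Basis. \<bar>m b\<bar>)" using b by (intro member_le_sum) auto
        finally show ?thesis using \<eta>(2) c(1) unfolding K_def by (meson mult_left_mono order_trans less_imp_le)
      qed
      interpret Ts: linear "T s" using lin inI[OF s] by blast
      have "T s \<eta> = T s (\<Sum>k\<in>Basis. (\<eta> \<bullet> k) *\<^sub>R k)" by (simp only: euclidean_representation)
      then have "z s b = (\<Sum>k\<in>Basis. (\<eta> \<bullet> k) *\<^sub>R T s k)" using \<eta> by (simp only: Ts.sum Ts.scale)
      then have "w \<bullet> (h s ** z s b ** g s) = (\<Sum>k\<in>Basis. (\<eta> \<bullet> k) * (w \<bullet> (h s ** T s k ** g s)))"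
        using linear_sum[OF linear_conj[of "h s" "g s"], of "\<lambda>k. (\<eta> \<bullet> k) *\<^sub>R T s k" Basis]
        by (simp add: inner_sum_right matrix_scaleR_simps)
      also have "norm \<dots> \<le> (\<Sum>k\<in>Basis. K * norm (w \<bullet> (h s ** T s k ** g s)))"
        using \<open>norm \<eta> \<le> K\<close> by (intro sum_norm_le)
          (auto simp: abs_mult intro!: mult_right_mono order_trans[OF Basis_le_norm])
      finally show "norm (w \<bullet> (h s ** z s b ** g s)) \<le> K * (\<Sum>k\<in>Basis. norm (w \<bullet> (h s ** T s k ** g s)))"
        by (simp add: sum_distrib_left)
    qed (use w t \<delta> b in \<open>auto simp: g0 V0_def\<close>)
    have basis: "h t ** T t b ** g t \<in> V0" if b: "b \<in> Basis" for b
    proof -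
      obtain v w where vw: "v \<in> span V0" "\<And>x. x \<in> span V0 \<Longrightarrow> orthogonal w x" "h t ** T t b ** g t = v + w"
        using orthogonal_subspace_decomp_exists[of V0 "h t ** T t b ** g t"] by metis
      have sp: "span V0 = V0" using sV0 by (simp add: span_eq_iff)
      have "w \<bullet> (v + w) = 0" using orth[of w b] vw b sp by (auto simp: orthogonal_def)
      then have "w = 0" using vw(1,2) by (auto simp: orthogonal_def inner_add_right)
      then show ?thesis using vw sp by simp
    qed
    interpret Ts: linear "T t" using lin inI[OF t] by blast
    have "T t \<eta> = T t (\<Sum>k\<in>Basis. (\<eta> \<bullet> k) *\<^sub>R k)" by (simp only: euclidean_representation)
    then have "h t ** T t \<eta> ** g t = (\<Sum>k\<in>Basis. (\<eta> \<bullet> k) *\<^sub>R (h t ** T t k ** g t))"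
      using linear_sum[OF linear_conj[of "h t" "g t"], of "\<lambda>k. (\<eta> \<bullet> k) *\<^sub>R T t k" Basis]
      by (simp only: Ts.sum Ts.scale matrix_scaleR_simps)
    then show ?thesis using basis sV0 by (auto intro!: subspace_sum subspace_scale)
  qed
  have img: "(\<lambda>B. g t ** B ** h t) ` V0 = range (T t)" if t: "t \<in> ?I" for t
  proof -
    have t': "t \<in> {t0 - d1<..<t0 + d1}" "t \<in> {a<..<b}" using inI[OF t] by blast+
    let ?c = "\<lambda>B. h t ** B ** g t"
    have inj: "inj ?c"
      by (rule inj_on_inverseI[where g = "\<lambda>B. g t ** B ** h t"])
        (simp add: matrix_mul_assoc matrix_cancel gh[OF t'(1)])
    have "dim (?c ` range (T t)) = dim (range (T t))"
      using inj by (intro dim_image_eq linear_conj) (auto intro: inj_on_subset)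
    moreover have "?c ` range (T t) \<subseteq> V0" using inV0[OF t] by auto
    ultimately have "?c ` range (T t) = V0"
      using dimT[OF t'(2)] sV0 lin[OF t'(2)] lin[OF t0] unfolding V0_def
      by (intro subspace_dim_equal linear_subspace_image linear_conj) auto
    then have "(\<lambda>B. g t ** B ** h t) ` V0 = (\<lambda>B. g t ** B ** h t) ` ?c ` range (T t)" by simp
    also have "\<dots> = range (T t)" by (simp add: image_image matrix_mul_assoc matrix_cancel gh[OF t'(1)])
    finally show ?thesis .
  qed
  have Jimg: "g t ** J t0 ** h t = J t" if t: "t \<in> ?I" for t
  proof -
    have t': "t \<in> {t0 - d1<..<t0 + d1}" "t \<in> {a<..<b}" using inI[OF t] by blast+
    have "h t ** J t ** g t = h t0 ** J t0 ** g t0"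
    proof (rule vector_derivative_zero_constant[of "t0 - \<delta>" "t0 + \<delta>"])
      fix s assume s: "s \<in> ?I"
      then have s': "s \<in> {t0 - d1<..<t0 + d1}" "s \<in> {a<..<b}" using inI[OF s] by blast+
      show "((\<lambda>t. h t ** J t ** g t) has_vector_derivative 0) (at s)"
        by (rule has_vector_derivative_eq_rhs, (rule has_vector_derivative_matrix_mult dg[OF s'(1)] dh[OF s'(1)] J[OF s'(2)])+)
          (simp add: matrix_expand)
    qed (use t \<delta> in auto)
    then have "J t0 = h t ** J t ** g t" by (simp add: g0)
    then show ?thesis by (simp add: matrix_mul_assoc matrix_cancel gh[OF t'(1)])
  qed
  have csp: "g t \<in> csp_group \<omega>" if t: "t \<in> ?I" for t
  proof -
    have t': "t \<in> {t0 - d1<..<t0 + d1}" "t \<in> {a<..<b}" using inI[OF t] by blast+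
    have "continuous_on {a<..<b} mu" unfolding mu_def
      by (intro continuous_intros bounded_bilinear.continuous_on[OF bounded_bilinear_symp] X)
    then have "bounded (mu ` ?C)"
      using CI(2) by (intro compact_imp_bounded compact_continuous_image) (auto intro: continuous_on_subset)
    then obtain k where k: "\<And>t. t \<in> ?C \<Longrightarrow> norm (mu t) \<le> k" unfolding bounded_iff by blast
    have lam: "\<omega> (X s *v x) y + \<omega> x (X s *v y) = mu s * \<omega> x y" if "s \<in> ?I" for s x y
      using X(2)[of s] inI[OF that] csp_mat_iff[OF u0, of "X s"] unfolding mu_def by blast
    define f where "f x y s = \<omega> (g s *v x) (g s *v y)" for x y s
    have df: "(f x y has_vector_derivative mu s * f x y s) (at s)" if s: "s \<in> ?I" for x y s
    proof -
      have s': "s \<in> {t0 - d1<..<t0 + d1}" using inI[OF s] by blast+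
      have "((\<lambda>s. g s *v x) has_vector_derivative X s *v (g s *v x)) (at s)" for x
        by (rule has_vector_derivative_eq_rhs, (rule has_vector_derivative_matrix_vector_mult dg[OF s'] has_vector_derivative_const)+)
          (simp add: matrix_vector_mul_assoc)
      from bounded_bilinear.has_vector_derivative[OF bounded_bilinear_symp this this]
      show ?thesis unfolding f_def lam[OF s, symmetric] by (simp add: add.commute)
    qed
    \<comment> \<open>Both \<open>f x y\<close> and \<open>f x0 y0\<close> scaled by
      \<open>\<omega> x y\<close> solve the scalar equation with coefficient \<open>mu\<close>, and
      they agree at \<open>t0\<close> because \<open>\<omega> x0 y0 = 1\<close>.\<close>
    have eq: "f x y t - f x0 y0 t * \<omega> x y = 0" for x y
    proof (rule linear_system_zero[where I = "{()}" and D = "\<lambda>_ s. f x y s - f x0 y0 s * \<omega> x y"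
          and D' = "\<lambda>_ s. mu s * (f x y s - f x0 y0 s * \<omega> x y)" and u = t0 and K = k
          and a = "t0 - \<delta>" and b = "t0 + \<delta>" and i = "()" and t = t])
      fix s assume s: "s \<in> ?I"
      show "((\<lambda>s. f x y s - f x0 y0 s * \<omega> x y) has_vector_derivative
          mu s * (f x y s - f x0 y0 s * \<omega> x y)) (at s)"
        using df[OF s]
        by (auto intro!: derivative_eq_intros simp: algebra_simps)
      show "norm (mu s * (f x y s - f x0 y0 s * \<omega> x y)) \<le> k * (\<Sum>j\<in>{()}. norm (f x y s - f x0 y0 s * \<omega> x y))"
        using k[of s] s by (auto simp: norm_mult intro!: mult_right_mono)
    qed (use t \<delta> in \<open>auto simp: f_def g0 u0\<close>)
    \<comment> \<open>If this factor vanished, \<open>f\<close> would vanish for all arguments, in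
      particular for the images of \<open>x0\<close> and \<open>y0\<close> under \<open>h t\<close>,
      where its value is 1.\<close>
    have "f x0 y0 t \<noteq> 0"
    proof
      assume "f x0 y0 t = 0"
      then have "f (h t *v x0) (h t *v y0) t = 0" using eq by simp
      then show False using u0 gh[OF t'(1)] by (simp add: f_def matrix_vector_mul_assoc)
    qed
    moreover have "\<omega> (g t *v x) (g t *v y) = f x0 y0 t * \<omega> x y" for x y
      using eq[of x y] unfolding f_def[of x y] by simp
    ultimately show ?thesis unfolding csp_group_def by blast
  qed
  show ?thesis
  proof (rule that[of \<delta> g h])
    fix t assume t: "t \<in> ?I"
    then have t': "t \<in> {t0 - d1<..<t0 + d1}" using inI[OF t] by blast
    show "(g has_vector_derivative X t ** g t) (at t)" by (rule dg[OF t'])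
    show "carries \<omega> (g t) (h t) (J t0) (range (T t0)) (J t) (range (T t))"
      unfolding carries_def using gh[OF t'] hg[OF t'] csp[OF t] Jimg[OF t] img[OF t] V0_def by simp
  next
    show "?I \<subseteq> {a<..<b}" using CI by (meson subset_trans)
  qed (use \<delta> g0 in auto)
qed

text \<open>This is \<open>flow_carries\<close> for a flag that does not move. A projection onto
  \<open>V\<close> presents this subspace as the range of a constant family of linear maps.\<close>

lemma stab_flow:
  assumes Y: "Y \<in> stab \<omega> J V" and V: "subspace V"
  obtains \<delta> g h where "\<delta> > 0" "g 0 = mat 1"
    "\<And>t. t \<in> {-\<delta><..<\<delta>} \<Longrightarrow> (g has_vector_derivative Y ** g t) (at t)"
    "\<And>t. t \<in> {-\<delta><..<\<delta>} \<Longrightarrow> carries \<omega> (g t) (h t) J V J V"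
proof -
  obtain P :: "complex ^ 's ^ 's \<Rightarrow> complex ^ 's ^ 's"
    where P': "range P \<subseteq> V" "linear P" "\<forall>v\<in>V. P v = v"
    using linear_exists_left_inverse_on[of "\<lambda>x. x", OF linear_ident V inj_on_id2] by blast
  have P: "linear P" "range P = V"
    using P' by (auto simp: image_iff) (metis rangeI)+
  obtain \<delta> g h where *: "\<delta> > 0" "{0 - \<delta><..<0 + \<delta>} \<subseteq> {-1<..<1}" "g 0 = mat 1" "h 0 = mat 1"
    "\<And>t. t \<in> {0 - \<delta><..<0 + \<delta>} \<Longrightarrow> (g has_vector_derivative Y ** g t) (at t)"
    "\<And>t. t \<in> {0 - \<delta><..<0 + \<delta>} \<Longrightarrow> carries \<omega> (g t) (h t) J (range P) J (range P)"
  proof (rule flow_carries[of "-1" 1 "\<lambda>_. Y" 0 "\<lambda>_. J" "\<lambda>_. P" "\<lambda>_ _. 0"])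
    show "0 - (Y ** P \<eta> - P \<eta> ** Y) \<in> range P" for \<eta>
      using Y V P unfolding stab_def by (metis (no_types, lifting) mem_Collect_eq rangeI subspace_diff subspace_0)
  qed (use Y P in \<open>auto simp: stab_def\<close>)
  then show ?thesis using that[of \<delta> g h] P(2) by auto
qed

end

section \<open>A moving involution with a constant symbol\<close>

text \<open>The identity \<open>h j - h0 = h j ** (g0 - g j) ** h0\<close> first bounds
  \<open>h j\<close> by \<open>2 * norm h0\<close> for large \<open>j\<close>, and with this bound
  it forces convergence.\<close>

lemma inverse_tendsto:
  fixes g h :: "nat \<Rightarrow> complex ^ 's ^ 's"
  assumes gh: "\<And>j. h j ** g j = mat 1" and g0: "g0 ** h0 = mat 1" and g: "g \<longlonglongrightarrow> g0"
  shows "h \<longlonglongrightarrow> h0"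
proof -
  obtain K where K: "K > 0" "\<And>(A :: complex ^ 's ^ 's) (B :: complex ^ 's ^ 's). norm (A ** B) \<le> norm A * norm B * K"
    using bounded_bilinear.pos_bounded[OF bounded_bilinear_matrix_mult] by blast
  have eq: "h j - h0 = (h j ** (g0 - g j)) ** h0" for j
    using gh[of j] g0 by (simp add: matrix_expand matrix_cancel(1)[OF g0])
  have bd: "norm (h j - h0) \<le> norm (h j) * (norm (g0 - g j) * K * norm h0 * K)" for j
    unfolding eq using K(2)[of "h j ** (g0 - g j)" h0] K(2)[of "h j" "g0 - g j"] K(1)
    by (smt (verit) mult.assoc mult.commute mult_right_mono norm_ge_zero)
  have lim0: "(\<lambda>j. norm (g0 - g j) * K * norm h0 * K) \<longlonglongrightarrow> 0"
  proof -
    have "(\<lambda>j. norm (g0 - g j) * K * norm h0 * K) \<longlonglongrightarrow> norm (g0 - g0) * K * norm h0 * K"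
      by (intro tendsto_intros g)
    then show ?thesis by simp
  qed
  then have ev: "\<forall>\<^sub>F j in sequentially. norm (g0 - g j) * K * norm h0 * K < 1 / 2"
    by (rule order_tendstoD) simp
  have "\<forall>\<^sub>F j in sequentially. norm (h j - h0) \<le> 2 * norm h0 * (norm (g0 - g j) * K * norm h0 * K)"
    using ev
  proof eventually_elim
    case (elim j)
    let ?q = "norm (g0 - g j) * K * norm h0 * K"
    have q: "?q \<ge> 0" using K by simp
    have "norm (h j) * ?q \<le> norm (h j) * (1 / 2)" using elim by (intro mult_left_mono) auto
    then have "norm (h j) \<le> 2 * norm h0"
      using bd[of j] norm_triangle_ineq2[of "h j" h0] by linarith
    then show ?case using bd[of j] mult_right_mono[OF _ q] by (meson order_trans)
  qed
  then have "(\<lambda>j. h j - h0) \<longlonglongrightarrow> 0"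
    by (rule Lim_null_comparison) (rule tendsto_mult_right_zero[OF lim0])
  then show ?thesis by (simp add: LIM_zero_iff)
qed

lemma convergent_pair_subseq:
  fixes f :: "nat \<Rightarrow> 'a::euclidean_space" and g :: "nat \<Rightarrow> 'b::euclidean_space"
  assumes "\<And>j. norm (f j) \<le> k" "\<And>j. norm (g j) \<le> k"
  obtains r u v where "strict_mono (r :: nat \<Rightarrow> nat)" "(f \<circ> r) \<longlonglongrightarrow> u" "(g \<circ> r) \<longlonglongrightarrow> v"
proof -
  have "norm (f j, g j) \<le> k + k" for j
    using norm_Pair_le[of "f j" "g j"] assms(1)[of j] assms(2)[of j] by linarith
  then have "bounded (range (\<lambda>j. (f j, g j)))"
    unfolding bounded_iff by blast
  then obtain l r where lr: "strict_mono (r :: nat \<Rightarrow> nat)" "((\<lambda>j. (f j, g j)) \<circ> r) \<longlonglongrightarrow> l"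
    using bounded_imp_convergent_subsequence[of "\<lambda>j. (f j, g j)"] by blast
  show ?thesis
    using that[OF lr(1), of "fst l" "snd l"] tendsto_fst[OF lr(2)] tendsto_snd[OF lr(2)]
    by (simp add: o_def)
qed

text \<open>A discontinuity produces a sequence whose images keep a fixed distance from
  \<open>f x\<close>, and no subsequence of it can converge there. The compactness arguments below
  deliver convergence only along subsequences.\<close>

lemma continuous_on_subseq:
  fixes f :: "'a::metric_space \<Rightarrow> 'b::metric_space"
  assumes "\<And>s x. x \<in> S \<Longrightarrow> (\<And>j. s j \<in> S) \<Longrightarrow> s \<longlonglongrightarrow> x \<Longrightarrow>
    \<exists>r. strict_mono (r :: nat \<Rightarrow> nat) \<and> (\<lambda>j. f (s (r j))) \<longlonglongrightarrow> f x"
  shows "continuous_on S f"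
  unfolding continuous_on_eq_continuous_within
proof
  fix x assume x: "x \<in> S"
  show "continuous (at x within S) f"
  proof (rule ccontr)
    assume "\<not> continuous (at x within S) f"
    then obtain e where e: "e > 0" "\<And>d. d > 0 \<Longrightarrow> \<exists>y\<in>S. dist y x < d \<and> \<not> dist (f y) (f x) < e"
      unfolding continuous_within_eps_delta by blast
    have "\<forall>j. \<exists>y\<in>S. dist y x < inverse (real (Suc j)) \<and> \<not> dist (f y) (f x) < e"
      using e(2) by simp
    then obtain s where s: "\<And>j. s j \<in> S" "\<And>j. dist (s j) x < inverse (real (Suc j))"
      "\<And>j. \<not> dist (f (s j)) (f x) < e" by metis
    have "(\<lambda>j. dist (s j) x) \<longlonglongrightarrow> 0"
      using s(2) by (intro tendsto_sandwich[OF _ _ tendsto_const LIMSEQ_inverse_real_of_nat])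
        (auto intro: always_eventually less_imp_le)
    then have "s \<longlonglongrightarrow> x" by (rule tendsto_dist_iff[THEN iffD2])
    from assms[OF x s(1) this] obtain r where "(\<lambda>j. f (s (r j))) \<longlonglongrightarrow> f x" by blast
    from metric_LIMSEQ_D[OF this e(1)] show False using s(3) by blast
  qed
qed

text \<open>The condition \<open>const_vel\<close> is the constancy of the modified symbol: the velocities of curves of
  frames, read in the initial frame, do not depend on that frame.\<close>

locale moving_flag =
  fixes \<omega> :: "complex ^ 's \<Rightarrow> complex ^ 's \<Rightarrow> complex"
    and J0 :: "complex ^ 's ^ 's" and G0 :: "(complex ^ 's ^ 's) set"
    and U :: "'e::euclidean_space set" and J :: "'e \<Rightarrow> complex ^ 's ^ 's"
    and e :: "'e \<Rightarrow> 'e \<Rightarrow> complex ^ 's ^ 's" and e2 :: "'e \<Rightarrow> 'e \<Rightarrow> 'e \<Rightarrow> complex ^ 's ^ 's"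
    and e3 :: "'e \<Rightarrow> 'e \<Rightarrow> 'e \<Rightarrow> 'e \<Rightarrow> complex ^ 's ^ 's"
    and \<Theta> :: "(complex ^ 's ^ 's) set"
  assumes symp: "symplectic_form \<omega>"
    and J0sq: "J0 ** J0 = mat 1" and J0csp: "\<And>x y. \<omega> (J0 *v x) (J0 *v y) = - \<omega> x y"
    and sG0: "subspace G0" and G0anti: "\<And>B. B \<in> G0 \<Longrightarrow> J0 ** B = - (B ** J0)"
    and G0csp: "G0 \<subseteq> csp_mat \<omega>"
    and openU: "open U"
    and dJ: "\<And>x. x \<in> U \<Longrightarrow> (J has_derivative (\<lambda>\<eta>. e \<eta> x)) (at x)"
    and de: "\<And>x \<eta>. x \<in> U \<Longrightarrow> (e \<eta> has_derivative (\<lambda>\<xi>. e2 \<xi> \<eta> x)) (at x)"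
    and de2: "\<And>x \<xi> \<eta>. x \<in> U \<Longrightarrow> (e2 \<xi> \<eta> has_derivative (\<lambda>\<zeta>. e3 \<zeta> \<xi> \<eta> x)) (at x)"
    and e2sym: "\<And>x \<xi> \<eta>. x \<in> U \<Longrightarrow> e2 \<xi> \<eta> x = e2 \<eta> \<xi> x"
    and e3sym: "\<And>x \<zeta> \<xi> \<eta>. x \<in> U \<Longrightarrow> e3 \<zeta> \<xi> \<eta> x = e3 \<xi> \<zeta> \<eta> x"
    and Jsq: "\<And>x. x \<in> U \<Longrightarrow> J x ** J x = mat 1"
    and split: "\<And>x \<xi>. x \<in> U \<Longrightarrow> J x ** e \<xi> x \<in> range (\<lambda>\<eta>. e \<eta> x)"
    and degenerate: "\<And>x \<xi> \<eta>. x \<in> U \<Longrightarrow> e \<xi> x = 0 \<Longrightarrow> e2 \<xi> \<eta> x = 0"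
    and frame_ex: "\<And>x. x \<in> U \<Longrightarrow> \<exists>g h. carries \<omega> g h J0 G0 (J x) (range (\<lambda>\<eta>. e \<eta> x))"
    and const_vel: "\<And>x g h. x \<in> U \<Longrightarrow> carries \<omega> g h J0 G0 (J x) (range (\<lambda>\<eta>. e \<eta> x)) \<Longrightarrow>
      \<Theta> = {A. \<exists>\<epsilon>>0. \<exists>xc gc. xc 0 = x \<and> gc 0 = g \<and>
        (\<forall>t\<in>{-\<epsilon><..<\<epsilon>}. xc t \<in> U \<and>
          (\<exists>h. carries \<omega> (gc t) h J0 G0 (J (xc t)) (range (\<lambda>\<eta>. e \<eta> (xc t))))) \<and>
        xc C1_differentiable_on {-\<epsilon><..<\<epsilon>} \<and> gc C1_differentiable_on {-\<epsilon><..<\<epsilon>} \<and>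
        (gc has_vector_derivative g ** A) (at 0)}"
begin

section \<open>The derivative image as a bundle of constant rank, and limits of frame
  changes\<close>

definition G :: "'e \<Rightarrow> (complex ^ 's ^ 's) set" where "G x = range (\<lambda>\<eta>. e \<eta> x)"

lemma linear_e: "x \<in> U \<Longrightarrow> linear (\<lambda>\<eta>. e \<eta> x)"
  using dJ has_derivative_linear by blast

lemma linear_e2: "x \<in> U \<Longrightarrow> linear (\<lambda>\<xi>. e2 \<xi> \<eta> x)"
  using de has_derivative_linear by blast

lemma subspace_G: "x \<in> U \<Longrightarrow> subspace (G x)"
  unfolding G_def using linear_e by (intro linear_subspace_image) auto

lemma tendsto_J: "x \<in> U \<Longrightarrow> s \<longlonglongrightarrow> x \<Longrightarrow> (\<lambda>j. J (s j)) \<longlonglongrightarrow> J x"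
  using has_derivative_continuous[OF dJ] isCont_tendsto_compose by blast

lemma tendsto_e: "x \<in> U \<Longrightarrow> s \<longlonglongrightarrow> x \<Longrightarrow> (\<lambda>j. e \<eta> (s j)) \<longlonglongrightarrow> e \<eta> x"
  using has_derivative_continuous[OF de] isCont_tendsto_compose by blast

lemma tendsto_e2: "x \<in> U \<Longrightarrow> s \<longlonglongrightarrow> x \<Longrightarrow> (\<lambda>j. e2 \<xi> \<eta> (s j)) \<longlonglongrightarrow> e2 \<xi> \<eta> x"
  using has_derivative_continuous[OF de2] isCont_tendsto_compose by blast

lemma eanti: 
  assumes x: "x \<in> U" shows "e \<xi> x ** J x = - (J x ** e \<xi> x)"
proof -
  have "((\<lambda>y. J y ** J y) has_derivative (\<lambda>h. J x ** e h x + e h x ** J x)) (at x)"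
    by (intro has_derivative_matrix_mult dJ x)
  moreover have "((\<lambda>y. J y ** J y) has_derivative (\<lambda>h. 0)) (at x)"
    by (rule has_derivative_transform_within_open[OF has_derivative_const[of "mat 1"] openU x])
      (simp add: Jsq)
  ultimately have "(\<lambda>h. J x ** e h x + e h x ** J x) = (\<lambda>h. 0)"
    by (rule has_derivative_unique)
  from fun_cong[OF this, of \<xi>] show ?thesis by (simp add: eq_neg_iff_add_eq_0 add.commute)
qed

lemma JG: "x \<in> U \<Longrightarrow> B \<in> G x \<Longrightarrow> J x ** B \<in> G x"
  unfolding G_def using split by auto

lemma G_dim: 
  assumes "x \<in> U" shows "dim (G x) = dim G0"
proof -
  obtain g h where c: "carries \<omega> g h J0 G0 (J x) (G x)" using frame_ex[OF assms] unfolding G_def by blast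
  then have inj: "inj (\<lambda>B. g ** B ** h)" unfolding carries_def
    by (intro inj_on_inverseI[where g = "\<lambda>B. h ** B ** g"]) (simp add: matrix_mul_assoc matrix_cancel)
  have "dim ((\<lambda>B. g ** B ** h) ` G0) = dim G0"
    using inj by (intro dim_image_eq linear_conj) (auto intro: inj_on_subset)
  then show ?thesis using c unfolding carries_def by simp
qed

lemma Gcsp: "x \<in> U \<Longrightarrow> B \<in> G x \<Longrightarrow> B \<in> csp_mat \<omega>"
proof -
  assume x: "x \<in> U" and B: "B \<in> G x"
  obtain g h where c: "carries \<omega> g h J0 G0 (J x) (G x)" using frame_ex[OF x] unfolding G_def by blast
  then obtain B0 where "B0 \<in> G0" "B = g ** B0 ** h" using B unfolding carries_def by blast
  then show ?thesis using csp_mat_conj[OF symp] G0csp c unfolding carries_def by blast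
qed

text \<open>Constant rank makes the total space of the bundle closed: by
  \<open>uniform_preimages\<close> the convergent sequence has bounded preimages, a subsequence of
  which converges to a preimage of the limit.\<close>

lemma G_closed_seq:
  assumes x: "x \<in> U" and s: "\<And>j. s j \<in> U" "s \<longlonglongrightarrow> x" and z: "\<And>j. z j \<in> G (s j)" "z \<longlonglongrightarrow> l"
  shows "l \<in> G x"
proof -
  have cont: "continuous (at x within U) (\<lambda>x. e \<eta> x)" for \<eta>
    using has_derivative_continuous[OF de[OF x]] continuous_at_imp_continuous_at_within by blast
  obtain c d where cd: "c > 0" "d > 0" "\<And>y z. y \<in> U \<Longrightarrow> dist y x < d \<Longrightarrow> z \<in> range (\<lambda>\<eta>. e \<eta> y) \<Longrightarrow>
      \<exists>\<eta>. e \<eta> y = z \<and> norm \<eta> \<le> c * norm z"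
    by (rule uniform_preimages[of U "\<lambda>x \<eta>. e \<eta> x" x])
      (use linear_e cont x G_dim in \<open>auto simp: G_def\<close>)
  obtain N where N: "\<And>j. j \<ge> N \<Longrightarrow> dist (s j) x < d" using metric_LIMSEQ_D[OF s(2) cd(2)] by blast
  have "\<exists>\<eta>. e \<eta> (s (j + N)) = z (j + N) \<and> norm \<eta> \<le> c * norm (z (j + N))" for j
    using cd(3)[OF s(1) N, of "j + N" "z (j + N)"] z(1)[of "j + N"] unfolding G_def by auto
  then obtain \<eta> where \<eta>: "\<And>j. e (\<eta> j) (s (j + N)) = z (j + N)" "\<And>j. norm (\<eta> j) \<le> c * norm (z (j + N))"
    by metis
  obtain m where m: "\<And>j. norm (z j) \<le> m"
    using convergent_imp_Bseq[of z] z(2) unfolding convergent_def Bseq_def by blast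
  have "norm (\<eta> j) \<le> c * m" for j using \<eta>(2)[of j] m[of "j + N"] cd(1)
    by (meson mult_left_mono less_imp_le order_trans)
  then obtain r \<eta>0 where r: "strict_mono (r :: nat \<Rightarrow> nat)" "(\<eta> \<circ> r) \<longlonglongrightarrow> \<eta>0"
    using bounded_imp_convergent_subsequence[of \<eta>] unfolding bounded_iff by blast
  have expand: "e \<eta> y = (\<Sum>b\<in>Basis. (\<eta> \<bullet> b) *\<^sub>R e b y)" if "y \<in> U" for y \<eta>
  proof -
    interpret linear "\<lambda>\<eta>. e \<eta> y" by (rule linear_e[OF that])
    have "e \<eta> y = e (\<Sum>b\<in>Basis. (\<eta> \<bullet> b) *\<^sub>R b) y" by (simp only: euclidean_representation)
    then show ?thesis by (simp only: sum scale)
  qed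
  have shift: "(\<lambda>j. f (r j + N)) \<longlonglongrightarrow> y" if "f \<longlonglongrightarrow> y" for f :: "nat \<Rightarrow> 'z::topological_space" and y
    using LIMSEQ_subseq_LIMSEQ[OF LIMSEQ_ignore_initial_segment[OF that, of N] r(1)] by (simp add: o_def)
  have "(\<lambda>j. \<Sum>b\<in>Basis. ((\<eta> \<circ> r) j \<bullet> b) *\<^sub>R e b (s (r j + N))) \<longlonglongrightarrow> (\<Sum>b\<in>Basis. (\<eta>0 \<bullet> b) *\<^sub>R e b x)"
    by (intro tendsto_intros r(2) tendsto_e x shift s(2))
  then have "(\<lambda>j. z (r j + N)) \<longlonglongrightarrow> e \<eta>0 x"
    using \<eta>(1) s(1) by (simp add: expand[symmetric] x)
  then have "l = e \<eta>0 x" using shift[OF z(2)] LIMSEQ_unique by blast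
  then show ?thesis unfolding G_def by blast
qed

text \<open>The scaling factors \<open>\<rho> j\<close> are arbitrary, so that ordinary difference
  quotients along a curve and the normalised quotients of \<open>tangency_exists\<close> are treated
  alike; \<open>j1\<close> and \<open>W\<close> are the corresponding limits for \<open>J\<close>
  and \<open>e\<close>.\<close>

lemma infinitesimal:
  assumes x: "x \<in> U" and s: "\<And>j. s j \<in> U" "s \<longlonglongrightarrow> x"
    and c: "\<And>j. carries \<omega> (g j) (h j) (J x) (G x) (J (s j)) (G (s j))"
    and g1: "g \<longlonglongrightarrow> mat 1"
    and gX: "(\<lambda>j. \<rho> j *\<^sub>R (g j - mat 1)) \<longlonglongrightarrow> X"
    and dJs: "(\<lambda>j. \<rho> j *\<^sub>R (J (s j) - J x)) \<longlonglongrightarrow> j1"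
    and des: "\<And>\<eta>. (\<lambda>j. \<rho> j *\<^sub>R (e \<eta> (s j) - e \<eta> x)) \<longlonglongrightarrow> W \<eta>"
  shows "X \<in> csp_mat \<omega>" "X ** J x - J x ** X = j1" "X ** e \<eta> x - e \<eta> x ** X - W \<eta> \<in> G x"
proof -
  have gh: "g j ** h j = mat 1" "h j ** g j = mat 1" for j using c unfolding carries_def by auto
  have h1: "h \<longlonglongrightarrow> mat 1" by (rule inverse_tendsto[OF gh(2) _ g1]) simp
  \<comment> \<open>The identity \<open>g B h - B = (g - 1) B h - B (g - 1) h\<close> involves only
    the quotients of \<open>g\<close>; the inverse enters through its limit.\<close>
  have conj: "(\<lambda>j. \<rho> j *\<^sub>R (g j ** B ** h j - B)) \<longlonglongrightarrow> X ** B - B ** X" for B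
  proof -
    have "(\<lambda>j. (\<rho> j *\<^sub>R (g j - mat 1)) ** B ** h j - B ** (\<rho> j *\<^sub>R (g j - mat 1)) ** h j)
        \<longlonglongrightarrow> X ** B ** mat 1 - B ** X ** mat 1"
      by (intro tendsto_intros gX h1)
    moreover have "(\<rho> j *\<^sub>R (g j - mat 1)) ** B ** h j - B ** (\<rho> j *\<^sub>R (g j - mat 1)) ** h j
        = \<rho> j *\<^sub>R (g j ** B ** h j - B)" for j
      by (simp add: matrix_expand matrix_cancel(1)[OF gh(1)] scaleR_diff_right)
    ultimately show ?thesis by simp
  qed
  have "g j ** J x ** h j = J (s j)" for j using c unfolding carries_def by auto
  then show "X ** J x - J x ** X = j1"
    using LIMSEQ_unique[OF conj[of "J x"]] dJs by simp
  show "X ** e \<eta> x - e \<eta> x ** X - W \<eta> \<in> G x"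
  proof (rule G_closed_seq[OF x s])
    show "(\<lambda>j. \<rho> j *\<^sub>R (g j ** e \<eta> x ** h j - e \<eta> x) - \<rho> j *\<^sub>R (e \<eta> (s j) - e \<eta> x))
        \<longlonglongrightarrow> X ** e \<eta> x - e \<eta> x ** X - W \<eta>"
      by (intro tendsto_intros conj des)
    show "\<rho> j *\<^sub>R (g j ** e \<eta> x ** h j - e \<eta> x) - \<rho> j *\<^sub>R (e \<eta> (s j) - e \<eta> x) \<in> G (s j)" for j
    proof -
      have "g j ** e \<eta> x ** h j \<in> G (s j)" using c[of j] unfolding carries_def G_def by blast
      moreover have "e \<eta> (s j) \<in> G (s j)" unfolding G_def by blast
      ultimately have "\<rho> j *\<^sub>R (g j ** e \<eta> x ** h j - e \<eta> (s j)) \<in> G (s j)"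
        using subspace_G[OF s(1)] by (intro subspace_scale subspace_diff)
      then show ?thesis by (simp add: algebra_simps)
    qed
  qed
  obtain x0 y0 where u: "\<omega> x0 y0 = 1" by (rule symp_unit_pair[OF symp])
  have lim: "(\<lambda>j. \<rho> j *\<^sub>R (\<omega> (g j *v a) (g j *v b) - \<omega> a b)) \<longlonglongrightarrow> \<omega> (X *v a) b + \<omega> a (X *v b)" for a b
  proof -
    have "(\<lambda>j. \<omega> ((\<rho> j *\<^sub>R (g j - mat 1)) *v a) (g j *v b) + \<omega> a ((\<rho> j *\<^sub>R (g j - mat 1)) *v b))
        \<longlonglongrightarrow> \<omega> (X *v a) (mat 1 *v b) + \<omega> a (X *v b)"
      by (intro tendsto_intros symp_tendsto[OF symp] gX g1)
    moreover have "\<omega> ((\<rho> j *\<^sub>R (g j - mat 1)) *v a) (g j *v b) + \<omega> a ((\<rho> j *\<^sub>R (g j - mat 1)) *v b)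
      = \<rho> j *\<^sub>R (\<omega> (g j *v a) (g j *v b) - \<omega> a b)" for j
      by (simp add: bounded_bilinear.scaleR_left[OF bounded_bilinear_matrix_vector_mult]
          symp_scaleR[OF symp] bounded_bilinear.diff_left[OF bounded_bilinear_matrix_vector_mult]
          symp_diff[OF symp] scaleR_right_distrib[symmetric])
    ultimately show ?thesis by simp
  qed
  \<comment> \<open>The similitude factor of \<open>g j\<close> is its value at the normalised pair,
    so its quotient converges by the same limit as all other values.\<close>
  have "\<omega> (g j *v a) (g j *v b) = \<omega> (g j *v x0) (g j *v y0) * \<omega> a b" for j a b
    using c[of j] u unfolding carries_def csp_group_def by auto
  then have "(\<lambda>j. \<rho> j *\<^sub>R (\<omega> (g j *v a) (g j *v b) - \<omega> a b))
      = (\<lambda>j. \<rho> j *\<^sub>R (\<omega> (g j *v x0) (g j *v y0) - \<omega> x0 y0) * \<omega> a b)" for a b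
    using u by (intro ext) (metis (no_types) left_diff_distrib mult_1 mult_scaleR_left)
  then have "(\<lambda>j. \<rho> j *\<^sub>R (\<omega> (g j *v a) (g j *v b) - \<omega> a b)) \<longlonglongrightarrow>
      (\<omega> (X *v x0) y0 + \<omega> x0 (X *v y0)) * \<omega> a b" for a b
    by (rule ssubst[where P = "\<lambda>f. f \<longlonglongrightarrow> _"]) (rule tendsto_mult_right[OF lim])
  then show "X \<in> csp_mat \<omega>"
    unfolding csp_mat_def using LIMSEQ_unique[OF lim] by blast
qed

end

lemma vector_derivative_seq:
  fixes f :: "real \<Rightarrow> 'a::real_normed_vector"
  assumes f: "(f has_vector_derivative f') (at 0)" and t: "\<tau> \<longlonglongrightarrow> 0" "\<And>j. \<tau> j \<noteq> 0"
  shows "(\<lambda>j. (1 / \<tau> j) *\<^sub>R (f (\<tau> j) - f 0)) \<longlonglongrightarrow> f'"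
proof -
  have lim: "((\<lambda>y. norm (f y - f 0 - y *\<^sub>R f') / norm y) \<longlongrightarrow> 0) (at 0)"
    using f unfolding has_vector_derivative_def has_derivative_iff_norm by simp
  have "filterlim \<tau> (at 0) sequentially" using t by (simp add: filterlim_at)
  from filterlim_compose[OF lim this]
  have "(\<lambda>j. norm (f (\<tau> j) - f 0 - \<tau> j *\<^sub>R f') / norm (\<tau> j)) \<longlonglongrightarrow> 0" .
  moreover have "norm (f (\<tau> j) - f 0 - \<tau> j *\<^sub>R f') / norm (\<tau> j) = norm ((1 / \<tau> j) *\<^sub>R (f (\<tau> j) - f 0) - f')" for j
  proof -
    have "(1 / \<tau> j) *\<^sub>R (f (\<tau> j) - f 0) - f' = (1 / \<tau> j) *\<^sub>R (f (\<tau> j) - f 0 - \<tau> j *\<^sub>R f')"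
      using t(2) by (simp add: scaleR_diff_right)
    then show ?thesis by simp
  qed
  ultimately have "(\<lambda>j. norm ((1 / \<tau> j) *\<^sub>R (f (\<tau> j) - f 0) - f')) \<longlonglongrightarrow> 0" by simp
  then show ?thesis by (rule LIM_zero_cancel[OF tendsto_norm_zero_cancel])
qed

section \<open>Infinitesimal frame changes along a line\<close>

context moving_flag
begin

text \<open>The inclusion of the conjugated \<open>G0\<close> into \<open>G x\<close> survives the
  limit by \<open>G_closed_seq\<close>, and equal dimensions turn it into an equality. The limiting
  similitude factor is nonzero because the limit has the inverse \<open>h0\<close>.\<close>

lemma carries_closed_seq:
  assumes x: "x \<in> U" and s: "\<And>j. s j \<in> U" "s \<longlonglongrightarrow> x"
    and c: "\<And>j. carries \<omega> (g j) (h j) J0 G0 (J (s j)) (G (s j))"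
    and g: "g \<longlonglongrightarrow> g0" and h: "h \<longlonglongrightarrow> h0"
  shows "carries \<omega> g0 h0 J0 G0 (J x) (G x)"
proof -
  have "(\<lambda>j. g j ** h j) \<longlonglongrightarrow> g0 ** h0" "(\<lambda>j. h j ** g j) \<longlonglongrightarrow> h0 ** g0"
    by (intro tendsto_intros g h)+
  then have gh: "g0 ** h0 = mat 1" "h0 ** g0 = mat 1"
    using c unfolding carries_def by (simp_all add: LIMSEQ_const_iff)
  have J: "g0 ** J0 ** h0 = J x"
  proof -
    have "(\<lambda>j. g j ** J0 ** h j) \<longlonglongrightarrow> g0 ** J0 ** h0" by (intro tendsto_intros g h)
    moreover have "(\<lambda>j. g j ** J0 ** h j) = (\<lambda>j. J (s j))" using c unfolding carries_def by auto
    ultimately show ?thesis using LIMSEQ_unique[OF tendsto_J[OF x s(2)]] by simp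
  qed
  have sub: "(\<lambda>B. g0 ** B ** h0) ` G0 \<subseteq> G x"
  proof
    fix C assume "C \<in> (\<lambda>B. g0 ** B ** h0) ` G0"
    then obtain B where B: "B \<in> G0" "C = g0 ** B ** h0" by blast
    have "(\<lambda>j. g j ** B ** h j) \<longlonglongrightarrow> C" unfolding B(2) by (intro tendsto_intros g h)
    moreover have "g j ** B ** h j \<in> G (s j)" for j using c[of j] B(1) unfolding carries_def by blast
    ultimately show "C \<in> G x" using G_closed_seq[OF x s, of "\<lambda>j. g j ** B ** h j"] by simp
  qed
  have inj: "inj (\<lambda>B. g0 ** B ** h0)"
    by (rule inj_on_inverseI[where g = "\<lambda>B. h0 ** B ** g0"]) (simp add: matrix_mul_assoc matrix_cancel gh)
  have "dim ((\<lambda>B. g0 ** B ** h0) ` G0) = dim (G x)"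
    unfolding G_dim[OF x] using inj by (intro dim_image_eq linear_conj) (auto intro: inj_on_subset)
  then have img: "(\<lambda>B. g0 ** B ** h0) ` G0 = G x"
    using sub sG0 subspace_G[OF x] by (intro subspace_dim_equal linear_subspace_image linear_conj) auto
  obtain x0 y0 where u: "\<omega> x0 y0 = 1" by (rule symp_unit_pair[OF symp])
  have eq: "\<omega> (g j *v a) (g j *v b) = \<omega> (g j *v x0) (g j *v y0) * \<omega> a b" for j a b
    using c[of j] u unfolding carries_def csp_group_def by auto
  have lim: "(\<lambda>j. \<omega> (g j *v a) (g j *v b)) \<longlonglongrightarrow> \<omega> (g0 *v a) (g0 *v b)" for a b
    by (intro symp_tendsto[OF symp] tendsto_intros g)
  have eq0: "\<omega> (g0 *v a) (g0 *v b) = \<omega> (g0 *v x0) (g0 *v y0) * \<omega> a b" for a b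
  proof (rule LIMSEQ_unique[OF lim])
    show "(\<lambda>j. \<omega> (g j *v a) (g j *v b)) \<longlonglongrightarrow> \<omega> (g0 *v x0) (g0 *v y0) * \<omega> a b"
      by (subst eq) (intro tendsto_intros lim)
  qed
  have "\<omega> (g0 *v x0) (g0 *v y0) \<noteq> 0"
    using eq0[of "h0 *v x0" "h0 *v y0"] u gh by (auto simp: matrix_vector_mul_assoc)
  then have "g0 \<in> csp_group \<omega>" unfolding csp_group_def using eq0 by blast
  then show ?thesis unfolding carries_def using gh J img by blast
qed

text \<open>\<open>tangency x u \<theta> \<xi>\<close>: the infinitesimal conformal symplectic map \<open>u\<close> moves the flag at \<open>x\<close> like the
  velocity \<open>\<theta> \<xi>\<close>.\<close>

definition tangency :: "'e \<Rightarrow> complex ^ 's ^ 's \<Rightarrow> real \<Rightarrow> 'e \<Rightarrow> bool"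
  where "tangency x u \<theta> \<xi> \<longleftrightarrow> u \<in> csp_mat \<omega> \<and> u ** J x - J x ** u = \<theta> *\<^sub>R e \<xi> x \<and>
    (\<forall>\<eta>. u ** e \<eta> x - e \<eta> x ** u - \<theta> *\<^sub>R e2 \<xi> \<eta> x \<in> G x)"

lemma tangency_closed:
  assumes x: "x \<in> U" and s: "\<And>j. s j \<in> U" "s \<longlonglongrightarrow> x"
    and t: "\<And>j. tangency (s j) (u j) (\<theta> j) \<xi>" and u: "u \<longlonglongrightarrow> u0" and \<theta>: "\<theta> \<longlonglongrightarrow> \<theta>0"
  shows "tangency x u0 \<theta>0 \<xi>"
  unfolding tangency_def
proof (intro conjI allI)
  show "u0 \<in> csp_mat \<omega>"
    using closed_sequentially[OF closed_subspace[OF subspace_csp_mat[OF symp]]] t u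
    unfolding tangency_def by blast
  have "(\<lambda>j. u j ** J (s j) - J (s j) ** u j) \<longlonglongrightarrow> u0 ** J x - J x ** u0"
    by (intro tendsto_intros u tendsto_J x s)
  moreover have "(\<lambda>j. u j ** J (s j) - J (s j) ** u j) \<longlonglongrightarrow> \<theta>0 *\<^sub>R e \<xi> x"
    using t unfolding tangency_def by (auto intro!: tendsto_intros tendsto_e x s \<theta>)
  ultimately show "u0 ** J x - J x ** u0 = \<theta>0 *\<^sub>R e \<xi> x" by (rule LIMSEQ_unique)
  show "u0 ** e \<eta> x - e \<eta> x ** u0 - \<theta>0 *\<^sub>R e2 \<xi> \<eta> x \<in> G x" for \<eta>
  proof (rule G_closed_seq[OF x s])
    show "(\<lambda>j. u j ** e \<eta> (s j) - e \<eta> (s j) ** u j - \<theta> j *\<^sub>R e2 \<xi> \<eta> (s j))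
      \<longlonglongrightarrow> u0 ** e \<eta> x - e \<eta> x ** u0 - \<theta>0 *\<^sub>R e2 \<xi> \<eta> x"
      by (intro tendsto_intros u tendsto_e tendsto_e2 x s \<theta>)
    show "u j ** e \<eta> (s j) - e \<eta> (s j) ** u j - \<theta> j *\<^sub>R e2 \<xi> \<eta> (s j) \<in> G (s j)" for j
      using t unfolding tangency_def by blast
  qed
qed

lemma tangency_scale:
  assumes x: "x \<in> U" and t: "tangency x u \<theta> \<xi>"
  shows "tangency x (r *\<^sub>R u) (r * \<theta>) \<xi>"
proof -
  have "(r *\<^sub>R u) ** e \<eta> x - e \<eta> x ** (r *\<^sub>R u) - (r * \<theta>) *\<^sub>R e2 \<xi> \<eta> x
      = r *\<^sub>R (u ** e \<eta> x - e \<eta> x ** u - \<theta> *\<^sub>R e2 \<xi> \<eta> x)" for \<eta>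
    by (simp add: matrix_scaleR_simps scaleR_diff_right)
  moreover have "(r *\<^sub>R u) ** J x - J x ** (r *\<^sub>R u) = r *\<^sub>R (u ** J x - J x ** u)"
    by (simp add: matrix_scaleR_simps scaleR_diff_right)
  ultimately show ?thesis
    using t subspace_scale[OF subspace_csp_mat[OF symp]] subspace_scale[OF subspace_G[OF x]]
    unfolding tangency_def by simp
qed

text \<open>The factor \<open>\<theta>\<close> records how much of the velocity survives a
  rescaling. At 0 only a symmetry of the flag is left, and this is the case that the compactness
  arguments have to exclude.\<close>

lemma tangency_zero_iff: "x \<in> U \<Longrightarrow> tangency x u 0 \<xi> \<longleftrightarrow> u \<in> stab \<omega> (J x) (G x)"
  unfolding tangency_def stab_def G_def by auto

lemma tangency_diff:
  assumes x: "x \<in> U" and t: "tangency x u \<theta> \<xi>" "tangency x u' \<theta>' \<xi>"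
  shows "tangency x (u - u') (\<theta> - \<theta>') \<xi>"
proof -
  have "(u - u') ** e \<eta> x - e \<eta> x ** (u - u') - (\<theta> - \<theta>') *\<^sub>R e2 \<xi> \<eta> x
      = (u ** e \<eta> x - e \<eta> x ** u - \<theta> *\<^sub>R e2 \<xi> \<eta> x) - (u' ** e \<eta> x - e \<eta> x ** u' - \<theta>' *\<^sub>R e2 \<xi> \<eta> x)" for \<eta>
    by (simp add: matrix_diff_simps scaleR_diff_left)
  then have "(u - u') ** e \<eta> x - e \<eta> x ** (u - u') - (\<theta> - \<theta>') *\<^sub>R e2 \<xi> \<eta> x \<in> G x" for \<eta>
    using t subspace_diff[OF subspace_G[OF x]] unfolding tangency_def by simp
  moreover have "(u - u') ** J x - J x ** (u - u') = (u ** J x - J x ** u) - (u' ** J x - J x ** u')"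
    by (simp add: matrix_diff_simps)
  ultimately show ?thesis
    using t subspace_diff[OF subspace_csp_mat[OF symp]]
    unfolding tangency_def by (simp add: scaleR_diff_left)
qed

lemma quotient_tendsto:
  fixes f :: "'e \<Rightarrow> complex ^ 's ^ 's"
  assumes f: "(f has_derivative f') (at x)" and t: "\<tau> \<longlonglongrightarrow> 0" "\<And>j. \<tau> j \<noteq> (0::real)"
  shows "(\<lambda>j. (1 / \<tau> j) *\<^sub>R (f (x + \<tau> j *\<^sub>R \<xi>) - f x)) \<longlonglongrightarrow> f' \<xi>"
proof -
  have "((\<lambda>t. f (x + t *\<^sub>R \<xi>)) has_derivative (\<lambda>t. f' (t *\<^sub>R \<xi>))) (at 0)"
    using f by (intro has_derivative_compose[of "\<lambda>t. x + t *\<^sub>R \<xi>" "\<lambda>t. t *\<^sub>R \<xi>" 0 UNIV f f'])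
      (auto intro!: derivative_eq_intros)
  then have "((\<lambda>t. f (x + t *\<^sub>R \<xi>)) has_vector_derivative f' \<xi>) (at 0)"
    unfolding has_vector_derivative_def using linear_scale[OF has_derivative_linear[OF f]] by simp
  from vector_derivative_seq[OF this t] show ?thesis by simp
qed

text \<open>The frames over a piece of the line \<open>x + t \<xi>\<close> with norms at most \<open>k\<close> form a compact set, so
  difference quotients of almost minimal frame changes converge after rescaling. If the limit only
  stabilised the flag, composing with the flow of the limit would give substantially smaller frame
  changes.\<close>

lemma tangency_exists:
  assumes I: "\<And>t. t \<in> {a<..<b} \<Longrightarrow> x0 + t *\<^sub>R \<xi> \<in> U"
    and fr: "\<And>t. t \<in> {a<..<b} \<Longrightarrow> \<exists>g h. carries \<omega> g h J0 G0 (J (x0 + t *\<^sub>R \<xi>)) (G (x0 + t *\<^sub>R \<xi>)) \<and>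
      norm g \<le> k \<and> norm h \<le> k"
    and t: "t \<in> {a<..<b}"
  shows "\<exists>u. tangency (x0 + t *\<^sub>R \<xi>) u 1 \<xi>"
proof -
  let ?p = "\<lambda>t. x0 + t *\<^sub>R \<xi>"
  let ?x = "?p t"
  have x: "?x \<in> U" using I t .
  \<comment> \<open>Half the distance to the right end point divided by \<open>Suc j\<close>:
    positive, tending to 0, and small enough for \<open>t + \<tau>' j\<close> to stay in the
    interval.\<close>
  define \<tau>' where "\<tau>' j = (b - t) / 2 * inverse (real (Suc j))" for j :: nat
  have "inverse (real (Suc j)) \<le> 1" for j by (simp add: field_simps)
  then have "\<tau>' j \<le> (b - t) / 2" for j
    using t unfolding \<tau>'_def by (intro mult_left_le) auto
  moreover have \<tau>'pos: "\<tau>' j > 0" for j using t unfolding \<tau>'_def by (intro mult_pos_pos) auto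
  ultimately have \<tau>': "\<tau>' j > 0" "t + \<tau>' j \<in> {a<..<b}" for j
  proof -
    assume le: "\<And>j. \<tau>' j \<le> (b - t) / 2" and pos: "\<And>j. \<tau>' j > 0"
    have "a < t" "t < b" using t by auto
    then show "t + \<tau>' j \<in> {a<..<b}" using le[of j] pos[of j] by (simp add: field_simps)
  qed (rule \<tau>'pos)
  have \<tau>'0: "\<tau>' \<longlonglongrightarrow> 0"
    unfolding \<tau>'_def by (rule tendsto_mult_right_zero[OF LIMSEQ_inverse_real_of_nat])
  have "\<forall>j. \<exists>g h. carries \<omega> g h J0 G0 (J (?p (t + \<tau>' j))) (G (?p (t + \<tau>' j))) \<and> norm g \<le> k \<and> norm h \<le> k"
    using fr \<tau>'(2) by blast
  then obtain g' h' where gh': "\<And>j. carries \<omega> (g' j) (h' j) J0 G0 (J (?p (t + \<tau>' j))) (G (?p (t + \<tau>' j)))"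
    "\<And>j. norm (g' j) \<le> k" "\<And>j. norm (h' j) \<le> k" by metis
  \<comment> \<open>Along this subsequence the frames over the points \<open>s j\<close> converge to
    a frame at \<open>t\<close>; composed with the inverse of that frame they become frame changes
    tending to the identity.\<close>
  obtain r1 g0 h0 where r1: "strict_mono (r1 :: nat \<Rightarrow> nat)" "(g' \<circ> r1) \<longlonglongrightarrow> g0" "(h' \<circ> r1) \<longlonglongrightarrow> h0"
    by (rule convergent_pair_subseq[OF gh'(2) gh'(3)])
  define \<tau> where "\<tau> j = \<tau>' (r1 j)" for j
  have \<tau>: "\<tau> j > 0" "t + \<tau> j \<in> {a<..<b}" for j unfolding \<tau>_def using \<tau>' by auto
  have \<tau>0: "\<tau> \<longlonglongrightarrow> 0"
    unfolding \<tau>_def[abs_def] using LIMSEQ_subseq_LIMSEQ[OF \<tau>'0 r1(1)] by (simp add: o_def)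
  define s where "s j = ?p (t + \<tau> j)" for j
  have sx: "s j = ?x + \<tau> j *\<^sub>R \<xi>" for j by (simp add: s_def scaleR_left_distrib)
  have sU: "s j \<in> U" for j unfolding s_def using I \<tau>(2) by blast
  have slim: "s \<longlonglongrightarrow> ?x"
  proof -
    have "(\<lambda>j. ?x + \<tau> j *\<^sub>R \<xi>) \<longlonglongrightarrow> ?x + 0 *\<^sub>R \<xi>" by (intro tendsto_intros \<tau>0)
    then show ?thesis by (simp add: sx[abs_def])
  qed
  have gh: "carries \<omega> (g' (r1 j)) (h' (r1 j)) J0 G0 (J (s j)) (G (s j))" for j
    unfolding s_def \<tau>_def by (rule gh'(1))
  have c0: "carries \<omega> g0 h0 J0 G0 (J ?x) (G ?x)"
    by (rule carries_closed_seq[OF x sU slim gh]) (use r1 in \<open>simp_all add: o_def\<close>)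
  have gh0: "g0 ** h0 = mat 1" using c0 unfolding carries_def by simp
  define M where "M j = {f. \<exists>f'. carries \<omega> f f' (J ?x) (G ?x) (J (s j)) (G (s j))}" for j
  have fM: "g' (r1 j) ** h0 \<in> M j" for j
    unfolding M_def using carries_trans[OF symp carries_sym[OF symp c0] gh] by blast
  \<comment> \<open>The slack \<open>\<tau> j\<close> replaces attainment of the infimum. After
    division by \<open>\<rho> j\<close> it becomes \<open>\<theta> j\<close>, which tends to 0 in
    the case to be refuted.\<close>
  have "\<exists>f\<in>M j. \<forall>f'\<in>M j. norm (f - mat 1) \<le> norm (f' - mat 1) + \<tau> j" for j
  proof -
    let ?N = "(\<lambda>f. norm (f - mat 1)) ` M j"
    have ne: "?N \<noteq> {}" using fM by blast
    have bdd: "bdd_below ?N" by (rule bdd_belowI[of _ 0]) auto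
    obtain f where "f \<in> M j" "norm (f - mat 1) < Inf ?N + \<tau> j"
      using cInf_lessD[OF ne, of "Inf ?N + \<tau> j"] \<tau>(1)[of j] by auto
    moreover have "Inf ?N \<le> norm (f' - mat 1)" if "f' \<in> M j" for f'
      using that bdd by (intro cInf_lower) auto
    ultimately show ?thesis by (intro bexI[of _ f]) fastforce+
  qed
  then obtain f where f: "\<And>j. f j \<in> M j" "\<And>j q. q \<in> M j \<Longrightarrow> norm (f j - mat 1) \<le> norm (q - mat 1) + \<tau> j"
    by metis
  have "\<forall>j. \<exists>f'. carries \<omega> (f j) f' (J ?x) (G ?x) (J (s j)) (G (s j))"
    using f(1) unfolding M_def by blast
  then obtain f' where f': "\<And>j. carries \<omega> (f j) (f' j) (J ?x) (G ?x) (J (s j)) (G (s j))"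
    by metis
  have flim: "f \<longlonglongrightarrow> mat 1"
  proof -
    have "(\<lambda>j. norm (g' (r1 j) ** h0 - mat 1) + \<tau> j) \<longlonglongrightarrow> norm (g0 ** h0 - mat 1) + 0"
      using r1(2) by (intro tendsto_intros \<tau>0) (simp add: o_def)
    then have "(\<lambda>j. norm (g' (r1 j) ** h0 - mat 1) + \<tau> j) \<longlonglongrightarrow> 0" by (simp add: gh0)
    then have "(\<lambda>j. f j - mat 1) \<longlonglongrightarrow> 0"
      by (rule Lim_null_comparison[rotated]) (use f(2) fM in auto)
    then show ?thesis by (simp add: LIM_zero_iff)
  qed
  \<comment> \<open>Adding \<open>\<tau> j\<close> makes \<open>\<rho>\<close> positive and
    normalises the pair by \<open>norm (u j) + \<theta> j = 1\<close>, so that its limit cannot be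
    zero in both components.\<close>
  define \<rho> where "\<rho> j = norm (f j - mat 1) + \<tau> j" for j
  have \<rho>: "\<rho> j > 0" for j unfolding \<rho>_def using \<tau>(1)[of j] by (simp add: add_nonneg_pos)
  define u where "u j = (1 / \<rho> j) *\<^sub>R (f j - mat 1)" for j
  define \<theta> where "\<theta> j = \<tau> j / \<rho> j" for j
  have sum1: "norm (u j) + \<theta> j = 1" for j
  proof -
    have "norm (u j) + \<theta> j = (norm (f j - mat 1) + \<tau> j) / \<rho> j"
      using \<rho>[of j] unfolding u_def \<theta>_def norm_scaleR by (simp add: add_divide_distrib)
    then show ?thesis using \<rho>[of j] by (simp add: \<rho>_def[symmetric])
  qed
  have \<theta>nn: "\<theta> j \<ge> 0" for j unfolding \<theta>_def using \<rho>[of j] \<tau>(1)[of j] by simp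
  have "norm (u j) \<le> 1" "norm (\<theta> j) \<le> 1" for j
    using sum1[of j] \<theta>nn[of j] norm_ge_zero[of "u j"] by (auto simp del: norm_ge_zero)
  then obtain r u0 \<theta>0 where r: "strict_mono (r :: nat \<Rightarrow> nat)" "(u \<circ> r) \<longlonglongrightarrow> u0" "(\<theta> \<circ> r) \<longlonglongrightarrow> \<theta>0"
    by (rule convergent_pair_subseq[of u 1 \<theta>])
  have sub: "(\<lambda>j. F (r j)) \<longlonglongrightarrow> l" if "F \<longlonglongrightarrow> l" for F :: "nat \<Rightarrow> 'z::topological_space" and l
    using LIMSEQ_subseq_LIMSEQ[OF that r(1)] by (simp add: o_def)
  have ulim: "(\<lambda>j. (1 / \<rho> (r j)) *\<^sub>R (f (r j) - mat 1)) \<longlonglongrightarrow> u0" using r(2) by (simp add: u_def o_def)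
  have \<theta>lim: "(\<lambda>j. \<theta> (r j)) \<longlonglongrightarrow> \<theta>0" using r(3) by (simp add: o_def)
  have norm1: "norm u0 + \<theta>0 = 1"
  proof (rule LIMSEQ_unique)
    show "(\<lambda>j. norm (u (r j)) + \<theta> (r j)) \<longlonglongrightarrow> norm u0 + \<theta>0"
      using r(2) \<theta>lim by (intro tendsto_intros) (simp_all add: o_def)
  qed (simp add: sum1)
  have quot: "(\<lambda>j. (1 / \<rho> (r j)) *\<^sub>R (F (s (r j)) - F ?x)) \<longlonglongrightarrow> \<theta>0 *\<^sub>R F' \<xi>"
    if F: "(F has_derivative F') (at ?x)" for F :: "'e \<Rightarrow> complex ^ 's ^ 's" and F'
  proof -
    have "\<tau> j \<noteq> 0" for j using \<tau>(1)[of j] by simp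
    then have "(\<lambda>j. \<theta> (r j) *\<^sub>R (1 / \<tau> (r j)) *\<^sub>R (F (s (r j)) - F ?x)) \<longlonglongrightarrow> \<theta>0 *\<^sub>R F' \<xi>"
      unfolding sx by (intro tendsto_intros \<theta>lim quotient_tendsto[OF F] sub[OF \<tau>0])
    moreover have "\<theta> j * (1 / \<tau> j) = 1 / \<rho> j" for j using \<tau>(1)[of j] by (simp add: \<theta>_def)
    ultimately show ?thesis by simp
  qed
  have tan: "tangency ?x u0 \<theta>0 \<xi>"
  proof -
    note inf = infinitesimal[where s = "\<lambda>j. s (r j)" and g = "\<lambda>j. f (r j)" and h = "\<lambda>j. f' (r j)"
        and \<rho> = "\<lambda>j. 1 / \<rho> (r j)", OF x sU sub[OF slim] f' sub[OF flim] ulim quot[OF dJ[OF x]] quot[OF de[OF x]]]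
    show ?thesis unfolding tangency_def using inf by blast
  qed
  have "\<theta>0 \<noteq> 0"
  proof
    assume z: "\<theta>0 = 0"
    then have "- u0 \<in> stab \<omega> (J ?x) (G ?x)"
      using tan subspace_neg[OF subspace_stab[OF symp subspace_G[OF x]]] by (simp add: tangency_zero_iff[OF x])
    then obtain \<delta> E E' where E: "\<delta> > 0" "E 0 = mat 1"
      "\<And>t. t \<in> {-\<delta><..<\<delta>} \<Longrightarrow> (E has_vector_derivative (- u0) ** E t) (at t)"
      "\<And>t. t \<in> {-\<delta><..<\<delta>} \<Longrightarrow> carries \<omega> (E t) (E' t) (J ?x) (G ?x) (J ?x) (G ?x)"
      using stab_flow[OF symp _ subspace_G[OF x]] by metis
    have \<rho>0: "\<rho> \<longlonglongrightarrow> 0"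
    proof -
      have "(\<lambda>j. norm (f j - mat 1) + \<tau> j) \<longlonglongrightarrow> norm (mat 1 - mat 1 :: complex ^ 's ^ 's) + 0"
        by (intro tendsto_intros flim \<tau>0)
      then show ?thesis by (simp add: \<rho>_def[abs_def])
    qed
    have "(E has_vector_derivative - u0) (at 0)" using E(1,2) E(3)[of 0] by simp
    then have "(\<lambda>j. (1 / \<rho> (r j)) *\<^sub>R (E (\<rho> (r j)) - E 0)) \<longlonglongrightarrow> - u0"
      by (rule vector_derivative_seq[OF _ sub[OF \<rho>0] less_imp_neq[OF \<rho>, symmetric]])
    then have El: "(\<lambda>j. (1 / \<rho> (r j)) *\<^sub>R (E (\<rho> (r j)) - mat 1)) \<longlonglongrightarrow> - u0" by (simp add: E(2))
    have "isCont E 0" using E(1) E(3)[of 0] has_vector_derivative_continuous by auto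
    then have E1: "(\<lambda>j. E (\<rho> (r j))) \<longlonglongrightarrow> mat 1"
      using isCont_tendsto_compose[OF _ sub[OF \<rho>0]] E(2) by metis
    \<comment> \<open>The rescaled distance of the competitor \<open>f ** E\<close> from the
      identity tends to \<open>norm (u0 - u0)\<close>. Near minimality passes this bound on to
      \<open>u\<close>, contrary to \<open>norm u0 = 1\<close>.\<close>
    have "(\<lambda>j. norm ((1 / \<rho> (r j)) *\<^sub>R (f (r j) - mat 1) ** E (\<rho> (r j)) + (1 / \<rho> (r j)) *\<^sub>R (E (\<rho> (r j)) - mat 1)) + \<theta> (r j))
       \<longlonglongrightarrow> norm (u0 ** mat 1 + - u0) + 0"
      using \<theta>lim z by (intro tendsto_intros ulim E1 El) simp
    then have lim0: "(\<lambda>j. norm ((1 / \<rho> (r j)) *\<^sub>R (f (r j) - mat 1) ** E (\<rho> (r j)) + (1 / \<rho> (r j)) *\<^sub>R (E (\<rho> (r j)) - mat 1)) + \<theta> (r j))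
       \<longlonglongrightarrow> 0" by simp
    obtain N where N: "\<And>j. j \<ge> N \<Longrightarrow> \<rho> (r j) < \<delta>"
      using order_tendstoD(2)[OF sub[OF \<rho>0] E(1)] unfolding eventually_sequentially by blast
    have "norm (u (r j)) \<le> norm ((1 / \<rho> (r j)) *\<^sub>R (f (r j) - mat 1) ** E (\<rho> (r j)) + (1 / \<rho> (r j)) *\<^sub>R (E (\<rho> (r j)) - mat 1)) + \<theta> (r j)"
      if j: "j \<ge> N" for j
    proof -
      let ?i = "r j"
      have "\<rho> ?i \<in> {-\<delta><..<\<delta>}" using N[OF j] \<rho>[of ?i] E(1) by auto
      then have "f ?i ** E (\<rho> ?i) \<in> M ?i"
        unfolding M_def using carries_trans[OF symp E(4) f'] by blast
      then have "norm (f ?i - mat 1) \<le> norm (f ?i ** E (\<rho> ?i) - mat 1) + \<tau> ?i" by (rule f(2))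
      then have "(1 / \<rho> ?i) * norm (f ?i - mat 1) \<le> (1 / \<rho> ?i) * (norm (f ?i ** E (\<rho> ?i) - mat 1) + \<tau> ?i)"
        using \<rho>[of ?i] by (intro mult_left_mono) auto
      also have "\<dots> = norm ((1 / \<rho> ?i) *\<^sub>R (f ?i ** E (\<rho> ?i) - mat 1)) + \<theta> ?i"
        using \<rho>[of ?i] by (simp add: \<theta>_def distrib_left)
      also have "(1 / \<rho> ?i) *\<^sub>R (f ?i ** E (\<rho> ?i) - mat 1)
          = (1 / \<rho> ?i) *\<^sub>R (f ?i - mat 1) ** E (\<rho> ?i) + (1 / \<rho> ?i) *\<^sub>R (E (\<rho> ?i) - mat 1)"
        by (simp add: matrix_expand scaleR_diff_right)
      finally show ?thesis using \<rho>[of ?i] by (simp add: u_def)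
    qed
    then have "(\<lambda>j. u (r j)) \<longlonglongrightarrow> 0"
      by (intro Lim_null_comparison[OF _ lim0]) (auto simp: eventually_sequentially)
    then have "u0 = 0" using r(2) LIMSEQ_unique by (auto simp: o_def)
    then show False using norm1 z by simp
  qed
  then show ?thesis
    using tangency_scale[OF x tan, of "1 / \<theta>0"] by auto
qed

end

section \<open>Continuous selection, velocities of frames and their diagonal part\<close>

context moving_flag
begin

text \<open>The infinitesimal changes with velocity \<open>\<xi>\<close> form an affine space over
  the stabiliser, so exactly one of them is orthogonal to the stabiliser. Uniqueness identifies
  every subsequential limit, and that gives continuity.\<close>

lemma tangency_selection:
  assumes I: "\<And>t. t \<in> {a<..<b} \<Longrightarrow> x0 + t *\<^sub>R \<xi> \<in> U"
    and fr: "\<And>t. t \<in> {a<..<b} \<Longrightarrow> \<exists>g h. carries \<omega> g h J0 G0 (J (x0 + t *\<^sub>R \<xi>)) (G (x0 + t *\<^sub>R \<xi>)) \<and>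
      norm g \<le> k \<and> norm h \<le> k"
  obtains X where "continuous_on {a<..<b} X" "\<And>t. t \<in> {a<..<b} \<Longrightarrow> tangency (x0 + t *\<^sub>R \<xi>) (X t) 1 \<xi>"
proof -
  let ?p = "\<lambda>t. x0 + t *\<^sub>R \<xi>"
  let ?S = "\<lambda>t. stab \<omega> (J (?p t)) (G (?p t))"
  let ?ok = "\<lambda>t X. tangency (?p t) X 1 \<xi> \<and> (\<forall>Y\<in>?S t. X \<bullet> Y = 0)"
  have sS: "subspace (?S t)" if "t \<in> {a<..<b}" for t
    using subspace_stab[OF symp subspace_G[OF I[OF that]]] .
  have "\<exists>X. ?ok t X" if t: "t \<in> {a<..<b}" for t
  proof -
    obtain u where u: "tangency (?p t) u 1 \<xi>" using tangency_exists[OF I fr t] by blast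
    obtain y z where yz: "y \<in> span (?S t)" "\<And>w. w \<in> span (?S t) \<Longrightarrow> orthogonal z w" "u = y + z"
      using orthogonal_subspace_decomp_exists[of "?S t" u] by metis
    have sp: "span (?S t) = ?S t" using sS[OF t] by (simp add: span_eq_iff)
    have "tangency (?p t) y 0 \<xi>" using yz(1) sp tangency_zero_iff[OF I[OF t]] by simp
    from tangency_diff[OF I[OF t] u this] have "tangency (?p t) z 1 \<xi>" using yz(3) by simp
    then show ?thesis using yz(2) sp by (auto simp: orthogonal_def)
  qed
  then obtain X where X: "\<And>t. t \<in> {a<..<b} \<Longrightarrow> ?ok t (X t)" by metis
  have uniq: "Z = X t" if t: "t \<in> {a<..<b}" and Z: "?ok t Z" for t Z
  proof -
    have "tangency (?p t) (Z - X t) (1 - 1) \<xi>" using Z X[OF t] by (intro tangency_diff I t) auto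
    then have "Z - X t \<in> ?S t" using tangency_zero_iff[OF I[OF t]] by simp
    then have "(Z - X t) \<bullet> (Z - X t) = 0" using Z X[OF t] by (simp add: inner_diff_left)
    then show ?thesis by simp
  qed
  have "continuous_on {a<..<b} X"
  proof (rule continuous_on_subseq)
    fix s :: "nat \<Rightarrow> real" and t assume t: "t \<in> {a<..<b}" and s: "\<And>j. s j \<in> {a<..<b}" "s \<longlonglongrightarrow> t"
    \<comment> \<open>A bound for \<open>X\<close> along the sequence is not yet available. Dividing
      by \<open>1 + norm X\<close> gives a bounded pair with \<open>norm (u j) + q j = 1\<close>,
      and \<open>q0 \<noteq> 0\<close> will recover the limit of \<open>X\<close>.\<close>
    define q where "q j = 1 / (1 + norm (X (s j)))" for j
    have qpos: "q j > 0" for j unfolding q_def by (simp add: add_pos_nonneg)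
    define u where "u j = q j *\<^sub>R X (s j)" for j
    have sum1: "norm (u j) + q j = 1" for j
    proof -
      have "norm (u j) + q j = q j * (1 + norm (X (s j)))" using qpos[of j] by (simp add: u_def algebra_simps)
      also have "\<dots> = 1" unfolding q_def by (simp add: add_pos_nonneg less_imp_neq[symmetric])
      finally show ?thesis .
    qed
    have "norm (u j) \<le> 1" "norm (q j) \<le> 1" for j
      using sum1[of j] qpos[of j] norm_ge_zero[of "u j"] by (auto simp del: norm_ge_zero)
    then obtain r u0 q0 where r: "strict_mono (r :: nat \<Rightarrow> nat)" "(u \<circ> r) \<longlonglongrightarrow> u0" "(q \<circ> r) \<longlonglongrightarrow> q0"
      by (rule convergent_pair_subseq[of u 1 q])
    have "\<exists>g h. carries \<omega> g h J0 G0 (J (?p (s (r j)))) (G (?p (s (r j)))) \<and> norm g \<le> k \<and> norm h \<le> k" for j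
      using fr[OF s(1)] .
    then obtain g h where gh: "\<And>j. carries \<omega> (g j) (h j) J0 G0 (J (?p (s (r j)))) (G (?p (s (r j))))"
      "\<And>j. norm (g j) \<le> k" "\<And>j. norm (h j) \<le> k" by metis
    obtain r2 g0 h0 where r2: "strict_mono (r2 :: nat \<Rightarrow> nat)" "(g \<circ> r2) \<longlonglongrightarrow> g0" "(h \<circ> r2) \<longlonglongrightarrow> h0"
      by (rule convergent_pair_subseq[OF gh(2) gh(3)])
    let ?r = "\<lambda>j. r (r2 j)"
    have mono: "strict_mono ?r" using strict_mono_o[OF r(1) r2(1)] by (simp add: o_def)
    have ul: "(\<lambda>j. u (?r j)) \<longlonglongrightarrow> u0" and ql: "(\<lambda>j. q (?r j)) \<longlonglongrightarrow> q0"
      using LIMSEQ_subseq_LIMSEQ[OF r(2) r2(1)] LIMSEQ_subseq_LIMSEQ[OF r(3) r2(1)] by (simp_all add: o_def)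
    have sl: "(\<lambda>j. s (?r j)) \<longlonglongrightarrow> t" using LIMSEQ_subseq_LIMSEQ[OF s(2) mono] by (simp add: o_def)
    have pl: "(\<lambda>j. ?p (s (?r j))) \<longlonglongrightarrow> ?p t" by (intro tendsto_intros sl)
    have pU: "?p (s (?r j)) \<in> U" for j using I[OF s(1)] .
    have x: "?p t \<in> U" using I[OF t] .
    have tan: "tangency (?p t) u0 q0 \<xi>"
    proof (rule tangency_closed[OF x pU pl _ ul ql])
      show "tangency (?p (s (?r j))) (u (?r j)) (q (?r j)) \<xi>" for j
        using tangency_scale[OF pU, of j "X (s (?r j))" 1 \<xi> "q (?r j)"] X[OF s(1), of "?r j"]
        by (simp add: u_def)
    qed
    have c0: "carries \<omega> g0 h0 J0 G0 (J (?p t)) (G (?p t))"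
      by (rule carries_closed_seq[OF x pU pl gh(1)]) (use r2 in \<open>simp_all add: o_def\<close>)
    \<comment> \<open>Every \<open>Y\<close> stabilising the limit flag is a limit of stabilisers of
      the nearby flags: the limit frame pulls it back to the model and the nearby frames push it
      forward.\<close>
    have orth: "u0 \<bullet> Y = 0" if Y: "Y \<in> ?S t" for Y
    proof (rule LIMSEQ_unique)
      let ?Y0 = "h0 ** Y ** g0"
      have Y0: "?Y0 \<in> stab \<omega> J0 G0" by (rule carries_stab[OF symp carries_sym[OF symp c0] Y])
      have "g0 ** ?Y0 ** h0 = Y" using c0 unfolding carries_def by (simp add: matrix_mul_assoc matrix_cancel)
      moreover have "(\<lambda>j. u (?r j) \<bullet> (g (r2 j) ** ?Y0 ** h (r2 j))) \<longlonglongrightarrow> u0 \<bullet> (g0 ** ?Y0 ** h0)"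
        using r2 by (intro tendsto_intros ul) (simp_all add: o_def)
      ultimately show "(\<lambda>j. u (?r j) \<bullet> (g (r2 j) ** ?Y0 ** h (r2 j))) \<longlonglongrightarrow> u0 \<bullet> Y" by simp
      have "u (?r j) \<bullet> (g (r2 j) ** ?Y0 ** h (r2 j)) = 0" for j
        using X[OF s(1), of "?r j"] carries_stab[OF symp gh(1) Y0, of "r2 j"] by (simp add: u_def)
      then show "(\<lambda>j. u (?r j) \<bullet> (g (r2 j) ** ?Y0 ** h (r2 j))) \<longlonglongrightarrow> 0" by simp
    qed
    have norm1: "norm u0 + q0 = 1"
    proof (rule LIMSEQ_unique)
      show "(\<lambda>j. norm (u (?r j)) + q (?r j)) \<longlonglongrightarrow> norm u0 + q0" by (intro tendsto_intros ul ql)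
    qed (simp add: sum1)
    have q0: "q0 \<noteq> 0"
    proof
      assume z: "q0 = 0"
      then have "u0 \<in> ?S t" using tan tangency_zero_iff[OF x] by simp
      then have "u0 = 0" using orth[of u0] by simp
      then show False using norm1 z by simp
    qed
    have "?ok t ((1 / q0) *\<^sub>R u0)"
      using tangency_scale[OF x tan, of "1 / q0"] q0 orth by simp
    then have eq: "(1 / q0) *\<^sub>R u0 = X t" by (rule uniq[OF t])
    have "(\<lambda>j. (1 / q (?r j)) *\<^sub>R u (?r j)) \<longlonglongrightarrow> (1 / q0) *\<^sub>R u0"
      by (intro tendsto_intros ul ql q0)
    moreover have "(1 / q j) *\<^sub>R u j = X (s j)" for j using qpos[of j] by (simp add: u_def)
    ultimately show "\<exists>r. strict_mono (r :: nat \<Rightarrow> nat) \<and> (\<lambda>j. X (s (r j))) \<longlonglongrightarrow> X t"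
      using mono eq by (intro exI[of _ ?r]) simp
  qed
  then show ?thesis using that[of X] X by blast
qed

text \<open>On \<open>G0\<close> conjugation by \<open>J0\<close> is multiplication by -1, so this
  subspace is preserved; the similitude factor of \<open>J0\<close> is -1, which the conformal group
  admits.\<close>

lemma carries_J0: "carries \<omega> g h J0 G0 J' V' \<Longrightarrow> carries \<omega> (g ** J0) (J0 ** h) J0 G0 J' V'"
proof -
  have "(\<lambda>B. J0 ** B ** J0) ` G0 = G0"
  proof -
    have eq: "J0 ** B ** J0 = - B" if "B \<in> G0" for B
      using G0anti[OF that] J0sq by (simp add: matrix_minus_simps matrix_mul_assoc[symmetric])
    have "(\<lambda>B. J0 ** B ** J0) ` G0 = uminus ` G0" using eq by (intro image_cong) auto
    also have "\<dots> = G0"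
      using subspace_neg[OF sG0] by (auto simp: image_iff) (metis minus_minus)
    finally show ?thesis .
  qed
  then have "carries \<omega> J0 J0 J0 G0 J0 G0"
    unfolding carries_def csp_group_def using J0sq J0csp
    by (auto intro!: exI[of _ "-1"])
  then show "carries \<omega> g h J0 G0 J' V' \<Longrightarrow> ?thesis"
    using carries_trans[OF symp] by blast
qed

text \<open>The element \<open>A\<close> is the velocity of a curve of frames starting at
  \<open>g\<close>. Read from \<open>g\<close>, this curve consists of frame changes near the
  identity, and \<open>infinitesimal\<close> applies to its difference quotients; \<open>v\<close>
  is the velocity of the base curve.\<close>

lemma velocity_tangency:
  assumes x: "x \<in> U" and c: "carries \<omega> g h J0 G0 (J x) (G x)" and A: "A \<in> \<Theta>"
  shows "\<exists>v. tangency x (g ** A ** h) 1 v"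
proof -
  obtain \<epsilon> xc gc where \<epsilon>: "\<epsilon> > 0" "xc 0 = x" "gc 0 = g"
    and fr: "\<And>t. t \<in> {-\<epsilon><..<\<epsilon>} \<Longrightarrow> xc t \<in> U \<and> (\<exists>h. carries \<omega> (gc t) h J0 G0 (J (xc t)) (G (xc t)))"
    and C1: "xc C1_differentiable_on {-\<epsilon><..<\<epsilon>}"
    and der: "(gc has_vector_derivative g ** A) (at 0)"
    using A unfolding const_vel[OF x c[unfolded G_def]] G_def by blast
  obtain v where v: "(xc has_vector_derivative v) (at 0)"
    using C1 \<epsilon>(1) unfolding C1_differentiable_on_def by (metis greaterThanLessThan_iff neg_less_0_iff_less)
  define \<tau> where "\<tau> j = \<epsilon> / 2 * inverse (real (Suc j))" for j :: nat
  have "inverse (real (Suc j)) \<le> 1" for j by (simp add: field_simps)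
  then have "\<tau> j \<le> \<epsilon> / 2" for j using \<epsilon> unfolding \<tau>_def by (intro mult_left_le) auto
  moreover have \<tau>pos: "\<tau> j > 0" for j using \<epsilon> unfolding \<tau>_def by (intro mult_pos_pos) auto
  ultimately have \<tau>: "\<tau> j \<in> {-\<epsilon><..<\<epsilon>}" "\<tau> j \<noteq> 0" for j
    using \<epsilon>(1) by (auto simp: less_le_trans) (smt (verit) field_sum_of_halves)+
  have \<tau>0: "\<tau> \<longlonglongrightarrow> 0"
    unfolding \<tau>_def[abs_def] by (rule tendsto_mult_right_zero[OF LIMSEQ_inverse_real_of_nat])
  have "\<forall>j. \<exists>h. carries \<omega> (gc (\<tau> j)) h J0 G0 (J (xc (\<tau> j))) (G (xc (\<tau> j)))" using fr[OF \<tau>(1)] by blast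
  then obtain h' where h': "\<And>j. carries \<omega> (gc (\<tau> j)) (h' j) J0 G0 (J (xc (\<tau> j))) (G (xc (\<tau> j)))" by metis
  have gh: "g ** h = mat 1" using c unfolding carries_def by simp
  have U: "xc (\<tau> j) \<in> U" for j using fr[OF \<tau>(1)] by blast
  have "isCont xc 0" using v has_vector_derivative_continuous by blast
  then have xl: "(\<lambda>j. xc (\<tau> j)) \<longlonglongrightarrow> x" using isCont_tendsto_compose[OF _ \<tau>0] \<epsilon>(2) by metis
  have "isCont gc 0" using der has_vector_derivative_continuous by blast
  then have gl: "(\<lambda>j. gc (\<tau> j)) \<longlonglongrightarrow> g" using isCont_tendsto_compose[OF _ \<tau>0] \<epsilon>(3) by metis
  have gl1: "(\<lambda>j. gc (\<tau> j) ** h) \<longlonglongrightarrow> mat 1"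
    using tendsto_matrix_mult[OF gl tendsto_const, of h] by (simp add: gh)
  have gX: "(\<lambda>j. (1 / \<tau> j) *\<^sub>R (gc (\<tau> j) ** h - mat 1)) \<longlonglongrightarrow> g ** A ** h"
  proof -
    have "(\<lambda>j. (1 / \<tau> j) *\<^sub>R (gc (\<tau> j) - gc 0) ** h) \<longlonglongrightarrow> g ** A ** h"
      by (intro tendsto_intros vector_derivative_seq[OF der \<tau>0 \<tau>(2)])
    then show ?thesis by (simp add: \<epsilon>(3) matrix_expand gh scaleR_diff_right)
  qed
  have quot: "(\<lambda>j. (1 / \<tau> j) *\<^sub>R (F (xc (\<tau> j)) - F x)) \<longlonglongrightarrow> F' v"
    if F: "(F has_derivative F') (at x)" for F :: "'e \<Rightarrow> complex ^ 's ^ 's" and F'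
  proof -
    have "((F \<circ> xc) has_vector_derivative F' v) (at 0)"
      using vector_derivative_diff_chain_within[OF v, of F F'] F \<epsilon>(2) has_derivative_at_withinI by blast
    from vector_derivative_seq[OF this \<tau>0 \<tau>(2)] show ?thesis by (simp add: \<epsilon>(2))
  qed
  have cr: "carries \<omega> (gc (\<tau> j) ** h) (g ** h' j) (J x) (G x) (J (xc (\<tau> j))) (G (xc (\<tau> j)))" for j
    by (rule carries_trans[OF symp carries_sym[OF symp c] h'])
  note inf = infinitesimal[where s = "\<lambda>j. xc (\<tau> j)" and g = "\<lambda>j. gc (\<tau> j) ** h" and h = "\<lambda>j. g ** h' j"
      and \<rho> = "\<lambda>j. 1 / \<tau> j", OF x U xl cr gl1 gX quot[OF dJ[OF x]] quot[OF de[OF x]]]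
  show ?thesis unfolding tangency_def using inf by (intro exI[of _ v]) simp
qed

text \<open>The solution \<open>u\<close> of \<open>u ** J x - J x ** u = e \<xi> x\<close> that
  anticommutes with \<open>J x\<close>, that is, the off-diagonal part forced on any infinitesimal
  change with velocity \<open>\<xi>\<close>.\<close>

definition off :: "'e \<Rightarrow> 'e \<Rightarrow> complex ^ 's ^ 's" where "off x \<xi> = - ((1 / 2) *\<^sub>R (J x ** e \<xi> x))"

text \<open>By \<open>eanti\<close> this says that \<open>e2 \<xi> \<eta> x\<close> equals minus one
  half of \<open>J x ** (e \<xi> x ** e \<eta> x + e \<eta> x ** e \<xi> x)\<close> modulo
  \<open>G x\<close>: the second derivative of \<open>J\<close> in terms of products of first
  ones.\<close>

definition star :: "'e \<Rightarrow> 'e \<Rightarrow> bool"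
  where "star x \<xi> \<longleftrightarrow> (\<forall>\<eta>. off x \<xi> ** e \<eta> x - e \<eta> x ** off x \<xi> - e2 \<xi> \<eta> x \<in> G x)"

text \<open>Right multiplication by \<open>J0\<close> maps frames at \<open>x\<close> to frames at \<open>x\<close>. Since the velocities do not
  depend on the frame, an element \<open>X\<close> realised at \<open>x\<close> is accompanied by \<open>J X J\<close>, whose off-diagonal
  part is opposite; hence the diagonal part of \<open>X\<close> stabilises the flag.\<close>

lemma velocity_star:
  assumes x: "x \<in> U" and c: "carries \<omega> g h J0 G0 (J x) (G x)" and A: "A \<in> \<Theta>"
  obtains v where "tangency x (g ** A ** h) 1 v" "star x v" "g ** A ** h - off x v \<in> stab \<omega> (J x) (G x)"
proof -
  let ?X = "g ** A ** h" and ?J = "J x"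
  have JJ: "?J ** ?J = mat 1" by (rule Jsq[OF x])
  obtain v where v: "tangency x ?X 1 v" using velocity_tangency[OF x c A] by blast
  have "(g ** J0) ** A ** (J0 ** h) = ?J ** ?X ** ?J"
  proof -
    have "?J = g ** J0 ** h" "h ** g = mat 1" using c unfolding carries_def by auto
    then show ?thesis by (simp add: matrix_mul_assoc matrix_cancel(1)[of h g])
  qed
  then obtain v' where v': "tangency x (?J ** ?X ** ?J) 1 v'"
    using velocity_tangency[OF x carries_J0[OF c] A] by metis
  have "e v' x = ?J ** ?X - ?X ** ?J"
    using v' unfolding tangency_def by (simp add: matrix_mul_assoc matrix_cancel JJ)
  moreover have "e v x = ?X ** ?J - ?J ** ?X" using v unfolding tangency_def by simp
  ultimately have ev: "e v' x = - e v x" by simp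
  \<comment> \<open>The two motions turn \<open>J x\<close> in opposite directions;
    \<open>degenerate\<close> carries this over to the second derivatives, which therefore cancel in
    the sum below.\<close>
  have "e (v' + v) x = 0" using linear_add[OF linear_e[OF x]] ev by simp
  then have "e2 (v' + v) \<eta> x = 0" for \<eta> by (rule degenerate[OF x])
  then have e2v: "e2 v' \<eta> x = - e2 v \<eta> x" for \<eta>
    using linear_add[OF linear_e2[OF x]] by (simp add: eq_neg_iff_add_eq_0)
  have exv: "e v x = ?X ** ?J - ?J ** ?X" using v unfolding tangency_def by simp
  \<comment> \<open>Twice the diagonal part of the velocity.\<close>
  define Y where "Y = ?X + ?J ** ?X ** ?J"
  have Y: "Y \<in> stab \<omega> ?J (G x)"
  proof -
    have "Y \<in> csp_mat \<omega>" unfolding Y_def using v v' subspace_add[OF subspace_csp_mat[OF symp]]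
      unfolding tangency_def by blast
    moreover have "Y ** ?J = ?J ** Y"
      unfolding Y_def by (simp add: matrix_expand matrix_cancel JJ)
    moreover have "Y ** e \<eta> x - e \<eta> x ** Y \<in> G x" for \<eta>
    proof -
      have "Y ** e \<eta> x - e \<eta> x ** Y = (?X ** e \<eta> x - e \<eta> x ** ?X - 1 *\<^sub>R e2 v \<eta> x)
        + ((?J ** ?X ** ?J) ** e \<eta> x - e \<eta> x ** (?J ** ?X ** ?J) - 1 *\<^sub>R e2 v' \<eta> x)"
        unfolding Y_def e2v by (simp add: matrix_expand)
      then show ?thesis
        using v v' subspace_add[OF subspace_G[OF x]] unfolding tangency_def by metis
    qed
    ultimately show ?thesis unfolding stab_def G_def by blast
  qed
  then have hY: "(1 / 2) *\<^sub>R Y \<in> stab \<omega> ?J (G x)"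
    by (rule subspace_scale[OF subspace_stab[OF symp subspace_G[OF x]]])
  have off: "off x v = ?X - (1 / 2) *\<^sub>R Y"
  proof -
    have "off x v = (1 / 2) *\<^sub>R (?X - ?J ** ?X ** ?J)"
      unfolding off_def exv by (simp add: matrix_expand matrix_cancel JJ scaleR_diff_right)
    also have "?X - ?J ** ?X ** ?J = (?X + ?X) - Y" unfolding Y_def by simp
    also have "(1 / 2) *\<^sub>R ((?X + ?X) - Y) = (1 / 2) *\<^sub>R (?X + ?X) - (1 / 2) *\<^sub>R Y"
      by (rule scaleR_diff_right)
    also have "(1 / 2) *\<^sub>R (?X + ?X) = ?X" by (rule scaleR_half_double)
    finally show ?thesis .
  qed
  have "star x v"
    unfolding star_def
  proof
    fix \<eta>
    have "off x v ** e \<eta> x - e \<eta> x ** off x v - e2 v \<eta> x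
      = (?X ** e \<eta> x - e \<eta> x ** ?X - 1 *\<^sub>R e2 v \<eta> x) - ((1/2) *\<^sub>R Y ** e \<eta> x - e \<eta> x ** ((1/2) *\<^sub>R Y))"
      unfolding off by (simp add: matrix_diff_simps)
    moreover have "(1/2) *\<^sub>R Y ** e \<eta> x - e \<eta> x ** ((1/2) *\<^sub>R Y) \<in> G x"
      using hY unfolding stab_def G_def by blast
    ultimately show "off x v ** e \<eta> x - e \<eta> x ** off x v - e2 v \<eta> x \<in> G x"
      using v subspace_diff[OF subspace_G[OF x]] unfolding tangency_def by metis
  qed
  moreover have "?X - off x v \<in> stab \<omega> ?J (G x)" using hY by (simp add: off)
  ultimately show thesis using that v by blast
qed

text \<open>By \<open>degenerate\<close> a change of direction that leaves \<open>e\<close> at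
  \<open>x\<close> unaltered also leaves \<open>e2\<close> unaltered, so the condition depends only
  on the resulting velocity of \<open>J\<close>.\<close>

lemma star_cong: 
  assumes x: "x \<in> U" and eq: "e v x = e \<xi> x" and s: "star x v" 
  shows "star x \<xi>"
proof -
  have "e (v - \<xi>) x = 0" using linear_diff[OF linear_e[OF x]] eq by simp
  then have "e2 (v - \<xi>) \<eta> x = 0" for \<eta> by (rule degenerate[OF x])
  then have "e2 v \<eta> x = e2 \<xi> \<eta> x" for \<eta> using linear_diff[OF linear_e2[OF x]] by simp
  then show ?thesis using s unfolding star_def off_def eq by simp
qed

lemma C1_interval:
  fixes f :: "real \<Rightarrow> 'a::real_normed_vector"
  assumes "\<And>t. t \<in> {a<..<b} \<Longrightarrow> (f has_vector_derivative f' t) (at t)" "continuous_on {a<..<b} f'"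
  shows "f C1_differentiable_on {a<..<b}"
  unfolding C1_differentiable_on_def using assms by blast

text \<open>Continuity of \<open>X\<close> is what allows integration: the flow of \<open>X\<close>
  moves the initial frame along the line as a C1 curve of frames, and such curves are what the
  modified symbol is made of.\<close>

lemma flow_velocity:
  assumes I: "\<And>t. t \<in> {a<..<b} \<Longrightarrow> x0 + t *\<^sub>R \<xi> \<in> U"
    and X: "continuous_on {a<..<b} X" "\<And>t. t \<in> {a<..<b} \<Longrightarrow> tangency (x0 + t *\<^sub>R \<xi>) (X t) 1 \<xi>"
    and t1: "t1 \<in> {a<..<b}" and c: "carries \<omega> g1 h1 J0 G0 (J (x0 + t1 *\<^sub>R \<xi>)) (G (x0 + t1 *\<^sub>R \<xi>))"
    and A0: "A0 \<in> stab \<omega> J0 G0"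
  shows "h1 ** X t1 ** g1 + A0 \<in> \<Theta>"
proof -
  let ?p = "\<lambda>t. x0 + t *\<^sub>R \<xi>"
  have dp: "(?p has_vector_derivative \<xi>) (at t)" for t by (auto intro!: derivative_eq_intros)
  have chain: "((\<lambda>t. F (?p t)) has_vector_derivative F' \<xi>) (at t)"
    if F: "(F has_derivative F') (at (?p t))" for F :: "'e \<Rightarrow> complex ^ 's ^ 's" and F' t
    using vector_derivative_diff_chain_within[OF dp[of t] has_derivative_at_withinI[OF F]]
    by (simp add: o_def)
  have tX: "X t \<in> csp_mat \<omega>" "X t ** J (?p t) - J (?p t) ** X t = e \<xi> (?p t)"
    "\<And>\<eta>. X t ** e \<eta> (?p t) - e \<eta> (?p t) ** X t - e2 \<xi> \<eta> (?p t) \<in> G (?p t)" if "t \<in> {a<..<b}" for t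
    using X(2)[OF that] unfolding tangency_def by auto
  obtain \<delta> g h where \<delta>: "\<delta> > 0" "{t1 - \<delta><..<t1 + \<delta>} \<subseteq> {a<..<b}" "g t1 = mat 1" "h t1 = mat 1"
    and dg: "\<And>t. t \<in> {t1 - \<delta><..<t1 + \<delta>} \<Longrightarrow> (g has_vector_derivative X t ** g t) (at t)"
    and cg: "\<And>t. t \<in> {t1 - \<delta><..<t1 + \<delta>} \<Longrightarrow>
      carries \<omega> (g t) (h t) (J (?p t1)) (G (?p t1)) (J (?p t)) (G (?p t))"
  proof (rule flow_carries[OF symp X(1) tX(1) t1, where T = "\<lambda>t \<eta>. e \<eta> (?p t)"
        and T' = "\<lambda>t \<eta>. e2 \<xi> \<eta> (?p t)" and J = "\<lambda>t. J (?p t)", folded G_def])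
    fix t assume t: "t \<in> {a<..<b}"
    show "((\<lambda>t. J (?p t)) has_vector_derivative X t ** J (?p t) - J (?p t) ** X t) (at t)"
      unfolding tX(2)[OF t] by (rule chain[OF dJ[OF I[OF t]]])
    show "linear (\<lambda>\<eta>. e \<eta> (?p t))" by (rule linear_e[OF I[OF t]])
    show "((\<lambda>t. e \<eta> (?p t)) has_vector_derivative e2 \<xi> \<eta> (?p t)) (at t)" for \<eta>
      by (rule chain[OF de[OF I[OF t]]])
    show "dim (G (?p t)) = dim (G (?p t1))" using G_dim I t t1 by simp
    show "e2 \<xi> \<eta> (?p t) - (X t ** e \<eta> (?p t) - e \<eta> (?p t) ** X t) \<in> G (?p t)" for \<eta>
      using subspace_neg[OF subspace_G[OF I[OF t]] tX(3)[OF t, of \<eta>]] by (simp add: algebra_simps)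
  next
    show "continuous_on {a<..<b} (\<lambda>t. e2 \<xi> \<eta> (?p t))" for \<eta>
      using has_vector_derivative_continuous[OF chain[OF de2[OF I]]]
      by (blast intro: continuous_at_imp_continuous_on)
  qed (assumption, rule that)
  obtain \<delta>' k k' where k: "\<delta>' > 0" "k 0 = mat 1"
    "\<And>t. t \<in> {-\<delta>'<..<\<delta>'} \<Longrightarrow> (k has_vector_derivative A0 ** k t) (at t)"
    "\<And>t. t \<in> {-\<delta>'<..<\<delta>'} \<Longrightarrow> carries \<omega> (k t) (k' t) J0 G0 J0 G0"
    using stab_flow[OF symp A0 sG0] by metis
  define \<epsilon> where "\<epsilon> = min \<delta> \<delta>'"
  have \<epsilon>: "\<epsilon> > 0" "\<And>t. t \<in> {-\<epsilon><..<\<epsilon>} \<Longrightarrow> t1 + t \<in> {t1 - \<delta><..<t1 + \<delta>}"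
    "\<And>t. t \<in> {-\<epsilon><..<\<epsilon>} \<Longrightarrow> t \<in> {-\<delta>'<..<\<delta>'}"
    using \<delta>(1) k(1) by (auto simp: \<epsilon>_def)
  have \<epsilon>ab: "t1 + t \<in> {a<..<b}" if "t \<in> {-\<epsilon><..<\<epsilon>}" for t using \<epsilon>(2)[OF that] \<delta>(2) by blast
  \<comment> \<open>At time 0 the left factor contributes \<open>h1 ** X t1 ** g1\<close> to the
    velocity read in the frame \<open>g1\<close>, and the right factor, a flow of symmetries of the
    model, adds \<open>A0\<close>.\<close>
  define gc where "gc t = g (t1 + t) ** g1 ** k t" for t
  define gc' where "gc' t = g (t1 + t) ** g1 ** (A0 ** k t) + X (t1 + t) ** g (t1 + t) ** g1 ** k t" for t
  have dgs: "((\<lambda>t. g (t1 + t)) has_vector_derivative X (t1 + t) ** g (t1 + t)) (at t)" if "t \<in> {-\<epsilon><..<\<epsilon>}" for t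
  proof -
    have "((\<lambda>t. t1 + t) has_vector_derivative 1) (at t)" by (auto intro!: derivative_eq_intros)
    from vector_diff_chain_at[OF this dg[OF \<epsilon>(2)[OF that]]] show ?thesis by (simp add: o_def)
  qed
  have dgc: "(gc has_vector_derivative gc' t) (at t)" if t: "t \<in> {-\<epsilon><..<\<epsilon>}" for t
    unfolding gc_def
    by (rule has_vector_derivative_eq_rhs,
        (rule has_vector_derivative_matrix_mult dgs[OF t] k(3)[OF \<epsilon>(3)[OF t]] has_vector_derivative_const)+)
      (simp add: gc'_def matrix_mul_assoc)
  have cgs: "continuous_on {-\<epsilon><..<\<epsilon>} (\<lambda>t. g (t1 + t))" "continuous_on {-\<epsilon><..<\<epsilon>} k"
    using has_vector_derivative_continuous[OF dgs] has_vector_derivative_continuous[OF k(3)[OF \<epsilon>(3)]]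
    by (blast intro: continuous_at_imp_continuous_on)+
  have cX: "continuous_on {-\<epsilon><..<\<epsilon>} (\<lambda>t. X (t1 + t))"
    by (rule continuous_on_compose2[OF X(1)]) (use \<epsilon>ab in \<open>auto intro!: continuous_intros\<close>)
  have cgc': "continuous_on {-\<epsilon><..<\<epsilon>} gc'"
    unfolding gc'_def[abs_def] by (intro continuous_intros cgs cX)
  have g10: "g1 ** h1 = mat 1" using c unfolding carries_def by simp
  show ?thesis
    unfolding const_vel[OF I[OF t1] c[unfolded G_def]] mem_Collect_eq
  proof (intro exI conjI ballI)
    show "\<epsilon> > 0" by fact
    show "(\<lambda>t. ?p (t1 + t)) 0 = ?p t1" "gc 0 = g1" by (simp_all add: gc_def \<delta>(3) k(2))
    show "(\<lambda>t. ?p (t1 + t)) C1_differentiable_on {-\<epsilon><..<\<epsilon>}"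
      by (rule C1_interval[where f' = "\<lambda>_. \<xi>"]) (auto intro!: derivative_eq_intros)
    show "gc C1_differentiable_on {-\<epsilon><..<\<epsilon>}" by (rule C1_interval[OF dgc cgc'])
    have "gc' 0 = g1 ** (h1 ** X t1 ** g1 + A0)"
      by (simp add: gc'_def \<delta>(3) k(2) matrix_expand g10)
    then show "(gc has_vector_derivative g1 ** (h1 ** X t1 ** g1 + A0)) (at 0)"
      using dgc[of 0] \<epsilon>(1) by simp
    fix t assume t: "t \<in> {-\<epsilon><..<\<epsilon>}"
    show "?p (t1 + t) \<in> U" using I[OF \<epsilon>ab[OF t]] .
    show "carries \<omega> (gc t) (k' t ** (h1 ** h (t1 + t))) J0 G0 (J (?p (t1 + t))) (range (\<lambda>\<eta>. e \<eta> (?p (t1 + t))))"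
      unfolding gc_def G_def[symmetric]
      by (rule carries_trans[OF symp k(4)[OF \<epsilon>(3)[OF t]] carries_trans[OF symp c cg[OF \<epsilon>(2)[OF t]]]])
  qed
qed

end

section \<open>The second-order identity at every point and its consequences\<close>

context moving_flag
begin

lemma continuous_on_star_data:
  assumes "\<And>t. t \<in> {a<..<b} \<Longrightarrow> x0 + t *\<^sub>R \<xi> \<in> U"
  shows "continuous_on {a<..<b} (\<lambda>t. off (x0 + t *\<^sub>R \<xi>) \<xi>)"
proof -
  have p: "continuous_on {a<..<b} (\<lambda>t. x0 + t *\<^sub>R \<xi>)" by (intro continuous_intros)
  have "continuous_on U J" "continuous_on U (e \<xi>)"
    using has_derivative_continuous[OF dJ] has_derivative_continuous[OF de]
    by (auto intro: continuous_at_imp_continuous_on)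
  then have "continuous_on {a<..<b} (\<lambda>t. J (x0 + t *\<^sub>R \<xi>))" "continuous_on {a<..<b} (\<lambda>t. e \<xi> (x0 + t *\<^sub>R \<xi>))"
    using assms by (auto intro: continuous_on_compose2[OF _ p])
  then show ?thesis unfolding off_def by (intro continuous_intros)
qed

text \<open>By Baire's theorem the frames are uniformly bounded over some subinterval.\<close>

lemma bounded_frames:
  assumes ab: "a < b" and I: "\<And>t. t \<in> {a..b} \<Longrightarrow> x0 + t *\<^sub>R \<xi> \<in> U"
  obtains c d k where "c < d" "{c<..<d} \<subseteq> {a..b}"
    "\<And>t. t \<in> {c<..<d} \<Longrightarrow> \<exists>g h. carries \<omega> g h J0 G0 (J (x0 + t *\<^sub>R \<xi>)) (G (x0 + t *\<^sub>R \<xi>)) \<and>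
      norm g \<le> k \<and> norm h \<le> k"
proof -
  let ?p = "\<lambda>t. x0 + t *\<^sub>R \<xi>"
  define F where "F k = {t \<in> {a..b}. \<exists>g h. carries \<omega> g h J0 G0 (J (?p t)) (G (?p t)) \<and>
      norm g \<le> k \<and> norm h \<le> k}" for k :: real
  have clF: "closed (F k)" for k
    unfolding closed_sequential_limits
  proof (intro allI impI, elim conjE)
    fix s :: "nat \<Rightarrow> real" and t assume s: "\<forall>j. s j \<in> F k" "s \<longlonglongrightarrow> t"
    have sab: "s j \<in> {a..b}" for j using s(1) unfolding F_def by blast
    have t: "t \<in> {a..b}" by (rule closed_sequentially[OF _ sab s(2)]) simp
    have "\<forall>j. \<exists>g h. carries \<omega> g h J0 G0 (J (?p (s j))) (G (?p (s j))) \<and> norm g \<le> k \<and> norm h \<le> k"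
      using s(1) unfolding F_def by blast
    then obtain g h where gh: "\<And>j. carries \<omega> (g j) (h j) J0 G0 (J (?p (s j))) (G (?p (s j)))"
      "\<And>j. norm (g j) \<le> k" "\<And>j. norm (h j) \<le> k" by metis
    obtain r g0 h0 where r: "strict_mono (r :: nat \<Rightarrow> nat)" "(g \<circ> r) \<longlonglongrightarrow> g0" "(h \<circ> r) \<longlonglongrightarrow> h0"
      by (rule convergent_pair_subseq[OF gh(2) gh(3)])
    have sl: "(\<lambda>j. s (r j)) \<longlonglongrightarrow> t" using LIMSEQ_subseq_LIMSEQ[OF s(2) r(1)] by (simp add: o_def)
    have pl: "(\<lambda>j. ?p (s (r j))) \<longlonglongrightarrow> ?p t" by (intro tendsto_intros sl)
    have "carries \<omega> g0 h0 J0 G0 (J (?p t)) (G (?p t))"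
      by (rule carries_closed_seq[OF I[OF t] I[OF sab] pl gh(1)]) (use r in \<open>simp_all add: o_def\<close>)
    moreover have "norm g0 \<le> k" "norm h0 \<le> k"
      by (rule Lim_bounded[OF tendsto_norm[OF r(2)], of 0], simp add: gh)
        (rule Lim_bounded[OF tendsto_norm[OF r(3)], of 0], simp add: gh)
    ultimately show "t \<in> F k" unfolding F_def using t by blast
  qed
  have cover: "\<exists>k::nat. t \<in> F (real k)" if t: "t \<in> {a..b}" for t
  proof -
    obtain g h where gh: "carries \<omega> g h J0 G0 (J (?p t)) (G (?p t))"
      using frame_ex[OF I[OF t]] unfolding G_def by blast
    obtain k :: nat where "max (norm g) (norm h) \<le> real k" using real_arch_simple by blast
    then show ?thesis unfolding F_def using t gh by (intro exI[of _ k]) auto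
  qed
  define \<G> where "\<G> = range (\<lambda>k::nat. {a..b} - F (real k))"
  \<comment> \<open>If all complements were dense in the interval, Baire's theorem would make their
    intersection dense, yet the sets \<open>F k\<close> cover the interval.\<close>
  have "\<not> (\<forall>T\<in>\<G>. {a..b} \<subseteq> closure T)"
  proof
    assume dense: "\<forall>T\<in>\<G>. {a..b} \<subseteq> closure T"
    have "{a..b} \<subseteq> closure (\<Inter>\<G>)"
    proof (rule Baire)
      fix T assume T: "T \<in> \<G>"
      then obtain k :: nat where k: "T = {a..b} - F (real k)" unfolding \<G>_def by blast
      have "openin (top_of_set {a..b}) ({a..b} - F (real k))"
        using clF by (simp add: Diff_eq openin_open_Int open_Compl)
      then show "openin (top_of_set {a..b}) T \<and> {a..b} \<subseteq> closure T" using dense T k by blast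
    qed (simp_all add: \<G>_def)
    moreover have "\<Inter>\<G> = {}"
    proof -
      have "t \<notin> \<Inter>\<G>" for t
      proof (cases "t \<in> {a..b}")
        case True
        then obtain k :: nat where "t \<in> F (real k)" using cover by blast
        then show ?thesis unfolding \<G>_def by blast
      qed (auto simp: \<G>_def)
      then show ?thesis by blast
    qed
    ultimately show False using ab by auto
  qed
  then obtain k :: nat and t where t: "t \<in> {a..b}" "t \<notin> closure ({a..b} - F (real k))"
    unfolding \<G>_def by blast
  then obtain \<delta> where \<delta>: "\<delta> > 0" "\<And>s. dist s t < \<delta> \<Longrightarrow> s \<notin> {a..b} - F (real k)"
    unfolding closure_approachable by blast
  define c d where "c = max a (t - \<delta>)" and "d = min b (t + \<delta>)"
  show ?thesis
  proof (rule that[of c d "real k"])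
    show "c < d" using t(1) \<delta>(1) ab unfolding c_def d_def by auto
    show "{c<..<d} \<subseteq> {a..b}" unfolding c_def d_def by auto
    fix s assume s: "s \<in> {c<..<d}"
    then have "dist s t < \<delta>" "s \<in> {a..b}" unfolding c_def d_def by (auto simp: dist_real_def)
    then have "s \<in> F (real k)" using \<delta>(2) by blast
    then show "\<exists>g h. carries \<omega> g h J0 G0 (J (?p s)) (G (?p s)) \<and> norm g \<le> real k \<and> norm h \<le> real k"
      unfolding F_def by blast
  qed
qed

text \<open>Bounded frames are available only over some subinterval, so what results is density on
  the line. At the midpoint of that subinterval the selected \<open>X\<close> is realised as a
  velocity, and \<open>velocity_star\<close> applies to it.\<close>

lemma star_dense:
  assumes ab: "a < b" and I: "\<And>t. t \<in> {a..b} \<Longrightarrow> x0 + t *\<^sub>R \<xi> \<in> U"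
  shows "\<exists>t\<in>{a..b}. star (x0 + t *\<^sub>R \<xi>) \<xi>"
proof -
  let ?p = "\<lambda>t. x0 + t *\<^sub>R \<xi>"
  obtain c d k where cd: "c < d" "{c<..<d} \<subseteq> {a..b}"
    "\<And>t. t \<in> {c<..<d} \<Longrightarrow> \<exists>g h. carries \<omega> g h J0 G0 (J (?p t)) (G (?p t)) \<and> norm g \<le> k \<and> norm h \<le> k"
    using bounded_frames[OF ab I] by metis
  have I': "?p t \<in> U" if "t \<in> {c<..<d}" for t using I cd(2) that by blast
  obtain X where X: "continuous_on {c<..<d} X" "\<And>t. t \<in> {c<..<d} \<Longrightarrow> tangency (?p t) (X t) 1 \<xi>"
    by (rule tangency_selection[where a = c and b = d, OF I' cd(3)]) (assumption, assumption, rule that)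
  define t where "t = (c + d) / 2"
  have t: "t \<in> {c<..<d}" using cd(1) by (simp add: t_def)
  have x: "?p t \<in> U" by (rule I'[OF t])
  obtain g h where gh: "carries \<omega> g h J0 G0 (J (?p t)) (G (?p t))" using cd(3)[OF t] by blast
  have "0 \<in> stab \<omega> J0 G0" by (rule subspace_0[OF subspace_stab[OF symp sG0]])
  from flow_velocity[OF I' X t gh this] have "h ** X t ** g \<in> \<Theta>" by simp
  from velocity_star[OF x gh this] obtain v where v: "tangency (?p t) (g ** (h ** X t ** g) ** h) 1 v" "star (?p t) v"
    by blast
  have "g ** (h ** X t ** g) ** h = X t"
    using gh unfolding carries_def by (simp add: matrix_mul_assoc matrix_cancel)
  then have "e v (?p t) = e \<xi> (?p t)" using v(1) X(2)[OF t] unfolding tangency_def by simp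
  then have "star (?p t) \<xi>" using star_cong[OF x _ v(2)] by blast
  then show ?thesis using t cd(2) by blast
qed

text \<open>The condition is closed by \<open>G_closed_seq\<close>, and \<open>star_dense\<close> on
  shrinking intervals starting at 0 supplies points that tend to \<open>x\<close>.\<close>

lemma star_all:
  assumes x: "x \<in> U" shows "star x \<xi>"
proof -
  have "continuous_on UNIV (\<lambda>t. x + t *\<^sub>R \<xi>)" by (intro continuous_intros)
  then have "open ((\<lambda>t. x + t *\<^sub>R \<xi>) -` U)" using openU by (simp add: open_vimage)
  then obtain \<delta> where \<delta>: "\<delta> > 0" "ball 0 \<delta> \<subseteq> (\<lambda>t. x + t *\<^sub>R \<xi>) -` U"
    using x open_contains_ball[of "(\<lambda>t. x + t *\<^sub>R \<xi>) -` U"] by force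
  have "\<exists>t. 0 \<le> t \<and> t \<le> \<delta> / 2 * inverse (real (Suc j)) \<and> x + t *\<^sub>R \<xi> \<in> U \<and> star (x + t *\<^sub>R \<xi>) \<xi>" for j :: nat
  proof -
    let ?b = "\<delta> / 2 * inverse (real (Suc j))"
    have "inverse (real (Suc j)) \<le> 1" by (simp add: field_simps)
    then have b: "0 < ?b" "?b \<le> \<delta> / 2" using \<delta>(1) by (auto intro: mult_left_le)
    have U: "x + t *\<^sub>R \<xi> \<in> U" if t: "t \<in> {0..?b}" for t
    proof -
      have "0 \<le> t" "t \<le> ?b" using t by auto
      then have "\<bar>t\<bar> < \<delta>" using b \<delta>(1) by linarith
      then have "t \<in> ball 0 \<delta>" by (simp add: dist_real_def)
      then show ?thesis using \<delta>(2) by blast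
    qed
    from star_dense[OF b(1) U] show ?thesis using U by fastforce
  qed
  then obtain t where t: "\<And>j. 0 \<le> t j" "\<And>j. t j \<le> \<delta> / 2 * inverse (real (Suc j))"
    "\<And>j. x + t j *\<^sub>R \<xi> \<in> U" "\<And>j. star (x + t j *\<^sub>R \<xi>) \<xi>" by metis
  have "(\<lambda>j. \<delta> / 2 * inverse (real (Suc j))) \<longlonglongrightarrow> 0"
    by (rule tendsto_mult_right_zero[OF LIMSEQ_inverse_real_of_nat])
  then have "t \<longlonglongrightarrow> 0"
    using t(1,2) by (intro tendsto_sandwich[of "\<lambda>_. 0" t sequentially "\<lambda>j. \<delta> / 2 * inverse (real (Suc j))"]) auto
  then have "(\<lambda>j. x + t j *\<^sub>R \<xi>) \<longlonglongrightarrow> x + 0 *\<^sub>R \<xi>" by (intro tendsto_intros)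
  then have sl: "(\<lambda>j. x + t j *\<^sub>R \<xi>) \<longlonglongrightarrow> x" by simp
  show ?thesis
    unfolding star_def
  proof
    fix \<eta>
    let ?s = "\<lambda>j. x + t j *\<^sub>R \<xi>"
    show "off x \<xi> ** e \<eta> x - e \<eta> x ** off x \<xi> - e2 \<xi> \<eta> x \<in> G x"
    proof (rule G_closed_seq[OF x t(3) sl])
      show "(\<lambda>j. off (?s j) \<xi> ** e \<eta> (?s j) - e \<eta> (?s j) ** off (?s j) \<xi> - e2 \<xi> \<eta> (?s j)) \<longlonglongrightarrow>
          off x \<xi> ** e \<eta> x - e \<eta> x ** off x \<xi> - e2 \<xi> \<eta> x"
        unfolding off_def by (intro tendsto_intros tendsto_J tendsto_e tendsto_e2 x sl)
      show "off (?s j) \<xi> ** e \<eta> (?s j) - e \<eta> (?s j) ** off (?s j) \<xi> - e2 \<xi> \<eta> (?s j) \<in> G (?s j)" for j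
        using t(4) unfolding star_def by blast
    qed
  qed
qed

text \<open>The section is compared with the particular section \<open>e \<eta>\<close> that has the
  same value at \<open>x\<close>: the derivative of the difference lies in \<open>G x\<close>, and
  \<open>star_all\<close> evaluates the derivative of \<open>e \<eta>\<close>. Doubling clears the
  halves in \<open>off\<close>.\<close>

lemma section_derivative:
  assumes x: "x \<in> U" and Z: "\<And>y. y \<in> U \<Longrightarrow> Z y \<in> G y" and dZ: "(Z has_derivative Z') (at x)"
  shows "Z' \<zeta> + Z' \<zeta> + J x ** (e \<zeta> x ** Z x + Z x ** e \<zeta> x) \<in> G x"
proof -
  obtain \<eta> where \<eta>: "Z x = e \<eta> x" using Z[OF x] unfolding G_def by blast
  obtain \<delta> where \<delta>: "\<delta> > 0" "ball x \<delta> \<subseteq> U" using openU x open_contains_ball by blast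
  \<comment> \<open>The constant keeps \<open>x + \<tau> j *\<^sub>R \<zeta>\<close> inside the
    ball; the 1 in the denominator covers \<open>\<zeta> = 0\<close>.\<close>
  define \<tau> where "\<tau> j = (\<delta> / (2 * (norm \<zeta> + 1))) * inverse (real (Suc j))" for j :: nat
  have n1: "norm \<zeta> + 1 > 0" by (simp add: add_nonneg_pos)
  have \<tau>pos: "\<tau> j > 0" for j using \<delta> n1 unfolding \<tau>_def by (intro mult_pos_pos divide_pos_pos) auto
  have \<tau>0: "\<tau> \<longlonglongrightarrow> 0"
    unfolding \<tau>_def[abs_def] by (rule tendsto_mult_right_zero[OF LIMSEQ_inverse_real_of_nat])
  have sU: "x + \<tau> j *\<^sub>R \<zeta> \<in> U" for j
  proof -
    have "inverse (real (Suc j)) \<le> 1" by (simp add: field_simps)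
    then have "\<tau> j \<le> \<delta> / (2 * (norm \<zeta> + 1))"
      using \<delta> n1 unfolding \<tau>_def by (intro mult_left_le) auto
    then have "\<tau> j * norm \<zeta> \<le> \<delta> / (2 * (norm \<zeta> + 1)) * norm \<zeta>" by (intro mult_right_mono) auto
    also have "\<dots> < \<delta>" using \<delta>(1) n1 by (simp add: field_simps) (smt (verit) mult_nonneg_nonneg norm_ge_zero)
    finally have "norm (\<tau> j *\<^sub>R \<zeta>) < \<delta>" using \<tau>pos[of j] by simp
    then have "x + \<tau> j *\<^sub>R \<zeta> \<in> ball x \<delta>" by (simp add: dist_norm)
    then show ?thesis using \<delta>(2) by blast
  qed
  have "(\<lambda>j. x + \<tau> j *\<^sub>R \<zeta>) \<longlonglongrightarrow> x + 0 *\<^sub>R \<zeta>" by (intro tendsto_intros \<tau>0)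
  then have sl: "(\<lambda>j. x + \<tau> j *\<^sub>R \<zeta>) \<longlonglongrightarrow> x" by simp
  have "Z' \<zeta> - e2 \<zeta> \<eta> x \<in> G x"
  proof (rule G_closed_seq[OF x sU sl])
    show "(\<lambda>j. (1 / \<tau> j) *\<^sub>R (Z (x + \<tau> j *\<^sub>R \<zeta>) - Z x) - (1 / \<tau> j) *\<^sub>R (e \<eta> (x + \<tau> j *\<^sub>R \<zeta>) - e \<eta> x))
        \<longlonglongrightarrow> Z' \<zeta> - e2 \<zeta> \<eta> x"
      by (intro tendsto_diff quotient_tendsto dZ de x \<tau>0 less_imp_neq[OF \<tau>pos, symmetric])
    have "Z (x + \<tau> j *\<^sub>R \<zeta>) - e \<eta> (x + \<tau> j *\<^sub>R \<zeta>) \<in> G (x + \<tau> j *\<^sub>R \<zeta>)" for j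
      using Z[OF sU] subspace_diff[OF subspace_G[OF sU]] unfolding G_def by blast
    from subspace_scale[OF subspace_G[OF sU] this]
    have "(1 / \<tau> j) *\<^sub>R (Z (x + \<tau> j *\<^sub>R \<zeta>) - e \<eta> (x + \<tau> j *\<^sub>R \<zeta>)) \<in> G (x + \<tau> j *\<^sub>R \<zeta>)" for j .
    then show "(1 / \<tau> j) *\<^sub>R (Z (x + \<tau> j *\<^sub>R \<zeta>) - Z x) - (1 / \<tau> j) *\<^sub>R (e \<eta> (x + \<tau> j *\<^sub>R \<zeta>) - e \<eta> x)
        \<in> G (x + \<tau> j *\<^sub>R \<zeta>)" for j
      by (simp add: \<eta> scaleR_diff_right)
  qed
  moreover have "off x \<zeta> ** e \<eta> x - e \<eta> x ** off x \<zeta> - e2 \<zeta> \<eta> x \<in> G x"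
    using star_all[OF x] unfolding star_def by blast
  ultimately have mem: "(Z' \<zeta> - e2 \<zeta> \<eta> x) - (off x \<zeta> ** e \<eta> x - e \<eta> x ** off x \<zeta> - e2 \<zeta> \<eta> x) \<in> G x"
    by (rule subspace_diff[OF subspace_G[OF x]])
  have "2 *\<^sub>R ((Z' \<zeta> - e2 \<zeta> \<eta> x) - (off x \<zeta> ** e \<eta> x - e \<eta> x ** off x \<zeta> - e2 \<zeta> \<eta> x))
    = Z' \<zeta> + Z' \<zeta> + J x ** (e \<zeta> x ** Z x + Z x ** e \<zeta> x)"
    unfolding off_def \<eta> by (simp add: matrix_expand eanti[OF x] scaleR_diff_right scaleR_2)
  with subspace_scale[OF subspace_G[OF x] mem, of 2] show ?thesis by simp
qed

text \<open>By \<open>star_all\<close> the expression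
  \<open>2 e2 \<xi> \<eta> + J (e \<xi> e \<eta> + e \<eta> e \<xi>)\<close> is a section of
  \<open>G\<close>. Its derivative along \<open>\<zeta>\<close>, corrected by
  \<open>section_derivative\<close>, lies in \<open>G x\<close>, and so does the one with
  \<open>\<xi>\<close> and \<open>\<zeta>\<close> exchanged. In the difference the symmetric third
  derivatives cancel and the double commutator is left.\<close>

lemma lie_triple:
  assumes x: "x \<in> U" and abc: "A \<in> G x" "B \<in> G x" "C \<in> G x"
  shows "(A ** B - B ** A) ** C - C ** (A ** B - B ** A) \<in> G x"
proof -
  obtain \<zeta> \<xi> \<eta> where z: "A = e \<zeta> x" "B = e \<xi> x" "C = e \<eta> x" using abc unfolding G_def by blast
  define S where "S \<xi> y = e2 \<xi> \<eta> y + e2 \<xi> \<eta> y + J y ** (e \<xi> y ** e \<eta> y + e \<eta> y ** e \<xi> y)" for \<xi> y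
  have SG: "S \<xi> y \<in> G y" if y: "y \<in> U" for \<xi> y
  proof -
    have "off y \<xi> ** e \<eta> y - e \<eta> y ** off y \<xi> - e2 \<xi> \<eta> y \<in> G y" using star_all[OF y] unfolding star_def by blast
    from subspace_scale[OF subspace_G[OF y] this, of "-2"]
    show ?thesis unfolding S_def off_def
      by (simp add: matrix_expand eanti[OF y] scaleR_diff_right scaleR_2 algebra_simps)
  qed
  define S' where "S' \<xi> \<zeta> = e3 \<zeta> \<xi> \<eta> x + e3 \<zeta> \<xi> \<eta> x
      + (J x ** ((e \<xi> x ** e2 \<zeta> \<eta> x + e2 \<zeta> \<xi> x ** e \<eta> x) + (e \<eta> x ** e2 \<zeta> \<xi> x + e2 \<zeta> \<eta> x ** e \<xi> x))
        + e \<zeta> x ** (e \<xi> x ** e \<eta> x + e \<eta> x ** e \<xi> x))" for \<xi> \<zeta>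
  have dS: "(S \<xi> has_derivative S' \<xi>) (at x)" for \<xi>
    unfolding S_def S'_def by (intro has_derivative_add has_derivative_matrix_mult dJ de de2 x)
  have 1: "S' \<xi> \<zeta> + S' \<xi> \<zeta> + J x ** (A ** S \<xi> x + S \<xi> x ** A) \<in> G x"
    unfolding z by (rule section_derivative[OF x SG dS])
  have 2: "S' \<zeta> \<xi> + S' \<zeta> \<xi> + J x ** (B ** S \<zeta> x + S \<zeta> x ** B) \<in> G x"
    unfolding z by (rule section_derivative[OF x SG dS])
  define P Q where "P = e2 \<xi> \<eta> x" and "Q = e2 \<zeta> \<eta> x"
  have JJ: "J x ** J x = mat 1" by (rule Jsq[OF x])
  have anti: "A ** J x = - (J x ** A)" "B ** J x = - (J x ** B)" "C ** J x = - (J x ** C)"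
    unfolding z by (rule eanti[OF x])+
  have anti': "Y ** A ** J x = - (Y ** J x ** A)" "Y ** B ** J x = - (Y ** J x ** B)"
    "Y ** C ** J x = - (Y ** J x ** C)" for Y
    by (simp_all add: matrix_mul_assoc[symmetric] anti matrix_minus_simps)
  have "(S' \<xi> \<zeta> + S' \<xi> \<zeta> + J x ** (A ** S \<xi> x + S \<xi> x ** A))
      - (S' \<zeta> \<xi> + S' \<zeta> \<xi> + J x ** (B ** S \<zeta> x + S \<zeta> x ** B))
    = (A ** B - B ** A) ** C - C ** (A ** B - B ** A)"
    unfolding S'_def S_def z[symmetric] P_def[symmetric] Q_def[symmetric] e3sym[OF x, of \<zeta> \<xi>] e2sym[OF x, of \<zeta> \<xi>]
    by (simp add: matrix_expand anti anti' JJ matrix_cancel[OF JJ])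
      (simp only: mult_2 matrix_add_ldistrib matrix_add_rdistrib, simp)
  with subspace_diff[OF subspace_G[OF x] 1 2] show ?thesis by simp
qed

text \<open>One inclusion is the splitting of \<open>velocity_star\<close>. For the other, once
  \<open>star\<close> holds everywhere, the explicit continuous field \<open>off\<close> is an
  infinitesimal frame change along any line, and \<open>flow_velocity\<close> realises it together
  with an arbitrary symmetry of the model.\<close>

lemma velocities_eq:
  assumes "U \<noteq> {}"
  shows "\<Theta> = {B + A | B A. B \<in> G0 \<and> A \<in> stab \<omega> J0 G0}"
proof -
  obtain x where x: "x \<in> U" using assms by blast
  obtain g h where c: "carries \<omega> g h J0 G0 (J x) (G x)" using frame_ex[OF x] unfolding G_def by blast
  then have gh: "g ** h = mat 1" "h ** g = mat 1" and img: "(\<lambda>B. g ** B ** h) ` G0 = G x"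
    unfolding carries_def by auto
  have img': "(\<lambda>B. h ** B ** g) ` G x = G0"
    using carries_sym[OF symp c] unfolding carries_def by auto
  have off_G: "off x \<xi> \<in> G x" for \<xi>
    using subspace_neg[OF subspace_G[OF x] subspace_scale[OF subspace_G[OF x] JG[OF x]]]
    unfolding off_def G_def by blast
  show ?thesis
  proof (intro set_eqI iffI)
    fix A assume "A \<in> \<Theta>"
    from velocity_star[OF x c this] obtain v where v: "g ** A ** h - off x v \<in> stab \<omega> (J x) (G x)" by metis
    have "h ** (g ** A ** h - off x v) ** g \<in> stab \<omega> J0 G0"
      by (rule carries_stab[OF symp carries_sym[OF symp c] v])
    moreover have "h ** off x v ** g \<in> G0" using img' off_G by blast
    moreover have "A = h ** off x v ** g + h ** (g ** A ** h - off x v) ** g"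
      by (simp add: matrix_expand matrix_cancel gh)
    ultimately show "A \<in> {B + A | B A. B \<in> G0 \<and> A \<in> stab \<omega> J0 G0}" by blast
  next
    fix A assume "A \<in> {B + A | B A. B \<in> G0 \<and> A \<in> stab \<omega> J0 G0}"
    then obtain B A0 where BA: "A = B + A0" "B \<in> G0" "A0 \<in> stab \<omega> J0 G0" by blast
    let ?B = "g ** B ** h"
    have "?B \<in> G x" using img BA(2) by blast
    \<comment> \<open>The multiple is chosen so that \<open>off x \<xi>\<close> equals
      \<open>g ** B ** h\<close>: the factors -1/2 and -2 cancel, and \<open>J x\<close> squares to
      the identity.\<close>
    then have "(-2) *\<^sub>R (J x ** ?B) \<in> G x"
      by (intro subspace_scale[OF subspace_G[OF x]] JG x)
    then obtain \<xi> where \<xi>: "e \<xi> x = (-2) *\<^sub>R (J x ** ?B)" unfolding G_def by (metis imageE)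
    have offB: "off x \<xi> = ?B"
      unfolding off_def \<xi> by (simp add: matrix_expand Jsq[OF x])
    have "continuous_on UNIV (\<lambda>t. x + t *\<^sub>R \<xi>)" by (intro continuous_intros)
    then have "open ((\<lambda>t. x + t *\<^sub>R \<xi>) -` U)" using openU by (simp add: open_vimage)
    then obtain \<delta> where \<delta>: "\<delta> > 0" "ball 0 \<delta> \<subseteq> (\<lambda>t. x + t *\<^sub>R \<xi>) -` U"
      using x open_contains_ball[of "(\<lambda>t. x + t *\<^sub>R \<xi>) -` U"] by force
    have I: "x + t *\<^sub>R \<xi> \<in> U" if "t \<in> {-\<delta><..<\<delta>}" for t
    proof -
      have "t \<in> ball 0 \<delta>" using that by (auto simp: dist_real_def)
      then show ?thesis using \<delta>(2) by blast
    qed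
    have tan: "tangency (x + t *\<^sub>R \<xi>) (off (x + t *\<^sub>R \<xi>) \<xi>) 1 \<xi>" if t: "t \<in> {-\<delta><..<\<delta>}" for t
    proof -
      let ?x = "x + t *\<^sub>R \<xi>"
      have U: "?x \<in> U" by (rule I[OF t])
      have "off ?x \<xi> \<in> G ?x"
        using subspace_neg[OF subspace_G[OF U] subspace_scale[OF subspace_G[OF U] JG[OF U]]]
        unfolding off_def G_def by blast
      then have "off ?x \<xi> \<in> csp_mat \<omega>" by (rule Gcsp[OF U])
      moreover have "off ?x \<xi> ** J ?x - J ?x ** off ?x \<xi> = 1 *\<^sub>R e \<xi> ?x"
      proof -
        have e: "J ?x ** e \<xi> ?x ** J ?x = - e \<xi> ?x"
          by (simp add: matrix_mul_assoc[symmetric] eanti[OF U] matrix_minus_simps)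
            (simp add: matrix_mul_assoc Jsq[OF U])
        have "off ?x \<xi> ** J ?x - J ?x ** off ?x \<xi> = (1/2) *\<^sub>R (e \<xi> ?x + e \<xi> ?x)"
          unfolding off_def by (simp add: matrix_expand e Jsq[OF U] scaleR_right_distrib)
        then show ?thesis by simp
      qed
      ultimately show ?thesis
        using star_all[OF U, of \<xi>] unfolding tangency_def star_def by simp
    qed
    have t0: "(0::real) \<in> {-\<delta><..<\<delta>}" using \<delta>(1) by simp
    have "h ** off (x + 0 *\<^sub>R \<xi>) \<xi> ** g + A0 \<in> \<Theta>"
      using c by (intro flow_velocity[OF I continuous_on_star_data[OF I] tan t0 _ BA(3)]) auto
    then show "A \<in> \<Theta>" by (simp add: offB BA(1) matrix_mul_assoc matrix_cancel gh)
  qed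
qed

lemma symbol_lie_triple:
  assumes "U \<noteq> {}" and abc: "A \<in> G0" "B \<in> G0" "C \<in> G0"
  shows "(A ** B - B ** A) ** C - C ** (A ** B - B ** A) \<in> G0"
proof -
  obtain x where x: "x \<in> U" using assms by blast
  obtain g h where c: "carries \<omega> g h J0 G0 (J x) (G x)" using frame_ex[OF x] unfolding G_def by blast
  then have gh: "g ** h = mat 1" "h ** g = mat 1" and img: "(\<lambda>B. g ** B ** h) ` G0 = G x"
    unfolding carries_def by auto
  have img': "(\<lambda>B. h ** B ** g) ` G x = G0"
    using carries_sym[OF symp c] unfolding carries_def by auto
  let ?c = "\<lambda>B. g ** B ** h"
  have "(?c A ** ?c B - ?c B ** ?c A) ** ?c C - ?c C ** (?c A ** ?c B - ?c B ** ?c A) \<in> G x"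
    using abc img by (intro lie_triple[OF x]) auto
  then have "h ** ((?c A ** ?c B - ?c B ** ?c A) ** ?c C - ?c C ** (?c A ** ?c B - ?c B ** ?c A)) ** g \<in> G0"
    using img' by blast
  then show ?thesis by (simp add: matrix_expand matrix_cancel gh)
qed

end

section \<open>Holomorphic functions of several variables\<close>

text \<open>Only homogeneity is demanded of the derivative, since additivity is part of
  \<open>has_derivative\<close>. The vector and matrix versions below are entrywise, so that
  determinants and Cauchy's formula act on scalar functions.\<close>

definition chol :: "(complex ^ 'a \<Rightarrow> complex) \<Rightarrow> (complex ^ 'a) set \<Rightarrow> bool"
  where "chol f U \<longleftrightarrow> open U \<and> (\<forall>p\<in>U. \<exists>A. (f has_derivative A) (at p) \<and> (\<forall>c v. A (c *s v) = c * A v))"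

abbreviation deriv_at :: "('a::real_normed_vector \<Rightarrow> 'b::real_normed_vector) \<Rightarrow> 'a \<Rightarrow> 'a \<Rightarrow> 'b"
  where "deriv_at f p \<equiv> frechet_derivative f (at p)"

lemma deriv_at_eq: "(f has_derivative A) (at p) \<Longrightarrow> deriv_at f p = A"
  using frechet_derivative_at by metis

lemma chol_open: "chol f U \<Longrightarrow> open U"
  by (simp add: chol_def)

lemma chol_has_derivative: "chol f U \<Longrightarrow> p \<in> U \<Longrightarrow> (f has_derivative deriv_at f p) (at p)"
  unfolding chol_def using deriv_at_eq by metis

lemma chol_deriv_scale: "chol f U \<Longrightarrow> p \<in> U \<Longrightarrow> deriv_at f p (c *s v) = c * deriv_at f p v"
  unfolding chol_def using deriv_at_eq by metis

lemma cholI: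
  assumes "open U" "\<And>p. p \<in> U \<Longrightarrow> (f has_derivative A p) (at p)" "\<And>p c v. p \<in> U \<Longrightarrow> A p (c *s v) = c * A p v"
  shows "chol f U"
  unfolding chol_def using assms by blast

lemma chol_subset: "chol f U \<Longrightarrow> open V \<Longrightarrow> V \<subseteq> U \<Longrightarrow> chol f V"
  unfolding chol_def by blast

lemma chol_continuous_on: "chol f U \<Longrightarrow> continuous_on U f"
  using chol_has_derivative has_derivative_continuous
  by (metis continuous_at_imp_continuous_on)

lemma chol_cong:
  assumes "chol f U" "\<And>p. p \<in> U \<Longrightarrow> f p = g p" shows "chol g U"
  using assms has_derivative_transform_within_open[OF _ chol_open[OF assms(1)], of f _ _ UNIV g]
  unfolding chol_def by metis

lemma chol_const: "open U \<Longrightarrow> chol (\<lambda>p. c) U"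
  by (rule cholI[where A = "\<lambda>p v. 0"]) auto

lemma chol_nth: "open U \<Longrightarrow> chol (\<lambda>p. p $ i) U"
  by (rule cholI[where A = "\<lambda>p v. v $ i"]) (auto intro: bounded_linear_imp_has_derivative bounded_linear_vec_nth)

lemma chol_add: "chol f U \<Longrightarrow> chol g U \<Longrightarrow> chol (\<lambda>p. f p + g p) U"
  by (rule cholI[where A = "\<lambda>p v. deriv_at f p v + deriv_at g p v"])
    (auto intro: chol_open has_derivative_add chol_has_derivative simp: chol_deriv_scale distrib_left)

lemma chol_mult: "chol f U \<Longrightarrow> chol g U \<Longrightarrow> chol (\<lambda>p. f p * g p) U"
proof (rule cholI[where A = "\<lambda>p v. f p * deriv_at g p v + deriv_at f p v * g p"])
  assume fg: "chol f U" "chol g U"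
  show "open U" using fg(1) by (rule chol_open)
  fix p assume p: "p \<in> U"
  show "((\<lambda>p. f p * g p) has_derivative (\<lambda>v. f p * deriv_at g p v + deriv_at f p v * g p)) (at p)"
    by (rule has_derivative_mult[OF chol_has_derivative[OF fg(1) p] chol_has_derivative[OF fg(2) p]])
  show "f p * deriv_at g p (c *s v) + deriv_at f p (c *s v) * g p
      = c * (f p * deriv_at g p v + deriv_at f p v * g p)" for c v
    using p fg by (simp add: chol_deriv_scale algebra_simps)
qed

lemma chol_uminus: "chol f U \<Longrightarrow> chol (\<lambda>p. - f p) U"
  using chol_mult[OF chol_const[of U "-1"], of f] chol_open[of f U] by simp

lemma chol_diff: "chol f U \<Longrightarrow> chol g U \<Longrightarrow> chol (\<lambda>p. f p - g p) U"
  using chol_add[of f U "\<lambda>p. - g p"] chol_uminus[of g U] by simp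

lemma chol_sum: "open U \<Longrightarrow> (\<And>i. i \<in> I \<Longrightarrow> chol (f i) U) \<Longrightarrow> chol (\<lambda>p. \<Sum>i\<in>I. f i p) U"
  by (induction I rule: infinite_finite_induct) (auto intro: chol_const chol_add)

lemma chol_prod: "open U \<Longrightarrow> (\<And>i. i \<in> I \<Longrightarrow> chol (f i) U) \<Longrightarrow> chol (\<lambda>p. \<Prod>i\<in>I. f i p) U"
  by (induction I rule: infinite_finite_induct) (auto intro: chol_const chol_mult)

lemma chol_inverse:
  assumes f: "chol f U" and nz: "\<And>p. p \<in> U \<Longrightarrow> f p \<noteq> 0"
  shows "chol (\<lambda>p. inverse (f p)) U"
proof (rule cholI[where A = "\<lambda>p v. - (inverse (f p) * deriv_at f p v * inverse (f p))"])
  fix p assume p: "p \<in> U"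
  show "((\<lambda>p. inverse (f p)) has_derivative (\<lambda>v. - (inverse (f p) * deriv_at f p v * inverse (f p)))) (at p)"
    by (rule Deriv.has_derivative_inverse[OF nz[OF p] chol_has_derivative[OF f p]])
qed (use f in \<open>auto simp: chol_deriv_scale chol_open\<close>)

definition vhol :: "(complex ^ 'a \<Rightarrow> complex ^ 'b) \<Rightarrow> (complex ^ 'a) set \<Rightarrow> bool"
  where "vhol f U \<longleftrightarrow> (\<forall>i. chol (\<lambda>p. f p $ i) U)"

definition mhol :: "(complex ^ 'a \<Rightarrow> complex ^ 'b ^ 'c) \<Rightarrow> (complex ^ 'a) set \<Rightarrow> bool"
  where "mhol F U \<longleftrightarrow> (\<forall>i j. chol (\<lambda>p. F p $ i $ j) U)"

text \<open>The entries lie in an arbitrary normed space so that the rule can be applied twice to a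
  matrix, once to its rows and once to their entries.\<close>

lemma has_derivative_vec_iff:
  fixes f :: "'x::real_normed_vector \<Rightarrow> ('y::real_normed_vector) ^ 'b"
  shows "(f has_derivative A) (at p) \<longleftrightarrow> (\<forall>i. ((\<lambda>p. f p $ i) has_derivative (\<lambda>v. A v $ i)) (at p))"
proof
  assume "(f has_derivative A) (at p)"
  then show "\<forall>i. ((\<lambda>p. f p $ i) has_derivative (\<lambda>v. A v $ i)) (at p)"
    using bounded_linear.has_derivative[OF bounded_linear_vec_nth] by blast
next
  assume *: "\<forall>i. ((\<lambda>p. f p $ i) has_derivative (\<lambda>v. A v $ i)) (at p)"
  have bl: "bounded_linear A"
  proof -
    have "linear A"
    proof (rule linearI)
      have l: "linear (\<lambda>v. A v $ i)" for i using * has_derivative_linear by blast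
      show "A (x + y) = A x + A y" "A (c *\<^sub>R x) = c *\<^sub>R A x" for x y c
        unfolding vec_eq_iff using linear_add[OF l] linear_scale[OF l] by simp_all
    qed
    moreover have "\<exists>K. \<forall>v. norm (A v) \<le> norm v * K"
    proof -
      have "\<forall>i. \<exists>K. \<forall>v. norm (A v $ i) \<le> norm v * K"
        using * has_derivative_bounded_linear bounded_linear.bounded by blast
      then obtain K where K: "\<And>i v. norm (A v $ i) \<le> norm v * K i" by metis
      have "norm (A v) \<le> norm v * (\<Sum>i\<in>UNIV. K i)" for v
        by (rule order_trans[of _ "\<Sum>i\<in>UNIV. norm (A v $ i)"])
          (simp_all add: norm_vec_def L2_set_le_sum sum_distrib_left K sum_mono)
      then show ?thesis by blast
    qed
    ultimately show ?thesis by (simp add: bounded_linear_def bounded_linear_axioms_def linear_def)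
  qed
  show "(f has_derivative A) (at p)"
    unfolding has_derivative_at2
  proof (intro conjI bl vec_tendstoI)
    fix i
    show "((\<lambda>y. ((1 / norm (y - p)) *\<^sub>R (f y - (f p + A (y - p)))) $ i) \<longlongrightarrow> 0 $ i) (at p)"
      using * unfolding has_derivative_at2 by simp
  qed
qed

lemma deriv_at_nth:
  fixes f :: "'x::real_normed_vector \<Rightarrow> ('y::real_normed_vector) ^ 'b"
  assumes "(f has_derivative A) (at p)"
  shows "deriv_at (\<lambda>p. f p $ i) p v = A v $ i"
  using deriv_at_eq[OF bounded_linear.has_derivative[OF bounded_linear_vec_nth assms]] by simp

lemma vhol_open: "vhol f U \<Longrightarrow> open U"
  unfolding vhol_def using chol_open by blast

lemma mhol_open: "mhol f U \<Longrightarrow> open U"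
  unfolding mhol_def using chol_open by blast

lemma vhol_has_derivative: 
  assumes "vhol f U" "p \<in> U" shows "(f has_derivative deriv_at f p) (at p)"
proof -
  have "(f has_derivative (\<lambda>v. \<chi> i. deriv_at (\<lambda>p. f p $ i) p v)) (at p)"
    unfolding has_derivative_vec_iff using assms chol_has_derivative unfolding vhol_def by auto
  then show ?thesis using deriv_at_eq by metis
qed

lemma vhol_deriv_nth:
  assumes "vhol f U" "p \<in> U" shows "deriv_at f p v $ i = deriv_at (\<lambda>p. f p $ i) p v"
  by (rule deriv_at_nth[OF vhol_has_derivative[OF assms], symmetric])

lemma vhol_deriv_scale: "vhol f U \<Longrightarrow> p \<in> U \<Longrightarrow> deriv_at f p (c *s v) = c *s deriv_at f p v"
  unfolding vec_eq_iff vhol_deriv_nth vector_smult_component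
  using chol_deriv_scale unfolding vhol_def by (metis vhol_def vhol_deriv_nth vector_smult_component)

lemma mhol_has_derivative: 
  assumes "mhol f U" "p \<in> U" shows "(f has_derivative deriv_at f p) (at p)"
proof -
  have D: "(f has_derivative (\<lambda>v. \<chi> i j. deriv_at (\<lambda>p. f p $ i $ j) p v)) (at p)"
    unfolding has_derivative_vec_iff
  proof (intro allI, simp only: vec_lambda_beta)
    fix i j
    have "chol (\<lambda>p. f p $ i $ j) U" using assms(1) unfolding mhol_def by blast
    from chol_has_derivative[OF this assms(2)]
    show "((\<lambda>p. f p $ i $ j) has_derivative (\<lambda>v. deriv_at (\<lambda>p. f p $ i $ j) p v)) (at p)" .
  qed
  show ?thesis unfolding deriv_at_eq[OF D] by (rule D)
qed

lemma mhol_deriv_nth: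
  assumes "mhol f U" "p \<in> U" shows "deriv_at f p v $ i $ j = deriv_at (\<lambda>p. f p $ i $ j) p v"
  using deriv_at_nth[OF bounded_linear.has_derivative[OF bounded_linear_vec_nth mhol_has_derivative[OF assms]]]
  by simp

lemma vhol_iff_holo_on: "vhol f U \<longleftrightarrow> holo_on f U"
proof
  assume f: "vhol f U"
  have "Vector_Spaces.linear (*s) (*s) (deriv_at f p)" if "p \<in> U" for p
    using vhol_deriv_scale[OF f that] linear_add[OF has_derivative_linear[OF vhol_has_derivative[OF f that]]]
    by (simp add: Vector_Spaces.linear_iff vec.vector_space_axioms)
  then show "holo_on f U"
    unfolding holo_on_def using f vhol_open vhol_has_derivative by blast
next
  assume f: "holo_on f U"
  show "vhol f U"
    unfolding vhol_def chol_def
  proof (intro allI conjI ballI)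
    show "open U" using f unfolding holo_on_def by blast
    fix i p assume "p \<in> U"
    then obtain A where A: "(f has_derivative A) (at p)" "clinear A" using f unfolding holo_on_def by blast
    show "\<exists>A. ((\<lambda>p. f p $ i) has_derivative A) (at p) \<and> (\<forall>c v. A (c *s v) = c * A v)"
      using A unfolding has_derivative_vec_iff Vector_Spaces.linear_iff
      by (intro exI[of _ "\<lambda>v. A v $ i"]) auto
  qed
qed

lemma chol_compose:
  assumes f: "chol f V" and g: "vhol g U" and sub: "g ` U \<subseteq> V"
  shows "chol (\<lambda>p. f (g p)) U"
proof (rule cholI[where A = "\<lambda>p v. deriv_at f (g p) (deriv_at g p v)"])
  fix p assume p: "p \<in> U"
  then have gp: "g p \<in> V" using sub by blast
  show "((\<lambda>p. f (g p)) has_derivative (\<lambda>v. deriv_at f (g p) (deriv_at g p v))) (at p)"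
    using has_derivative_compose[OF vhol_has_derivative[OF g p] chol_has_derivative[OF f gp]] .
  show "deriv_at f (g p) (deriv_at g p (c *s v)) = c * deriv_at f (g p) (deriv_at g p v)" for c v
    by (simp add: vhol_deriv_scale[OF g p] chol_deriv_scale[OF f gp])
qed (use g vhol_open in blast)

section \<open>Cauchy's integral in one complex direction, and derivatives of derivatives\<close>

lemma norm_smult: "norm (c *s (v :: complex ^ 'n)) = norm c * norm v"
  by (simp add: norm_vec_def norm_mult L2_set_right_distrib)

lemma bounded_linear_smult_left: "bounded_linear (\<lambda>\<zeta>. \<zeta> *s (v :: complex ^ 'n))"
  by (rule bounded_linear_intro[of _ "norm v"])
    (auto simp: vec_eq_iff norm_smult algebra_simps)

text \<open>Cauchy's formula for the derivative at 0 of the restriction to the complex line through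
  \<open>q\<close> in direction \<open>v\<close>. The radius and the neighbourhood serve all
  \<open>q\<close> near \<open>p\<close> and all functions holomorphic on \<open>U\<close>, so that
  the integral can be differentiated in \<open>q\<close> and applied to derivatives of
  \<open>f\<close>.\<close>

lemma chol_cauchy:
  assumes f: "chol f U" and p: "p \<in> U"
  obtains R d where "R > 0" "d > 0" "ball p d \<subseteq> U"
    "\<And>q t. q \<in> ball p d \<Longrightarrow> q + circlepath 0 R t *s v \<in> U"
    "\<And>h q. chol h U \<Longrightarrow> q \<in> ball p d \<Longrightarrow>
      deriv_at h q v = integral {0..1} (\<lambda>t. h (q + circlepath 0 R t *s v) / circlepath 0 R t)"
proof -
  obtain r where r: "r > 0" "ball p r \<subseteq> U" using chol_open[OF f] p open_contains_ball by blast
  \<comment> \<open>Chosen so that \<open>R * norm v \<le> r / 2\<close>, half of the available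
    radius; the summand 1 covers \<open>v = 0\<close>.\<close>
  define R where "R = r / 2 / (norm v + 1)"
  define d where "d = r / 2"
  have n1: "norm v + 1 > 0" by (simp add: add_nonneg_pos)
  have R: "R > 0" using r n1 by (simp add: R_def)
  have Rv: "R * norm v \<le> r / 2"
  proof -
    have "R * norm v \<le> R * (norm v + 1)" using R by simp
    also have "\<dots> = r / 2"
      using n1 R_def nonzero_eq_divide_eq[of "norm v + 1" R "r / 2"] by simp
    finally show ?thesis .
  qed
  have inU: "q + \<zeta> *s v \<in> U" if q: "q \<in> ball p d" and z: "norm \<zeta> \<le> R" for q \<zeta>
  proof -
    have "norm (\<zeta> *s v) \<le> R * norm v"
      using z by (simp add: norm_smult mult_right_mono)
    then have "dist p (q + \<zeta> *s v) < r"
      using q Rv norm_triangle_ineq4[of "p - q" "\<zeta> *s v"] by (simp add: dist_norm d_def algebra_simps)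
    then show ?thesis using r(2) by auto
  qed
  have circ: "norm (circlepath 0 R t) = R" "circlepath 0 R t \<noteq> 0" for t
    using R by (auto simp: circlepath norm_mult)
  show ?thesis
  proof (rule that[of R d])
    show "ball p d \<subseteq> U" using r by (auto simp: d_def)
    show "q + circlepath 0 R t *s v \<in> U" if "q \<in> ball p d" for q t
      using inU[OF that, of "circlepath 0 R t"] circ by simp
    fix h q assume h: "chol h U" and q: "q \<in> ball p d"
    let ?F = "\<lambda>\<zeta>. h (q + \<zeta> *s v)"
    have dF: "(?F has_field_derivative deriv_at h (q + \<zeta> *s v) v) (at \<zeta>)" if "norm \<zeta> \<le> R" for \<zeta>
    proof -
      have "((\<lambda>\<zeta>. q + \<zeta> *s v) has_derivative (\<lambda>\<zeta>. \<zeta> *s v)) (at \<zeta>)"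
        using bounded_linear_imp_has_derivative[OF bounded_linear_smult_left] by (auto intro!: derivative_eq_intros)
      from has_derivative_compose[OF this chol_has_derivative[OF h inU[OF q that]]]
      show ?thesis
        unfolding has_field_derivative_def chol_deriv_scale[OF h inU[OF q that]]
        by (rule has_derivative_eq_rhs) (simp add: fun_eq_iff mult.commute)
    qed
    have "?F holomorphic_on ball 0 R"
    proof (rule holomorphic_onI)
      fix \<zeta> :: complex assume "\<zeta> \<in> ball 0 R"
      then have "norm \<zeta> \<le> R" by simp
      from has_field_derivative_at_within[OF dF[OF this]]
      show "?F field_differentiable (at \<zeta> within ball 0 R)" unfolding field_differentiable_def by blast
    qed
    moreover have "continuous_on (cball 0 R) ?F"
    proof (rule continuous_at_imp_continuous_on, rule ballI)
      fix \<zeta> :: complex assume "\<zeta> \<in> cball 0 R"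
      then show "isCont ?F \<zeta>" using DERIV_isCont[OF dF] by simp
    qed
    ultimately have "(?F has_field_derivative 1 / (2 * of_real pi * \<i>) *
        contour_integral (circlepath 0 R) (\<lambda>u. ?F u / (u - 0)\<^sup>2)) (at 0)"
      using R by (intro Cauchy_derivative_integral_circlepath(2)) auto
    moreover have "(?F has_field_derivative deriv_at h q v) (at 0)" using dF[of 0] R by simp
    ultimately have "deriv_at h q v = 1 / (2 * of_real pi * \<i>) *
        contour_integral (circlepath 0 R) (\<lambda>u. ?F u / u\<^sup>2)"
      using DERIV_unique by fastforce
    also have "\<dots> = 1 / (2 * of_real pi * \<i>) * integral {0..1} (\<lambda>t. (2 * of_real pi * \<i>) *
        (?F (circlepath 0 R t) / circlepath 0 R t))"
    proof -
      \<comment> \<open>The velocity of the circle is \<open>2 * pi * \<i>\<close> times its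
        position, which lowers the square in the denominator and cancels the prefactor.\<close>
      have "?F (circlepath 0 R t) / (circlepath 0 R t)\<^sup>2 * vector_derivative (circlepath 0 R) (at t)
          = (2 * of_real pi * \<i>) * (?F (circlepath 0 R t) / circlepath 0 R t)" for t
      proof -
        have "vector_derivative (circlepath 0 R) (at t) = (2 * of_real pi * \<i>) * circlepath 0 R t"
          unfolding vector_derivative_circlepath by (simp add: circlepath)
        then show ?thesis using circ(2)[of t] by (simp add: power2_eq_square field_simps)
      qed
      then show ?thesis unfolding contour_integral_integral by simp
    qed
    also have "\<dots> = integral {0..1} (\<lambda>t. ?F (circlepath 0 R t) / circlepath 0 R t)"
      unfolding integral_mult_right by simp
    finally show "deriv_at h q v = integral {0..1} (\<lambda>t. ?F (circlepath 0 R t) / circlepath 0 R t)" .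
  qed (use R r in \<open>auto simp: d_def\<close>)
qed

lemma continuous_on_circle_param:
  assumes h: "continuous_on U h" and sub: "\<And>q t. q \<in> B \<Longrightarrow> q + circlepath 0 R t *s v \<in> U" and R: "R > 0"
  shows "continuous_on (B \<times> S) (\<lambda>(q, t). h (q + circlepath 0 R t *s v) / circlepath 0 R t :: complex)"
proof -
  have circ: "circlepath 0 R t \<noteq> 0" for t using R by (auto simp: circlepath)
  have cc: "continuous_on (B \<times> S) (\<lambda>z. circlepath 0 R (snd z))"
    unfolding circlepath by (intro continuous_intros)
  have sm: "continuous_on (B \<times> S) (\<lambda>z. fst z + circlepath 0 R (snd z) *s v)"
    by (intro continuous_intros bounded_linear.continuous_on[OF bounded_linear_smult_left cc])
  have "continuous_on (B \<times> S) (\<lambda>z. h (fst z + circlepath 0 R (snd z) *s v))"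
    by (rule continuous_on_compose2[OF h sm]) (use sub in auto)
  then show ?thesis
    unfolding case_prod_unfold by (intro continuous_intros cc) (auto simp: circ)
qed

lemma chol_deriv_continuous:
  assumes f: "chol f U" shows "continuous_on U (\<lambda>q. deriv_at f q w)"
proof -
  have "continuous (at p) (\<lambda>q. deriv_at f q w)" if p: "p \<in> U" for p
  proof -
    obtain R d where Rd: "R > 0" "d > 0" "ball p d \<subseteq> U"
      "\<And>q t. q \<in> ball p d \<Longrightarrow> q + circlepath 0 R t *s w \<in> U"
      "\<And>h q. chol h U \<Longrightarrow> q \<in> ball p d \<Longrightarrow>
        deriv_at h q w = integral {0..1} (\<lambda>t. h (q + circlepath 0 R t *s w) / circlepath 0 R t)"
      by (rule chol_cauchy[OF f p, where v = w]) (rule that)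
    have "continuous_on (ball p d) (\<lambda>q. integral (cbox 0 1) (\<lambda>t. f (q + circlepath 0 R t *s w) / circlepath 0 R t))"
      by (rule integral_continuous_on_param[OF continuous_on_circle_param[OF chol_continuous_on[OF f] Rd(4,1)]])
    then have "continuous_on (ball p d) (\<lambda>q. deriv_at f q w)"
      by (rule continuous_on_eq) (simp add: Rd(5)[OF f])
    then show ?thesis using Rd(2) by (simp add: continuous_on_eq_continuous_at)
  qed
  then show ?thesis by (simp add: continuous_at_imp_continuous_on)
qed

text \<open>Differentiation under the integral sign. Continuity of the first derivatives, a
  consequence of the same integral formula, provides the hypothesis of Leibniz' rule.\<close>

lemma chol_deriv_formula:
  assumes f: "chol f U" and p: "p \<in> U"
    and Rd: "R > 0" "d > 0" "ball p d \<subseteq> U" "\<And>q t. q \<in> ball p d \<Longrightarrow> q + circlepath 0 R t *s v \<in> U"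
    and int: "\<And>q. q \<in> ball p d \<Longrightarrow>
        deriv_at f q v = integral {0..1} (\<lambda>t. f (q + circlepath 0 R t *s v) / circlepath 0 R t)"
  shows "((\<lambda>q. deriv_at f q v) has_derivative
      (\<lambda>w. integral {0..1} (\<lambda>t. deriv_at f (p + circlepath 0 R t *s v) w / circlepath 0 R t))) (at p)"
proof -
  let ?g = "circlepath 0 R" and ?B = "ball p d"
  have pB: "p \<in> ?B" using Rd(2) by simp
  have g0: "?g t \<noteq> 0" for t using Rd(1) by (auto simp: circlepath)
  \<comment> \<open>Leibniz' rule asks for the partial derivatives as bounded operators that are
    jointly continuous; evaluation at \<open>w\<close> returns the stated formula at the
    end.\<close>
  define fx where "fx q t = Blinfun (\<lambda>w. deriv_at f (q + ?g t *s v) w / ?g t)" for q t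
  have bl: "bounded_linear (\<lambda>w. deriv_at f (q + ?g t *s v) w / ?g t)" if "q \<in> ?B" for q t
    using has_derivative_bounded_linear[OF chol_has_derivative[OF f Rd(4)[OF that]]]
    by (intro bounded_linear_compose[OF bounded_linear_divide])
  have fx: "blinfun_apply (fx q t) = (\<lambda>w. deriv_at f (q + ?g t *s v) w / ?g t)" if "q \<in> ?B" for q t
    unfolding fx_def by (rule bounded_linear_Blinfun_apply[OF bl[OF that]])
  have cfx: "continuous_on (?B \<times> cbox 0 1) (\<lambda>(q, t). fx q t)"
  proof (rule continuous_on_blinfun_componentwise)
    fix i :: "complex ^ 'a"
    have "continuous_on (?B \<times> cbox 0 1) (\<lambda>(q, t). deriv_at f (q + ?g t *s v) i / ?g t)"
      by (rule continuous_on_circle_param[OF chol_deriv_continuous[OF f] Rd(4,1)])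
    then show "continuous_on (?B \<times> cbox 0 1) (\<lambda>x. blinfun_apply (case x of (q, t) \<Rightarrow> fx q t) i)"
      by (rule continuous_on_eq) (auto simp: fx)
  qed
  have cf: "continuous_on (?B \<times> cbox 0 1) (\<lambda>(q, t). f (q + ?g t *s v) / ?g t)"
    by (rule continuous_on_circle_param[OF chol_continuous_on[OF f] Rd(4,1)])
  have sec: "continuous_on (cbox 0 1) (\<lambda>t. F q t)"
    if "continuous_on (?B \<times> cbox 0 1) (\<lambda>(q, t). F q t)" "q \<in> ?B" for F :: "_ \<Rightarrow> real \<Rightarrow> 'z::real_normed_vector" and q
  proof -
    have c: "continuous_on (cbox 0 1) (\<lambda>t::real. (q, t))" by (intro continuous_intros)
    have "(\<lambda>t. (q, t)) ` cbox 0 1 \<subseteq> ?B \<times> cbox 0 1" using that(2) by blast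
    from continuous_on_compose2[OF that(1) c this] show ?thesis by simp
  qed
  have "((\<lambda>q. integral (cbox 0 1) (\<lambda>t. f (q + ?g t *s v) / ?g t)) has_derivative
      integral (cbox 0 1) (fx p)) (at p within ?B)"
  proof (rule leibniz_rule[OF _ _ cfx pB convex_ball])
    fix q and t :: real assume q: "q \<in> ?B"
    have d: "((\<lambda>q. q + ?g t *s v) has_derivative (\<lambda>w. w)) (at q within ?B)"
      by (auto intro!: derivative_eq_intros)
    have "((\<lambda>q. f (q + ?g t *s v)) has_derivative deriv_at f (q + ?g t *s v)) (at q within ?B)"
      using has_derivative_compose[OF d chol_has_derivative[OF f Rd(4)[OF q]]] by simp
    then show "((\<lambda>q. f (q + ?g t *s v) / ?g t) has_derivative blinfun_apply (fx q t)) (at q within ?B)"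
      unfolding fx[OF q] by (intro bounded_linear.has_derivative[OF bounded_linear_divide])
  next
    fix q assume "q \<in> ?B"
    then show "(\<lambda>t. f (q + ?g t *s v) / ?g t) integrable_on cbox 0 1"
      using sec[OF cf] by (intro integrable_continuous) auto
  qed
  then have 1: "((\<lambda>q. integral (cbox 0 1) (\<lambda>t. f (q + ?g t *s v) / ?g t)) has_derivative
      integral (cbox 0 1) (fx p)) (at p)"
    using at_within_open[OF pB open_ball] by metis
  have "blinfun_apply (integral (cbox 0 1) (fx p)) w
      = integral {0..1} (\<lambda>t. deriv_at f (p + ?g t *s v) w / ?g t)" for w
  proof -
    have "fx p integrable_on cbox 0 1" using sec[OF cfx pB] by (rule integrable_continuous)
    from integral_linear[OF this blinfun.bounded_linear_left[of w]]
    show ?thesis by (simp add: o_def fx[OF pB])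
  qed
  then have "((\<lambda>q. integral (cbox 0 1) (\<lambda>t. f (q + ?g t *s v) / ?g t)) has_derivative
      (\<lambda>w. integral {0..1} (\<lambda>t. deriv_at f (p + ?g t *s v) w / ?g t))) (at p)"
    using 1 by presburger
  then show ?thesis
    by (rule has_derivative_transform_within_open[OF _ open_ball pB]) (simp add: int)
qed

lemma chol_deriv:
  assumes f: "chol f U" shows "chol (\<lambda>q. deriv_at f q v) U"
  unfolding chol_def
proof (intro conjI ballI)
  show "open U" by (rule chol_open[OF f])
  fix p assume p: "p \<in> U"
  obtain R d where Rd: "R > 0" "d > 0" "ball p d \<subseteq> U"
    "\<And>q t. q \<in> ball p d \<Longrightarrow> q + circlepath 0 R t *s v \<in> U"
    "\<And>h q. chol h U \<Longrightarrow> q \<in> ball p d \<Longrightarrow>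
      deriv_at h q v = integral {0..1} (\<lambda>t. h (q + circlepath 0 R t *s v) / circlepath 0 R t)"
    by (rule chol_cauchy[OF f p, where v = v]) (rule that)
  have pB: "p \<in> ball p d" using Rd(2) by simp
  note D = chol_deriv_formula[OF f p Rd(1-4) Rd(5)[OF f]]
  show "\<exists>A. ((\<lambda>q. deriv_at f q v) has_derivative A) (at p) \<and> (\<forall>c v. A (c *s v) = c * A v)"
  proof (intro exI conjI allI, rule D)
    fix c w
    have "deriv_at f (p + circlepath 0 R t *s v) (c *s w) / circlepath 0 R t
        = c * (deriv_at f (p + circlepath 0 R t *s v) w / circlepath 0 R t)" for t
      by (simp add: chol_deriv_scale[OF f Rd(4)[OF pB]])
    then show "integral {0..1} (\<lambda>t. deriv_at f (p + circlepath 0 R t *s v) (c *s w) / circlepath 0 R t)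
      = c * integral {0..1} (\<lambda>t. deriv_at f (p + circlepath 0 R t *s v) w / circlepath 0 R t)"
      by (simp only: integral_mult_right)
  qed
qed

text \<open>Both sides are one integral: differentiating Cauchy's integral for direction
  \<open>v\<close> along \<open>w\<close> gives Cauchy's integral for direction \<open>v\<close> of
  the holomorphic function \<open>deriv_at f q w\<close>.\<close>

lemma chol_deriv_symmetric:
  assumes f: "chol f U" and p: "p \<in> U"
  shows "deriv_at (\<lambda>q. deriv_at f q v) p w = deriv_at (\<lambda>q. deriv_at f q w) p v"
proof -
  obtain R d where Rd: "R > 0" "d > 0" "ball p d \<subseteq> U"
    "\<And>q t. q \<in> ball p d \<Longrightarrow> q + circlepath 0 R t *s v \<in> U"
    "\<And>h q. chol h U \<Longrightarrow> q \<in> ball p d \<Longrightarrow>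
      deriv_at h q v = integral {0..1} (\<lambda>t. h (q + circlepath 0 R t *s v) / circlepath 0 R t)"
    by (rule chol_cauchy[OF f p, where v = v]) (rule that)
  have pB: "p \<in> ball p d" using Rd(2) by simp
  note D = chol_deriv_formula[OF f p Rd(1-4) Rd(5)[OF f]]
  have "deriv_at (\<lambda>q. deriv_at f q v) p w
      = integral {0..1} (\<lambda>t. deriv_at f (p + circlepath 0 R t *s v) w / circlepath 0 R t)"
    by (simp only: deriv_at_eq[OF D])
  also have "\<dots> = deriv_at (\<lambda>q. deriv_at f q w) p v"
    by (rule Rd(5)[OF chol_deriv[OF f] pB, symmetric])
  finally show ?thesis .
qed

lemma vhol_deriv: "vhol f U \<Longrightarrow> vhol (\<lambda>q. deriv_at f q v) U"
  unfolding vhol_def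
proof
  fix i assume f: "\<forall>i. chol (\<lambda>p. f p $ i) U"
  show "chol (\<lambda>q. deriv_at f q v $ i) U"
    by (rule chol_cong[OF chol_deriv[of "\<lambda>p. f p $ i" U v]])
      (use f vhol_deriv_nth[of f U] in \<open>auto simp: vhol_def\<close>)
qed

lemma vhol_deriv_symmetric:
  assumes f: "vhol f U" and p: "p \<in> U"
  shows "deriv_at (\<lambda>q. deriv_at f q v) p w = deriv_at (\<lambda>q. deriv_at f q w) p v"
proof -
  have nth: "deriv_at (\<lambda>q. deriv_at f q v) p w $ i = deriv_at (\<lambda>q. deriv_at (\<lambda>p. f p $ i) q v) p w" for i v w
  proof -
    have "((\<lambda>q. deriv_at (\<lambda>p. f p $ i) q v) has_derivative (\<lambda>w. deriv_at (\<lambda>q. deriv_at f q v) p w $ i)) (at p)"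
    proof (rule has_derivative_transform_within_open[OF _ vhol_open[OF f] p])
      show "((\<lambda>q. deriv_at f q v $ i) has_derivative (\<lambda>w. deriv_at (\<lambda>q. deriv_at f q v) p w $ i)) (at p)"
        by (rule bounded_linear.has_derivative[OF bounded_linear_vec_nth vhol_has_derivative[OF vhol_deriv[OF f] p]])
    qed (simp add: vhol_deriv_nth[OF f])
    from deriv_at_eq[OF this] show ?thesis by simp
  qed
  have "chol (\<lambda>p. f p $ i) U" for i using f unfolding vhol_def by blast
  then show ?thesis unfolding vec_eq_iff nth using chol_deriv_symmetric[OF _ p] by blast
qed

lemma mhol_deriv: "mhol f U \<Longrightarrow> mhol (\<lambda>q. deriv_at f q v) U"
  unfolding mhol_def
proof (intro allI)
  fix i j assume f: "\<forall>i j. chol (\<lambda>p. f p $ i $ j) U"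
  show "chol (\<lambda>q. deriv_at f q v $ i $ j) U"
    by (rule chol_cong[OF chol_deriv[of "\<lambda>p. f p $ i $ j" U v]])
      (use f mhol_deriv_nth[of f U] in \<open>auto simp: mhol_def\<close>)
qed

lemma mhol_deriv_symmetric:
  assumes f: "mhol f U" and p: "p \<in> U"
  shows "deriv_at (\<lambda>q. deriv_at f q v) p w = deriv_at (\<lambda>q. deriv_at f q w) p v"
proof -
  have row: "vhol (\<lambda>p. f p $ i) U" for i using f unfolding vhol_def mhol_def by blast
  have nth: "deriv_at (\<lambda>q. deriv_at f q v) p w $ i = deriv_at (\<lambda>q. deriv_at (\<lambda>p. f p $ i) q v) p w" for i v w
  proof -
    have d1: "deriv_at f q v $ i = deriv_at (\<lambda>p. f p $ i) q v" if "q \<in> U" for q v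
      by (rule deriv_at_nth[OF mhol_has_derivative[OF f that], symmetric])
    have "((\<lambda>q. deriv_at (\<lambda>p. f p $ i) q v) has_derivative (\<lambda>w. deriv_at (\<lambda>q. deriv_at f q v) p w $ i)) (at p)"
    proof (rule has_derivative_transform_within_open[OF _ mhol_open[OF f] p])
      show "((\<lambda>q. deriv_at f q v $ i) has_derivative (\<lambda>w. deriv_at (\<lambda>q. deriv_at f q v) p w $ i)) (at p)"
        by (rule bounded_linear.has_derivative[OF bounded_linear_vec_nth mhol_has_derivative[OF mhol_deriv[OF f] p]])
    qed (simp add: d1)
    from deriv_at_eq[OF this] show ?thesis by simp
  qed
  show ?thesis unfolding vec_eq_iff nth using vhol_deriv_symmetric[OF row p] by simp
qed

lemma mhol_const: "open U \<Longrightarrow> mhol (\<lambda>p. A) U"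
  by (simp add: mhol_def chol_const)

lemma vhol_const: "open U \<Longrightarrow> vhol (\<lambda>p. a) U"
  by (simp add: vhol_def chol_const)

lemma vhol_id: "open U \<Longrightarrow> vhol (\<lambda>p. p) U"
  by (simp add: vhol_def chol_nth)

lemma mhol_add: "mhol F U \<Longrightarrow> mhol G U \<Longrightarrow> mhol (\<lambda>p. F p + G p) U"
  by (simp add: mhol_def chol_add)

lemma vhol_add: "vhol F U \<Longrightarrow> vhol G U \<Longrightarrow> vhol (\<lambda>p. F p + G p) U"
  by (simp add: vhol_def chol_add)

lemma vhol_diff: "vhol F U \<Longrightarrow> vhol G U \<Longrightarrow> vhol (\<lambda>p. F p - G p) U"
  by (simp add: vhol_def chol_diff)

lemma vhol_smult: "chol c U \<Longrightarrow> vhol F U \<Longrightarrow> vhol (\<lambda>p. c p *s F p) U"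
  by (simp add: vhol_def chol_mult)

lemma vhol_sum: "open U \<Longrightarrow> (\<And>i. i \<in> I \<Longrightarrow> vhol (f i) U) \<Longrightarrow> vhol (\<lambda>p. \<Sum>i\<in>I. f i p) U"
  by (simp add: vhol_def chol_sum)

lemma vhol_subset: "vhol f U \<Longrightarrow> open V \<Longrightarrow> V \<subseteq> U \<Longrightarrow> vhol f V"
  unfolding vhol_def using chol_subset by blast

lemma mhol_subset: "mhol f U \<Longrightarrow> open V \<Longrightarrow> V \<subseteq> U \<Longrightarrow> mhol f V"
  unfolding mhol_def using chol_subset by blast

lemma mhol_mult: "mhol F U \<Longrightarrow> mhol G U \<Longrightarrow> mhol (\<lambda>p. F p ** G p) U"
  unfolding mhol_def matrix_matrix_mult_def
  by (auto intro!: chol_sum chol_mult dest: chol_open)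

lemma vhol_matrix_vector: "mhol F U \<Longrightarrow> vhol f U \<Longrightarrow> vhol (\<lambda>p. F p *v f p) U"
  unfolding mhol_def vhol_def matrix_vector_mult_def
  by (auto intro!: chol_sum chol_mult dest: chol_open)

lemma vhol_compose: "vhol f V \<Longrightarrow> vhol g U \<Longrightarrow> g ` U \<subseteq> V \<Longrightarrow> vhol (\<lambda>p. f (g p)) U"
  unfolding vhol_def using chol_compose[unfolded vhol_def] by blast

lemma mhol_compose: "mhol f V \<Longrightarrow> vhol g U \<Longrightarrow> g ` U \<subseteq> V \<Longrightarrow> mhol (\<lambda>p. f (g p)) U"
  unfolding mhol_def using chol_compose by blast

lemma vhol_cong: "vhol f U \<Longrightarrow> (\<And>p. p \<in> U \<Longrightarrow> f p = g p) \<Longrightarrow> vhol g U"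
proof -
  assume f: "vhol f U" and eq: "\<And>p. p \<in> U \<Longrightarrow> f p = g p"
  have "chol (\<lambda>p. g p $ i) U" for i
    by (rule chol_cong[of "\<lambda>p. f p $ i"]) (use f eq in \<open>auto simp: vhol_def\<close>)
  then show ?thesis unfolding vhol_def by blast
qed

lemma chol_det:
  fixes F :: "complex ^ 'a \<Rightarrow> complex ^ 'b ^ 'b"
  assumes F: "mhol F U" shows "chol (\<lambda>p. det (F p)) U"
proof -
  have oU: "open U" by (rule mhol_open[OF F])
  have entry: "chol (\<lambda>p. F p $ i $ j) U" for i j using F unfolding mhol_def by blast
  show ?thesis
    unfolding det_def by (rule chol_sum[OF oU], rule chol_mult[OF chol_const[OF oU] chol_prod[OF oU]], rule entry)
qed

text \<open>By Cramer's rule the entries of the inverse are quotients of determinants of holomorphic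
  matrices.\<close>

lemma mhol_inverse:
  fixes F H :: "complex ^ 'a \<Rightarrow> complex ^ 'b ^ 'b"
  assumes F: "mhol F U" and FH: "\<And>p. p \<in> U \<Longrightarrow> F p ** H p = mat 1"
  shows "mhol H U"
  unfolding mhol_def
proof (intro allI)
  fix k j
  have oU: "open U" by (rule mhol_open[OF F])
  have nz: "det (F p) \<noteq> 0" if "p \<in> U" for p
    using FH[OF that] invertible_det_nz[of "F p"] invertible_right_inverse by blast
  let ?N = "\<lambda>p. \<chi> i l. if l = k then (axis j 1 :: complex ^ 'b) $ i else F p $ i $ l"
  have "mhol ?N U"
    unfolding mhol_def
  proof (intro allI)
    fix i l show "chol (\<lambda>p. ?N p $ i $ l) U"
      using F oU by (cases "l = k") (auto simp: mhol_def chol_const)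
  qed
  then have "chol (\<lambda>p. det (?N p) * inverse (det (F p))) U"
    by (intro chol_mult chol_inverse chol_det F nz)
  moreover have "det (?N p) * inverse (det (F p)) = H p $ k $ j" if p: "p \<in> U" for p
  proof -
    have "F p *v (H p *v axis j 1) = axis j 1" by (simp add: matrix_vector_mul_assoc FH[OF p])
    then have "H p *v axis j 1 = (\<chi> k. det (\<chi> i l. if l = k then axis j 1 $ i else F p $ i $ l) / det (F p))"
      using cramer[OF nz[OF p]] by blast
    then have "(H p *v axis j 1) $ k = det (?N p) / det (F p)" by simp
    moreover have "(H p *v axis j 1) $ k = H p $ k $ j"
      by (simp add: matrix_vector_mult_def axis_def if_distrib[of "\<lambda>x. _ * x"] cong: if_cong)
    ultimately show ?thesis by (simp add: divide_inverse)
  qed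
  ultimately show "chol (\<lambda>p. H p $ k $ j) U" by (rule chol_cong)
qed

lemma mhol_local_inverse:
  fixes F :: "complex ^ 'a \<Rightarrow> complex ^ 'b ^ 'b"
  assumes F: "mhol F U" and p: "p \<in> U" and inv: "F p = mat 1"
  obtains V H where "open V" "p \<in> V" "V \<subseteq> U" "mhol H V"
    "\<And>q. q \<in> V \<Longrightarrow> F q ** H q = mat 1" "\<And>q. q \<in> V \<Longrightarrow> H q ** F q = mat 1"
proof -
  define V where "V = {q \<in> U. det (F q) \<noteq> 0}"
  have "continuous_on U (\<lambda>q. det (F q))" by (rule chol_continuous_on[OF chol_det[OF F]])
  then have "open (U \<inter> (\<lambda>q. det (F q)) -` (- {0}))"
    using mhol_open[OF F] by (intro continuous_open_preimage) auto
  moreover have "U \<inter> (\<lambda>q. det (F q)) -` (- {0}) = V" unfolding V_def by blast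
  ultimately have V: "open V" "V \<subseteq> U" "p \<in> V" using p inv by (auto simp: V_def)
  have "\<exists>H. F q ** H = mat 1 \<and> H ** F q = mat 1" if "q \<in> V" for q
    using that unfolding V_def invertible_det_nz[symmetric] invertible_def by blast
  then obtain H where H: "\<And>q. q \<in> V \<Longrightarrow> F q ** H q = mat 1" "\<And>q. q \<in> V \<Longrightarrow> H q ** F q = mat 1"
    by metis
  have "mhol H V" by (rule mhol_inverse[OF mhol_subset[OF F V(1,2)] H(1)])
  then show ?thesis using that V H by blast
qed

section \<open>Identity theorems on complex lines and from real points\<close>

lemma chol_line:
  assumes f: "chol f U"
  shows "(\<lambda>\<zeta>. f (p + \<zeta> *s v)) holomorphic_on {\<zeta>. p + \<zeta> *s v \<in> U}"
proof (rule holomorphic_onI)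
  fix \<zeta> assume "\<zeta> \<in> {\<zeta>. p + \<zeta> *s v \<in> U}"
  then have U: "p + \<zeta> *s v \<in> U" by simp
  have "((\<lambda>\<zeta>. p + \<zeta> *s v) has_derivative (\<lambda>\<zeta>. \<zeta> *s v)) (at \<zeta>)"
    using bounded_linear_imp_has_derivative[OF bounded_linear_smult_left] by (auto intro!: derivative_eq_intros)
  from has_derivative_compose[OF this chol_has_derivative[OF f U]]
  have "((\<lambda>\<zeta>. f (p + \<zeta> *s v)) has_field_derivative deriv_at f (p + \<zeta> *s v) v) (at \<zeta>)"
    unfolding has_field_derivative_def chol_deriv_scale[OF f U]
    by (rule has_derivative_eq_rhs) (simp add: fun_eq_iff mult.commute)
  then show "(\<lambda>\<zeta>. f (p + \<zeta> *s v)) field_differentiable (at \<zeta> within {\<zeta>. p + \<zeta> *s v \<in> U})"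
    using has_field_derivative_at_within unfolding field_differentiable_def by blast
qed

lemma open_line: "open U \<Longrightarrow> open {\<zeta>. p + \<zeta> *s v \<in> (U :: (complex ^ 'n) set)}"
proof -
  assume U: "open U"
  have "continuous_on UNIV (\<lambda>\<zeta>. p + \<zeta> *s v)"
    by (intro continuous_intros bounded_linear.continuous_on[OF bounded_linear_smult_left])
  from open_vimage[OF U this] show ?thesis by (simp add: vimage_def)
qed

lemma connected_line:
  assumes U: "convex U" shows "connected {\<zeta>. p + \<zeta> *s v \<in> (U :: (complex ^ 'n) set)}"
proof (rule convex_connected, rule convexI)
  fix x y :: complex and a b :: real
  assume xy: "x \<in> {\<zeta>. p + \<zeta> *s v \<in> U}" "y \<in> {\<zeta>. p + \<zeta> *s v \<in> U}" "0 \<le> a" "0 \<le> b" "a + b = 1"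
  then have "a *\<^sub>R (p + x *s v) + b *\<^sub>R (p + y *s v) \<in> U" using U by (simp add: convexD)
  moreover have "a *\<^sub>R (p + x *s v) + b *\<^sub>R (p + y *s v) = p + (a *\<^sub>R x + b *\<^sub>R y) *s v"
  proof -
    have "b = 1 - a" using xy(5) by simp
    then show ?thesis by (simp add: vec_eq_iff) (simp add: scaleR_conv_of_real algebra_simps)
  qed
  ultimately show "a *\<^sub>R x + b *\<^sub>R y \<in> {\<zeta>. p + \<zeta> *s v \<in> U}" by simp
qed

text \<open>Restriction to the complex line through \<open>a\<close> and \<open>z\<close> reduces
  the claim to one variable; convexity of \<open>B\<close> makes the parameter set
  connected.\<close>

lemma chol_zero_open:
  assumes f: "chol f B" and B: "convex B" and O: "open O'" "O' \<subseteq> B" "a \<in> O'" "\<And>q. q \<in> O' \<Longrightarrow> f q = 0"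
    and z: "z \<in> B"
  shows "f z = 0"
proof -
  let ?S = "{\<zeta>. a + \<zeta> *s (z - a) \<in> B}" and ?T = "{\<zeta>. a + \<zeta> *s (z - a) \<in> O'}"
  have T: "open ?T" by (rule open_line[OF O(1)])
  have T0: "0 \<in> ?T" using O(3) by simp
  have "(\<lambda>\<zeta>. f (a + \<zeta> *s (z - a))) 1 = 0"
  proof (rule analytic_continuation[OF chol_line[OF f] open_line[OF chol_open[OF f]] connected_line[OF B]])
    show "?T \<subseteq> ?S" using O(2) by auto
    show "0 islimpt ?T" using T T0 by (metis interior_limit_point interior_open)
    show "f (a + \<zeta> *s (z - a)) = 0" if "\<zeta> \<in> ?T" for \<zeta> using that O(4) by simp
  qed (use z O in auto)
  then show ?thesis by simp
qed

lemma cvec_split: "z = cvec (Rev z) + \<i> *s cvec (Imv z)"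
  by (simp add: vec_eq_iff cvec_def Rev_def Imv_def complex_eq)

text \<open>On the complex line through the real point \<open>cvec (Rev z)\<close> in the real
  direction \<open>cvec (Imv z)\<close> the function vanishes for real parameters, and
  \<open>z\<close> itself has the parameter \<open>\<i>\<close>.\<close>

lemma chol_zero_real:
  assumes f: "chol f (ball (cvec x) R)" and zero: "\<And>y. cvec y \<in> ball (cvec x) R \<Longrightarrow> f (cvec y) = 0"
    and z: "z \<in> ball (cvec x) R"
  shows "f z = 0"
proof -
  let ?B = "ball (cvec x) R"
  let ?a = "cvec (Rev z)" and ?v = "cvec (Imv z)"
  \<comment> \<open>Passing to the real part does not increase the distance to the real centre, so
    the base point of the line lies in the ball.\<close>
  have le: "norm (?a - cvec x) \<le> norm (z - cvec x)"
    unfolding norm_vec_def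
    by (rule L2_set_mono)
      (auto simp: cvec_def Rev_def intro: order_trans[OF _ abs_Re_le_cmod] simp flip: of_real_diff)
  have aB: "?a \<in> ?B" using le z by (simp add: dist_norm norm_minus_commute)
  let ?S = "{\<zeta>. ?a + \<zeta> *s ?v \<in> ?B}" and ?T = "of_real ` UNIV \<inter> {\<zeta>. ?a + \<zeta> *s ?v \<in> ?B}"
  have S: "open ?S" "0 \<in> ?S" using open_line[OF open_ball] aB by auto
  have "(\<lambda>\<zeta>. f (?a + \<zeta> *s ?v)) \<i> = 0"
  proof (rule analytic_continuation[OF chol_line[OF f] open_line[OF open_ball] connected_line[OF convex_ball]])
    show "?T \<subseteq> ?S" by auto
    show "0 islimpt ?T"
      unfolding islimpt_approachable
    proof (intro allI impI)
      fix e :: real assume e: "e > 0"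
      obtain d where d: "d > 0" "ball 0 d \<subseteq> ?S" using S open_contains_ball by blast
      let ?t = "min d e / 2"
      have "(of_real ?t :: complex) \<in> ball 0 d" unfolding mem_ball_0 norm_of_real using d(1) e by linarith
      then have "of_real ?t \<in> ?T" using d(2) by blast
      moreover have "(of_real ?t :: complex) \<noteq> 0" "dist (of_real ?t :: complex) 0 < e"
        unfolding dist_0_norm dist_norm diff_zero norm_of_real using d(1) e by (auto simp del: of_real_divide)
      ultimately show "\<exists>x'\<in>?T. x' \<noteq> 0 \<and> dist x' 0 < e" by blast
    qed
    show "f (?a + \<zeta> *s ?v) = 0" if \<zeta>: "\<zeta> \<in> ?T" for \<zeta>
    proof -
      obtain t where t: "\<zeta> = of_real t" using \<zeta> by blast
      have "?a + \<zeta> *s ?v = cvec (Rev z + t *\<^sub>R Imv z)" by (simp add: t vec_eq_iff cvec_def)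
      then show ?thesis using zero \<zeta> by simp
    qed
    show "\<i> \<in> ?S" using z cvec_split[of z] by simp
  qed (use S in auto)
  then show ?thesis using cvec_split[of z] by simp
qed

text \<open>A property that is locally a common zero set of holomorphic functions spreads from real
  points. The interior \<open>N\<close> of its domain of validity contains the real points by
  \<open>chol_zero_real\<close> and is relatively closed by \<open>chol_zero_open\<close>, so it
  fills every component.\<close>

lemma real_identity_principle:
  fixes U :: "(complex ^ 'n) set"
  assumes U: "open U" and comp: "\<And>B. B \<in> components U \<Longrightarrow> \<exists>x. cvec x \<in> B"
    and local: "\<And>p. p \<in> U \<Longrightarrow> \<exists>V F. open V \<and> p \<in> V \<and> V \<subseteq> U \<and> (\<forall>f\<in>F. chol f V) \<and>
      (\<forall>q\<in>V. P q \<longleftrightarrow> (\<forall>f\<in>F. f q = 0))"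
    and real: "\<And>x. cvec x \<in> U \<Longrightarrow> P (cvec x)" and p: "p \<in> U"
  shows "P p"
proof -
  define N where "N = interior {q \<in> U. P q}"
  define B where "B = connected_component_set U p"
  have BU: "B \<subseteq> U" "p \<in> B" unfolding B_def using p connected_component_subset connected_component_refl by fastforce+
  have Bc: "connected B" unfolding B_def by (rule connected_connected_component)
  have Bo: "open B" unfolding B_def using U by (rule open_connected_component)
  have ball: "\<exists>R F. R > 0 \<and> ball q R \<subseteq> U \<and> (\<forall>f\<in>F. chol f (ball q R)) \<and>
      (\<forall>z\<in>ball q R. P z \<longleftrightarrow> (\<forall>f\<in>F. f z = 0))" if qU: "q \<in> U" for q
  proof -
    obtain V F where V: "open V" "q \<in> V" "V \<subseteq> U" "\<forall>f\<in>F. chol f V"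
      "\<forall>q\<in>V. P q \<longleftrightarrow> (\<forall>f\<in>F. f q = 0)" using local[OF qU] by blast
    obtain R where R: "R > 0" "ball q R \<subseteq> V" using V open_contains_ball by blast
    show ?thesis
      using R V chol_subset[OF _ open_ball R(2)] by (intro exI[of _ R] exI[of _ F]) blast
  qed
  have realN: "cvec x \<in> N" if x: "cvec x \<in> U" for x
  proof -
    obtain R F where R: "R > 0" "ball (cvec x) R \<subseteq> U" "\<forall>f\<in>F. chol f (ball (cvec x) R)"
      "\<forall>z\<in>ball (cvec x) R. P z \<longleftrightarrow> (\<forall>f\<in>F. f z = 0)" using ball[OF x] by blast
    have "f z = 0" if f: "f \<in> F" and z: "z \<in> ball (cvec x) R" for f z
    proof (rule chol_zero_real[OF _ _ z])
      show "chol f (ball (cvec x) R)" using R(3) f by blast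
      show "f (cvec y) = 0" if "cvec y \<in> ball (cvec x) R" for y
        using R(2,4) real f that by blast
    qed
    then have "ball (cvec x) R \<subseteq> {q \<in> U. P q}" using R(2,4) by blast
    then show ?thesis unfolding N_def using R(1) by (meson centre_in_ball interior_maximal open_ball subsetD)
  qed
  have closedN: "q \<in> N" if q: "q \<in> U" "q \<in> closure N" for q
  proof -
    obtain R F where R: "R > 0" "ball q R \<subseteq> U" "\<forall>f\<in>F. chol f (ball q R)"
      "\<forall>z\<in>ball q R. P z \<longleftrightarrow> (\<forall>f\<in>F. f z = 0)" using ball[OF q(1)] by blast
    obtain a where a: "a \<in> N" "a \<in> ball q R"
      using q(2) R(1) unfolding closure_approachable by (metis dist_commute mem_ball)
    have "f z = 0" if f: "f \<in> F" and z: "z \<in> ball q R" for f z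
    proof (rule chol_zero_open[OF _ convex_ball _ _ _ _ z])
      show "chol f (ball q R)" using R(3) f by blast
      show "open (N \<inter> ball q R)" unfolding N_def by auto
      show "a \<in> N \<inter> ball q R" using a by blast
      show "f y = 0" if "y \<in> N \<inter> ball q R" for y
        using that R(4) f interior_subset unfolding N_def by blast
    qed blast
    then have "ball q R \<subseteq> {q \<in> U. P q}" using R(2,4) by blast
    then show ?thesis unfolding N_def using R(1) by (meson centre_in_ball interior_maximal open_ball subsetD)
  qed
  have "B \<in> components U" unfolding B_def using p by (simp add: componentsI)
  then obtain x where x: "cvec x \<in> B" using comp by blast
  have "B \<subseteq> N"
  proof (rule ccontr)
    assume "\<not> B \<subseteq> N"
    then have "B \<inter> - closure N \<noteq> {}" using closedN BU by blast
    moreover have "B \<inter> N \<noteq> {}" using x realN BU by blast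
    moreover have "B \<subseteq> N \<union> - closure N" using closedN BU by blast
    moreover have "N \<inter> - closure N = {}" using closure_subset by blast
    ultimately show False
      using connectedD[OF Bc, of N "- closure N"] unfolding N_def by auto
  qed
  then show ?thesis using BU interior_subset unfolding N_def by blast
qed

section \<open>Holomorphic subbundles\<close>

lemma subbundle_subspace: "holo_subbundle k U E \<Longrightarrow> p \<in> U \<Longrightarrow> vec.subspace (E p)"
  unfolding holo_subbundle_def using vec.subspace_span by metis

lemma subbundle_dim: "holo_subbundle k U E \<Longrightarrow> p \<in> U \<Longrightarrow> vec.dim (E p) = k"
  unfolding holo_subbundle_def by metis

text \<open>Near \<open>p\<close> a subbundle is the image of \<open>E p\<close> under a holomorphic family \<open>S\<close> of projections onto
  \<open>E p\<close> followed by extension of sections, and the kernel of a holomorphic family \<open>L\<close>.\<close>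

lemma subbundle_local:
  fixes E :: "complex ^ 'a \<Rightarrow> (complex ^ 'a) set"
  assumes E: "holo_subbundle k U E" and p: "p \<in> U"
  obtains V and S L :: "complex ^ 'a \<Rightarrow> complex ^ 'a ^ 'a" where "open V" "p \<in> V" "V \<subseteq> U" "mhol S V" "mhol L V"
    "\<And>q h. q \<in> V \<Longrightarrow> S q *v h \<in> E q" "\<And>h. h \<in> E p \<Longrightarrow> S p *v h = h"
    "\<And>q. q \<in> V \<Longrightarrow> E q = (\<lambda>h. S q *v h) ` E p"
    "\<And>q. q \<in> V \<Longrightarrow> E q = {z. L q *v z = 0}"
proof -
  obtain W X where W: "p \<in> W" "W \<subseteq> U" "open W" and X: "\<And>i. i < k \<Longrightarrow> holo_on (X i) W"
    and sp: "\<And>q. q \<in> W \<Longrightarrow> vec.span ((\<lambda>i::nat. X i q) ` {..<k}) = E q \<and> vec.dim (E q) = k"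
    using E p unfolding holo_subbundle_def by metis
  let ?B = "(\<lambda>i. X i p) ` {..<k}"
  have spB: "vec.span ?B = E p" "vec.dim (E p) = k" using sp[OF W(1)] by auto
  have cardB: "card ?B \<le> k" using card_image_le[of "{..<k}" "\<lambda>i. X i p"] by simp
  have indB: "vec.independent ?B"
    using vec.card_le_dim_spanning[of ?B "E p"] spB cardB vec.span_base by (metis finite_imageI finite_lessThan order_refl subsetI)
  have "card ?B = k" using vec.dim_span_eq_card_independent[OF indB] spB by simp
  then have inj: "inj_on (\<lambda>i. X i p) {..<k}" by (intro eq_card_imp_inj_on) auto
  let ?u = "axis undefined 1 :: complex ^ 'a"
  have "\<exists>g. clinear g \<and> (\<forall>x\<in>?B. g x = (if x = X i p then ?u else 0))" for i
    by (rule vec.linear_independent_extend[OF indB])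
  then obtain g where g: "\<And>i. clinear (g i)" "\<And>i x. x \<in> ?B \<Longrightarrow> g i x = (if x = X i p then ?u else 0)"
    by metis
  define c where "c i h = g i h $ undefined" for i h
  have c_lin: "c i (x + y) = c i x + c i y" "c i (a *s x) = a * c i x" for i x y a
    unfolding c_def using g(1)[of i] unfolding Vector_Spaces.linear_iff by auto
  have cX: "c i (X j p) = (if i = j then 1 else 0)" if "i < k" "j < k" for i j
    using g(2)[of "X j p" i] that inj unfolding c_def by (auto simp: inj_on_def axis_def)
  define s where "s q h = (\<Sum>i<k. c i h *s X i q)" for q h
  have s_lin: "clinear (s q)" for q
    unfolding Vector_Spaces.linear_iff s_def
    by (simp add: vec.vector_space_axioms c_lin vec.scale_left_distrib sum.distrib vec.scale_sum_right)
  define S where "S q = matrix (s q)" for q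
  have S: "S q *v h = s q h" for q h unfolding S_def by (rule matrix_works[OF s_lin])
  have Sh: "mhol S W"
    unfolding mhol_def
  proof (intro allI)
    fix a b
    have "chol (\<lambda>q. \<Sum>i<k. c i (axis b 1) * X i q $ a) W"
      using X W(3) by (intro chol_sum chol_mult chol_const) (auto simp: vhol_iff_holo_on[symmetric] vhol_def)
    then show "chol (\<lambda>q. S q $ a $ b) W" by (simp add: S_def matrix_def s_def)
  qed
  have Smem: "S q *v h \<in> E q" if "q \<in> W" for q h
    unfolding S s_def using sp[OF that] by (auto intro!: vec.span_sum vec.span_scale intro: vec.span_base simp: set_eq_iff)
  have SX: "S q *v X j p = X j q" if j: "j < k" for q j
  proof -
    have "s q (X j p) = (\<Sum>i<k. (if i = j then X j q else 0))"
      unfolding s_def using j cX by (intro sum.cong) auto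
    then show ?thesis using j by (simp add: S)
  qed
  have Sp: "S p *v h = h" if "h \<in> E p" for h
  proof -
    have cl: "clinear (\<lambda>h. S p *v h - h)"
      unfolding Vector_Spaces.linear_iff
      by (simp add: vec.vector_space_axioms matrix_vector_right_distrib vec.scale_right_diff_distrib
          vector_scalar_commute)
    show ?thesis
      using vec.linear_eq_0_on_span[OF cl, of ?B h] SX that spB by auto
  qed
  \<comment> \<open>Adding the part complementary to \<open>S p\<close> makes the family invertible
    near \<open>p\<close> and keeps the values of \<open>S\<close> on \<open>E p\<close>.\<close>
  define F where "F q = S q + (mat 1 - S p)" for q
  have Fh: "mhol F W" unfolding F_def using W(3) by (intro mhol_add Sh mhol_const)
  have Fp: "F p = mat 1" by (simp add: F_def)
  obtain V H where V: "open V" "p \<in> V" "V \<subseteq> W" "mhol H V" and FH: "\<And>q. q \<in> V \<Longrightarrow> F q ** H q = mat 1"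
    "\<And>q. q \<in> V \<Longrightarrow> H q ** F q = mat 1"
    by (rule mhol_local_inverse[OF Fh W(1) Fp]) (rule that)
  have FS: "F q *v h = S q *v h" if "h \<in> E p" for q h
    using Sp[OF that] by (simp add: F_def matrix_vector_mult_add_rdistrib matrix_vector_mult_diff_rdistrib)
  have img: "E q = (\<lambda>h. S q *v h) ` E p" if q: "q \<in> V" for q
  proof -
    have "(\<lambda>i. X i q) ` {..<k} = (*v) (S q) ` ?B"
      unfolding image_image by (rule image_cong) (simp_all add: SX)
    then have "E q = vec.span ((*v) (S q) ` ?B)"
      using conjunct1[OF sp[OF subsetD[OF V(3) q]]] by simp
    also have "\<dots> = (*v) (S q) ` vec.span ?B"
      by (rule vec.linear_span_image[OF matrix_vector_mul_linear_gen])
    finally show ?thesis by (simp only: spB)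
  qed
  show ?thesis
  \<comment> \<open>A vector lies in \<open>E q\<close> exactly when \<open>H q\<close> takes it
    into \<open>E p\<close>, which is the fixed space of \<open>S p\<close>; this matrix expresses
    that condition as an equation.\<close>
  proof (rule that[of V S "\<lambda>q. (mat 1 - S p) ** H q"])
    show "V \<subseteq> U" using V W by blast
    show "mhol S V" by (rule mhol_subset[OF Sh V(1,3)])
    show "mhol (\<lambda>q. (mat 1 - S p) ** H q) V" by (rule mhol_mult[OF mhol_const[OF V(1)] V(4)])
    show "S q *v h \<in> E q" if "q \<in> V" for q h using Smem V(3) that by blast
    show "E q = {z. ((mat 1 - S p) ** H q) *v z = 0}" if q: "q \<in> V" for q
    proof -
      have Ep: "y \<in> E p \<longleftrightarrow> S p *v y = y" for y using Sp Smem[OF W(1), of y] by metis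
      have "z \<in> E q \<longleftrightarrow> H q *v z \<in> E p" for z
      proof
        assume "z \<in> E q"
        then obtain h where "h \<in> E p" "z = F q *v h" using img[OF q] FS by auto
        then show "H q *v z \<in> E p" by (simp add: matrix_vector_mul_assoc FH(2)[OF q])
      next
        assume h: "H q *v z \<in> E p"
        have "z = F q *v (H q *v z)" by (simp add: matrix_vector_mul_assoc FH(1)[OF q])
        then show "z \<in> E q" using img[OF q] FS[OF h] h by auto
      qed
      moreover have "((mat 1 - S p) ** H q) *v z = H q *v z - S p *v (H q *v z)" for z
        by (simp add: matrix_vector_mul_assoc[symmetric] matrix_vector_mult_diff_rdistrib)
      ultimately have "z \<in> E q \<longleftrightarrow> ((mat 1 - S p) ** H q) *v z = 0" for z
        using Ep[of "H q *v z"] by (metis eq_iff_diff_eq_0)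
      then show ?thesis by blast
    qed
    show "E q = (\<lambda>h. S q *v h) ` E p" if "q \<in> V" for q by (rule img[OF that])
    show "S p *v h = h" if "h \<in> E p" for h by (rule Sp[OF that])
  qed (rule V)+
qed

lemma cnjv_simps [simp]: "cnjv (cnjv v) = v" "cnjv (v + w) = cnjv v + cnjv w" "cnjv (v - w) = cnjv v - cnjv w"
  "cnjv (c *s v) = cnj c *s cnjv v" "cnjv 0 = 0" "cnjv (cvec x) = cvec x" "cnjv (r *\<^sub>R v) = r *\<^sub>R cnjv v"
  by (simp_all add: cnjv_def cvec_def vec_eq_iff)

lemma bounded_linear_cnjv: "bounded_linear cnjv"
  by (simp add: linear_conv_bounded_linear[symmetric] linear_iff)

lemma cnjv_span: "cnjv ` vec.span B = vec.span (cnjv ` B)"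
proof -
  have sub: "cnjv ` vec.span B \<subseteq> vec.span (cnjv ` B)" for B :: "(complex ^ 'n) set"
  proof
    fix y assume "y \<in> cnjv ` vec.span B"
    then obtain x where x: "x \<in> vec.span B" "y = cnjv x" by blast
    have "cnjv x \<in> vec.span (cnjv ` B)"
      using x(1) by (induction rule: vec.span_induct_alt)
        (auto intro: vec.span_zero vec.span_add vec.span_scale vec.span_base)
    then show "y \<in> vec.span (cnjv ` B)" using x by simp
  qed
  have "vec.span (cnjv ` B) = cnjv ` (cnjv ` vec.span (cnjv ` B))" by (simp add: image_image)
  also have "\<dots> \<subseteq> cnjv ` vec.span B"
    using image_mono[OF sub[of "cnjv ` B"], of cnjv] by (simp add: image_image)
  finally show ?thesis using sub by blast
qed

lemma cnjv_dim: "vec.dim (cnjv ` (E :: (complex ^ 'n) set)) = vec.dim E"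
proof -
  have le: "vec.dim (cnjv ` E) \<le> vec.dim E" for E :: "(complex ^ 'n) set"
  proof -
    obtain B where B: "B \<subseteq> E" "vec.independent B" "E \<subseteq> vec.span B" "card B = vec.dim E"
      using vec.basis_exists[of E] by metis
    have fin: "finite B" using B(2) vec.finiteI_independent by blast
    have "cnjv ` E \<subseteq> vec.span (cnjv ` B)" using B(3) cnjv_span by blast
    then have "vec.dim (cnjv ` E) \<le> card (cnjv ` B)" using fin by (intro vec.dim_le_card) auto
    also have "\<dots> \<le> card B" by (rule card_image_le[OF fin])
    finally show ?thesis using B(4) by simp
  qed
  have "vec.dim E \<le> vec.dim (cnjv ` E)" using le[of "cnjv ` E"] by (simp add: image_image)
  then show ?thesis using le[of E] by simp
qed

lemma deriv_cnjv:
  assumes "(X has_derivative A) (at (cnjv q))"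
  shows "((\<lambda>q. cnjv (X (cnjv q))) has_derivative (\<lambda>v. cnjv (A (cnjv v)))) (at q)"
proof -
  have "((\<lambda>q. X (cnjv q)) has_derivative (\<lambda>v. A (cnjv v))) (at q)"
    using has_derivative_compose[OF bounded_linear_imp_has_derivative[OF bounded_linear_cnjv] assms] .
  then show ?thesis by (rule bounded_linear.has_derivative[OF bounded_linear_cnjv])
qed

lemma open_cnjv: "open V \<Longrightarrow> open (cnjv ` V)"
proof -
  assume "open V"
  then have "open (cnjv -` V)"
    by (intro open_vimage bounded_linear.continuous_on[OF bounded_linear_cnjv] continuous_on_id)
  moreover have "x \<in> cnjv -` V \<Longrightarrow> x \<in> cnjv ` V" for x
    by (rule image_eqI[of x cnjv "cnjv x"]) simp_all
  then have "cnjv -` V = cnjv ` V" by auto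
  ultimately show ?thesis by simp
qed

lemma holo_on_cnjv: "holo_on X V \<Longrightarrow> holo_on (\<lambda>q. cnjv (X (cnjv q))) (cnjv ` V)"
  unfolding holo_on_def
proof (intro conjI ballI, elim conjE)
  assume X: "open V \<and> (\<forall>p\<in>V. \<exists>A. (X has_derivative A) (at p) \<and> clinear A)"
  fix q assume "q \<in> cnjv ` V"
  then have "cnjv q \<in> V" by auto
  then obtain A where A: "(X has_derivative A) (at (cnjv q))" "clinear A" using X by blast
  have "clinear (\<lambda>v. cnjv (A (cnjv v)))"
    using A(2) unfolding Vector_Spaces.linear_iff by simp
  then show "\<exists>A. ((\<lambda>q. cnjv (X (cnjv q))) has_derivative A) (at q) \<and> clinear A"
    using deriv_cnjv[OF A(1)] by blast
qed (auto intro: open_cnjv)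

lemma tau_push_subbundle:
  assumes E: "holo_subbundle k U E" and U: "cnjv ` U = U"
  shows "holo_subbundle k U (tau_push E)"
  unfolding holo_subbundle_def
proof
  fix p assume "p \<in> U"
  then have "cnjv p \<in> U" using U by blast
  from bspec[OF E[unfolded holo_subbundle_def] this]
  obtain V X where V: "cnjv p \<in> V" "V \<subseteq> U" "\<forall>i<k. holo_on (X i) V" "open V"
    "\<forall>q\<in>V. vec.span ((\<lambda>i::nat. X i q) ` {..<k}) = E q \<and> vec.dim (E q) = k"
    by blast
  let ?X = "\<lambda>i q. cnjv (X i (cnjv q))"
  show "\<exists>V X. p \<in> V \<and> V \<subseteq> U \<and> (\<forall>i<k. holo_on (X i) V) \<and> open V \<and>
      (\<forall>q\<in>V. vec.span ((\<lambda>i. X i q) ` {..<k}) = tau_push E q \<and> vec.dim (tau_push E q) = k)"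
  proof (intro exI[of _ "cnjv ` V"] exI[of _ ?X] conjI ballI)
    show "p \<in> cnjv ` V" using V(1) by (metis cnjv_simps(1) imageI)
    show "cnjv ` V \<subseteq> U" using V(2) U by blast
    show "\<forall>i<k. holo_on (?X i) (cnjv ` V)" using V(3) holo_on_cnjv by blast
    show "open (cnjv ` V)" using V(4) by (rule open_cnjv)
    fix q assume "q \<in> cnjv ` V"
    then have q: "cnjv q \<in> V" by auto
    have "(\<lambda>i. ?X i q) ` {..<k} = cnjv ` (\<lambda>i. X i (cnjv q)) ` {..<k}" by (simp add: image_image)
    then show "vec.span ((\<lambda>i. ?X i q) ` {..<k}) = tau_push E q"
      using V(5) q cnjv_span unfolding tau_push_def by metis
    show "vec.dim (tau_push E q) = k" unfolding tau_push_def cnjv_dim using V(5) q by blast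
  qed
qed

section \<open>Local sections and their derivatives\<close>

lemma vhol_deriv_dir:
  assumes f: "vhol f U" and v: "vhol v U"
  shows "vhol (\<lambda>q. deriv_at f q (v q)) U"
proof (rule vhol_cong)
  show "vhol (\<lambda>q. \<Sum>i\<in>UNIV. (v q $ i) *s deriv_at f q (axis i 1)) U"
    using v by (intro vhol_sum vhol_smult vhol_deriv f vhol_open[OF f]) (auto simp: vhol_def)
  fix q assume q: "q \<in> U"
  interpret linear "deriv_at f q" by (rule has_derivative_linear[OF vhol_has_derivative[OF f q]])
  have "deriv_at f q (v q) = deriv_at f q (\<Sum>i\<in>UNIV. (v q $ i) *s axis i 1)" by (simp add: basis_expansion)
  then show "(\<Sum>i\<in>UNIV. (v q $ i) *s deriv_at f q (axis i 1)) = deriv_at f q (v q)"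
    by (simp only: sum vhol_deriv_scale[OF f q])
qed

text \<open>A defining family turns the bracket of two sections, modulo the subbundle, into an expression in
  the values of the sections.\<close>

lemma section_bracket_local:
  assumes L: "mhol L V" and X: "vhol X V" and q: "q \<in> V"
    and LX: "\<And>z. z \<in> V \<Longrightarrow> L z *v X z = 0"
  shows "L q *v deriv_at X q v = - (deriv_at L q v *v X q)"
proof -
  have "((\<lambda>z. L z *v X z) has_derivative (\<lambda>v. L q *v deriv_at X q v + deriv_at L q v *v X q)) (at q)"
    by (rule has_derivative_matrix_vector_mult[OF mhol_has_derivative[OF L q] vhol_has_derivative[OF X q]])
  moreover have "((\<lambda>z. L z *v X z) has_derivative (\<lambda>v. 0)) (at q)"
    by (rule has_derivative_transform_within_open[OF has_derivative_const vhol_open[OF X] q]) (simp add: LX)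
  ultimately have "(\<lambda>v. L q *v deriv_at X q v + deriv_at L q v *v X q) = (\<lambda>v. 0)" by (rule has_derivative_unique)
  from fun_cong[OF this, of v] show ?thesis by (simp add: eq_neg_iff_add_eq_0)
qed

lemma hsectionsE:
  assumes "X \<in> hsections U E p"
  obtains V where "open V" "p \<in> V" "V \<subseteq> U" "vhol X V" "\<And>q. q \<in> V \<Longrightarrow> X q \<in> E q"
  using assms vhol_open unfolding hsections_def vhol_iff_holo_on[symmetric] by blast

lemma hsectionsI:
  assumes "open V" "p \<in> V" "V \<subseteq> U" "vhol X V" "\<And>q. q \<in> V \<Longrightarrow> X q \<in> E q"
  shows "X \<in> hsections U E p"
  using assms unfolding hsections_def vhol_iff_holo_on[symmetric] by blast

lemma section_through:
  fixes E :: "complex ^ 'a \<Rightarrow> (complex ^ 'a) set"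
  assumes E: "holo_subbundle k U E" and p: "p \<in> U" and v: "v \<in> E p"
  obtains X where "X \<in> hsections U E p" "X p = v"
proof -
  obtain V and S L :: "complex ^ 'a \<Rightarrow> complex ^ 'a ^ 'a" where V: "open V" "p \<in> V" "V \<subseteq> U" "mhol S V" "\<And>q h. q \<in> V \<Longrightarrow> S q *v h \<in> E q"
    "\<And>h. h \<in> E p \<Longrightarrow> S p *v h = h"
    by (rule subbundle_local[OF E p]) blast
  show ?thesis
    using V v by (intro that[of "\<lambda>q. S q *v v"] hsectionsI[of V] vhol_matrix_vector vhol_const) auto
qed

text \<open>Differentiating the defining equation \<open>L X = 0\<close> at a zero of
  \<open>X\<close> kills the term with the derivative of \<open>L\<close>.\<close>

lemma section_zero_deriv:
  fixes E :: "complex ^ 'a \<Rightarrow> (complex ^ 'a) set"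
  assumes E: "holo_subbundle k U E" and p: "p \<in> U" and X: "X \<in> hsections U E p" and X0: "X p = 0"
  shows "deriv_at X p v \<in> E p"
proof -
  obtain V and S L :: "complex ^ 'a \<Rightarrow> complex ^ 'a ^ 'a" where V: "open V" "p \<in> V" "V \<subseteq> U" "mhol L V" "\<And>q. q \<in> V \<Longrightarrow> E q = {z. L q *v z = 0}"
    by (rule subbundle_local[OF E p]) blast
  obtain W where W: "open W" "p \<in> W" "W \<subseteq> U" "vhol X W" "\<And>q. q \<in> W \<Longrightarrow> X q \<in> E q"
    by (rule hsectionsE[OF X]) (rule that)
  have VW: "open (V \<inter> W)" "p \<in> V \<inter> W" using V W by auto
  have "L p *v deriv_at X p v = - (deriv_at L p v *v X p)"
  proof (rule section_bracket_local[of L "V \<inter> W" X])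
    show "L z *v X z = 0" if "z \<in> V \<inter> W" for z
      using that V(5)[of z] W(5)[of z] by blast
    show "mhol L (V \<inter> W)" using mhol_subset[OF V(4) VW(1)] by blast
    show "vhol X (V \<inter> W)" using vhol_subset[OF W(4) VW(1)] by blast
  qed (rule VW(2))
  then show ?thesis using V(2,5) X0 by auto
qed

lemma hsections_diff:
  assumes E: "holo_subbundle k U E" and X: "X \<in> hsections U E p" and Y: "Y \<in> hsections U E p"
  shows "(\<lambda>q. X q - Y q) \<in> hsections U E p"
proof -
  obtain V where V: "open V" "p \<in> V" "V \<subseteq> U" "vhol X V" "\<And>q. q \<in> V \<Longrightarrow> X q \<in> E q" by (rule hsectionsE[OF X]) (rule that)
  obtain W where W: "open W" "p \<in> W" "W \<subseteq> U" "vhol Y W" "\<And>q. q \<in> W \<Longrightarrow> Y q \<in> E q" by (rule hsectionsE[OF Y]) (rule that)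
  show ?thesis
  proof (rule hsectionsI[of "V \<inter> W"])
    show "vhol (\<lambda>q. X q - Y q) (V \<inter> W)"
      using V(1) W(1) by (intro vhol_diff vhol_subset[OF V(4)] vhol_subset[OF W(4)]) auto
    show "X q - Y q \<in> E q" if "q \<in> V \<inter> W" for q
      using that V W vec.subspace_diff[OF subbundle_subspace[OF E]] by blast
  qed (use V W in auto)
qed

lemma hsections_differentiable:
  "X \<in> hsections U E p \<Longrightarrow> (X has_derivative deriv_at X p) (at p)"
  by (erule hsectionsE) (rule vhol_has_derivative)

lemma deriv_dir_rule:
  assumes f: "vhol f U" and v: "vhol v U" and p: "p \<in> U"
  shows "((\<lambda>q. deriv_at f q (v q)) has_derivative
    (\<lambda>w. deriv_at f p (deriv_at v p w) + deriv_at (\<lambda>q. deriv_at f q (v p)) p w)) (at p)"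
proof -
  let ?b = "\<lambda>i. axis i 1 :: complex ^ 'a"
  have ex: "deriv_at f q u = (\<Sum>i\<in>UNIV. (u $ i) *s deriv_at f q (?b i))" if q: "q \<in> U" for q u
  proof -
    interpret linear "deriv_at f q" by (rule has_derivative_linear[OF vhol_has_derivative[OF f q]])
    have "deriv_at f q u = deriv_at f q (\<Sum>i\<in>UNIV. (u $ i) *s ?b i)" by (simp add: basis_expansion)
    then show ?thesis by (simp only: sum vhol_deriv_scale[OF f q])
  qed
  have bs: "bounded_bilinear ((*s) :: complex \<Rightarrow> complex ^ 'b \<Rightarrow> complex ^ 'b)"
  proof -
    have "bilinear ((*s) :: complex \<Rightarrow> complex ^ 'b \<Rightarrow> complex ^ 'b)"
      unfolding bilinear_def by (auto intro!: linearI simp: vec_eq_iff algebra_simps)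
    then show ?thesis by (simp add: bilinear_conv_bounded_bilinear)
  qed
  have dv: "((\<lambda>q. v q $ i) has_derivative (\<lambda>w. deriv_at v p w $ i)) (at p)" for i
    by (rule bounded_linear.has_derivative[OF bounded_linear_vec_nth vhol_has_derivative[OF v p]])
  have df: "((\<lambda>q. deriv_at f q u) has_derivative deriv_at (\<lambda>q. deriv_at f q u) p) (at p)" for u
    by (rule vhol_has_derivative[OF vhol_deriv[OF f] p])
  have term_d: "((\<lambda>q. (v q $ i) *s deriv_at f q (?b i)) has_derivative
      (\<lambda>w. (v p $ i) *s deriv_at (\<lambda>q. deriv_at f q (?b i)) p w + (deriv_at v p w $ i) *s deriv_at f p (?b i))) (at p)" for i
    by (rule bounded_bilinear.FDERIV[OF bs dv df])
  have "((\<lambda>q. \<Sum>i\<in>UNIV. (v q $ i) *s deriv_at f q (?b i)) has_derivative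
      (\<lambda>w. \<Sum>i\<in>UNIV. (v p $ i) *s deriv_at (\<lambda>q. deriv_at f q (?b i)) p w + (deriv_at v p w $ i) *s deriv_at f p (?b i))) (at p)"
    by (rule has_derivative_sum) (rule term_d)
  then have 1: "((\<lambda>q. deriv_at f q (v q)) has_derivative
      (\<lambda>w. \<Sum>i\<in>UNIV. (v p $ i) *s deriv_at (\<lambda>q. deriv_at f q (?b i)) p w + (deriv_at v p w $ i) *s deriv_at f p (?b i))) (at p)"
    by (rule has_derivative_transform_within_open[OF _ vhol_open[OF f] p]) (simp add: ex[symmetric])
  have c: "((\<lambda>q. \<Sum>i\<in>UNIV. (v p $ i) *s deriv_at f q (?b i)) has_derivative
      (\<lambda>w. \<Sum>i\<in>UNIV. (v p $ i) *s deriv_at (\<lambda>q. deriv_at f q (?b i)) p w)) (at p)"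
    by (rule has_derivative_sum) (rule bounded_linear.has_derivative[OF bounded_bilinear.bounded_linear_right[OF bs] df])
  have "((\<lambda>q. deriv_at f q (v p)) has_derivative
      (\<lambda>w. \<Sum>i\<in>UNIV. (v p $ i) *s deriv_at (\<lambda>q. deriv_at f q (?b i)) p w)) (at p)"
    by (rule has_derivative_transform_within_open[OF c vhol_open[OF f] p]) (simp add: ex[symmetric])
  from deriv_at_eq[OF this]
  have 2: "deriv_at (\<lambda>q. deriv_at f q (v p)) p w = (\<Sum>i\<in>UNIV. (v p $ i) *s deriv_at (\<lambda>q. deriv_at f q (?b i)) p w)" for w
    by simp
  show ?thesis
    using 1 unfolding 2 sum.distrib ex[OF p, of "deriv_at v p _", symmetric] by (simp only: add.commute)
qed

section \<open>Holomorphic inverse functions and charts adapted to a fibre\<close>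

lemma vhol_continuous_on: "vhol f U \<Longrightarrow> continuous_on U f"
  using vhol_has_derivative has_derivative_continuous by (metis continuous_at_imp_continuous_on)

lemma vholI:
  assumes "open U" "\<And>p. p \<in> U \<Longrightarrow> (f has_derivative A p) (at p)" "\<And>p c v. p \<in> U \<Longrightarrow> A p (c *s v) = c *s A p v"
  shows "vhol f U"
  unfolding vhol_def
proof
  fix i show "chol (\<lambda>p. f p $ i) U"
  proof (rule cholI[where A = "\<lambda>p v. A p v $ i"])
    show "((\<lambda>p. f p $ i) has_derivative (\<lambda>v. A p v $ i)) (at p)" if "p \<in> U" for p
      by (rule bounded_linear.has_derivative[OF bounded_linear_vec_nth assms(2)[OF that]])
  qed (simp_all add: assms)
qed

text \<open>The real inverse function theorem yields a differentiable inverse, whose derivative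
  inverts a complex linear bijection and is therefore complex linear. Normalising the derivative at
  \<open>p\<close> to the identity provides the inverse operator that the theorem asks for.\<close>

lemma vhol_inverse_function:
  fixes F :: "complex ^ 'a \<Rightarrow> complex ^ 'a"
  assumes F: "vhol F U" and p: "p \<in> U" and id: "\<And>v. deriv_at F p v = v"
  obtains U' V g where "open U'" "U' \<subseteq> U" "p \<in> U'" "open V" "vhol g V"
    "\<And>x. x \<in> U' \<Longrightarrow> F x \<in> V \<and> g (F x) = x" "\<And>y. y \<in> V \<Longrightarrow> g y \<in> U' \<and> F (g y) = y"
proof -
  define F' where "F' x = Blinfun (deriv_at F x)" for x
  have F': "blinfun_apply (F' x) = deriv_at F x" if "x \<in> U" for x
    unfolding F'_def
    by (rule bounded_linear_Blinfun_apply[OF has_derivative_bounded_linear[OF vhol_has_derivative[OF F that]]])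
  have cont: "continuous_on U F'"
  proof (rule continuous_on_blinfun_componentwise)
    fix i :: "complex ^ 'a"
    show "continuous_on U (\<lambda>x. blinfun_apply (F' x) i)"
      by (rule continuous_on_eq[OF vhol_continuous_on[OF vhol_deriv[OF F, of i]]]) (simp add: F')
  qed
  have inv: "id_blinfun o\<^sub>L F' p = id_blinfun" by (rule blinfun_eqI) (simp add: F'[OF p] id)
  obtain U' V g g' where I: "open U'" "U' \<subseteq> U" "p \<in> U'" "open V" "F p \<in> V" "homeomorphism U' V F g"
    "\<And>y. y \<in> V \<Longrightarrow> (g has_derivative (g' y)) (at y)"
    "\<And>y. y \<in> V \<Longrightarrow> g' y = inv (blinfun_apply (F' (g y)))"
    "\<And>y. y \<in> V \<Longrightarrow> bij (blinfun_apply (F' (g y)))"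
  proof (rule inverse_function_theorem[OF vhol_open[OF F] _ cont p inv])
    show "(F has_derivative blinfun_apply (F' x)) (at x)" if "x \<in> U" for x
      unfolding F'[OF that] by (rule vhol_has_derivative[OF F that])
  qed (rule that)
  have h: "\<And>x. x \<in> U' \<Longrightarrow> F x \<in> V \<and> g (F x) = x" "\<And>y. y \<in> V \<Longrightarrow> g y \<in> U' \<and> F (g y) = y"
    using I(6) unfolding homeomorphism_def by auto
  have "vhol g V"
  proof (rule vholI[OF I(4) I(7)])
    fix y c v assume y: "y \<in> V"
    have gy: "g y \<in> U" using h(2)[OF y] I(2) by blast
    have b: "bij (deriv_at F (g y))" using I(9)[OF y] F'[OF gy] by simp
    have g': "g' y = inv (deriv_at F (g y))" using I(8)[OF y] F'[OF gy] by simp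
    have "deriv_at F (g y) (c *s g' y v) = c *s v"
      unfolding g' vhol_deriv_scale[OF F gy] using b by (simp add: bij_is_surj surj_f_inv_f)
    then show "g' y (c *s v) = c *s g' y v"
      unfolding g' using b by (metis bij_inv_eq_iff)
  qed
  then show ?thesis using that[OF I(1-4) _ h] by blast
qed

text \<open>A holomorphic submersion is straightened near \<open>p\<close>. The projection
  \<open>P\<close> onto the kernel of the derivative at \<open>p\<close> describes the fibre inside
  the full coordinate space, so the chart needs no separate type of lower dimension.\<close>

lemma fibre_chart:
  fixes f :: "complex ^ 'a \<Rightarrow> complex ^ 'b"
  assumes f: "vhol f Z" and p: "p \<in> Z" and surj: "surj (deriv_at f p)"
  obtains P :: "complex ^ 'a ^ 'a" and N V \<kappa> \<Psi> where
    "open N" "0 \<in> N" "open V" "p \<in> V" "V \<subseteq> Z" "vhol \<kappa> N" "vhol \<Psi> V" "\<kappa> 0 = p"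
    "\<And>x. x \<in> N \<Longrightarrow> \<kappa> x \<in> V \<and> \<Psi> (\<kappa> x) = x" "\<And>q. q \<in> V \<Longrightarrow> \<Psi> q \<in> N \<and> \<kappa> (\<Psi> q) = q"
    "P ** P = P" "\<And>x. P *v x = x \<longleftrightarrow> deriv_at f p x = 0"
    "\<And>x. x \<in> N \<Longrightarrow> P *v x = x \<Longrightarrow> f (\<kappa> x) = f p"
    "\<And>q. q \<in> V \<Longrightarrow> f q = f p \<Longrightarrow> P *v \<Psi> q = \<Psi> q"
    "\<And>q v. q \<in> V \<Longrightarrow> deriv_at f q v = 0 \<Longrightarrow> P *v deriv_at \<Psi> q v = deriv_at \<Psi> q v"
    "\<And>x v. x \<in> N \<Longrightarrow> P *v v = v \<Longrightarrow> P *v x = x \<Longrightarrow> deriv_at f (\<kappa> x) (deriv_at \<kappa> x v) = 0"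
proof -
  have cl: "clinear (deriv_at f q)" if "q \<in> Z" for q
    using vhol_deriv_scale[OF f that] linear_add[OF has_derivative_linear[OF vhol_has_derivative[OF f that]]]
    by (simp add: Vector_Spaces.linear_iff vec.vector_space_axioms)
  obtain \<sigma> where \<sigma>: "clinear \<sigma>" "deriv_at f p \<circ> \<sigma> = id"
    using vec.linear_surjective_right_inverse[OF cl[OF p] surj] by blast
  define Sg where "Sg = matrix \<sigma>"
  define Df where "Df = matrix (deriv_at f p)"
  have Sg: "Sg *v y = \<sigma> y" for y unfolding Sg_def by (rule matrix_works[OF \<sigma>(1)])
  have Df: "Df *v x = deriv_at f p x" for x unfolding Df_def by (rule matrix_works[OF cl[OF p]])
  have DS: "Df ** Sg = mat 1"
    unfolding matrix_eq using \<sigma>(2) by (simp add: matrix_vector_mul_assoc[symmetric] Sg Df fun_eq_iff)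
  define P where "P = mat 1 - Sg ** Df"
  have PP: "P ** P = P"
    unfolding P_def by (simp add: matrix_diff_simps matrix_mul_assoc) (simp add: matrix_mul_assoc[symmetric, of _ Df Sg] DS matrix_mul_assoc)
  have DP: "Df ** P = 0" unfolding P_def by (simp add: matrix_diff_simps matrix_mul_assoc DS)
  have PSg: "P ** Sg = 0" unfolding P_def by (simp add: matrix_diff_simps matrix_mul_assoc[symmetric] DS)
  have Pfix: "P *v x = x \<longleftrightarrow> deriv_at f p x = 0" for x
  proof
    assume "P *v x = x"
    then have "Df *v x = (Df ** P) *v x" by (metis matrix_vector_mul_assoc)
    then show "deriv_at f p x = 0" by (simp add: DP Df)
  next
    assume "deriv_at f p x = 0"
    then have "Df *v x = 0" by (simp add: Df)
    then show "P *v x = x" unfolding P_def by (simp add: matrix_vector_mult_diff_rdistrib matrix_vector_mul_assoc[symmetric])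
  qed
  have oZ: "open Z" by (rule vhol_open[OF f])
  \<comment> \<open>The first summand records \<open>f\<close> through a right inverse of its
    derivative, the second the position along the kernel. Since \<open>Df ** P\<close> and
    \<open>P ** Sg\<close> vanish, \<open>Df\<close> and \<open>P\<close> recover the two parts
    separately.\<close>
  define \<Psi> where "\<Psi> q = Sg *v (f q - f p) + P *v (q - p)" for q
  have \<Psi>h: "vhol \<Psi> Z"
    unfolding \<Psi>_def by (intro vhol_add vhol_matrix_vector mhol_const oZ vhol_diff f vhol_const vhol_id)
  have d\<Psi>: "deriv_at \<Psi> q v = Sg *v deriv_at f q v + P *v v" if q: "q \<in> Z" for q v
  proof -
    have "(\<Psi> has_derivative (\<lambda>v. Sg *v (deriv_at f q v - 0) + P *v (v - 0))) (at q)"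
      unfolding \<Psi>_def
      by (intro has_derivative_add has_derivative_diff has_derivative_const has_derivative_ident
          vhol_has_derivative[OF f q] bounded_linear.has_derivative[OF bounded_bilinear.bounded_linear_right[OF bounded_bilinear_matrix_vector_mult]])
    from deriv_at_eq[OF this] show ?thesis by simp
  qed
  have "deriv_at \<Psi> p v = v" for v
    unfolding d\<Psi>[OF p] P_def by (simp add: Df[symmetric] matrix_vector_mult_diff_rdistrib matrix_vector_mul_assoc)
  then obtain V N \<kappa> where K: "open V" "V \<subseteq> Z" "p \<in> V" "open N" "vhol \<kappa> N"
    "\<And>x. x \<in> V \<Longrightarrow> \<Psi> x \<in> N \<and> \<kappa> (\<Psi> x) = x" "\<And>y. y \<in> N \<Longrightarrow> \<kappa> y \<in> V \<and> \<Psi> (\<kappa> y) = y"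
    using vhol_inverse_function[OF \<Psi>h p] by metis
  have \<Psi>p: "\<Psi> p = 0" by (simp add: \<Psi>_def)
  have PPsi: "P *v \<Psi> q = P *v (q - p)" for q
    by (simp add: \<Psi>_def matrix_vector_right_distrib matrix_vector_mul_assoc PP PSg)
  have DPsi: "Df *v \<Psi> q = f q - f p" for q
    by (simp add: \<Psi>_def matrix_vector_right_distrib matrix_vector_mul_assoc DP DS)
  have fib: "f (\<kappa> x) = f p" if x: "x \<in> N" "P *v x = x" for x
  proof -
    have "Df *v x = 0" using Pfix x(2) Df by simp
    then show ?thesis using DPsi[of "\<kappa> x"] K(7)[OF x(1)] by simp
  qed
  show ?thesis
  proof (rule that[of N V \<kappa> \<Psi> P])
    show "0 \<in> N" "\<kappa> 0 = p" using K(6)[OF K(3)] \<Psi>p by auto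
    show "vhol \<Psi> V" by (rule vhol_subset[OF \<Psi>h K(1,2)])
    show "f (\<kappa> x) = f p" if "x \<in> N" "P *v x = x" for x using fib that by blast
    show "P *v \<Psi> q = \<Psi> q" if q: "q \<in> V" "f q = f p" for q
      using q(2) PPsi[of q] by (simp add: \<Psi>_def)
    show "P *v deriv_at \<Psi> q v = deriv_at \<Psi> q v" if q: "q \<in> V" "deriv_at f q v = 0" for q v
      using q K(2) by (simp add: d\<Psi>[OF subsetD[OF K(2) q(1)]] matrix_vector_mul_assoc PP)
    show "deriv_at f (\<kappa> x) (deriv_at \<kappa> x v) = 0" if x: "x \<in> N" "P *v v = v" "P *v x = x" for x v
    proof -
      have kx: "\<kappa> x \<in> Z" using K(2,7) x(1) by blast
      have "((\<lambda>x. \<Psi> (\<kappa> x)) has_derivative (\<lambda>v. deriv_at \<Psi> (\<kappa> x) (deriv_at \<kappa> x v))) (at x)"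
        by (rule has_derivative_compose[OF vhol_has_derivative[OF K(5) x(1)] vhol_has_derivative[OF \<Psi>h kx]])
      moreover have "((\<lambda>x. \<Psi> (\<kappa> x)) has_derivative (\<lambda>v. v)) (at x)"
        by (rule has_derivative_transform_within_open[OF has_derivative_ident K(4) x(1)]) (simp add: K(7))
      ultimately have "(\<lambda>v. deriv_at \<Psi> (\<kappa> x) (deriv_at \<kappa> x v)) = (\<lambda>v. v)" by (rule has_derivative_unique)
      from fun_cong[OF this, of v] have "Df *v (Sg *v deriv_at f (\<kappa> x) (deriv_at \<kappa> x v) + P *v deriv_at \<kappa> x v) = Df *v v"
        by (simp add: d\<Psi>[OF kx])
      then have "deriv_at f (\<kappa> x) (deriv_at \<kappa> x v) = Df *v v"
        by (simp add: matrix_vector_right_distrib matrix_vector_mul_assoc DS DP)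
      also have "\<dots> = 0" using Pfix x(2) Df by simp
      finally show ?thesis .
    qed
  qed (use K PP Pfix in auto)
qed

lemma closed_vec_subspace: "vec.subspace (D :: (complex ^ 'n) set) \<Longrightarrow> closed D"
proof (rule closed_subspace)
  assume D: "vec.subspace D"
  have "r *\<^sub>R x = of_real r *s x" for r and x :: "complex ^ 'n"
    by (simp add: vec_eq_iff) (simp add: scaleR_conv_of_real)
  then show "subspace D"
    using D unfolding subspace_def vec.subspace_def by simp
qed

lemma vec_subspace_scaleR: "vec.subspace (D :: (complex ^ 'n) set) \<Longrightarrow> x \<in> D \<Longrightarrow> r *\<^sub>R x \<in> D"
proof -
  assume D: "vec.subspace D" "x \<in> D"
  have "r *\<^sub>R x = of_real r *s x"
    by (simp add: vec_eq_iff) (simp add: scaleR_conv_of_real)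
  then show "r *\<^sub>R x \<in> D" using vec.subspace_scale[OF D] by simp
qed

text \<open>Kernel directions of the derivative are velocities of curves in the fibre.\<close>

lemma fibre_derivative:
  fixes f :: "complex ^ 'a \<Rightarrow> complex ^ 'b" and F :: "complex ^ 'a \<Rightarrow> complex ^ 'c"
  assumes f: "vhol f Z" and p: "p \<in> Z" and surj: "surj (deriv_at f p)" and v: "deriv_at f p v = 0"
    and F: "vhol F W" "p \<in> W" and D: "vec.subspace D" and mem: "\<And>q. q \<in> W \<Longrightarrow> q \<in> Z \<Longrightarrow> f q = f p \<Longrightarrow> F q \<in> D"
  shows "deriv_at F p v \<in> D"
proof -
  obtain P :: "complex ^ 'a ^ 'a" and N V \<kappa> \<Psi> where
    N: "open N" "0 \<in> N" and V: "open V" "p \<in> V" "V \<subseteq> Z" and \<kappa>: "vhol \<kappa> N" "vhol \<Psi> V" "\<kappa> 0 = p"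
    "\<And>x. x \<in> N \<Longrightarrow> \<kappa> x \<in> V \<and> \<Psi> (\<kappa> x) = x" "\<And>q. q \<in> V \<Longrightarrow> \<Psi> q \<in> N \<and> \<kappa> (\<Psi> q) = q"
    and P: "\<And>x. P *v x = x \<longleftrightarrow> deriv_at f p x = 0"
    "\<And>x. x \<in> N \<Longrightarrow> P *v x = x \<Longrightarrow> f (\<kappa> x) = f p"
    "\<And>q v. q \<in> V \<Longrightarrow> deriv_at f q v = 0 \<Longrightarrow> P *v deriv_at \<Psi> q v = deriv_at \<Psi> q v"
    by (rule fibre_chart[OF f p surj]) (rule that)
  define u where "u = deriv_at \<Psi> p v"
  have Pu: "P *v u = u" unfolding u_def by (rule P(3)[OF V(2) v])
  have \<Psi>p: "\<Psi> p = 0" using \<kappa>(3,4) N(2) by metis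
  have d: "((\<lambda>q. \<kappa> (\<Psi> q)) has_derivative (\<lambda>v. deriv_at \<kappa> 0 (deriv_at \<Psi> p v))) (at p)"
    using has_derivative_compose[OF vhol_has_derivative[OF \<kappa>(2) V(2)], of \<kappa>] vhol_has_derivative[OF \<kappa>(1) N(2)] \<Psi>p by simp
  have "((\<lambda>q. \<kappa> (\<Psi> q)) has_derivative (\<lambda>v. v)) (at p)"
    by (rule has_derivative_transform_within_open[OF has_derivative_ident V(1,2)]) (simp add: \<kappa>(5))
  from has_derivative_unique[OF d this] have du: "deriv_at \<kappa> 0 u = v" unfolding u_def by (rule fun_cong)
  have cont: "continuous_on UNIV (\<lambda>t::real. t *\<^sub>R u)" by (intro continuous_intros)
  have "open (\<kappa> -` W \<inter> N)"
    using continuous_open_preimage[OF vhol_continuous_on[OF \<kappa>(1)] N(1) vhol_open[OF F(1)]] by (simp add: Int_commute)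
  from open_vimage[OF this cont] have "open ((\<lambda>t::real. t *\<^sub>R u) -` (\<kappa> -` W \<inter> N))" .
  moreover have "0 \<in> (\<lambda>t::real. t *\<^sub>R u) -` (\<kappa> -` W \<inter> N)" using F(2) N(2) \<kappa>(3) by simp
  ultimately obtain e where e: "e > 0" "ball 0 e \<subseteq> (\<lambda>t::real. t *\<^sub>R u) -` (\<kappa> -` W \<inter> N)"
    using open_contains_ball by blast
  define \<tau> where "\<tau> j = e / 2 * inverse (real (Suc j))" for j :: nat
  have "inverse (real (Suc j)) \<le> 1" for j by (simp add: field_simps)
  then have \<tau>le: "\<tau> j \<le> e / 2" for j using e(1) unfolding \<tau>_def by (intro mult_left_le) auto
  have \<tau>pos: "\<tau> j > 0" for j using e(1) unfolding \<tau>_def by (intro mult_pos_pos) auto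
  have \<tau>0: "\<tau> \<longlonglongrightarrow> 0" unfolding \<tau>_def[abs_def] by (rule tendsto_mult_right_zero[OF LIMSEQ_inverse_real_of_nat])
  have Pt: "P *v (t *\<^sub>R u) = t *\<^sub>R u" for t :: real
    by (simp add: bounded_bilinear.scaleR_right[OF bounded_bilinear_matrix_vector_mult] Pu)
  have inD: "F (\<kappa> (t *\<^sub>R u)) \<in> D" if "t \<in> ball 0 e" for t
  proof (rule mem)
    have t: "t *\<^sub>R u \<in> N" "\<kappa> (t *\<^sub>R u) \<in> W" using e(2) that by auto
    then show "\<kappa> (t *\<^sub>R u) \<in> W" "\<kappa> (t *\<^sub>R u) \<in> Z" using \<kappa>(4)[of "t *\<^sub>R u"] V(3) by auto
    show "f (\<kappa> (t *\<^sub>R u)) = f p" by (rule P(2)[OF t(1) Pt])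
  qed
  have "((\<lambda>t::real. t *\<^sub>R u) has_vector_derivative u) (at 0)" by (auto intro!: derivative_eq_intros)
  then have c1: "((\<lambda>t::real. \<kappa> (t *\<^sub>R u)) has_vector_derivative v) (at 0)"
    using vector_derivative_diff_chain_within[of "\<lambda>t. t *\<^sub>R u" u 0 UNIV \<kappa> "deriv_at \<kappa> 0"]
      has_derivative_at_withinI[OF vhol_has_derivative[OF \<kappa>(1) N(2)]] du by (simp add: o_def)
  then have "((\<lambda>t::real. F (\<kappa> (t *\<^sub>R u))) has_vector_derivative deriv_at F p v) (at 0)"
    using vector_derivative_diff_chain_within[of "\<lambda>t. \<kappa> (t *\<^sub>R u)" v 0 UNIV F "deriv_at F p"]
      has_derivative_at_withinI[OF vhol_has_derivative[OF F]] \<kappa>(3) by (simp add: o_def)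
  from vector_derivative_seq[OF this \<tau>0 less_imp_neq[OF \<tau>pos, symmetric]]
  have lim: "(\<lambda>j. (1 / \<tau> j) *\<^sub>R (F (\<kappa> (\<tau> j *\<^sub>R u)) - F (\<kappa> (0 *\<^sub>R u)))) \<longlonglongrightarrow> deriv_at F p v" .
  show ?thesis
  proof (rule closed_sequentially[OF closed_vec_subspace[OF D] _ lim])
    fix j
    have "\<tau> j \<in> ball 0 e" "0 \<in> ball 0 e" using \<tau>le[of j] \<tau>pos[of j] e(1) by (auto simp: dist_real_def)
    then show "(1 / \<tau> j) *\<^sub>R (F (\<kappa> (\<tau> j *\<^sub>R u)) - F (\<kappa> (0 *\<^sub>R u))) \<in> D"
      using inD by (intro vec_subspace_scaleR[OF D] vec.subspace_diff[OF D]) blast+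
  qed
qed

section \<open>Brackets and the adjoint action on the leaf space\<close>

lemma vec_subspace_set_plus:
  assumes "vec.subspace K" "vec.subspace (B :: (complex ^ 'n) set)"
  shows "vec.subspace (K + B)"
  unfolding vec.subspace_def
proof (intro conjI ballI allI)
  show "0 \<in> K + B" using assms vec.subspace_0 set_zero_plus2 by (metis add.left_neutral set_plus_intro)
next
  fix x y assume "x \<in> K + B" "y \<in> K + B"
  then obtain k b k' b' where "k \<in> K" "b \<in> B" "x = k + b" "k' \<in> K" "b' \<in> B" "y = k' + b'"
    by (elim set_plus_elim) blast
  then have "x + y = (k + k') + (b + b')" "k + k' \<in> K" "b + b' \<in> B"
    using assms vec.subspace_add by (auto simp: algebra_simps)
  then show "x + y \<in> K + B" by (metis set_plus_intro)
next
  fix c x assume "x \<in> K + B"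
  then obtain k b where "k \<in> K" "b \<in> B" "x = k + b" by (elim set_plus_elim) blast
  then have "c *s x = c *s k + c *s b" "c *s k \<in> K" "c *s b \<in> B"
    using assms vec.subspace_scale by (auto simp: vec.scale_right_distrib)
  then show "c *s x \<in> K + B" by (metis set_plus_intro)
qed

lemma coset_eqI:
  assumes Q: "vec.subspace (Q :: (complex ^ 'n) set)" and xy: "x - y \<in> Q"
  shows "x +o Q = y +o Q"
proof -
  have sub: "x +o Q \<subseteq> y +o Q" if "x - y \<in> Q" for x y :: "complex ^ 'n"
  proof
    fix z assume "z \<in> x +o Q"
    then obtain q where q: "q \<in> Q" "z = x + q" unfolding elt_set_plus_def by blast
    then have "z = y + ((x - y) + q)" "(x - y) + q \<in> Q" using vec.subspace_add[OF Q that] by auto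
    then show "z \<in> y +o Q" unfolding elt_set_plus_def by blast
  qed
  have "y - x \<in> Q" using vec.subspace_neg[OF Q xy] by simp
  then show ?thesis using sub[OF xy] sub[of y x] by blast
qed

text \<open>Neutral names for one ordering of the two distributions. The interpretations by
  \<open>H, Hbar, K, Kbar\<close> and by \<open>Hbar, H, Kbar, K\<close> obtain both adjoint actions
  from one development.\<close>

locale leaf_pair =
  fixes C :: "('n::finite, 'm::finite) complexified"
    and A B K L :: "complex ^ 'n \<Rightarrow> (complex ^ 'n) set" and n r :: nat
  assumes hol: "vhol (leafproj C) (cmfd C)"
    and surj: "\<And>p. p \<in> cmfd C \<Longrightarrow> surj (dproj C p)"
    and ker: "\<And>p. p \<in> cmfd C \<Longrightarrow> {v. dproj C p v = 0} = K p + L p"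
    and sA: "holo_subbundle n (cmfd C) A" and sB: "holo_subbundle n (cmfd C) B"
    and sK: "holo_subbundle r (cmfd C) K" and sL: "holo_subbundle r (cmfd C) L"
    and KA: "\<And>p. p \<in> cmfd C \<Longrightarrow> K p \<subseteq> A p" and LB: "\<And>p. p \<in> cmfd C \<Longrightarrow> L p \<subseteq> B p"
    and AB: "\<And>p. p \<in> cmfd C \<Longrightarrow> A p \<inter> B p = {0}"
    and invB: "\<And>p X Y. p \<in> cmfd C \<Longrightarrow> X \<in> hsections (cmfd C) B p \<Longrightarrow> Y \<in> hsections (cmfd C) B p \<Longrightarrow>
      hbracket X Y p \<in> B p"
    and contact: "\<And>p. p \<in> cmfd C \<Longrightarrow> contactD C (leafproj C p) = dproj C p ` A p + dproj C p ` B p"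
    and dAB: "\<And>p. p \<in> cmfd C \<Longrightarrow> dproj C p ` A p \<inter> dproj C p ` B p = {0}"
begin

lemma clinear_dproj: "p \<in> cmfd C \<Longrightarrow> clinear (dproj C p)"
  using vhol_deriv_scale[OF hol] linear_add[OF has_derivative_linear[OF vhol_has_derivative[OF hol]]]
  by (simp add: Vector_Spaces.linear_iff vec.vector_space_axioms)

lemma dproj_add: "p \<in> cmfd C \<Longrightarrow> dproj C p (v + w) = dproj C p v + dproj C p w"
  and dproj_diff: "p \<in> cmfd C \<Longrightarrow> dproj C p (v - w) = dproj C p v - dproj C p w"
  and dproj_zero: "p \<in> cmfd C \<Longrightarrow> dproj C p 0 = 0"
  using clinear_dproj[of p] vec.linear_add vec.linear_diff vec.linear_0 by blast+

lemma subspace_image: "p \<in> cmfd C \<Longrightarrow> vec.subspace E \<Longrightarrow> vec.subspace (dproj C p ` E)"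
  using vec.linear_subspace_image[OF clinear_dproj] by blast

lemma subspace_contact: "p \<in> cmfd C \<Longrightarrow> vec.subspace (contactD C (leafproj C p))"
  unfolding contact
  by (intro vec_subspace_set_plus subspace_image subbundle_subspace[OF sA] subbundle_subspace[OF sB])

lemma kernel_mem: "p \<in> cmfd C \<Longrightarrow> v \<in> K p \<or> v \<in> L p \<Longrightarrow> dproj C p v = 0"
proof -
  assume p: "p \<in> cmfd C" and v: "v \<in> K p \<or> v \<in> L p"
  have "0 \<in> K p" "0 \<in> L p"
    using vec.subspace_0[OF subbundle_subspace[OF sK p]] vec.subspace_0[OF subbundle_subspace[OF sL p]] by auto
  then have "v \<in> K p + L p"
    using v set_plus_intro[of v "K p" 0 "L p"] set_plus_intro[of 0 "K p" v "L p"] by auto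
  then show "dproj C p v = 0" using ker[OF p] by blast
qed

lemma kernel_split:
  assumes "p \<in> cmfd C" "dproj C p v = 0"
  obtains k l where "k \<in> K p" "l \<in> L p" "v = k + l"
  using assms ker[OF assms(1)] set_plus_elim by blast

lemma kernel_B: "p \<in> cmfd C \<Longrightarrow> b \<in> B p \<Longrightarrow> dproj C p b = 0 \<Longrightarrow> b \<in> L p"
proof -
  assume p: "p \<in> cmfd C" and b: "b \<in> B p" "dproj C p b = 0"
  obtain k l where kl: "k \<in> K p" "l \<in> L p" "b = k + l" using kernel_split[OF p b(2)] by blast
  have "b - l \<in> B p" using vec.subspace_diff[OF subbundle_subspace[OF sB p] b(1)] LB[OF p] kl by blast
  then have "k \<in> A p \<inter> B p" using KA[OF p] kl by auto
  then show "b \<in> L p" using AB[OF p] kl by auto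
qed

text \<open>A section read in the leaf space. Along one leaf its values lie in one fixed vector
  space, where they can be differentiated, and this derivative represents the bracket with the Levi
  kernel.\<close>

definition dsec :: "(complex ^ 'n \<Rightarrow> complex ^ 'n) \<Rightarrow> complex ^ 'n \<Rightarrow> complex ^ 'm"
  where "dsec Y q = dproj C q (Y q)"

lemma dsec_vhol: "vhol Y V \<Longrightarrow> V \<subseteq> cmfd C \<Longrightarrow> vhol (dsec Y) V"
  unfolding dsec_def[abs_def]
  by (rule vhol_deriv_dir[OF vhol_subset[OF hol]]) (auto dest: vhol_open)

lemma dsec_deriv:
  assumes Y: "Y \<in> hsections (cmfd C) E p"
  shows "(dsec Y has_derivative (\<lambda>w. dproj C p (deriv_at Y p w) + deriv_at (\<lambda>q. dproj C q (Y p)) p w)) (at p)"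
proof -
  obtain V where V: "open V" "p \<in> V" "V \<subseteq> cmfd C" "vhol Y V" "\<And>q. q \<in> V \<Longrightarrow> Y q \<in> E q"
    by (rule hsectionsE[OF Y]) (rule that)
  show ?thesis
    unfolding dsec_def[abs_def] by (rule deriv_dir_rule[OF vhol_subset[OF hol V(1,3)] V(4,2)])
qed

lemma dsec_diff_deriv:
  assumes p: "p \<in> cmfd C" and Y: "Y \<in> hsections (cmfd C) E p" "Y' \<in> hsections (cmfd C) E p"
  shows "deriv_at (dsec (\<lambda>q. Y q - Y' q)) p v = deriv_at (dsec Y) p v - deriv_at (dsec Y') p v"
proof -
  obtain V where V: "open V" "p \<in> V" "V \<subseteq> cmfd C" "vhol Y V" "\<And>q. q \<in> V \<Longrightarrow> Y q \<in> E q"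
    by (rule hsectionsE[OF Y(1)]) (rule that)
  have d: "((\<lambda>q. dsec Y q - dsec Y' q) has_derivative (\<lambda>v. deriv_at (dsec Y) p v - deriv_at (dsec Y') p v)) (at p)"
    using has_derivative_diff[OF dsec_deriv[OF Y(1)] dsec_deriv[OF Y(2)]]
    unfolding deriv_at_eq[OF dsec_deriv[OF Y(1)]] deriv_at_eq[OF dsec_deriv[OF Y(2)]] .
  have "(dsec (\<lambda>q. Y q - Y' q) has_derivative (\<lambda>v. deriv_at (dsec Y) p v - deriv_at (dsec Y') p v)) (at p)"
  proof (rule has_derivative_transform_within_open[OF d V(1,2)])
    show "dsec Y q - dsec Y' q = dsec (\<lambda>q. Y q - Y' q) q" if "q \<in> V" for q
      unfolding dsec_def by (rule dproj_diff[OF subsetD[OF V(3) that], symmetric])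
  qed
  from deriv_at_eq[OF this] show ?thesis by simp
qed

text \<open>Since \<open>V\<close> projects to zero identically, differentiating that relation
  trades the derivative of \<open>V\<close> for a second derivative of \<open>leafproj\<close>;
  symmetry of the second derivative merges it with the product rule for
  \<open>dsec Y\<close>.\<close>

lemma dsec_bracket:
  assumes p: "p \<in> cmfd C" and V: "V \<in> hsections (cmfd C) E p" and Y: "Y \<in> hsections (cmfd C) E' p"
    and E: "\<And>q. q \<in> cmfd C \<Longrightarrow> E q \<subseteq> {v. dproj C q v = 0}"
  shows "dproj C p (hbracket V Y p) = deriv_at (dsec Y) p (V p)"
proof -
  obtain W where W: "open W" "p \<in> W" "W \<subseteq> cmfd C" "vhol V W" "\<And>q. q \<in> W \<Longrightarrow> V q \<in> E q"
    by (rule hsectionsE[OF V]) (rule that)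
  have "(dsec V has_derivative (\<lambda>w. 0)) (at p)"
  proof (rule has_derivative_transform_within_open[OF has_derivative_const[of 0] W(1,2)])
    show "0 = dsec V q" if "q \<in> W" for q
      using E[OF subsetD[OF W(3) that]] W(5)[OF that] unfolding dsec_def by auto
  qed
  from fun_cong[OF has_derivative_unique[OF dsec_deriv[OF V] this], of "Y p"]
  have 1: "dproj C p (deriv_at V p (Y p)) = - deriv_at (\<lambda>q. dproj C q (V p)) p (Y p)"
    by (simp add: eq_neg_iff_add_eq_0)
  have 2: "deriv_at (dsec Y) p (V p) = dproj C p (deriv_at Y p (V p)) + deriv_at (\<lambda>q. dproj C q (Y p)) p (V p)"
    using fun_cong[OF deriv_at_eq[OF dsec_deriv[OF Y]]] by simp
  have "deriv_at (\<lambda>q. dproj C q (V p)) p (Y p) = deriv_at (\<lambda>q. dproj C q (Y p)) p (V p)"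
    by (rule vhol_deriv_symmetric[OF hol p])
  then show ?thesis
    unfolding hbracket_def dproj_diff[OF p] 2 1 by simp
qed

text \<open>At points of the leaf through \<open>p\<close> the projected section stays in the single
  contact space of that leaf, and \<open>fibre_derivative\<close> applies because \<open>v\<close>
  is tangent to the leaf.\<close>

lemma dsec_contact:
  assumes p: "p \<in> cmfd C" and v: "dproj C p v = 0"
    and Y: "Y \<in> hsections (cmfd C) A p \<or> Y \<in> hsections (cmfd C) B p"
  shows "deriv_at (dsec Y) p v \<in> contactD C (leafproj C p)"
proof -
  obtain E where E: "Y \<in> hsections (cmfd C) E p" "E = A \<or> E = B" using Y by blast
  obtain V where V: "open V" "p \<in> V" "V \<subseteq> cmfd C" "vhol Y V" "\<And>q. q \<in> V \<Longrightarrow> Y q \<in> E q"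
    by (rule hsectionsE[OF E(1)]) (rule that)
  show ?thesis
  proof (rule fibre_derivative[OF hol p surj[OF p] v dsec_vhol[OF V(4,3)] V(2) subspace_contact[OF p]])
    fix q assume q: "q \<in> V" "q \<in> cmfd C" "leafproj C q = leafproj C p"
    have z: "0 \<in> dproj C q ` A q" "0 \<in> dproj C q ` B q"
      using vec.subspace_0[OF subspace_image[OF q(2) subbundle_subspace[OF sA q(2)]]]
        vec.subspace_0[OF subspace_image[OF q(2) subbundle_subspace[OF sB q(2)]]] by auto
    have "dsec Y q \<in> dproj C q ` E q" using V(5)[OF q(1)] unfolding dsec_def by blast
    then have "dsec Y q \<in> dproj C q ` A q + dproj C q ` B q"
      using E(2) set_plus_intro[OF _ z(2), of "dsec Y q" "dproj C q ` A q"]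
        set_plus_intro[OF z(1), of "dsec Y q" "dproj C q ` B q"] by (elim disjE) simp_all
    then show "dsec Y q \<in> contactD C (leafproj C p)" using contact[OF q(2)] q(3) by simp
  qed
qed

text \<open>The distribution \<open>L\<close> lies in the involutive \<open>B\<close>, so the
  bracket of a section of \<open>L\<close> with \<open>Y\<close> stays in \<open>B\<close>; its
  projection is this derivative.\<close>

lemma dsec_L_B:
  assumes p: "p \<in> cmfd C" and v: "v \<in> L p" and Y: "Y \<in> hsections (cmfd C) B p"
  shows "deriv_at (dsec Y) p v \<in> dproj C p ` B p"
proof -
  obtain V where V: "V \<in> hsections (cmfd C) L p" "V p = v" by (rule section_through[OF sL p v])
  then have VB: "V \<in> hsections (cmfd C) B p" using LB unfolding hsections_def by blast
  have "dproj C p (hbracket V Y p) = deriv_at (dsec Y) p (V p)"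
    by (rule dsec_bracket[OF p V(1) Y]) (use kernel_mem in auto)
  then show ?thesis using invB[OF p VB Y] V(2) by (metis imageI)
qed

text \<open>A section of \<open>B\<close> whose projection vanishes at \<open>p\<close> agrees there with a section of \<open>L\<close>, whose
  projection vanishes identically.\<close>

lemma dsec_zero_B:
  assumes p: "p \<in> cmfd C" and Y: "Y \<in> hsections (cmfd C) B p" and Y0: "dproj C p (Y p) = 0"
  shows "deriv_at (dsec Y) p v \<in> dproj C p ` B p"
proof -
  have "Y p \<in> B p" using Y unfolding hsections_def by blast
  then have "Y p \<in> L p" using kernel_B[OF p _ Y0] by blast
  then obtain W where W: "W \<in> hsections (cmfd C) L p" "W p = Y p" by (rule section_through[OF sL p])
  then have WB: "W \<in> hsections (cmfd C) B p" using LB unfolding hsections_def by blast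
  obtain V where V: "open V" "p \<in> V" "V \<subseteq> cmfd C" "vhol W V" "\<And>q. q \<in> V \<Longrightarrow> W q \<in> L q"
    by (rule hsectionsE[OF W(1)]) (rule that)
  have "(dsec W has_derivative (\<lambda>w. 0)) (at p)"
  proof (rule has_derivative_transform_within_open[OF has_derivative_const[of 0] V(1,2)])
    show "0 = dsec W q" if "q \<in> V" for q
      using kernel_mem[OF subsetD[OF V(3) that]] V(5)[OF that] unfolding dsec_def by simp
  qed
  then have dW: "deriv_at (dsec W) p v = 0" using deriv_at_eq by metis
  let ?Z = "\<lambda>q. Y q - W q"
  have Z: "?Z \<in> hsections (cmfd C) B p" by (rule hsections_diff[OF sB Y WB])
  have "deriv_at (dsec ?Z) p v = dproj C p (deriv_at ?Z p v) + deriv_at (\<lambda>q. dproj C q (?Z p)) p v"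
    using fun_cong[OF deriv_at_eq[OF dsec_deriv[OF Z]]] by simp
  moreover have "deriv_at (\<lambda>q. dproj C q (?Z p)) p v = 0"
  proof -
    have "((\<lambda>q. dproj C q (?Z p)) has_derivative (\<lambda>w. 0)) (at p)"
      by (rule has_derivative_transform_within_open[OF has_derivative_const[of 0] V(1,2)])
        (use V(3) in \<open>auto simp: W(2) dproj_zero\<close>)
    then show ?thesis using deriv_at_eq by metis
  qed
  moreover have "deriv_at ?Z p v \<in> B p" by (rule section_zero_deriv[OF sB p Z]) (simp add: W(2))
  ultimately show ?thesis using dsec_diff_deriv[OF p Y WB, of v] dW by simp
qed

lemma dproj_B_imp:
  assumes p: "p \<in> cmfd C" and w: "dproj C p w \<in> dproj C p ` B p"
  shows "w \<in> K p + B p"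
proof -
  obtain b where b: "b \<in> B p" "dproj C p w = dproj C p b" using w by blast
  then have "dproj C p (w - b) = 0" using dproj_diff[OF p] by simp
  then obtain k l where kl: "k \<in> K p" "l \<in> L p" "w - b = k + l" by (rule kernel_split[OF p])
  then have "l + b \<in> B p" using vec.subspace_add[OF subbundle_subspace[OF sB p]] LB[OF p] b by blast
  moreover have "w = k + (l + b)" using kl(3) by (simp add: algebra_simps)
  ultimately show ?thesis using kl(1) by (metis set_plus_intro)
qed

lemma dproj_KB: "p \<in> cmfd C \<Longrightarrow> w \<in> K p + B p \<Longrightarrow> dproj C p w \<in> dproj C p ` B p"
  using kernel_mem dproj_add by (elim set_plus_elim) auto

lemma subspace_KB: "p \<in> cmfd C \<Longrightarrow> vec.subspace (K p + B p)"
  by (intro vec_subspace_set_plus subbundle_subspace[OF sK] subbundle_subspace[OF sB])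

text \<open>This legitimises the definite description in \<open>bracket_class\<close>. The projected
  bracket depends on \<open>V\<close> only through \<open>V p\<close>, and two choices of
  \<open>Y\<close> differ by a section of \<open>B\<close> vanishing at \<open>p\<close>, to which
  \<open>dsec_zero_B\<close> applies.\<close>

lemma ad_class:
  assumes p: "p \<in> cmfd C" and V: "V \<in> hsections (cmfd C) K p" and Y: "Y \<in> hsections (cmfd C) B p"
  shows "bracket_class hbracket (hsections (cmfd C) K p) (hsections (cmfd C) B p) (K p + B p) p (V p) (Y p)
    = hbracket V Y p +o (K p + B p)"
  unfolding bracket_class_def
proof (rule the_equality)
  show "\<exists>V'\<in>hsections (cmfd C) K p. \<exists>Y'\<in>hsections (cmfd C) B p. V' p = V p \<and> Y' p = Y p \<and>
      hbracket V Y p +o (K p + B p) = hbracket V' Y' p +o (K p + B p)" using V Y by blast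
next
  fix c assume "\<exists>V'\<in>hsections (cmfd C) K p. \<exists>Y'\<in>hsections (cmfd C) B p. V' p = V p \<and> Y' p = Y p \<and>
      c = hbracket V' Y' p +o (K p + B p)"
  then obtain V' Y' where V': "V' \<in> hsections (cmfd C) K p" "V' p = V p"
    and Y': "Y' \<in> hsections (cmfd C) B p" "Y' p = Y p" and c: "c = hbracket V' Y' p +o (K p + B p)" by blast
  have K0: "\<And>q. q \<in> cmfd C \<Longrightarrow> K q \<subseteq> {v. dproj C q v = 0}" using kernel_mem by auto
  have "dproj C p (hbracket V' Y' p - hbracket V Y p) = deriv_at (dsec Y') p (V p) - deriv_at (dsec Y) p (V p)"
    using dsec_bracket[OF p V'(1) Y'(1) K0] dsec_bracket[OF p V Y K0] dproj_diff[OF p] V'(2) by simp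
  also have "\<dots> = deriv_at (dsec (\<lambda>q. Y' q - Y q)) p (V p)"
    by (rule dsec_diff_deriv[OF p Y'(1) Y, symmetric])
  also have "\<dots> \<in> dproj C p ` B p"
    by (rule dsec_zero_B[OF p hsections_diff[OF sB Y'(1) Y]]) (simp add: Y'(2) dproj_zero[OF p])
  finally show "c = hbracket V Y p +o (K p + B p)"
    unfolding c by (intro coset_eqI subspace_KB p dproj_B_imp)
qed

text \<open>The bracket projects to the derivative of \<open>dsec Y\<close> along \<open>v\<close>,
  so the adjoint action is the component of this derivative in the image of \<open>A\<close>;
  directness of the splitting makes it unique.\<close>

lemma ad_leaf_eq:
  assumes p: "p \<in> cmfd C" and v: "v \<in> K p" and a: "a \<in> A p" and Y: "Y \<in> hsections (cmfd C) B p"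
    and u: "u \<in> dproj C p ` A p" "deriv_at (dsec Y) p v - u \<in> dproj C p ` B p"
  shows "ad_leaf C A B K p v (dproj C p a + dproj C p (Y p)) = u"
  unfolding ad_leaf_def
proof (rule the_equality)
  obtain V where V: "V \<in> hsections (cmfd C) K p" "V p = v" by (rule section_through[OF sK p v])
  have K0: "\<And>q. q \<in> cmfd C \<Longrightarrow> K q \<subseteq> {v. dproj C q v = 0}" using kernel_mem by auto
  have Yp: "Y p \<in> B p" using Y unfolding hsections_def by blast
  obtain a' where a': "a' \<in> A p" "u = dproj C p a'" using u(1) by blast
  have "dproj C p (hbracket V Y p - a') \<in> dproj C p ` B p"
    using u(2) dsec_bracket[OF p V(1) Y K0] a' V(2) dproj_diff[OF p] by simp
  then have "hbracket V Y p - a' \<in> K p + B p" by (rule dproj_B_imp[OF p])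
  then have "a' - hbracket V Y p \<in> K p + B p" using vec.subspace_neg[OF subspace_KB[OF p]] by (metis minus_diff_eq)
  then have "a' \<in> hbracket V Y p +o (K p + B p)"
    unfolding elt_set_plus_def by (intro CollectI bexI[of _ "a' - hbracket V Y p"]) simp_all
  then have mem: "a' \<in> bracket_class hbracket (hsections (cmfd C) K p) (hsections (cmfd C) B p) (K p + B p) p v (Y p)"
    using ad_class[OF p V(1) Y] V(2) by simp
  show "\<exists>a0\<in>A p. \<exists>b\<in>B p. \<exists>a'\<in>A p. dproj C p a + dproj C p (Y p) = dproj C p a0 + dproj C p b \<and>
      u = dproj C p a' \<and>
      a' \<in> bracket_class hbracket (hsections (cmfd C) K p) (hsections (cmfd C) B p) (K p + B p) p v b"
    using a Yp a' mem by blast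
  fix u' assume "\<exists>a0\<in>A p. \<exists>b\<in>B p. \<exists>a'\<in>A p. dproj C p a + dproj C p (Y p) = dproj C p a0 + dproj C p b \<and>
      u' = dproj C p a' \<and>
      a' \<in> bracket_class hbracket (hsections (cmfd C) K p) (hsections (cmfd C) B p) (K p + B p) p v b"
  then obtain a0 b c where 0: "a0 \<in> A p" "b \<in> B p" "c \<in> A p"
    "dproj C p a + dproj C p (Y p) = dproj C p a0 + dproj C p b" "u' = dproj C p c"
    "c \<in> bracket_class hbracket (hsections (cmfd C) K p) (hsections (cmfd C) B p) (K p + B p) p v b" by blast
  obtain Y' where Y': "Y' \<in> hsections (cmfd C) B p" "Y' p = b" by (rule section_through[OF sB p 0(2)])
  have group: "x - z = w - y" if "x + y = z + w" for x y z w :: "complex ^ 'm"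
    using that by (simp add: algebra_simps)
  have "dproj C p (a - a0) = dproj C p (b - Y p)"
    using group[OF 0(4)] unfolding dproj_diff[OF p] .
  moreover have "a - a0 \<in> A p" "b - Y p \<in> B p"
    using a 0(1,2) Yp vec.subspace_diff[OF subbundle_subspace[OF sA p]] vec.subspace_diff[OF subbundle_subspace[OF sB p]] by auto
  ultimately have "dproj C p (b - Y p) \<in> dproj C p ` A p \<inter> dproj C p ` B p" by (metis IntI imageI)
  \<comment> \<open>The description of \<open>ad_leaf\<close> admits other decompositions of the
    same vector, but by directness their parts in \<open>B\<close> have equal projections.\<close>
  then have b0: "dproj C p (b - Y p) = 0" using dAB[OF p] by blast
  have "c \<in> hbracket V Y' p +o (K p + B p)" using 0(6) ad_class[OF p V(1) Y'(1)] V(2) Y'(2) by simp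
  then obtain w where w: "w \<in> K p + B p" "c = hbracket V Y' p + w" unfolding elt_set_plus_def by blast
  have "u' = deriv_at (dsec Y') p v + dproj C p w"
    using 0(5) w(2) dproj_add[OF p] dsec_bracket[OF p V(1) Y'(1) K0] V(2) by simp
  then have "u' - u = deriv_at (dsec (\<lambda>q. Y' q - Y q)) p v + dproj C p w + (deriv_at (dsec Y) p v - u)"
    using dsec_diff_deriv[OF p Y'(1) Y, of v] by simp
  also have "\<dots> \<in> dproj C p ` B p"
    using dsec_zero_B[OF p hsections_diff[OF sB Y'(1) Y], of v] b0 Y'(2) dproj_KB[OF p w(1)] u(2)
    by (intro vec.subspace_add[OF subspace_image[OF p subbundle_subspace[OF sB p]]]) simp_all
  finally have "u' - u \<in> dproj C p ` B p" .
  moreover have "u' - u \<in> dproj C p ` A p"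
    using 0(3,5) a' dproj_diff[OF p, of c a'] vec.subspace_diff[OF subbundle_subspace[OF sA p]] by (metis imageI)
  ultimately have "u' - u = 0" using dAB[OF p] by blast
  then show "u' = u" by simp
qed

end

section \<open>The holomorphic extensions of the CR structure\<close>

lemma bounded_linear_cvec: "bounded_linear (cvec :: real ^ 'n \<Rightarrow> complex ^ 'n)"
proof -
  have "linear (cvec :: real ^ 'n \<Rightarrow> complex ^ 'n)"
    by (rule linearI) (simp_all add: cvec_def vec_eq_iff scaleR_complex.ctr complex_eq_iff)
  then show ?thesis by (rule linear_conv_bounded_linear[THEN iffD1])
qed

text \<open>Splitting \<open>v\<close> into real and imaginary part and using complex linearity of
  the derivative matches the two conventions, so brackets of restrictions to \<open>M\<close> are
  restrictions of brackets.\<close>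

lemma rderiv_cvec:
  assumes X: "vhol X V" and x: "cvec x \<in> V"
  shows "rderiv (\<lambda>y. X (cvec y)) x v = deriv_at X (cvec x) v"
proof -
  have "((\<lambda>y. X (cvec y)) has_derivative (\<lambda>w. deriv_at X (cvec x) (cvec w))) (at x)"
    using has_derivative_compose[OF bounded_linear.has_derivative[OF bounded_linear_cvec has_derivative_ident] vhol_has_derivative[OF X x]] .
  then have d: "frechet_derivative (\<lambda>y. X (cvec y)) (at x) = (\<lambda>w. deriv_at X (cvec x) (cvec w))"
    by (rule deriv_at_eq)
  have "deriv_at X (cvec x) v = deriv_at X (cvec x) (cvec (Rev v) + \<i> *s cvec (Imv v))"
    by (subst cvec_split[of v]) (rule refl)
  also have "\<dots> = deriv_at X (cvec x) (cvec (Rev v)) + \<i> *s deriv_at X (cvec x) (cvec (Imv v))"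
    using linear_add[OF has_derivative_linear[OF vhol_has_derivative[OF X x]]] vhol_deriv_scale[OF X x] by metis
  finally show ?thesis unfolding rderiv_def d by simp
qed

lemma hsections_cvec:
  assumes X: "X \<in> hsections U E (cvec x)" and M: "cvec -` U = M" and E: "\<And>y. y \<in> M \<Longrightarrow> E (cvec y) = H y"
  shows "(\<lambda>y. X (cvec y)) \<in> rsections M H x"
proof -
  obtain V where V: "open V" "cvec x \<in> V" "V \<subseteq> U" "vhol X V" "\<And>q. q \<in> V \<Longrightarrow> X q \<in> E q"
    by (rule hsectionsE[OF X]) (rule that)
  have o: "open (cvec -` V)"
    using continuous_open_vimage[OF V(1)] linear_continuous_on[OF bounded_linear_cvec] by (metis continuous_on_eq_continuous_at open_UNIV UNIV_I)
  have "ranalytic_on (\<lambda>y. X (cvec y)) (cvec -` V)"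
    unfolding ranalytic_on_def using o V(4) vhol_iff_holo_on[of X V] by blast
  then show ?thesis
    unfolding rsections_def
    using V(2,3,5) M E by (intro CollectI exI[of _ "cvec -` V"] conjI) auto
qed

text \<open>Modulo \<open>E\<close> the bracket depends only on the values of the sections.
  Involutivity is therefore locally the vanishing of holomorphic functions of the point, and the
  identity principle spreads it from the real points.\<close>

lemma involutive_extension:
  fixes E :: "complex ^ 'n \<Rightarrow> (complex ^ 'n) set"
  assumes U: "open U" and comp: "\<And>B. B \<in> components U \<Longrightarrow> \<exists>x. cvec x \<in> B"
    and E: "holo_subbundle k U E"
    and real: "\<And>x X Y. cvec x \<in> U \<Longrightarrow> X \<in> hsections U E (cvec x) \<Longrightarrow> Y \<in> hsections U E (cvec x) \<Longrightarrow>
      hbracket X Y (cvec x) \<in> E (cvec x)"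
    and p: "p \<in> U" and X: "X \<in> hsections U E p" and Y: "Y \<in> hsections U E p"
  shows "hbracket X Y p \<in> E p"
proof -
  define P where "P q \<longleftrightarrow> (\<forall>X\<in>hsections U E q. \<forall>Y\<in>hsections U E q. hbracket X Y q \<in> E q)" for q
  have "P p"
  proof (rule real_identity_principle[OF U comp _ _ p])
    show "P (cvec x)" if "cvec x \<in> U" for x using real[OF that] unfolding P_def by blast
    fix p assume p: "p \<in> U"
    obtain V and S L :: "complex ^ 'n \<Rightarrow> complex ^ 'n ^ 'n" where V: "open V" "p \<in> V" "V \<subseteq> U" "mhol S V" "mhol L V"
      and SE: "\<And>q h. q \<in> V \<Longrightarrow> S q *v h \<in> E q" and "\<And>h. h \<in> E p \<Longrightarrow> S p *v h = h"
      and ES: "\<And>q. q \<in> V \<Longrightarrow> E q = (\<lambda>h. S q *v h) ` E p"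
      and EL: "\<And>q. q \<in> V \<Longrightarrow> E q = {z. L q *v z = 0}"
      by (rule subbundle_local[OF E p]) (rule that)
    have Sh: "vhol (\<lambda>q. S q *v h) V" for h by (rule vhol_matrix_vector[OF V(4) vhol_const[OF V(1)]])
    define br where "br h h' = hbracket (\<lambda>q. S q *v h) (\<lambda>q. S q *v h')" for h h'
    have br: "vhol (\<lambda>q. L q *v br h h' q) V" for h h'
      unfolding br_def hbracket_def
      by (intro vhol_matrix_vector[OF V(5)] vhol_diff vhol_deriv_dir Sh)
    \<comment> \<open>The entries of the defining matrix applied to brackets of the sections
      \<open>S h\<close>, whose values fill \<open>E\<close>.\<close>
    define F where "F = {\<lambda>q. (L q *v br h h' q) $ i |h h' i. True}"
    have "P q \<longleftrightarrow> (\<forall>f\<in>F. f q = 0)" if q: "q \<in> V" for q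
    proof
      assume P: "P q"
      have "br h h' q \<in> E q" for h h'
      proof -
        have "(\<lambda>q. S q *v h) \<in> hsections U E q" for h by (rule hsectionsI[OF V(1) q V(3) Sh SE])
        then show ?thesis using P unfolding P_def br_def by blast
      qed
      then have "L q *v br h h' q = 0" for h h' using EL[OF q] by blast
      then show "\<forall>f\<in>F. f q = 0" unfolding F_def by auto
    next
      assume "\<forall>f\<in>F. f q = 0"
      then have z: "L q *v br h h' q = 0" for h h' unfolding F_def vec_eq_iff by force
      show "P q" unfolding P_def
      proof (intro ballI)
        fix X Y assume XY: "X \<in> hsections U E q" "Y \<in> hsections U E q"
        \<comment> \<open>After multiplication by \<open>L q\<close> the derivative of a section is
          determined by its value at \<open>q\<close>; this reduces arbitrary sections to the
          sections \<open>S h\<close>.\<close>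
        have key: "L q *v deriv_at X q v = - (deriv_at L q v *v X q)" "X q \<in> E q"
          if "X \<in> hsections U E q" for X v
        proof -
          obtain W where W: "open W" "q \<in> W" "W \<subseteq> U" "vhol X W" "\<And>z. z \<in> W \<Longrightarrow> X z \<in> E z"
            by (rule hsectionsE[OF \<open>X \<in> hsections U E q\<close>]) (rule that)
          have o: "open (V \<inter> W)" using V(1) W(1) by blast
          show "L q *v deriv_at X q v = - (deriv_at L q v *v X q)"
            by (rule section_bracket_local[OF mhol_subset[OF V(5) o] vhol_subset[OF W(4) o]])
              (use q W EL in auto)
          show "X q \<in> E q" using W by blast
        qed
        obtain h h' where h: "X q = S q *v h" "Y q = S q *v h'" using key(2)[OF XY(1)] key(2)[OF XY(2)] ES[OF q] by blast
        have sec: "(\<lambda>q. S q *v h) \<in> hsections U E q" for h by (rule hsectionsI[OF V(1) q V(3) Sh SE])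
        have "L q *v hbracket X Y q = L q *v br h h' q"
          unfolding br_def hbracket_def matrix_vector_mult_diff_distrib key(1)[OF XY(1)] key(1)[OF XY(2)] key(1)[OF sec] h ..
        then show "hbracket X Y q \<in> E q" using z EL[OF q] by simp
      qed
    qed
    moreover have "\<forall>f\<in>F. chol f V" using br unfolding F_def vhol_def by blast
    ultimately show "\<exists>V F. open V \<and> p \<in> V \<and> V \<subseteq> U \<and> (\<forall>f\<in>F. chol f V) \<and> (\<forall>q\<in>V. P q \<longleftrightarrow> (\<forall>f\<in>F. f q = 0))"
      using V(1-3) by blast
  qed
  then show ?thesis using X Y unfolding P_def by blast
qed

text \<open>Locally the inclusion is the vanishing of \<open>L' ** S\<close>, with \<open>L'\<close>
  defining \<open>E\<close> and the image of \<open>S\<close> filling \<open>K\<close>; this is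
  again a holomorphic condition that spreads from the real points.\<close>

lemma subbundle_inclusion:
  fixes E :: "complex ^ 'n \<Rightarrow> (complex ^ 'n) set"
  assumes U: "open U" and comp: "\<And>B. B \<in> components U \<Longrightarrow> \<exists>x. cvec x \<in> B"
    and K: "holo_subbundle k U K" and E: "holo_subbundle l U E"
    and real: "\<And>x. cvec x \<in> U \<Longrightarrow> K (cvec x) \<subseteq> E (cvec x)"
    and p: "p \<in> U"
  shows "K p \<subseteq> E p"
proof (rule real_identity_principle[where P="\<lambda>p. K p \<subseteq> E p", OF U comp _ real p])
  fix p assume p: "p \<in> U"
  obtain V and S L :: "complex ^ 'n \<Rightarrow> complex ^ 'n ^ 'n" where V: "open V" "p \<in> V" "V \<subseteq> U" "mhol S V" "mhol L V"
    and SE: "\<And>q h. q \<in> V \<Longrightarrow> S q *v h \<in> K q" and "\<And>h. h \<in> K p \<Longrightarrow> S p *v h = h"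
    and ES: "\<And>q. q \<in> V \<Longrightarrow> K q = (\<lambda>h. S q *v h) ` K p"
    and "\<And>q. q \<in> V \<Longrightarrow> K q = {z. L q *v z = 0}"
    by (rule subbundle_local[OF K p]) (rule that)
  obtain V' and S' L' :: "complex ^ 'n \<Rightarrow> complex ^ 'n ^ 'n" where V': "open V'" "p \<in> V'" "V' \<subseteq> U" "mhol S' V'" "mhol L' V'"
    and "\<And>q h. q \<in> V' \<Longrightarrow> S' q *v h \<in> E q" and "\<And>h. h \<in> E p \<Longrightarrow> S' p *v h = h"
    and "\<And>q. q \<in> V' \<Longrightarrow> E q = (\<lambda>h. S' q *v h) ` E p"
    and EL: "\<And>q. q \<in> V' \<Longrightarrow> E q = {z. L' q *v z = 0}"
    by (rule subbundle_local[OF E p]) (rule that)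
  have o: "open (V \<inter> V')" using V(1) V'(1) by blast
  define F where "F = range (\<lambda>(h, i) q. (L' q *v (S q *v h)) $ i)"
  have "vhol (\<lambda>q. L' q *v (S q *v h)) (V \<inter> V')" for h
    by (intro vhol_matrix_vector mhol_subset[OF V(4) o] mhol_subset[OF V'(5) o] vhol_const o) auto
  then have FV: "\<forall>f\<in>F. chol f (V \<inter> V')" unfolding F_def vhol_def by auto
  have KE: "K q \<subseteq> E q \<longleftrightarrow> (\<forall>f\<in>F. f q = 0)" if q: "q \<in> V \<inter> V'" for q
  proof -
    have "(\<forall>f\<in>F. f q = 0) \<longleftrightarrow> (\<forall>h i. (L' q *v (S q *v h)) $ i = 0)"
      unfolding F_def by auto
    also have "\<dots> \<longleftrightarrow> (\<forall>h. L' q *v (S q *v h) = 0)" unfolding vec_eq_iff by simp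
    also have "\<dots> \<longleftrightarrow> (\<forall>h. S q *v h \<in> E q)" using EL[of q] q by simp
    also have "\<dots> \<longleftrightarrow> K q \<subseteq> E q"
    proof
      assume *: "\<forall>h. S q *v h \<in> E q"
      show "K q \<subseteq> E q" using * ES[of q] q by auto
    next
      assume "K q \<subseteq> E q"
      then show "\<forall>h. S q *v h \<in> E q" using SE[of q] q by auto
    qed
    finally show ?thesis ..
  qed
  have "p \<in> V \<inter> V'" "V \<inter> V' \<subseteq> U" using V(2,3) V'(2) by auto
  then show "\<exists>W F. open W \<and> p \<in> W \<and> W \<subseteq> U \<and> (\<forall>f\<in>F. chol f W) \<and> (\<forall>q\<in>W. K q \<subseteq> E q \<longleftrightarrow> (\<forall>f\<in>F. f q = 0))"
    using o FV KE by (intro exI[of _ "V \<inter> V'"] exI[of _ F] conjI) (assumption | rule ballI)+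
qed

lemma hsections_tau:
  assumes X: "X \<in> hsections U (tau_push E) p" and U: "cnjv ` U = U"
  shows "(\<lambda>q. cnjv (X (cnjv q))) \<in> hsections U E (cnjv p)"
proof -
  obtain V where V: "p \<in> V" "V \<subseteq> U" "holo_on X V" "\<And>q. q \<in> V \<Longrightarrow> X q \<in> tau_push E q"
    using X unfolding hsections_def by blast
  have "cnjv (X (cnjv q)) \<in> E q" if "q \<in> cnjv ` V" for q
  proof -
    have "cnjv q \<in> V" using that by auto
    then show ?thesis using V(4)[of "cnjv q"] unfolding tau_push_def by auto
  qed
  then show ?thesis
    unfolding hsections_def using V(1,2) U holo_on_cnjv[OF V(3)]
    by (intro CollectI exI[of _ "cnjv ` V"]) blast
qed

lemma involutive_tau:
  assumes E: "\<And>p X Y. p \<in> U \<Longrightarrow> X \<in> hsections U E p \<Longrightarrow> Y \<in> hsections U E p \<Longrightarrow> hbracket X Y p \<in> E p"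
    and U: "cnjv ` U = U" and p: "p \<in> U"
    and X: "X \<in> hsections U (tau_push E) p" and Y: "Y \<in> hsections U (tau_push E) p"
  shows "hbracket X Y p \<in> tau_push E p"
proof -
  let ?X = "\<lambda>q. cnjv (X (cnjv q))" and ?Y = "\<lambda>q. cnjv (Y (cnjv q))"
  have p': "cnjv p \<in> U" using p U by blast
  have "hbracket ?X ?Y (cnjv p) \<in> E (cnjv p)" by (rule E[OF p' hsections_tau[OF X U] hsections_tau[OF Y U]])
  moreover have "hbracket ?X ?Y (cnjv p) = cnjv (hbracket X Y p)"
  proof -
    have "deriv_at (\<lambda>q. cnjv (X (cnjv q))) (cnjv p) v = cnjv (deriv_at X p (cnjv v))"
      if "X \<in> hsections U (tau_push E) p" for X v
      using fun_cong[OF deriv_at_eq[OF deriv_cnjv[of X _ "cnjv p"]]] hsections_differentiable[OF that] by simp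
    then show ?thesis unfolding hbracket_def using X Y by simp
  qed
  ultimately show ?thesis unfolding tau_push_def by (metis cnjv_simps(1) imageI)
qed

text \<open>A frame transports the splitting of the symbol. In this way the contact space, defined
  as a union over the whole leaf, becomes a direct sum at each single point.\<close>

lemma symbol_iso_contact:
  assumes S: "cr_symbol n r S" and iso: "symbol_iso C S p \<phi>"
  shows "contactD C (leafproj C p) = gm1_pos_at C p + gm1_neg_at C p"
    and "gm1_pos_at C p \<inter> gm1_neg_at C p = {0}"
proof -
  have \<phi>: "clinear (snd \<phi>)" "bij_betw (snd \<phi>) UNIV (contactD C (leafproj C p))"
    and i: "snd \<phi> ` gm1_pos S = gm1_pos_at C p" "snd \<phi> ` gm1_neg S = gm1_neg_at C p"
    using iso unfolding symbol_iso_def heis_iso_def by auto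
  have gm: "gm1_pos S \<inter> gm1_neg S = {0}" "gm1_neg S + gm1_pos S = UNIV" using S unfolding cr_symbol_def by auto
  have add: "snd \<phi> (x + y) = snd \<phi> x + snd \<phi> y" for x y using vec.linear_add[OF \<phi>(1)] by blast
  have "snd \<phi> ` (gm1_neg S + gm1_pos S) = snd \<phi> ` gm1_pos S + snd \<phi> ` gm1_neg S"
  proof (intro subset_antisym subsetI)
    fix z assume "z \<in> snd \<phi> ` (gm1_neg S + gm1_pos S)"
    then obtain a b where "a \<in> gm1_neg S" "b \<in> gm1_pos S" "z = snd \<phi> b + snd \<phi> a"
      using add by (auto elim!: set_plus_elim simp: add.commute)
    then show "z \<in> snd \<phi> ` gm1_pos S + snd \<phi> ` gm1_neg S" by (metis imageI set_plus_intro)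
  next
    fix z assume "z \<in> snd \<phi> ` gm1_pos S + snd \<phi> ` gm1_neg S"
    then obtain a b where "a \<in> gm1_neg S" "b \<in> gm1_pos S" "z = snd \<phi> (a + b)"
      using add by (auto elim!: set_plus_elim simp: add.commute)
    then show "z \<in> snd \<phi> ` (gm1_neg S + gm1_pos S)" by (metis imageI set_plus_intro)
  qed
  then show "contactD C (leafproj C p) = gm1_pos_at C p + gm1_neg_at C p"
    using \<phi>(2) gm(2) i unfolding bij_betw_def by simp
  have "snd \<phi> ` gm1_pos S \<inter> snd \<phi> ` gm1_neg S = snd \<phi> ` (gm1_pos S \<inter> gm1_neg S)"
    using \<phi>(2) unfolding bij_betw_def by (blast dest: inj_onD)
  then show "gm1_pos_at C p \<inter> gm1_neg_at C p = {0}"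
    unfolding i gm using vec.linear_0[OF \<phi>(1)] by simp
qed

lemma leaf_pairs:
  fixes C :: "('n::finite, 'm::finite) complexified" and S :: "('s::finite) symbol_data"
  assumes cr: "cr_structure n M H" and cx: "complexification n r M H C" and ls: "levi_leaf_space C"
    and S: "cr_symbol n r S" and const: "constant_symbol C S"
  shows "leaf_pair C (holH C) (holHbar C) (holK C) (holKbar C) n r"
    and "leaf_pair C (holHbar C) (holH C) (holKbar C) (holK C) n r"
proof -
  have U: "open (cmfd C)" and cnj: "cnjv ` cmfd C = cmfd C" and M: "cvec -` cmfd C = M"
    and comp: "\<And>B. B \<in> components (cmfd C) \<Longrightarrow> \<exists>x. cvec x \<in> B"
    and sH: "holo_subbundle n (cmfd C) (holH C)" and HM: "\<And>x. x \<in> M \<Longrightarrow> holH C (cvec x) = H x"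
    and sK: "holo_subbundle r (cmfd C) (holK C)" and KM: "\<And>x. x \<in> M \<Longrightarrow> holK C (cvec x) = levi_kernel M H x"
    and HH: "\<And>p. p \<in> cmfd C \<Longrightarrow> holH C p \<inter> holHbar C p = {0}"
    using cx unfolding complexification_def by blast+
  have hol: "vhol (leafproj C) (cmfd C)" and surj: "\<And>p. p \<in> cmfd C \<Longrightarrow> surj (dproj C p)"
    and ker: "\<And>p. p \<in> cmfd C \<Longrightarrow> {v. dproj C p v = 0} = holK C p + holKbar C p"
    using ls unfolding levi_leaf_space_def vhol_iff_holo_on by blast+
  have sH': "holo_subbundle n (cmfd C) (holHbar C)" and sK': "holo_subbundle r (cmfd C) (holKbar C)"
    using tau_push_subbundle sH sK cnj by blast+
  have KH: "holK C p \<subseteq> holH C p" if "p \<in> cmfd C" for p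
  proof (rule subbundle_inclusion[OF U comp sK sH _ that])
    fix x assume "cvec x \<in> cmfd C"
    then have "x \<in> M" using M by blast
    then show "holK C (cvec x) \<subseteq> holH C (cvec x)" unfolding HM[OF \<open>x \<in> M\<close>] KM[OF \<open>x \<in> M\<close>] levi_kernel_def by blast
  qed
  have KH': "holKbar C p \<subseteq> holHbar C p" if "p \<in> cmfd C" for p
  proof -
    have "cnjv p \<in> cmfd C" using that cnj by blast
    from KH[OF this] show ?thesis unfolding tau_push_def by blast
  qed
  have inv: "hbracket X Y p \<in> holH C p"
    if p: "p \<in> cmfd C" and X: "X \<in> hsections (cmfd C) (holH C) p" and Y: "Y \<in> hsections (cmfd C) (holH C) p" for p X Y
  proof (rule involutive_extension[OF U comp sH _ p X Y])
    fix x X Y assume x: "cvec x \<in> cmfd C"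
      and X: "X \<in> hsections (cmfd C) (holH C) (cvec x)" and Y: "Y \<in> hsections (cmfd C) (holH C) (cvec x)"
    have xM: "x \<in> M" using x M by blast
    have d: "rderiv (\<lambda>y. X (cvec y)) x v = deriv_at X (cvec x) v" if "X \<in> hsections (cmfd C) (holH C) (cvec x)" for X v
    proof -
      obtain V where V: "open V" "cvec x \<in> V" "V \<subseteq> cmfd C" "vhol X V" "\<And>q. q \<in> V \<Longrightarrow> X q \<in> holH C q"
        by (rule hsectionsE[OF \<open>X \<in> hsections (cmfd C) (holH C) (cvec x)\<close>]) (rule that)
      show ?thesis by (rule rderiv_cvec[OF V(4,2)])
    qed
    have "rbracket (\<lambda>y. X (cvec y)) (\<lambda>y. Y (cvec y)) x \<in> H x"
      using cr hsections_cvec[OF X M HM] hsections_cvec[OF Y M HM] xM unfolding cr_structure_def by blast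
    then show "hbracket X Y (cvec x) \<in> holH C (cvec x)"
      unfolding rbracket_def hbracket_def d[OF X] d[OF Y] HM[OF xM] .
  qed
  have inv': "hbracket X Y p \<in> holHbar C p"
    if "p \<in> cmfd C" and "X \<in> hsections (cmfd C) (holHbar C) p" and "Y \<in> hsections (cmfd C) (holHbar C) p" for p X Y
    by (rule involutive_tau[OF inv cnj that])
  have contact: "contactD C (leafproj C p) = dproj C p ` holH C p + dproj C p ` holHbar C p"
    and dHH: "dproj C p ` holH C p \<inter> dproj C p ` holHbar C p = {0}" if p: "p \<in> cmfd C" for p
  proof -
    obtain \<phi> where "symbol_iso C S p \<phi>" using const p unfolding constant_symbol_def by blast
    from symbol_iso_contact[OF S this]
    show "contactD C (leafproj C p) = dproj C p ` holH C p + dproj C p ` holHbar C p"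
      "dproj C p ` holH C p \<inter> dproj C p ` holHbar C p = {0}"
      unfolding gm1_pos_at_def gm1_neg_at_def .
  qed
  show "leaf_pair C (holH C) (holHbar C) (holK C) (holKbar C) n r"
    by (unfold_locales; (rule hol sH sK sH' sK' | erule (2) inv inv' | erule surj ker KH KH' HH contact dHH))
  have c1: "holHbar C p \<inter> holH C p = {0}" if "p \<in> cmfd C" for p using HH[OF that] by (simp only: Int_commute)
  have c2: "dproj C p ` holHbar C p \<inter> dproj C p ` holH C p = {0}" if "p \<in> cmfd C" for p
    using dHH[OF that] by (simp only: Int_commute)
  have c3: "contactD C (leafproj C p) = dproj C p ` holHbar C p + dproj C p ` holH C p" if "p \<in> cmfd C" for p
    using contact[OF that] by (simp only: add.commute)
  have c4: "{v. dproj C p v = 0} = holKbar C p + holK C p" if "p \<in> cmfd C" for p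
    using ker[OF that] by (simp only: add.commute)
  show "leaf_pair C (holHbar C) (holH C) (holKbar C) (holK C) n r"
    by (rule leaf_pair.intro; fact hol surj c4 sH' sH sK' sK KH' KH c1 inv' inv c3 c2)
qed

section \<open>The symbol in terms of matrices\<close>

text \<open>The matrix is \<open>2 f - 1\<close> for the projection \<open>f\<close> onto
  \<open>L\<close> along \<open>N\<close>.\<close>

lemma splitting_involution:
  fixes L N :: "(complex ^ 's) set"
  assumes L: "vec.subspace L" and N: "vec.subspace N" and LN: "L \<inter> N = {0}" and sum: "L + N = UNIV"
  obtains J :: "complex ^ 's ^ 's" where "\<And>x. J *v x = x \<longleftrightarrow> x \<in> L" "\<And>x. J *v x = - x \<longleftrightarrow> x \<in> N"
proof -
  have "\<exists>a. a \<in> L \<and> x - a \<in> N" for x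
  proof -
    obtain a b where "a \<in> L" "b \<in> N" "x = a + b" using sum set_plus_elim[of x L N] by blast
    then show ?thesis by (intro exI[of _ a]) simp
  qed
  then obtain f where f: "\<And>x. f x \<in> L" "\<And>x. x - f x \<in> N" by metis
  have uniq: "f x = a" if "a \<in> L" "x - a \<in> N" for x a
  proof -
    have "(x - a) - (x - f x) \<in> N" by (rule vec.subspace_diff[OF N that(2) f(2)])
    then have "f x - a \<in> L \<inter> N" using vec.subspace_diff[OF L f(1)[of x] that(1)] by simp
    then show ?thesis using LN by auto
  qed
  have "f (x + y) = f x + f y" for x y
  proof (rule uniq[OF vec.subspace_add[OF L f(1) f(1)]])
    show "x + y - (f x + f y) \<in> N" using vec.subspace_add[OF N f(2)[of x] f(2)[of y]] by (simp add: algebra_simps)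
  qed
  moreover have "f (c *s x) = c *s f x" for c x
  proof (rule uniq[OF vec.subspace_scale[OF L f(1)]])
    show "c *s x - c *s f x \<in> N"
      using vec.subspace_scale[OF N f(2)[of x], of c] by (simp add: vec.scale_right_diff_distrib)
  qed
  ultimately have lin: "clinear (\<lambda>x. f x + f x - x)"
    unfolding Vector_Spaces.linear_iff by (simp add: vec.vector_space_axioms vec_eq_iff algebra_simps)
  have J: "matrix (\<lambda>x. f x + f x - x) *v x = f x + f x - x" for x by (rule matrix_works[OF lin])
  have two: "a = b" if "a + a = b + b" for a b :: "complex ^ 's"
    using that by (simp add: vec_eq_iff)
  have "f x + f x - x = x \<longleftrightarrow> x \<in> L" for x
  proof
    assume "f x + f x - x = x"
    then have "f x + f x = x + x" by (simp add: diff_eq_eq)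
    then show "x \<in> L" using two f(1) by metis
  next
    assume "x \<in> L"
    then have "f x = x" by (intro uniq) (simp_all add: vec.subspace_0[OF N])
    then show "f x + f x - x = x" by simp
  qed
  moreover have "f x + f x - x = - x \<longleftrightarrow> x \<in> N" for x
  proof
    assume "f x + f x - x = - x"
    then have "f x + f x = 0 + 0" by (simp add: diff_eq_eq)
    then have "f x = 0" by (rule two)
    then show "x \<in> N" using f(2)[of x] by simp
  next
    assume "x \<in> N"
    then have "f x = 0" by (intro uniq) (simp_all add: vec.subspace_0[OF L])
    then show "f x + f x - x = - x" by simp
  qed
  ultimately show ?thesis using that[of "matrix (\<lambda>x. f x + f x - x)"] J by auto
qed

lemma endo_vector_space: "vector_space endo_scale"
  by unfold_locales (auto simp: fun_eq_iff vec.scale_right_distrib vec.scale_left_distrib)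

locale graded_symbol =
  fixes n r :: nat and S :: "('s::finite) symbol_data" and J0 :: "complex ^ 's ^ 's"
  assumes S: "cr_symbol n r S"
    and Jpos: "\<And>x. J0 *v x = x \<longleftrightarrow> x \<in> gm1_pos S" and Jneg: "\<And>x. J0 *v x = - x \<longleftrightarrow> x \<in> gm1_neg S"
begin

sublocale endo: vector_space endo_scale by (rule endo_vector_space)

lemma symp: "symplectic_form (form S)"
  and lagr: "lagrangian (form S) (gm1_pos S)" "lagrangian (form S) (gm1_neg S)"
  and gm1: "gm1_pos S \<inter> gm1_neg S = {0}" "gm1_neg S + gm1_pos S = UNIV"
  and sub0: "endo.subspace (g0_pos S)" "endo.subspace (g0_neg S)"
  and dim0: "endo.dim (g0_pos S) = r" "endo.dim (g0_neg S) = r"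
  and csp0: "g0_pos S \<subseteq> csp (form S)" "g0_neg S \<subseteq> csp (form S)"
  and posD: "\<And>A x. A \<in> g0_pos S \<Longrightarrow> x \<in> gm1_neg S \<Longrightarrow> A x \<in> gm1_pos S" "\<And>A x. A \<in> g0_pos S \<Longrightarrow> x \<in> gm1_pos S \<Longrightarrow> A x = 0"
  and negD: "\<And>A x. A \<in> g0_neg S \<Longrightarrow> x \<in> gm1_pos S \<Longrightarrow> A x \<in> gm1_neg S" "\<And>A x. A \<in> g0_neg S \<Longrightarrow> x \<in> gm1_neg S \<Longrightarrow> A x = 0"
  using S by (simp_all add: cr_symbol_def image_subset_iff)

lemma J0_split: obtains a b where "a \<in> gm1_neg S" "b \<in> gm1_pos S" "x = a + b"
  using gm1(2) set_plus_elim[of x "gm1_neg S" "gm1_pos S"] by blast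

lemma J0sq: "J0 ** J0 = mat 1"
proof -
  have "J0 *v (J0 *v x) = x" for x
  proof -
    obtain a b where ab: "a \<in> gm1_neg S" "b \<in> gm1_pos S" "x = a + b" by (rule J0_split)
    have "J0 *v a = - a" "J0 *v b = b" using ab Jpos Jneg by auto
    then show ?thesis unfolding ab(3) by (simp add: matrix_vector_right_distrib matrix_vector_mult_diff_distrib)
  qed
  then show ?thesis by (simp add: matrix_eq matrix_vector_mul_assoc[symmetric])
qed

text \<open>Both eigenspaces are Lagrangian, so only mixed terms survive, and in each of them
  exactly one argument changes its sign.\<close>

lemma J0csp: "form S (J0 *v x) (J0 *v y) = - form S x y"
proof -
  obtain a b where ab: "a \<in> gm1_neg S" "b \<in> gm1_pos S" "x = a + b" by (rule J0_split)
  obtain c d where cd: "c \<in> gm1_neg S" "d \<in> gm1_pos S" "y = c + d" by (rule J0_split)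
  have z: "form S a c = 0" "form S b d = 0" using lagr ab cd unfolding lagrangian_def by blast+
  have "J0 *v x = b - a" "J0 *v y = d - c"
    using ab cd Jpos[of b] Jpos[of d] Jneg[of a] Jneg[of c] by (simp_all add: matrix_vector_right_distrib)
  then show ?thesis
    unfolding ab(3) cd(3) using z by (simp add: symp_add[OF symp] symp_diff[OF symp])
qed

lemma clinear_g0: "A \<in> g0_pos S \<or> A \<in> g0_neg S \<Longrightarrow> clinear A"
  using csp0 unfolding csp_def by blast

definition G0 :: "(complex ^ 's ^ 's) set"
  where "G0 = {B. (*v) B \<in> g0_neg S + g0_pos S}"

lemma matrix_pos_iff:
  assumes "A \<in> g0_pos S \<or> A \<in> g0_neg S"
  shows "(*v) (matrix A) = A"
  using clinear_g0[OF assms] by (simp add: fun_eq_iff matrix_works)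

lemma csp_matrix: "(*v) B \<in> csp (form S) \<longleftrightarrow> B \<in> csp_mat (form S)"
  unfolding csp_def csp_mat_def by (simp add: matrix_vector_mul_linear_gen)

lemma pos_J0: "(*v) B \<in> g0_pos S \<Longrightarrow> J0 ** B = B \<and> B ** J0 = - B"
  and neg_J0: "(*v) B \<in> g0_neg S \<Longrightarrow> J0 ** B = - B \<and> B ** J0 = B"
proof -
  have mv: "(- B) *v x = - (B *v x)" "B *v (- x) = - (B *v x)" for B :: "complex ^ 's ^ 's" and x
    using bounded_bilinear.minus_left[OF bounded_bilinear_matrix_vector_mult]
      bounded_bilinear.minus_right[OF bounded_bilinear_matrix_vector_mult] by blast+
  show "J0 ** B = B \<and> B ** J0 = - B" if B: "(*v) B \<in> g0_pos S"
  proof -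
    have "J0 *v (B *v x) = B *v x \<and> B *v (J0 *v x) = - (B *v x)" for x
    proof -
      obtain a b where ab: "a \<in> gm1_neg S" "b \<in> gm1_pos S" "x = a + b" by (rule J0_split)
      have "J0 *v a = - a" "J0 *v b = b" "B *v b = 0" "J0 *v (B *v a) = B *v a"
        using ab Jpos Jneg posD[OF B] by auto
      then show ?thesis unfolding ab(3) by (simp add: matrix_vector_right_distrib matrix_vector_mult_diff_distrib mv)
    qed
    then show ?thesis by (simp add: matrix_eq matrix_vector_mul_assoc[symmetric] mv)
  qed
  show "J0 ** B = - B \<and> B ** J0 = B" if B: "(*v) B \<in> g0_neg S"
  proof -
    have "J0 *v (B *v x) = - (B *v x) \<and> B *v (J0 *v x) = B *v x" for x
    proof -
      obtain a b where ab: "a \<in> gm1_neg S" "b \<in> gm1_pos S" "x = a + b" by (rule J0_split)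
      have "J0 *v a = - a" "J0 *v b = b" "B *v a = 0" "J0 *v (B *v b) = - (B *v b)"
        using ab Jpos Jneg negD[OF B] by auto
      then show ?thesis unfolding ab(3) by (simp add: matrix_vector_right_distrib matrix_vector_mult_diff_distrib mv)
    qed
    then show ?thesis by (simp add: matrix_eq matrix_vector_mul_assoc[symmetric] mv)
  qed
qed

lemma G0_split:
  assumes "B \<in> G0"
  obtains a b where "(*v) a \<in> g0_neg S" "(*v) b \<in> g0_pos S" "B = a + b"
proof -
  obtain f g where fg: "f \<in> g0_neg S" "g \<in> g0_pos S" "(*v) B = f + g"
    using assms unfolding G0_def by (auto elim: set_plus_elim)
  have "B = matrix f + matrix g"
    using fg fun_cong[OF fg(3)] matrix_pos_iff[of f] matrix_pos_iff[of g]
    by (simp add: matrix_eq matrix_vector_mult_add_rdistrib)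
  then show ?thesis using that[of "matrix f" "matrix g"] fg matrix_pos_iff by metis
qed

lemma G0I:
  assumes "(*v) a \<in> g0_neg S" "(*v) b \<in> g0_pos S"
  shows "a + b \<in> G0"
proof -
  have "(*v) (a + b) = (*v) a + (*v) b" by (simp add: fun_eq_iff matrix_vector_mult_add_rdistrib)
  then show ?thesis unfolding G0_def using assms by (simp add: set_plus_intro)
qed

lemma zero_mem: "(*v) (0 :: complex ^ 's ^ 's) \<in> g0_neg S" "(*v) (0 :: complex ^ 's ^ 's) \<in> g0_pos S"
proof -
  have "(*v) (0 :: complex ^ 's ^ 's) = 0" by (simp add: fun_eq_iff)
  then show "(*v) (0 :: complex ^ 's ^ 's) \<in> g0_neg S" "(*v) (0 :: complex ^ 's ^ 's) \<in> g0_pos S"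
    using endo.subspace_0[OF sub0(1)] endo.subspace_0[OF sub0(2)] by auto
qed

text \<open>Left multiplication by \<open>J0\<close> acts as 1 on the summand from
  \<open>g0_pos\<close> and as -1 on the one from \<open>g0_neg\<close>; the pair \<open>J0\<close>,
  \<open>G0\<close> thus retains both summands.\<close>

lemma pos_iff: "(*v) B \<in> g0_pos S \<longleftrightarrow> B \<in> G0 \<and> J0 ** B = B"
proof
  assume "(*v) B \<in> g0_pos S"
  then show "B \<in> G0 \<and> J0 ** B = B" using G0I[OF zero_mem(1)] pos_J0 by simp
next
  assume B: "B \<in> G0 \<and> J0 ** B = B"
  then obtain a b where ab: "(*v) a \<in> g0_neg S" "(*v) b \<in> g0_pos S" "B = a + b" by (blast elim: G0_split)
  have "- a + b = a + b" using B ab pos_J0[OF ab(2)] neg_J0[OF ab(1)] by (simp add: matrix_add_ldistrib)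
  then have "a = 0" by (simp add: vec_eq_iff)
  then show "(*v) B \<in> g0_pos S" using ab by simp
qed

lemma neg_iff: "(*v) B \<in> g0_neg S \<longleftrightarrow> B \<in> G0 \<and> J0 ** B = - B"
proof
  assume "(*v) B \<in> g0_neg S"
  then show "B \<in> G0 \<and> J0 ** B = - B" using G0I[OF _ zero_mem(2), of B] neg_J0 by simp
next
  assume B: "B \<in> G0 \<and> J0 ** B = - B"
  then obtain a b where ab: "(*v) a \<in> g0_neg S" "(*v) b \<in> g0_pos S" "B = a + b" by (blast elim: G0_split)
  have "- a + b = - a - b" using B ab pos_J0[OF ab(2)] neg_J0[OF ab(1)] by (simp add: matrix_add_ldistrib)
  then have "b = 0" by (simp add: vec_eq_iff)
  then show "(*v) B \<in> g0_neg S" using ab by simp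
qed

lemma G0anti: "B \<in> G0 \<Longrightarrow> J0 ** B = - (B ** J0)"
  by (elim G0_split) (simp add: matrix_expand pos_J0 neg_J0)

lemma G0_scale: "B \<in> G0 \<Longrightarrow> (*v) B' = endo_scale c ((*v) B) \<Longrightarrow> B' \<in> G0"
proof (elim G0_split)
  fix a b assume B': "(*v) B' = endo_scale c ((*v) B)" and ab: "(*v) a \<in> g0_neg S" "(*v) b \<in> g0_pos S" "B = a + b"
  have "endo_scale c ((*v) B) = endo_scale c ((*v) a) + endo_scale c ((*v) b)"
    unfolding ab(3) by (simp add: fun_eq_iff matrix_vector_mult_add_rdistrib vec.scale_right_distrib)
  then show "B' \<in> G0"
    unfolding G0_def B' using endo.subspace_scale[OF sub0(2) ab(1), of c] endo.subspace_scale[OF sub0(1) ab(2), of c]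
    by (simp add: B' set_plus_intro)
qed

lemma subspace_G0: "subspace G0"
proof (rule subspaceI)
  show "0 \<in> G0" using G0I[OF zero_mem] by simp
  fix B B' assume B: "B \<in> G0"
  show "c *\<^sub>R B \<in> G0" for c
    by (rule G0_scale[OF B, of _ "of_real c"])
      (simp add: fun_eq_iff vec_eq_iff matrix_vector_mult_def sum_distrib_left scaleR_conv_of_real[where 'a=complex] mult.assoc)
  assume B': "B' \<in> G0"
  from B B' show "B + B' \<in> G0"
  proof (elim G0_split)
    fix a b a' b' assume ab: "(*v) a \<in> g0_neg S" "(*v) b \<in> g0_pos S" "B = a + b"
      "(*v) a' \<in> g0_neg S" "(*v) b' \<in> g0_pos S" "B' = a' + b'"
    have s: "(*v) (x + y) = (*v) x + (*v) y" for x y :: "complex ^ 's ^ 's"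
      by (simp add: fun_eq_iff matrix_vector_mult_add_rdistrib)
    have "B + B' = (a + a') + (b + b')" using ab by simp
    then show "B + B' \<in> G0"
      using G0I[of "a + a'" "b + b'"] endo.subspace_add[OF sub0(2) ab(1,4)] endo.subspace_add[OF sub0(1) ab(2,5)]
      by (simp add: s)
  qed
qed

lemma G0csp: "G0 \<subseteq> csp_mat (form S)"
proof
  fix B assume "B \<in> G0"
  then obtain a b where ab: "(*v) a \<in> g0_neg S" "(*v) b \<in> g0_pos S" "B = a + b" by (rule G0_split)
  have "a \<in> csp_mat (form S)" "b \<in> csp_mat (form S)" using ab csp0 csp_matrix by blast+
  then show "B \<in> csp_mat (form S)" unfolding ab(3) using subspace_csp_mat[OF symp] subspace_add by blast
qed

lemma commutator_matrix: "commutator ((*v) A) ((*v) B) = (*v) (A ** B - B ** A)"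
  by (simp add: commutator_def fun_eq_iff matrix_vector_mult_diff_rdistrib matrix_vector_mul_assoc)

text \<open>Commuting with \<open>J0\<close> means preserving both eigenspaces. It also makes the
  commutator with the matrix respect the two eigenvalues of left multiplication by
  \<open>J0\<close>, so stabilising \<open>G0\<close> stabilises each summand.\<close>

lemma g00_matrix: "(*v) A \<in> g00 S \<longleftrightarrow> A \<in> stab (form S) J0 G0"
proof
  assume A: "(*v) A \<in> g00 S"
  have comm: "A ** J0 = J0 ** A"
  proof -
    have "A *v (J0 *v x) = J0 *v (A *v x)" for x
    proof -
      obtain a b where ab: "a \<in> gm1_neg S" "b \<in> gm1_pos S" "x = a + b" by (rule J0_split)
      have "A *v a \<in> gm1_neg S" "A *v b \<in> gm1_pos S" using A ab unfolding g00_def by auto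
      then have "J0 *v a = - a" "J0 *v b = b" "J0 *v (A *v a) = - (A *v a)" "J0 *v (A *v b) = A *v b"
        using ab Jpos Jneg by auto
      then show ?thesis unfolding ab(3)
        by (simp add: matrix_vector_right_distrib matrix_vector_mult_diff_distrib bounded_bilinear.minus_right[OF bounded_bilinear_matrix_vector_mult])
    qed
    then show ?thesis by (simp add: matrix_eq matrix_vector_mul_assoc[symmetric])
  qed
  have "A ** B - B ** A \<in> G0" if "B \<in> G0" for B
  proof -
    obtain a b where ab: "(*v) a \<in> g0_neg S" "(*v) b \<in> g0_pos S" "B = a + b"
      by (rule G0_split[OF \<open>B \<in> G0\<close>]) (rule that)
    have "(*v) (A ** a - a ** A) \<in> g0_neg S" "(*v) (A ** b - b ** A) \<in> g0_pos S"
      using A ab unfolding g00_def commutator_matrix[symmetric] by auto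
    from G0I[OF this] show ?thesis unfolding ab(3) by (simp add: matrix_expand algebra_simps)
  qed
  moreover have "A \<in> csp_mat (form S)" using A csp_matrix unfolding g00_def by blast
  ultimately show "A \<in> stab (form S) J0 G0" using comm unfolding stab_def by blast
next
  assume A: "A \<in> stab (form S) J0 G0"
  then have c: "A \<in> csp_mat (form S)" "A ** J0 = J0 ** A" "\<And>B. B \<in> G0 \<Longrightarrow> A ** B - B ** A \<in> G0"
    unfolding stab_def by auto
  have AJ: "A *v (J0 *v x) = J0 *v (A *v x)" for x using c(2) by (simp add: matrix_vector_mul_assoc)
  have p: "A *v x \<in> gm1_pos S" if "x \<in> gm1_pos S" for x using AJ[of x] that Jpos by metis
  have n: "A *v x \<in> gm1_neg S" if "x \<in> gm1_neg S" for x
    using AJ[of x] that Jneg bounded_bilinear.minus_right[OF bounded_bilinear_matrix_vector_mult, of A x] by metis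
  have cp: "commutator ((*v) A) B \<in> g0_pos S" if "B \<in> g0_pos S" for B
  proof -
    have B: "(*v) (matrix B) = B" using that matrix_pos_iff by blast
    then have m: "matrix B \<in> G0" "J0 ** matrix B = matrix B" using that pos_iff[of "matrix B"] by auto
    have "J0 ** (A ** matrix B) = A ** matrix B" "J0 ** (matrix B ** A) = matrix B ** A"
      using m(2) c(2) by (metis matrix_mul_assoc)+
    then have "J0 ** (A ** matrix B - matrix B ** A) = A ** matrix B - matrix B ** A"
      by (simp add: matrix_diff_simps)
    then show ?thesis using c(3)[OF m(1)] pos_iff commutator_matrix[of A "matrix B"] B by simp
  qed
  have cn: "commutator ((*v) A) B \<in> g0_neg S" if "B \<in> g0_neg S" for B
  proof -
    have B: "(*v) (matrix B) = B" using that matrix_pos_iff by blast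
    then have m: "matrix B \<in> G0" "J0 ** matrix B = - matrix B" using that neg_iff[of "matrix B"] by auto
    have "J0 ** (A ** matrix B) = - (A ** matrix B)" "J0 ** (matrix B ** A) = - (matrix B ** A)"
      using m(2) c(2) by (metis matrix_minus_simps matrix_mul_assoc)+
    then have "J0 ** (A ** matrix B - matrix B ** A) = - (A ** matrix B - matrix B ** A)"
      by (simp add: matrix_diff_simps)
    then show ?thesis using c(3)[OF m(1)] neg_iff commutator_matrix[of A "matrix B"] B by simp
  qed
  show "(*v) A \<in> g00 S" unfolding g00_def using csp_matrix c(1) p n cp cn by blast
qed

end

lemma graded_symbol_ex:
  assumes "cr_symbol n r S"
  obtains J0 where "graded_symbol n r S J0"
proof -
  have "vec.subspace (gm1_pos S)" "vec.subspace (gm1_neg S)" "gm1_pos S \<inter> gm1_neg S = {0}"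
    "gm1_pos S + gm1_neg S = UNIV"
    using assms unfolding cr_symbol_def lagrangian_def by (auto simp: add.commute)
  then obtain J where "\<And>x. J *v x = x \<longleftrightarrow> x \<in> gm1_pos S" "\<And>x. J *v x = - x \<longleftrightarrow> x \<in> gm1_neg S"
    by (rule splitting_involution) (rule that)
  then show ?thesis by (intro that[of J] graded_symbol.intro[OF assms])
qed

section \<open>The moving splitting of the contact space along a leaf\<close>

text \<open>For a section of \<open>B\<close>, a direction in \<open>K\<close> moves it into the
  image of \<open>A\<close> exactly by the adjoint action, and a direction in \<open>L\<close> keeps
  it in the image of \<open>B\<close>.\<close>

lemma (in leaf_pair) dsec_split:
  assumes p: "p \<in> cmfd C" and k: "k \<in> K p" and l: "l \<in> L p" and Y: "Y \<in> hsections (cmfd C) B p"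
  obtains u w where "u \<in> dproj C p ` A p" "w \<in> dproj C p ` B p" "deriv_at (dsec Y) p (k + l) = u + w"
    "\<And>a. a \<in> A p \<Longrightarrow> ad_leaf C A B K p k (dproj C p a + dproj C p (Y p)) = u"
proof -
  have "deriv_at (dsec Y) p k \<in> contactD C (leafproj C p)"
    by (rule dsec_contact[OF p]) (use kernel_mem[OF p] k Y in auto)
  then obtain u w where u: "u \<in> dproj C p ` A p" and w: "w \<in> dproj C p ` B p"
    and uw: "deriv_at (dsec Y) p k = u + w"
    unfolding contact[OF p] by (rule set_plus_elim) (rule that)
  have "deriv_at (dsec Y) p k - u \<in> dproj C p ` B p" using uw w by simp
  then have ad: "ad_leaf C A B K p k (dproj C p a + dproj C p (Y p)) = u" if "a \<in> A p" for a
    by (rule ad_leaf_eq[OF p k that Y u])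
  have l': "deriv_at (dsec Y) p l \<in> dproj C p ` B p" by (rule dsec_L_B[OF p l Y])
  have "deriv_at (dsec Y) p (k + l) = u + (w + deriv_at (dsec Y) p l)"
    using uw linear_add[OF has_derivative_linear[OF dsec_deriv[OF Y]]] deriv_at_eq[OF dsec_deriv[OF Y]] by (simp add: add.assoc)
  then show ?thesis
    by (rule that[OF u vec.subspace_add[OF subspace_image[OF p subbundle_subspace[OF sB p]] w l'] _ ad])
qed

lemma mhol_jacobian: "vhol f U \<Longrightarrow> mhol (\<lambda>q. matrix (deriv_at f q)) U"
  using vhol_deriv[of f U] unfolding mhol_def vhol_def matrix_def by simp

text \<open>Differentiating \<open>J z = c z\<close>. For an involution and \<open>c = 1\<close> or
  \<open>c = -1\<close> the right-hand side sees only the component of \<open>z'\<close> in the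
  opposite eigenspace.\<close>

lemma eigenvector_derivative:
  fixes J :: "complex ^ 'a \<Rightarrow> complex ^ 's ^ 's"
  assumes J: "mhol J V" and q: "q \<in> V" and z: "(z has_derivative z') (at q)"
    and Jz: "\<And>q. q \<in> V \<Longrightarrow> J q *v z q = c *\<^sub>R z q"
  shows "deriv_at J q v *v z q = c *\<^sub>R z' v - J q *v z' v"
proof -
  have 1: "((\<lambda>q. J q *v z q) has_derivative (\<lambda>v. J q *v z' v + deriv_at J q v *v z q)) (at q)"
    by (rule has_derivative_matrix_vector_mult[OF mhol_has_derivative[OF J q] z])
  have 2: "((\<lambda>q. J q *v z q) has_derivative (\<lambda>v. c *\<^sub>R z' v)) (at q)"
    by (rule has_derivative_transform_within_open[OF has_derivative_scaleR_right[OF z] mhol_open[OF J] q])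
      (simp add: Jz)
  from fun_cong[OF has_derivative_unique[OF 1 2], of v] show ?thesis by (simp add: algebra_simps)
qed

locale leaf_bridge =
  pos: leaf_pair C "holH C" "holHbar C" "holK C" "holKbar C" n r +
  neg: leaf_pair C "holHbar C" "holH C" "holKbar C" "holK C" n r +
  graded_symbol n r S J0
  for C :: "('n::finite, 'm::finite) complexified" and n r :: nat and S :: "('s::finite) symbol_data" and J0 +
  fixes p :: "complex ^ 'n" and \<phi>\<^sub>0 :: "('m, 's) frame"
  assumes p: "p \<in> cmfd C" and iso: "symbol_iso C S p \<phi>\<^sub>0"
begin

abbreviation "\<gamma> \<equiv> leafproj C p"
abbreviation "ad_pos \<equiv> ad_leaf C (holH C) (holHbar C) (holK C)"
abbreviation "ad_neg \<equiv> ad_leaf C (holHbar C) (holH C) (holKbar C)"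

lemma iso_linear: "clinear (snd \<phi>\<^sub>0)" and iso_bij: "bij_betw (snd \<phi>\<^sub>0) UNIV (contactD C \<gamma>)"
  and iso_pos: "snd \<phi>\<^sub>0 ` gm1_pos S = gm1_pos_at C p" and iso_neg: "snd \<phi>\<^sub>0 ` gm1_neg S = gm1_neg_at C p"
  using iso unfolding symbol_iso_def heis_iso_def by auto

lemma iso_inj: "snd \<phi>\<^sub>0 x = snd \<phi>\<^sub>0 y \<longleftrightarrow> x = y"
  using iso_bij unfolding bij_betw_def inj_on_def by blast

lemma contact_at: "q \<in> cmfd C \<Longrightarrow> leafproj C q = \<gamma> \<Longrightarrow> contactD C \<gamma> = gm1_pos_at C q + gm1_neg_at C q"
  using pos.contact[of q] unfolding gm1_pos_at_def gm1_neg_at_def by simp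

lemma gm1_subspaces: "q \<in> cmfd C \<Longrightarrow> vec.subspace (gm1_pos_at C q)" "q \<in> cmfd C \<Longrightarrow> vec.subspace (gm1_neg_at C q)"
  unfolding gm1_pos_at_def gm1_neg_at_def
  using pos.subspace_image subbundle_subspace[OF pos.sA] subbundle_subspace[OF pos.sB] by blast+

lemma gm1_disjoint: "q \<in> cmfd C \<Longrightarrow> z \<in> gm1_pos_at C q \<Longrightarrow> z \<in> gm1_neg_at C q \<Longrightarrow> z = 0"
  unfolding gm1_pos_at_def gm1_neg_at_def using pos.dAB[of q] by blast

lemma gm1_contact:
  assumes "q \<in> cmfd C" "leafproj C q = \<gamma>" "z \<in> gm1_pos_at C q \<or> z \<in> gm1_neg_at C q"
  shows "z \<in> contactD C \<gamma>"
proof -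
  have "0 \<in> gm1_pos_at C q" "0 \<in> gm1_neg_at C q" using gm1_subspaces assms(1) vec.subspace_0 by blast+
  then show ?thesis
    unfolding contact_at[OF assms(1,2)] using assms(3) set_plus_intro[of z "gm1_pos_at C q" 0 "gm1_neg_at C q"]
      set_plus_intro[of 0 "gm1_pos_at C q" z "gm1_neg_at C q"] by auto
qed

lemma iso_left_inverse:
  obtains R :: "complex ^ 'm ^ 's" where "\<And>x. R *v snd \<phi>\<^sub>0 x = x" "\<And>z. z \<in> contactD C \<gamma> \<Longrightarrow> snd \<phi>\<^sub>0 (R *v z) = z"
proof -
  have "inj (snd \<phi>\<^sub>0)" using iso_bij unfolding bij_betw_def by blast
  then obtain g where g: "clinear g" "g \<circ> snd \<phi>\<^sub>0 = id" using vec.linear_injective_left_inverse[OF iso_linear] by blast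
  have R: "matrix g *v snd \<phi>\<^sub>0 x = x" for x using matrix_works[OF g(1)] g(2) by (simp add: fun_eq_iff)
  show ?thesis
  proof (rule that[OF R])
    fix z assume "z \<in> contactD C \<gamma>"
    then obtain x where "z = snd \<phi>\<^sub>0 x" using iso_bij unfolding bij_betw_def by blast
    then show "snd \<phi>\<^sub>0 (matrix g *v z) = z" using R by simp
  qed
qed

lemma adapted_sections:
  obtains V and X Z :: "complex ^ 'n \<Rightarrow> complex ^ 's ^ 'n" where "open V" "p \<in> V" "V \<subseteq> cmfd C" "mhol X V" "mhol Z V"
    "\<And>q y. q \<in> V \<Longrightarrow> X q *v y \<in> holH C q" "\<And>q y. q \<in> V \<Longrightarrow> Z q *v y \<in> holHbar C q"
    "\<And>q y. y \<in> gm1_neg S \<Longrightarrow> X q *v y = 0" "\<And>q y. y \<in> gm1_pos S \<Longrightarrow> Z q *v y = 0"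
    "\<And>y. y \<in> gm1_pos S \<Longrightarrow> dproj C p (X p *v y) = snd \<phi>\<^sub>0 y"
    "\<And>y. y \<in> gm1_neg S \<Longrightarrow> dproj C p (Z p *v y) = snd \<phi>\<^sub>0 y"
proof -
  obtain V1 and S1 L1 :: "complex ^ 'n \<Rightarrow> complex ^ 'n ^ 'n" where V1: "open V1" "p \<in> V1" "V1 \<subseteq> cmfd C" "mhol S1 V1" "mhol L1 V1"
    and S1: "\<And>q h. q \<in> V1 \<Longrightarrow> S1 q *v h \<in> holH C q" "\<And>h. h \<in> holH C p \<Longrightarrow> S1 p *v h = h"
    and "\<And>q. q \<in> V1 \<Longrightarrow> holH C q = (\<lambda>h. S1 q *v h) ` holH C p" "\<And>q. q \<in> V1 \<Longrightarrow> holH C q = {z. L1 q *v z = 0}"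
    by (rule subbundle_local[OF pos.sA p]) (rule that)
  obtain V2 and S2 L2 :: "complex ^ 'n \<Rightarrow> complex ^ 'n ^ 'n" where V2: "open V2" "p \<in> V2" "V2 \<subseteq> cmfd C" "mhol S2 V2" "mhol L2 V2"
    and S2: "\<And>q h. q \<in> V2 \<Longrightarrow> S2 q *v h \<in> holHbar C q" "\<And>h. h \<in> holHbar C p \<Longrightarrow> S2 p *v h = h"
    and "\<And>q. q \<in> V2 \<Longrightarrow> holHbar C q = (\<lambda>h. S2 q *v h) ` holHbar C p" "\<And>q. q \<in> V2 \<Longrightarrow> holHbar C q = {z. L2 q *v z = 0}"
    by (rule subbundle_local[OF pos.sB p]) (rule that)
  obtain f where f: "range f \<subseteq> holH C p" "clinear f" "\<And>v. v \<in> dproj C p ` holH C p \<Longrightarrow> dproj C p (f v) = v"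
    using vec.linear_exists_right_inverse_on[OF pos.clinear_dproj[OF p] subbundle_subspace[OF pos.sA p]] by blast
  obtain g where g: "range g \<subseteq> holHbar C p" "clinear g" "\<And>v. v \<in> dproj C p ` holHbar C p \<Longrightarrow> dproj C p (g v) = v"
    using vec.linear_exists_right_inverse_on[OF pos.clinear_dproj[OF p] subbundle_subspace[OF pos.sB p]] by blast
  \<comment> \<open>The matrices \<open>(1 + J0) / 2\<close> and \<open>(1 - J0) / 2\<close> project
    onto the two halves of the symbol, so \<open>F\<close> and \<open>G\<close> vanish on opposite
    halves.\<close>
  define F where "F = matrix f ** matrix (snd \<phi>\<^sub>0) ** (mat (1/2) ** (mat 1 + J0))"
  define G where "G = matrix g ** matrix (snd \<phi>\<^sub>0) ** (mat (1/2) ** (mat 1 - J0))"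
  have half: "mat (1/2) *v (y + y) = y" for y :: "complex ^ 's"
    by (simp add: vec_eq_iff matrix_vector_mult_def mat_def if_distrib[of "\<lambda>x. x * _"] cong: if_cong)
  have F: "F *v y = f (snd \<phi>\<^sub>0 (mat (1/2) *v (y + J0 *v y)))" for y
    unfolding F_def by (simp add: matrix_vector_mul_assoc[symmetric] matrix_works[OF f(2)] matrix_works[OF iso_linear] matrix_vector_mult_add_rdistrib)
  have G: "G *v y = g (snd \<phi>\<^sub>0 (mat (1/2) *v (y - J0 *v y)))" for y
    unfolding G_def by (simp add: matrix_vector_mul_assoc[symmetric] matrix_works[OF g(2)] matrix_works[OF iso_linear] matrix_vector_mult_diff_rdistrib)
  note lin0 = vec.linear_0[OF f(2)] vec.linear_0[OF g(2)] vec.linear_0[OF iso_linear]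
  have Fp: "F *v y = f (snd \<phi>\<^sub>0 y)" "G *v y = 0" if "y \<in> gm1_pos S" for y
  proof -
    have "J0 *v y = y" using that Jpos by simp
    then show "F *v y = f (snd \<phi>\<^sub>0 y)" "G *v y = 0" unfolding F G using half by (simp_all add: lin0)
  qed
  have Fn: "F *v y = 0" "G *v y = g (snd \<phi>\<^sub>0 y)" if "y \<in> gm1_neg S" for y
  proof -
    have "J0 *v y = - y" using that Jneg by simp
    then show "F *v y = 0" "G *v y = g (snd \<phi>\<^sub>0 y)" unfolding F G using half by (simp_all add: lin0)
  qed
  have o: "open (V1 \<inter> V2)" using V1 V2 by blast
  have Xm: "mhol (\<lambda>q. S1 q ** F) (V1 \<inter> V2)" "mhol (\<lambda>q. S2 q ** G) (V1 \<inter> V2)"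
    by (intro mhol_mult mhol_const o mhol_subset[OF V1(4) o] mhol_subset[OF V2(4) o]; blast)+
  show ?thesis
  proof (rule that[OF o _ _ Xm])
    show "p \<in> V1 \<inter> V2" "V1 \<inter> V2 \<subseteq> cmfd C" using V1 V2 by auto
    show "(S1 q ** F) *v y \<in> holH C q" if "q \<in> V1 \<inter> V2" for q y
      using S1(1)[of q] that by (simp add: matrix_vector_mul_assoc[symmetric])
    show "(S2 q ** G) *v y \<in> holHbar C q" if "q \<in> V1 \<inter> V2" for q y
      using S2(1)[of q] that by (simp add: matrix_vector_mul_assoc[symmetric])
    show "(S1 q ** F) *v y = 0" if "y \<in> gm1_neg S" for q y using Fn[OF that] by (simp add: matrix_vector_mul_assoc[symmetric])
    show "(S2 q ** G) *v y = 0" if "y \<in> gm1_pos S" for q y using Fp[OF that] by (simp add: matrix_vector_mul_assoc[symmetric])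
    show "dproj C p ((S1 p ** F) *v y) = snd \<phi>\<^sub>0 y" if y: "y \<in> gm1_pos S" for y
    proof -
      have "snd \<phi>\<^sub>0 y \<in> dproj C p ` holH C p" using iso_pos y unfolding gm1_pos_at_def by blast
      moreover have "S1 p *v f (snd \<phi>\<^sub>0 y) = f (snd \<phi>\<^sub>0 y)" using S1(2) f(1) by blast
      ultimately show ?thesis using f(3) by (simp add: matrix_vector_mul_assoc[symmetric] Fp(1)[OF y])
    qed
    show "dproj C p ((S2 p ** G) *v y) = snd \<phi>\<^sub>0 y" if y: "y \<in> gm1_neg S" for y
    proof -
      have "snd \<phi>\<^sub>0 y \<in> dproj C p ` holHbar C p" using iso_neg y unfolding gm1_neg_at_def by blast
      moreover have "S2 p *v g (snd \<phi>\<^sub>0 y) = g (snd \<phi>\<^sub>0 y)" using S2(2) g(1) by blast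
      ultimately show ?thesis using g(3) by (simp add: matrix_vector_mul_assoc[symmetric] Fn(2)[OF y])
    qed
  qed
qed

text \<open>Read in the frame at \<open>p\<close>, the splitting at \<open>q\<close> becomes an
  involution of the symbol space. It is extended holomorphically to an open set, so that ordinary
  derivatives are available, while its eigenspaces are identified with the splitting along the leaf
  of \<open>p\<close>. Its derivative there is twice the adjoint action, up to sign.\<close>

lemma moving_splitting:
  obtains V and R :: "complex ^ 'm ^ 's" and J :: "complex ^ 'n \<Rightarrow> complex ^ 's ^ 's" where "open V" "p \<in> V" "V \<subseteq> cmfd C" "mhol J V"
    "\<And>x. R *v snd \<phi>\<^sub>0 x = x" "\<And>z. z \<in> contactD C \<gamma> \<Longrightarrow> snd \<phi>\<^sub>0 (R *v z) = z"
    "\<And>q. q \<in> V \<Longrightarrow> J q ** J q = mat 1"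
    "\<And>q x. q \<in> V \<Longrightarrow> leafproj C q = \<gamma> \<Longrightarrow> J q *v x = x \<longleftrightarrow> snd \<phi>\<^sub>0 x \<in> gm1_pos_at C q"
    "\<And>q x. q \<in> V \<Longrightarrow> leafproj C q = \<gamma> \<Longrightarrow> J q *v x = - x \<longleftrightarrow> snd \<phi>\<^sub>0 x \<in> gm1_neg_at C q"
    "\<And>q k l x. q \<in> V \<Longrightarrow> leafproj C q = \<gamma> \<Longrightarrow> k \<in> holK C q \<Longrightarrow> l \<in> holKbar C q \<Longrightarrow>
      ad_pos q k (snd \<phi>\<^sub>0 x) \<in> gm1_pos_at C q \<and> ad_neg q l (snd \<phi>\<^sub>0 x) \<in> gm1_neg_at C q \<and>
      deriv_at J q (k + l) *v x = 2 *\<^sub>R (R *v ad_neg q l (snd \<phi>\<^sub>0 x) - R *v ad_pos q k (snd \<phi>\<^sub>0 x))"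
proof -
  obtain R :: "complex ^ 'm ^ 's" where R: "\<And>x. R *v snd \<phi>\<^sub>0 x = x" "\<And>z. z \<in> contactD C \<gamma> \<Longrightarrow> snd \<phi>\<^sub>0 (R *v z) = z"
    by (rule iso_left_inverse) (rule that)
  obtain V and X Z :: "complex ^ 'n \<Rightarrow> complex ^ 's ^ 'n" where V: "open V" "p \<in> V" "V \<subseteq> cmfd C" "mhol X V" "mhol Z V"
    and XZ: "\<And>q y. q \<in> V \<Longrightarrow> X q *v y \<in> holH C q" "\<And>q y. q \<in> V \<Longrightarrow> Z q *v y \<in> holHbar C q"
    and X0: "\<And>q y. y \<in> gm1_neg S \<Longrightarrow> X q *v y = 0" and Z0: "\<And>q y. y \<in> gm1_pos S \<Longrightarrow> Z q *v y = 0"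
    and Xp: "\<And>y. y \<in> gm1_pos S \<Longrightarrow> dproj C p (X p *v y) = snd \<phi>\<^sub>0 y"
    and Zp: "\<And>y. y \<in> gm1_neg S \<Longrightarrow> dproj C p (Z p *v y) = snd \<phi>\<^sub>0 y"
    by (rule adapted_sections) (rule that)
  \<comment> \<open>Equal to the identity at \<open>p\<close>, hence invertible nearby; along the
    leaf it maps the two halves of the symbol onto the two halves at \<open>q\<close>, so that
    conjugating \<open>J0\<close> by it gives the involution.\<close>
  define m where "m q = R ** (matrix (dproj C q) ** (X q + Z q))" for q
  have m: "m q *v y = R *v (dproj C q (X q *v y) + dproj C q (Z q *v y))" if "q \<in> V" for q y
  proof -
    have q: "q \<in> cmfd C" using V(3) that by blast
    show ?thesis unfolding m_def pos.dproj_add[OF q, symmetric]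
      by (simp add: matrix_vector_mul_assoc[symmetric] matrix_works[OF pos.clinear_dproj[OF q]] matrix_vector_mult_add_rdistrib)
  qed
  have mp: "m q *v y = R *v dproj C q (X q *v y)" if "q \<in> V" "y \<in> gm1_pos S" for q y
    using m[OF that(1)] Z0[OF that(2)] pos.dproj_zero[OF subsetD[OF V(3) that(1)]] by simp
  have mn: "m q *v y = R *v dproj C q (Z q *v y)" if "q \<in> V" "y \<in> gm1_neg S" for q y
    using m[OF that(1)] X0[OF that(2)] pos.dproj_zero[OF subsetD[OF V(3) that(1)]] by simp
  have mV: "mhol m V"
    unfolding m_def[abs_def]
    by (intro mhol_mult mhol_const mhol_add mhol_jacobian vhol_subset[OF pos.hol] V)
  have m1: "m p = mat 1"
  proof -
    have "m p *v y = y" for y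
    proof -
      obtain a b where ab: "a \<in> gm1_neg S" "b \<in> gm1_pos S" "y = a + b" by (rule J0_split)
      show ?thesis unfolding ab(3) matrix_vector_right_distrib mp[OF V(2) ab(2)] mn[OF V(2) ab(1)] Xp[OF ab(2)] Zp[OF ab(1)] R ..
    qed
    then show ?thesis by (simp add: matrix_eq)
  qed
  obtain V' h where V': "open V'" "p \<in> V'" "V' \<subseteq> V" "mhol h V'"
    "\<And>q. q \<in> V' \<Longrightarrow> m q ** h q = mat 1" "\<And>q. q \<in> V' \<Longrightarrow> h q ** m q = mat 1"
    by (rule mhol_local_inverse[OF mV V(2) m1]) (rule that)
  have mh: "m q *v (h q *v x) = x" "h q *v (m q *v x) = x" if "q \<in> V'" for q x
    using V'(5,6)[OF that] by (simp_all add: matrix_vector_mul_assoc)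
  have V'c: "q \<in> V" "q \<in> cmfd C" if "q \<in> V'" for q using that V(3) V'(3) by auto
  define J where "J q = m q ** (J0 ** h q)" for q
  have JV: "mhol J V'"
    unfolding J_def[abs_def] by (intro mhol_mult mhol_const V'(1,4) mhol_subset[OF mV V'(1,3)])
  have J: "J q *v x = m q *v (J0 *v (h q *v x))" for q x unfolding J_def by (simp add: matrix_vector_mul_assoc)
  have JJ: "J q ** J q = mat 1" if q: "q \<in> V'" for q
  proof -
    have "J0 *v (J0 *v x) = x" for x using J0sq by (simp add: matrix_vector_mul_assoc)
    then have "J q *v (J q *v x) = x" for x unfolding J mh(2)[OF q] by (simp add: mh[OF q])
    then show ?thesis by (simp add: matrix_eq matrix_vector_mul_assoc[symmetric])
  qed
  have hJ: "J q *v x = x \<longleftrightarrow> h q *v x \<in> gm1_pos S" "J q *v x = - x \<longleftrightarrow> h q *v x \<in> gm1_neg S" if q: "q \<in> V'" for q x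
  proof -
    have neg: "m q *v (- y) = - (m q *v y)" for y by (rule bounded_bilinear.minus_right[OF bounded_bilinear_matrix_vector_mult])
    have "J q *v x = x \<longleftrightarrow> J0 *v (h q *v x) = h q *v x" unfolding J using mh[OF q] by metis
    then show "J q *v x = x \<longleftrightarrow> h q *v x \<in> gm1_pos S" using Jpos by simp
    have "J q *v x = - x \<longleftrightarrow> J0 *v (h q *v x) = - (h q *v x)" unfolding J using mh[OF q] neg by metis
    then show "J q *v x = - x \<longleftrightarrow> h q *v x \<in> gm1_neg S" using Jneg by simp
  qed
  have mpos: "snd \<phi>\<^sub>0 (m q *v y) = dproj C q (X q *v y)" "dproj C q (X q *v y) \<in> gm1_pos_at C q"
    if q: "q \<in> V'" "leafproj C q = \<gamma>" "y \<in> gm1_pos S" for q y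
  proof -
    show *: "dproj C q (X q *v y) \<in> gm1_pos_at C q" using XZ(1)[OF V'c(1)[OF q(1)]] unfolding gm1_pos_at_def by blast
    then show "snd \<phi>\<^sub>0 (m q *v y) = dproj C q (X q *v y)"
      unfolding mp[OF V'c(1)[OF q(1)] q(3)] by (intro R(2) gm1_contact[OF V'c(2)[OF q(1)] q(2)] disjI1)
  qed
  have mneg: "snd \<phi>\<^sub>0 (m q *v y) = dproj C q (Z q *v y)" "dproj C q (Z q *v y) \<in> gm1_neg_at C q"
    if q: "q \<in> V'" "leafproj C q = \<gamma>" "y \<in> gm1_neg S" for q y
  proof -
    show *: "dproj C q (Z q *v y) \<in> gm1_neg_at C q" using XZ(2)[OF V'c(1)[OF q(1)]] unfolding gm1_neg_at_def by blast
    then show "snd \<phi>\<^sub>0 (m q *v y) = dproj C q (Z q *v y)"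
      unfolding mn[OF V'c(1)[OF q(1)] q(3)] by (intro R(2) gm1_contact[OF V'c(2)[OF q(1)] q(2)] disjI2)
  qed
  note iso_add = vec.linear_add[OF iso_linear]
  have decomp: "\<exists>a\<in>gm1_neg S. \<exists>b\<in>gm1_pos S. x = m q *v a + m q *v b \<and> h q *v x = a + b" if q: "q \<in> V'" for q x
  proof -
    obtain a b where ab: "a \<in> gm1_neg S" "b \<in> gm1_pos S" "h q *v x = a + b" by (rule J0_split)
    have "x = m q *v a + m q *v b" using mh(1)[OF q, of x] unfolding ab(3) matrix_vector_right_distrib by simp
    then show ?thesis using ab by blast
  qed
  have eig_pos: "J q *v x = x \<longleftrightarrow> snd \<phi>\<^sub>0 x \<in> gm1_pos_at C q" if q: "q \<in> V'" "leafproj C q = \<gamma>" for q x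
  proof
    assume "J q *v x = x"
    then have "h q *v x \<in> gm1_pos S" using hJ(1)[OF q(1)] by simp
    from mpos[OF q this] show "snd \<phi>\<^sub>0 x \<in> gm1_pos_at C q" unfolding mh(1)[OF q(1)] by simp
  next
    assume x: "snd \<phi>\<^sub>0 x \<in> gm1_pos_at C q"
    obtain a b where ab: "a \<in> gm1_neg S" "b \<in> gm1_pos S" "x = m q *v a + m q *v b" "h q *v x = a + b"
      using decomp[OF q(1)] by blast
    have "snd \<phi>\<^sub>0 x - snd \<phi>\<^sub>0 (m q *v b) \<in> gm1_pos_at C q"
      using vec.subspace_diff[OF gm1_subspaces(1)[OF V'c(2)[OF q(1)]] x] mpos[OF q ab(2)] by simp
    then have "snd \<phi>\<^sub>0 (m q *v a) \<in> gm1_pos_at C q" using iso_add[of "m q *v a" "m q *v b"] ab(3) by simp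
    then have "snd \<phi>\<^sub>0 (m q *v a) = 0" using gm1_disjoint[OF V'c(2)[OF q(1)]] mneg[OF q ab(1)] by simp
    then have "m q *v a = 0" using iso_inj[of _ 0] vec.linear_0[OF iso_linear] by simp
    then have "a = 0" using mh(2)[OF q(1), of a] by simp
    then show "J q *v x = x" using hJ(1)[OF q(1)] ab by simp
  qed
  have eig_neg: "J q *v x = - x \<longleftrightarrow> snd \<phi>\<^sub>0 x \<in> gm1_neg_at C q" if q: "q \<in> V'" "leafproj C q = \<gamma>" for q x
  proof
    assume "J q *v x = - x"
    then have "h q *v x \<in> gm1_neg S" using hJ(2)[OF q(1)] by simp
    from mneg[OF q this] show "snd \<phi>\<^sub>0 x \<in> gm1_neg_at C q" unfolding mh(1)[OF q(1)] by simp
  next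
    assume x: "snd \<phi>\<^sub>0 x \<in> gm1_neg_at C q"
    obtain a b where ab: "a \<in> gm1_neg S" "b \<in> gm1_pos S" "x = m q *v a + m q *v b" "h q *v x = a + b"
      using decomp[OF q(1)] by blast
    have "snd \<phi>\<^sub>0 x - snd \<phi>\<^sub>0 (m q *v a) \<in> gm1_neg_at C q"
      using vec.subspace_diff[OF gm1_subspaces(2)[OF V'c(2)[OF q(1)]] x] mneg[OF q ab(1)] by simp
    then have "snd \<phi>\<^sub>0 (m q *v b) \<in> gm1_neg_at C q" using iso_add[of "m q *v a" "m q *v b"] ab(3) by simp
    then have "snd \<phi>\<^sub>0 (m q *v b) = 0" using gm1_disjoint[OF V'c(2)[OF q(1)]] mpos[OF q ab(2)] by simp
    then have "m q *v b = 0" using iso_inj[of _ 0] vec.linear_0[OF iso_linear] by simp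
    then have "b = 0" using mh(2)[OF q(1), of b] by simp
    then show "J q *v x = - x" using hJ(2)[OF q(1)] ab by simp
  qed
  have dJ: "ad_pos q k (snd \<phi>\<^sub>0 x) \<in> gm1_pos_at C q \<and> ad_neg q l (snd \<phi>\<^sub>0 x) \<in> gm1_neg_at C q \<and>
      deriv_at J q (k + l) *v x = 2 *\<^sub>R (R *v ad_neg q l (snd \<phi>\<^sub>0 x) - R *v ad_pos q k (snd \<phi>\<^sub>0 x))"
    if q: "q \<in> V'" "leafproj C q = \<gamma>" and k: "k \<in> holK C q" and l: "l \<in> holKbar C q" for q k l x
  proof -
    note qc = V'c[OF q(1)]
    obtain a b where ab: "a \<in> gm1_neg S" "b \<in> gm1_pos S" "x = m q *v a + m q *v b" "h q *v x = a + b"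
      using decomp[OF q(1)] by blast
    have Xs: "(\<lambda>q. X q *v b) \<in> hsections (cmfd C) (holH C) q"
      by (rule hsectionsI[OF V(1) qc(1) V(3)]) (intro vhol_matrix_vector V vhol_const, rule XZ(1))
    have Zs: "(\<lambda>q. Z q *v a) \<in> hsections (cmfd C) (holHbar C) q"
      by (rule hsectionsI[OF V(1) qc(1) V(3)]) (intro vhol_matrix_vector V vhol_const, rule XZ(2))
    have \<phi>x: "snd \<phi>\<^sub>0 x = dproj C q (X q *v b) + dproj C q (Z q *v a)"
      unfolding ab(3) iso_add mpos(1)[OF q ab(2)] mneg(1)[OF q ab(1)] by simp
    obtain u w where u: "u \<in> gm1_pos_at C q" and w: "w \<in> gm1_neg_at C q"
      and duw: "deriv_at (pos.dsec (\<lambda>q. Z q *v a)) q (k + l) = u + w"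
      and ad: "\<And>e. e \<in> holH C q \<Longrightarrow> ad_pos q k (dproj C q e + dproj C q (Z q *v a)) = u"
      by (rule pos.dsec_split[OF qc(2) k l Zs, folded gm1_pos_at_def gm1_neg_at_def]) (rule that)
    obtain u' w' where u': "u' \<in> gm1_neg_at C q" and w': "w' \<in> gm1_pos_at C q"
      and duw': "deriv_at (neg.dsec (\<lambda>q. X q *v b)) q (l + k) = u' + w'"
      and ad': "\<And>e. e \<in> holHbar C q \<Longrightarrow> ad_neg q l (dproj C q e + dproj C q (X q *v b)) = u'"
      by (rule neg.dsec_split[OF qc(2) l k Xs, folded gm1_pos_at_def gm1_neg_at_def]) (rule that)
    have adx: "ad_pos q k (snd \<phi>\<^sub>0 x) = u" unfolding \<phi>x by (rule ad[OF XZ(1)[OF qc(1)]])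
    have adx': "ad_neg q l (snd \<phi>\<^sub>0 x) = u'"
      unfolding \<phi>x by (subst add.commute) (rule ad'[OF XZ(2)[OF qc(1)]])
    have Rpos: "J q *v (R *v z) = R *v z" if "z \<in> gm1_pos_at C q" for z
      using eig_pos[OF q] R(2)[OF gm1_contact[OF qc(2) q(2)]] that by simp
    have Rneg: "J q *v (R *v z) = - (R *v z)" if "z \<in> gm1_neg_at C q" for z
      using eig_neg[OF q] R(2)[OF gm1_contact[OF qc(2) q(2)]] that by simp
    have Ja: "J q' *v (m q' *v a) = (- 1) *\<^sub>R (m q' *v a)" if "q' \<in> V'" for q'
      using hJ(2)[OF that] mh(2)[OF that] ab(1) by simp
    have Jb: "J q' *v (m q' *v b) = 1 *\<^sub>R (m q' *v b)" if "q' \<in> V'" for q'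
      using hJ(1)[OF that] mh(2)[OF that] ab(2) by simp
    have da: "((\<lambda>q. m q *v a) has_derivative (\<lambda>v. R *v deriv_at (pos.dsec (\<lambda>q. Z q *v a)) q v)) (at q)"
    proof (rule has_derivative_transform_within_open[OF _ V(1) qc(1)])
      show "((\<lambda>q. R *v pos.dsec (\<lambda>q. Z q *v a) q) has_derivative (\<lambda>v. R *v deriv_at (pos.dsec (\<lambda>q. Z q *v a)) q v)) (at q)"
        by (rule bounded_linear.has_derivative[OF bounded_bilinear.bounded_linear_right[OF bounded_bilinear_matrix_vector_mult]])
          (rule vhol_has_derivative[OF pos.dsec_vhol[OF vhol_matrix_vector[OF V(5) vhol_const[OF V(1)]] V(3)] qc(1)])
      show "R *v pos.dsec (\<lambda>q. Z q *v a) q' = m q' *v a" if "q' \<in> V" for q'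
        using mn[OF that ab(1)] unfolding pos.dsec_def by simp
    qed
    have db: "((\<lambda>q. m q *v b) has_derivative (\<lambda>v. R *v deriv_at (neg.dsec (\<lambda>q. X q *v b)) q v)) (at q)"
    proof (rule has_derivative_transform_within_open[OF _ V(1) qc(1)])
      show "((\<lambda>q. R *v neg.dsec (\<lambda>q. X q *v b) q) has_derivative (\<lambda>v. R *v deriv_at (neg.dsec (\<lambda>q. X q *v b)) q v)) (at q)"
        by (rule bounded_linear.has_derivative[OF bounded_bilinear.bounded_linear_right[OF bounded_bilinear_matrix_vector_mult]])
          (rule vhol_has_derivative[OF neg.dsec_vhol[OF vhol_matrix_vector[OF V(4) vhol_const[OF V(1)]] V(3)] qc(1)])
      show "R *v neg.dsec (\<lambda>q. X q *v b) q' = m q' *v b" if "q' \<in> V" for q'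
        using mp[OF that ab(2)] unfolding neg.dsec_def by simp
    qed
    \<comment> \<open>The vector \<open>m q *v a\<close> has eigenvalue -1, and its derivative has
      the component \<open>R *v u\<close> in the other eigenspace; the gap between the eigenvalues
      gives the factor -2. The second equation exchanges the roles.\<close>
    have 1: "deriv_at J q (k + l) *v (m q *v a) = (- 2) *\<^sub>R (R *v u)"
      using eigenvector_derivative[OF JV q(1) da Ja, of "k + l"]
      unfolding duw matrix_vector_right_distrib Rpos[OF u] Rneg[OF w] by (simp add: vec_eq_iff scaleR_conv_of_real[where 'a = complex])
    have 2: "deriv_at J q (k + l) *v (m q *v b) = 2 *\<^sub>R (R *v u')"
      using eigenvector_derivative[OF JV q(1) db Jb, of "l + k"]
      unfolding duw' matrix_vector_right_distrib Rpos[OF w'] Rneg[OF u']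
      by (simp add: vec_eq_iff add.commute[of k] scaleR_conv_of_real[where 'a = complex])
    have "deriv_at J q (k + l) *v x = deriv_at J q (k + l) *v (m q *v a) + deriv_at J q (k + l) *v (m q *v b)"
      by (subst ab(3)) (rule matrix_vector_right_distrib)
    then show ?thesis unfolding adx adx' using 1 2 u u' by (simp add: algebra_simps)
  qed
  show ?thesis
    by (rule that[OF V'(1,2) _ JV R JJ eig_pos eig_neg dJ]) (use V'c in auto)
qed

end

section \<open>Frames\<close>

lemma mhol_deriv_scale:
  assumes J: "mhol J U" and q: "q \<in> U"
  shows "deriv_at J q (c *s v) *v x = c *s (deriv_at J q v *v x)"
proof -
  have "deriv_at J q (c *s v) $ i $ j = c * deriv_at J q v $ i $ j" for i j
    using chol_deriv_scale[of "\<lambda>p. J p $ i $ j" U q] J q unfolding mhol_deriv_nth[OF J q] mhol_def by blast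
  then show ?thesis by (simp add: vec_eq_iff matrix_vector_mult_def sum_distrib_left mult.assoc)
qed

lemma linear_kernel_trivial:
  fixes T :: "complex ^ 'n \<Rightarrow> complex ^ 's \<Rightarrow> complex ^ 's"
  assumes T: "Vector_Spaces.linear (*s) endo_scale T" and K: "vec.subspace K"
    and dim: "vector_space.dim endo_scale (T ` K) = vec.dim K" and k: "k \<in> K" "T k = 0"
  shows "k = 0"
proof (rule ccontr)
  assume k0: "k \<noteq> 0"
  interpret T: Vector_Spaces.linear "(*s)" endo_scale T by (rule T)
  interpret endo: vector_space endo_scale by (rule endo_vector_space)
  have "vec.independent {k}" using k0 by simp
  then obtain B where B: "{k} \<subseteq> B" "B \<subseteq> K" "vec.independent B" "K \<subseteq> vec.span B"
    using vec.maximal_independent_subset_extend[of "{k}" K] k by blast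
  have fin: "finite B" using vec.finiteI_independent[OF B(3)] .
  have card: "card B = vec.dim K" by (rule vec.basis_card_eq_dim[OF B(2,4,3)])
  have "T ` K \<subseteq> endo.span (T ` B)" using T.span_image[of B] B(4) by blast
  also have "T ` B = insert 0 (T ` (B - {k}))" using B(1) k(2) by auto
  also have "endo.span (insert 0 (T ` (B - {k}))) = endo.span (T ` (B - {k}))" by (rule endo.span_insert_0)
  finally have "endo.dim (T ` K) \<le> card (T ` (B - {k}))" by (rule endo.dim_le_card) (use fin in auto)
  also have "\<dots> \<le> card (B - {k})" using fin by (intro card_image_le) auto
  also have "\<dots> < card B" using fin B(1) by (intro psubset_card_mono) auto
  finally show False using dim card by simp
qed

locale leaf_flag = leaf_bridge C n r S J0 p \<phi>\<^sub>0
  for C :: "('n::finite, 'm::finite) complexified" and n r :: nat and S :: "('s::finite) symbol_data"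
    and J0 p \<phi>\<^sub>0 +
  fixes V :: "(complex ^ 'n) set" and R :: "complex ^ 'm ^ 's" and J :: "complex ^ 'n \<Rightarrow> complex ^ 's ^ 's"
  assumes const: "\<And>q. q \<in> cmfd C \<Longrightarrow> \<exists>\<phi>. symbol_iso C S q \<phi>"
    and V: "open V" "p \<in> V" "V \<subseteq> cmfd C" and JV: "mhol J V"
    and R: "\<And>x. R *v snd \<phi>\<^sub>0 x = x" "\<And>z. z \<in> contactD C (leafproj C p) \<Longrightarrow> snd \<phi>\<^sub>0 (R *v z) = z"
    and JJ: "\<And>q. q \<in> V \<Longrightarrow> J q ** J q = mat 1"
    and eig_pos: "\<And>q x. q \<in> V \<Longrightarrow> leafproj C q = leafproj C p \<Longrightarrow>
      J q *v x = x \<longleftrightarrow> snd \<phi>\<^sub>0 x \<in> gm1_pos_at C q"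
    and eig_neg: "\<And>q x. q \<in> V \<Longrightarrow> leafproj C q = leafproj C p \<Longrightarrow>
      J q *v x = - x \<longleftrightarrow> snd \<phi>\<^sub>0 x \<in> gm1_neg_at C q"
    and dJ: "\<And>q k l x. q \<in> V \<Longrightarrow> leafproj C q = leafproj C p \<Longrightarrow> k \<in> holK C q \<Longrightarrow> l \<in> holKbar C q \<Longrightarrow>
      ad_leaf C (holH C) (holHbar C) (holK C) q k (snd \<phi>\<^sub>0 x) \<in> gm1_pos_at C q \<and>
      ad_leaf C (holHbar C) (holH C) (holKbar C) q l (snd \<phi>\<^sub>0 x) \<in> gm1_neg_at C q \<and>
      deriv_at J q (k + l) *v x = 2 *\<^sub>R (R *v ad_leaf C (holHbar C) (holH C) (holKbar C) q l (snd \<phi>\<^sub>0 x)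
        - R *v ad_leaf C (holH C) (holHbar C) (holK C) q k (snd \<phi>\<^sub>0 x))"
begin

definition ran :: "complex ^ 'n \<Rightarrow> (complex ^ 's ^ 's) set"
  where "ran q = {deriv_at J q v |v. dproj C q v = 0}"

definition fibre :: "(complex ^ 'n) set" where "fibre = {q \<in> V. leafproj C q = \<gamma>}"

lemma fibreD: "q \<in> fibre \<Longrightarrow> q \<in> V" "q \<in> fibre \<Longrightarrow> leafproj C q = \<gamma>" "q \<in> fibre \<Longrightarrow> q \<in> cmfd C"
  using V(3) unfolding fibre_def by auto

lemma K_zero: "q \<in> fibre \<Longrightarrow> 0 \<in> holK C q" "q \<in> fibre \<Longrightarrow> 0 \<in> holKbar C q"
  using vec.subspace_0 subbundle_subspace[OF pos.sK] subbundle_subspace[OF pos.sL] fibreD(3) by blast+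

lemma R_pos: "q \<in> fibre \<Longrightarrow> z \<in> gm1_pos_at C q \<Longrightarrow> J q *v (R *v z) = R *v z"
  using eig_pos[of q "R *v z"] R(2) gm1_contact[of q z] fibreD[of q] by simp

lemma R_neg: "q \<in> fibre \<Longrightarrow> z \<in> gm1_neg_at C q \<Longrightarrow> J q *v (R *v z) = - (R *v z)"
  using eig_neg[of q "R *v z"] R(2) gm1_contact[of q z] fibreD[of q] by simp

lemma deriv_J_add: "q \<in> fibre \<Longrightarrow> deriv_at J q (v + w) = deriv_at J q v + deriv_at J q w"
  and deriv_J_scaleR: "q \<in> fibre \<Longrightarrow> deriv_at J q (c *\<^sub>R v) = c *\<^sub>R deriv_at J q v"
  and deriv_J_zero: "q \<in> fibre \<Longrightarrow> deriv_at J q 0 = 0"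
  and deriv_J_minus: "q \<in> fibre \<Longrightarrow> deriv_at J q (- v) = - deriv_at J q v"
  using has_derivative_linear[OF mhol_has_derivative[OF JV fibreD(1)], of q]
  by (auto simp: linear_add linear_cmul linear_0 linear_neg)

lemma self_opposite: "x = - x \<Longrightarrow> x = 0" for x :: "complex ^ 's"
  by (simp add: vec_eq_iff)

text \<open>The map \<open>ad_leaf\<close> is a definite description, so vanishing at 0 is derived
  from \<open>dJ\<close>: for \<open>k = l = 0\<close> it equates a vector of eigenvalue 1 with one
  of eigenvalue -1.\<close>

lemma ad_zero:
  assumes q: "q \<in> fibre"
  shows "R *v ad_pos q 0 (snd \<phi>\<^sub>0 x) = 0" "R *v ad_neg q 0 (snd \<phi>\<^sub>0 x) = 0"
proof -
  note d = dJ[OF fibreD(1,2)[OF q] K_zero[OF q], of x]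
  have eq: "R *v ad_neg q 0 (snd \<phi>\<^sub>0 x) = R *v ad_pos q 0 (snd \<phi>\<^sub>0 x)"
    using d deriv_J_zero[OF q] by simp
  have "J q *v (R *v ad_pos q 0 (snd \<phi>\<^sub>0 x)) = R *v ad_pos q 0 (snd \<phi>\<^sub>0 x)" using R_pos[OF q] d by blast
  moreover have "J q *v (R *v ad_neg q 0 (snd \<phi>\<^sub>0 x)) = - (R *v ad_neg q 0 (snd \<phi>\<^sub>0 x))" using R_neg[OF q] d by blast
  ultimately show "R *v ad_pos q 0 (snd \<phi>\<^sub>0 x) = 0" using self_opposite eq by metis
  then show "R *v ad_neg q 0 (snd \<phi>\<^sub>0 x) = 0" using eq by simp
qed

lemma dJ_pos:
  assumes q: "q \<in> fibre" and k: "k \<in> holK C q"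
  shows "ad_pos q k (snd \<phi>\<^sub>0 x) \<in> gm1_pos_at C q" "deriv_at J q k *v x = (- 2) *\<^sub>R (R *v ad_pos q k (snd \<phi>\<^sub>0 x))"
  using dJ[OF fibreD(1,2)[OF q] k K_zero(2)[OF q], of x] ad_zero(2)[OF q, of x] by auto

lemma dJ_neg:
  assumes q: "q \<in> fibre" and l: "l \<in> holKbar C q"
  shows "ad_neg q l (snd \<phi>\<^sub>0 x) \<in> gm1_neg_at C q" "deriv_at J q l *v x = 2 *\<^sub>R (R *v ad_neg q l (snd \<phi>\<^sub>0 x))"
  using dJ[OF fibreD(1,2)[OF q] K_zero(1)[OF q] l, of x] ad_zero(1)[OF q, of x] by auto

lemma matrix_scaleR_vector: "A *v (c *\<^sub>R x) = c *\<^sub>R (A *v x)" for A :: "complex ^ 's ^ 's"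
  by (rule bounded_bilinear.scaleR_right[OF bounded_bilinear_matrix_vector_mult])

lemma matrix_minus_vector: "(- A) *v x = - (A *v x)" for A :: "complex ^ 's ^ 's"
  by (rule bounded_bilinear.minus_left[OF bounded_bilinear_matrix_vector_mult])

lemma matrix_vector_minus: "A *v (- x) = - (A *v x)" for A :: "complex ^ 's ^ 's"
  by (rule bounded_bilinear.minus_right[OF bounded_bilinear_matrix_vector_mult])

lemma dJ_block:
  assumes q: "q \<in> fibre"
  shows "k \<in> holK C q \<Longrightarrow> J q ** deriv_at J q k = deriv_at J q k"
    and "l \<in> holKbar C q \<Longrightarrow> J q ** deriv_at J q l = - deriv_at J q l"
  by (simp_all add: matrix_eq matrix_vector_mul_assoc[symmetric] matrix_minus_vector dJ_pos[OF q] dJ_neg[OF q]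
    matrix_scaleR_vector matrix_vector_minus R_pos[OF q] R_neg[OF q])

lemma kernel_pair: "q \<in> fibre \<Longrightarrow> k \<in> holK C q \<Longrightarrow> l \<in> holKbar C q \<Longrightarrow> dproj C q (k + l) = 0"
  using pos.kernel_mem fibreD(3) pos.dproj_add by simp

lemma ranE:
  assumes "q \<in> fibre" "M \<in> ran q"
  obtains k l where "k \<in> holK C q" "l \<in> holKbar C q" "M = deriv_at J q k + deriv_at J q l"
proof -
  obtain v where v: "dproj C q v = 0" "M = deriv_at J q v" using assms(2) unfolding ran_def by blast
  obtain k l where "k \<in> holK C q" "l \<in> holKbar C q" "v = k + l"
    by (rule pos.kernel_split[OF fibreD(3)[OF assms(1)] v(1)]) (rule that)
  then show ?thesis using that v(2) deriv_J_add[OF assms(1)] by blast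
qed

lemma ranI: "q \<in> fibre \<Longrightarrow> k \<in> holK C q \<Longrightarrow> l \<in> holKbar C q \<Longrightarrow> deriv_at J q k + deriv_at J q l \<in> ran q"
  unfolding ran_def by (intro CollectI exI[of _ "k + l"] conjI kernel_pair deriv_J_add[symmetric])

lemma ran_pos:
  assumes q: "q \<in> fibre"
  shows "M \<in> ran q \<and> J q ** M = M \<longleftrightarrow> (\<exists>k\<in>holK C q. M = deriv_at J q k)"
proof
  assume M: "M \<in> ran q \<and> J q ** M = M"
  then obtain k l where kl: "k \<in> holK C q" "l \<in> holKbar C q" "M = deriv_at J q k + deriv_at J q l"
    using ranE[OF q] by blast
  have "deriv_at J q k - deriv_at J q l = deriv_at J q k + deriv_at J q l"
    using M unfolding kl(3) by (simp add: matrix_add_ldistrib dJ_block[OF q] kl)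
  then have "deriv_at J q l = 0" by (simp add: vec_eq_iff)
  then show "\<exists>k\<in>holK C q. M = deriv_at J q k" using kl by auto
next
  assume "\<exists>k\<in>holK C q. M = deriv_at J q k"
  then obtain k where k: "k \<in> holK C q" "M = deriv_at J q k" by blast
  then show "M \<in> ran q \<and> J q ** M = M"
    using ranI[OF q k(1) K_zero(2)[OF q]] deriv_J_zero[OF q] dJ_block[OF q] by simp
qed

lemma ran_neg:
  assumes q: "q \<in> fibre"
  shows "M \<in> ran q \<and> J q ** M = - M \<longleftrightarrow> (\<exists>l\<in>holKbar C q. M = deriv_at J q l)"
proof
  assume M: "M \<in> ran q \<and> J q ** M = - M"
  then obtain k l where kl: "k \<in> holK C q" "l \<in> holKbar C q" "M = deriv_at J q k + deriv_at J q l"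
    using ranE[OF q] by blast
  have "deriv_at J q k - deriv_at J q l = - deriv_at J q k - deriv_at J q l"
    using M unfolding kl(3) by (simp add: matrix_add_ldistrib dJ_block[OF q] kl)
  then have "deriv_at J q k = 0" by (simp add: vec_eq_iff)
  then show "\<exists>l\<in>holKbar C q. M = deriv_at J q l" using kl by auto
next
  assume "\<exists>l\<in>holKbar C q. M = deriv_at J q l"
  then obtain l where l: "l \<in> holKbar C q" "M = deriv_at J q l" by blast
  then show "M \<in> ran q \<and> J q ** M = - M"
    using ranI[OF q K_zero(1)[OF q] l(1)] deriv_J_zero[OF q] dJ_block[OF q] by simp
qed

lemma inv_frame:
  fixes g h :: "complex ^ 's ^ 's"
  assumes gh: "g ** h = mat 1" "h ** g = mat 1" and z: "z \<in> contactD C \<gamma>"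
  shows "inv (\<lambda>x. snd \<phi>\<^sub>0 (g *v x)) z = h *v (R *v z)"
proof (rule inv_f_eq)
  have hg: "h *v (g *v x) = x" "g *v (h *v x) = x" for x using gh by (simp_all add: matrix_vector_mul_assoc)
  show "inj (\<lambda>x. snd \<phi>\<^sub>0 (g *v x))" by (rule injI) (metis iso_inj hg(1))
  show "snd \<phi>\<^sub>0 (g *v (h *v (R *v z))) = z" using hg R(2)[OF z] by simp
qed

text \<open>The adjoint action equals the derivative of \<open>J\<close> up to the factors -1/2 and
  1/2. These are absorbed into the directions, since the kernels are subspaces.\<close>

lemma frame_conj:
  fixes g h :: "complex ^ 's ^ 's"
  assumes q: "q \<in> fibre" and gh: "g ** h = mat 1" "h ** g = mat 1"
  defines "\<psi> \<equiv> \<lambda>x. snd \<phi>\<^sub>0 (g *v x)"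
  shows "(\<lambda>A. inv \<psi> \<circ> A \<circ> \<psi>) ` g0_pos_at C q = (\<lambda>k. (*v) (h ** deriv_at J q k ** g)) ` holK C q"
    and "(\<lambda>A. inv \<psi> \<circ> A \<circ> \<psi>) ` g0_neg_at C q = (\<lambda>l. (*v) (h ** deriv_at J q l ** g)) ` holKbar C q"
proof -
  have p: "inv \<psi> \<circ> ad_pos q k \<circ> \<psi> = (*v) (h ** deriv_at J q ((- 1/2) *\<^sub>R k) ** g)" if k: "k \<in> holK C q" for k
  proof
    fix x
    have "inv \<psi> (ad_pos q k (\<psi> x)) = h *v (R *v ad_pos q k (\<psi> x))"
      unfolding \<psi>_def by (intro inv_frame gh gm1_contact[OF fibreD(3,2)[OF q]] disjI1 dJ_pos(1)[OF q k])
    also have "R *v ad_pos q k (\<psi> x) = deriv_at J q ((- 1/2) *\<^sub>R k) *v (g *v x)"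
      unfolding deriv_J_scaleR[OF q] \<psi>_def
        bounded_bilinear.scaleR_left[OF bounded_bilinear_matrix_vector_mult] dJ_pos(2)[OF q k] by simp
    finally show "(inv \<psi> \<circ> ad_pos q k \<circ> \<psi>) x = (h ** deriv_at J q ((- 1/2) *\<^sub>R k) ** g) *v x"
      by (simp add: matrix_vector_mul_assoc matrix_mul_assoc)
  qed
  have n: "inv \<psi> \<circ> ad_neg q l \<circ> \<psi> = (*v) (h ** deriv_at J q ((1/2) *\<^sub>R l) ** g)" if l: "l \<in> holKbar C q" for l
  proof
    fix x
    have "inv \<psi> (ad_neg q l (\<psi> x)) = h *v (R *v ad_neg q l (\<psi> x))"
      unfolding \<psi>_def by (intro inv_frame gh gm1_contact[OF fibreD(3,2)[OF q]] disjI2 dJ_neg(1)[OF q l])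
    also have "R *v ad_neg q l (\<psi> x) = deriv_at J q ((1/2) *\<^sub>R l) *v (g *v x)"
      unfolding deriv_J_scaleR[OF q] \<psi>_def
        bounded_bilinear.scaleR_left[OF bounded_bilinear_matrix_vector_mult] dJ_neg(2)[OF q l] by simp
    finally show "(inv \<psi> \<circ> ad_neg q l \<circ> \<psi>) x = (h ** deriv_at J q ((1/2) *\<^sub>R l) ** g) *v x"
      by (simp add: matrix_vector_mul_assoc matrix_mul_assoc)
  qed
  have K: "c *\<^sub>R k \<in> holK C q" if "k \<in> holK C q" for c k
    using vec_subspace_scaleR[OF subbundle_subspace[OF pos.sK fibreD(3)[OF q]] that] .
  have L: "c *\<^sub>R k \<in> holKbar C q" if "k \<in> holKbar C q" for c k
    using vec_subspace_scaleR[OF subbundle_subspace[OF pos.sL fibreD(3)[OF q]] that] .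
  show "(\<lambda>A. inv \<psi> \<circ> A \<circ> \<psi>) ` g0_pos_at C q = (\<lambda>k. (*v) (h ** deriv_at J q k ** g)) ` holK C q"
    unfolding g0_pos_at_def image_image
  proof (intro subset_antisym image_subsetI)
    fix k assume k: "k \<in> holK C q"
    show "inv \<psi> \<circ> ad_pos q k \<circ> \<psi> \<in> (\<lambda>k. (*v) (h ** deriv_at J q k ** g)) ` holK C q"
      unfolding p[OF k] using K[OF k] by blast
    have "(*v) (h ** deriv_at J q k ** g) = inv \<psi> \<circ> ad_pos q ((- 2) *\<^sub>R k) \<circ> \<psi>" unfolding p[OF K[OF k]] by simp
    then show "(*v) (h ** deriv_at J q k ** g) \<in> (\<lambda>x. inv \<psi> \<circ> ad_pos q x \<circ> \<psi>) ` holK C q"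
      using K[OF k, of "- 2"] by (simp only:) blast
  qed
  show "(\<lambda>A. inv \<psi> \<circ> A \<circ> \<psi>) ` g0_neg_at C q = (\<lambda>l. (*v) (h ** deriv_at J q l ** g)) ` holKbar C q"
    unfolding g0_neg_at_def image_image
  proof (intro subset_antisym image_subsetI)
    fix l assume l: "l \<in> holKbar C q"
    show "inv \<psi> \<circ> ad_neg q l \<circ> \<psi> \<in> (\<lambda>k. (*v) (h ** deriv_at J q k ** g)) ` holKbar C q"
      unfolding n[OF l] using L[OF l] by blast
    have "(*v) (h ** deriv_at J q l ** g) = inv \<psi> \<circ> ad_neg q (2 *\<^sub>R l) \<circ> \<psi>" unfolding n[OF L[OF l]] by simp
    then show "(*v) (h ** deriv_at J q l ** g) \<in> (\<lambda>x. inv \<psi> \<circ> ad_neg q x \<circ> \<psi>) ` holKbar C q"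
      using L[OF l, of 2] by (simp only:) blast
  qed
qed

lemma matrix_fun_inject: "(*v) A = (*v) B \<longleftrightarrow> A = B" for A B :: "complex ^ 's ^ 's"
  by (auto simp: matrix_eq fun_eq_iff)

lemma conj_swap:
  fixes g h M B :: "complex ^ 's ^ 's"
  assumes gh: "g ** h = mat 1" "h ** g = mat 1"
  shows "g ** B ** h = M \<longleftrightarrow> B = h ** M ** g"
proof
  assume "g ** B ** h = M"
  then have "h ** M ** g = (h ** g) ** B ** (h ** g)" by (auto simp: matrix_mul_assoc)
  then show "B = h ** M ** g" using gh by simp
next
  assume "B = h ** M ** g"
  then have "g ** B ** h = (g ** h) ** M ** (g ** h)" by (auto simp: matrix_mul_assoc)
  then show "g ** B ** h = M" using gh by simp
qed

text \<open>The degree -2 components of the two frames are bijections from \<open>complex\<close>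
  onto the same quotient, so they differ by a nonzero scalar \<open>c\<close>; compatibility with
  the brackets turns \<open>c\<close> into the similitude factor of \<open>g\<close>.\<close>

lemma frame_similitude:
  assumes q: "q \<in> fibre" and \<phi>: "symbol_iso C S q \<phi>" and g: "\<And>x. snd \<phi> x = snd \<phi>\<^sub>0 (g *v x)"
  shows "g \<in> csp_group (form S)"
proof -
  have i0: "heis_iso C S \<gamma> \<phi>\<^sub>0" using iso unfolding symbol_iso_def by blast
  have i1: "heis_iso C S \<gamma> \<phi>" using \<phi> fibreD(2)[OF q] unfolding symbol_iso_def by simp
  obtain t0 where t0: "\<And>z. fst \<phi>\<^sub>0 z = (z *s t0) +o contactD C \<gamma>" using i0 unfolding heis_iso_def by blast
  obtain t where t: "\<And>z. fst \<phi> z = (z *s t) +o contactD C \<gamma>" using i1 unfolding heis_iso_def by blast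
  have b0: "bij_betw (fst \<phi>\<^sub>0) UNIV (range (\<lambda>v. v +o contactD C \<gamma>))"
    and b1: "bij_betw (fst \<phi>) UNIV (range (\<lambda>v. v +o contactD C \<gamma>))"
    using i0 i1 unfolding heis_iso_def by blast+
  have sD: "vec.subspace (contactD C \<gamma>)" by (rule pos.subspace_contact[OF p])
  obtain c where c: "fst \<phi> 1 = fst \<phi>\<^sub>0 c" using b0 b1 unfolding bij_betw_def by (metis rangeE rangeI)
  have "t \<in> (1 *s t) +o contactD C \<gamma>"
    unfolding elt_set_plus_def using vec.subspace_0[OF sD] by (intro CollectI bexI[of _ 0]) simp_all
  then have "t \<in> (c *s t0) +o contactD C \<gamma>" using c t t0 by metis
  then have d: "t - c *s t0 \<in> contactD C \<gamma>" unfolding elt_set_plus_def by auto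
  have fst_eq: "fst \<phi> z = fst \<phi>\<^sub>0 (z * c)" for z
    unfolding t t0
  proof (rule coset_eqI[OF sD])
    show "z *s t - (z * c) *s t0 \<in> contactD C \<gamma>"
      using vec.subspace_scale[OF sD d, of z] by (simp add: vec.scale_right_diff_distrib)
  qed
  have "form S (g *v x) (g *v y) = form S x y * c" for x y
  proof -
    have "fst \<phi>\<^sub>0 (form S (g *v x) (g *v y)) = heis_bracket C \<gamma> (snd \<phi> x) (snd \<phi> y)"
      using i0 unfolding heis_iso_def g by simp
    also have "\<dots> = fst \<phi>\<^sub>0 (form S x y * c)" using i1 unfolding heis_iso_def fst_eq[symmetric] by simp
    finally show ?thesis using b0 unfolding bij_betw_def inj_on_def by blast
  qed
  moreover have "c \<noteq> 0"
  proof
    assume "c = 0"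
    then have "fst \<phi> 1 = fst \<phi> 0" using fst_eq[of 1] fst_eq[of 0] by simp
    then show False using b1 unfolding bij_betw_def inj_on_def by (metis UNIV_I zero_neq_one)
  qed
  ultimately show ?thesis unfolding csp_group_def by (auto intro!: exI[of _ c] simp: mult.commute)
qed

text \<open>With \<open>carries_frame\<close> this forms the dictionary between frames at
  \<open>q\<close> and conformal symplectic matrices carrying the model pair \<open>J0\<close>,
  \<open>G0\<close> to the pair at \<open>q\<close>.\<close>

lemma frame_carries:
  assumes q: "q \<in> fibre" and \<phi>: "symbol_iso C S q \<phi>" and g: "\<And>x. snd \<phi> x = snd \<phi>\<^sub>0 (g *v x)"
  shows "\<exists>h. carries (form S) g h J0 G0 (J q) (ran q)"
proof -
  have i1: "heis_iso C S \<gamma> \<phi>" using \<phi> fibreD(2)[OF q] unfolding symbol_iso_def by simp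
  have "inj (snd \<phi>)" using i1 unfolding heis_iso_def bij_betw_def by blast
  then have "inj ((*v) g)" unfolding inj_def g by metis
  then obtain h where hg: "h ** g = mat 1" using matrix_left_invertible_injective by blast
  then have gh: "g ** h = mat 1" using matrix_left_right_inverse by blast
  have \<psi>: "snd \<phi> = (\<lambda>x. snd \<phi>\<^sub>0 (g *v x))" using g by blast
  have P: "(\<lambda>k. (*v) (h ** deriv_at J q k ** g)) ` holK C q = g0_pos S"
    and N: "(\<lambda>k. (*v) (h ** deriv_at J q k ** g)) ` holKbar C q = g0_neg S"
    using \<phi> frame_conj[OF q gh hg] unfolding symbol_iso_def \<psi> by auto
  have "J q *v (g *v x) = g *v (J0 *v x)" for x
  proof -
    obtain a b where ab: "a \<in> gm1_neg S" "b \<in> gm1_pos S" "x = a + b" by (rule J0_split)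
    have "snd \<phi>\<^sub>0 (g *v a) \<in> gm1_neg_at C q" "snd \<phi>\<^sub>0 (g *v b) \<in> gm1_pos_at C q"
      using \<phi> ab(1,2) unfolding symbol_iso_def g[symmetric] by blast+
    then have "J q *v (g *v a) = - (g *v a)" "J q *v (g *v b) = g *v b"
      using eig_pos[OF fibreD(1,2)[OF q]] eig_neg[OF fibreD(1,2)[OF q]] by blast+
    moreover have "J0 *v a = - a" "J0 *v b = b" using ab Jpos Jneg by auto
    ultimately show ?thesis
      unfolding ab(3) by (simp add: matrix_vector_right_distrib matrix_vector_mult_diff_distrib)
  qed
  then have "J q ** g = g ** J0" by (simp add: matrix_eq matrix_vector_mul_assoc[symmetric])
  then have Jq: "g ** J0 ** h = J q" using matrix_cancel(1)[OF gh, of "J q"] by simp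
  have "(\<lambda>B. g ** B ** h) ` G0 = ran q"
  proof (intro subset_antisym subsetI)
    fix M assume "M \<in> (\<lambda>B. g ** B ** h) ` G0"
    then obtain B where B: "B \<in> G0" "M = g ** B ** h" by blast
    obtain a b where ab: "(*v) a \<in> g0_neg S" "(*v) b \<in> g0_pos S" "B = a + b" by (rule G0_split[OF B(1)])
    obtain l where l: "l \<in> holKbar C q" "a = h ** deriv_at J q l ** g" using ab(1) unfolding N[symmetric] by (auto simp: matrix_fun_inject)
    obtain k where k: "k \<in> holK C q" "b = h ** deriv_at J q k ** g" using ab(2) unfolding P[symmetric] by (auto simp: matrix_fun_inject)
    have "M = g ** a ** h + g ** b ** h" unfolding B(2) ab(3) by (simp add: matrix_expand)
    also have "\<dots> = deriv_at J q k + deriv_at J q l"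
      using conj_swap[OF gh hg, of a "deriv_at J q l"] conj_swap[OF gh hg, of b "deriv_at J q k"] l k by simp
    finally show "M \<in> ran q" using ranI[OF q k(1) l(1)] by simp
  next
    fix M assume "M \<in> ran q"
    then obtain k l where kl: "k \<in> holK C q" "l \<in> holKbar C q" "M = deriv_at J q k + deriv_at J q l" by (rule ranE[OF q])
    let ?a = "h ** deriv_at J q l ** g" and ?b = "h ** deriv_at J q k ** g"
    have "?a + ?b \<in> G0" by (rule G0I) (use N P kl in blast)+
    moreover have "M = g ** (?a + ?b) ** h"
      unfolding kl(3) using conj_swap[OF gh hg, of ?a "deriv_at J q l"] conj_swap[OF gh hg, of ?b "deriv_at J q k"]
      by (simp add: matrix_add_ldistrib matrix_add_rdistrib add.commute)
    ultimately show "M \<in> (\<lambda>B. g ** B ** h) ` G0" by blast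
  qed
  then show ?thesis unfolding carries_def using gh hg Jq frame_similitude[OF q \<phi> g] by blast
qed

text \<open>The missing degree -2 component is that of \<open>\<phi>\<^sub>0\<close> rescaled by the
  similitude factor of \<open>g\<close>; the two halves of degree 0 are recovered from
  \<open>ran q\<close> as eigenspaces of left multiplication by \<open>J q\<close>.\<close>

lemma carries_frame:
  assumes q: "q \<in> fibre" and c: "carries (form S) g h J0 G0 (J q) (ran q)"
  shows "\<exists>f. symbol_iso C S q (f, \<lambda>x. snd \<phi>\<^sub>0 (g *v x))"
proof -
  have gh: "g ** h = mat 1" and hg: "h ** g = mat 1" and g: "g \<in> csp_group (form S)"
    and Jq: "g ** J0 ** h = J q" and ran: "(\<lambda>B. g ** B ** h) ` G0 = ran q"
    using c unfolding carries_def by blast+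
  let ?\<psi> = "\<lambda>x. snd \<phi>\<^sub>0 (g *v x)"
  have ghx: "g *v (h *v x) = x" "h *v (g *v x) = x" for x using gh hg by (simp_all add: matrix_vector_mul_assoc)
  obtain c where c: "c \<noteq> 0" "\<And>x y. form S (g *v x) (g *v y) = c * form S x y" using g unfolding csp_group_def by blast
  have i0: "heis_iso C S \<gamma> \<phi>\<^sub>0" using iso unfolding symbol_iso_def by blast
  obtain t0 where t0: "\<And>z. fst \<phi>\<^sub>0 z = (z *s t0) +o contactD C \<gamma>" using i0 unfolding heis_iso_def by blast
  have b0: "bij_betw (fst \<phi>\<^sub>0) UNIV (range (\<lambda>v. v +o contactD C \<gamma>))" using i0 unfolding heis_iso_def by blast
  let ?f = "\<lambda>z. fst \<phi>\<^sub>0 (c * z)"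
  have "bij_betw (fst \<phi>\<^sub>0 \<circ> (*) c) UNIV (range (\<lambda>v. v +o contactD C \<gamma>))"
  proof (rule bij_betw_trans[OF _ b0])
    show "bij_betw ((*) c) UNIV UNIV" using c(1) by (intro bij_betw_byWitness[where f' = "\<lambda>z. z / c"]) auto
  qed
  then have bf: "bij_betw ?f UNIV (range (\<lambda>v. v +o contactD C \<gamma>))" by (simp add: comp_def)
  have "bij_betw (snd \<phi>\<^sub>0 \<circ> (*v) g) UNIV (contactD C \<gamma>)"
  proof (rule bij_betw_trans[OF _ iso_bij])
    show "bij_betw ((*v) g) UNIV UNIV" using ghx by (intro bij_betw_byWitness[where f' = "(*v) h"]) auto
  qed
  then have b\<psi>: "bij_betw ?\<psi> UNIV (contactD C \<gamma>)" by (simp add: comp_def)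
  have l\<psi>: "clinear ?\<psi>"
    using Vector_Spaces.linear_compose[OF matrix_vector_mul_linear_gen[of g] iso_linear] by (simp add: comp_def)
  have t: "?f z = (z *s (c *s t0)) +o contactD C \<gamma>" for z
    unfolding t0 by (simp add: mult.commute)
  have br: "?f (form S x y) = heis_bracket C \<gamma> (?\<psi> x) (?\<psi> y)" for x y
    using i0 unfolding heis_iso_def c(2)[symmetric] by blast
  have c1: "heis_iso C S \<gamma> (?f, ?\<psi>)"
    unfolding heis_iso_def fst_conv snd_conv using t bf b\<psi> l\<psi> br by blast
  have JG: "J q *v (g *v x) = g *v (J0 *v x)" for x
    unfolding Jq[symmetric] by (simp add: matrix_vector_mul_assoc[symmetric] ghx)
  have hJ: "J0 *v (h *v x) = h *v (J q *v x)" for x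
    using JG[of "h *v x"] ghx by metis
  have c2: "?\<psi> ` gm1_pos S = gm1_pos_at C q"
  proof (intro subset_antisym subsetI)
    fix z assume "z \<in> ?\<psi> ` gm1_pos S"
    then obtain x where x: "x \<in> gm1_pos S" "z = ?\<psi> x" by blast
    have "J q *v (g *v x) = g *v x" unfolding JG using Jpos[of x] x(1) by simp
    then show "z \<in> gm1_pos_at C q" using eig_pos[OF fibreD(1,2)[OF q]] x(2) by simp
  next
    fix z assume z: "z \<in> gm1_pos_at C q"
    have "z = ?\<psi> (h *v (R *v z))" using ghx R(2)[OF gm1_contact[OF fibreD(3,2)[OF q]]] z by simp
    moreover have "h *v (R *v z) \<in> gm1_pos S" using hJ[of "R *v z"] R_pos[OF q z] Jpos by simp
    ultimately show "z \<in> ?\<psi> ` gm1_pos S" by blast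
  qed
  have c3: "?\<psi> ` gm1_neg S = gm1_neg_at C q"
  proof (intro subset_antisym subsetI)
    fix z assume "z \<in> ?\<psi> ` gm1_neg S"
    then obtain x where x: "x \<in> gm1_neg S" "z = ?\<psi> x" by blast
    have "J q *v (g *v x) = - (g *v x)" unfolding JG using Jneg[of x] x(1) by (simp add: vec.linear_neg)
    then show "z \<in> gm1_neg_at C q" using eig_neg[OF fibreD(1,2)[OF q]] x(2) by simp
  next
    fix z assume z: "z \<in> gm1_neg_at C q"
    have "z = ?\<psi> (h *v (R *v z))" using ghx R(2)[OF gm1_contact[OF fibreD(3,2)[OF q]]] z by simp
    moreover have "h *v (R *v z) \<in> gm1_neg S" using hJ[of "R *v z"] R_neg[OF q z] Jneg by (simp add: vec.linear_neg)
    ultimately show "z \<in> ?\<psi> ` gm1_neg S" by blast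
  qed
  have block: "J0 ** B = B \<longleftrightarrow> J q ** (g ** B ** h) = g ** B ** h"
    "J0 ** B = - B \<longleftrightarrow> J q ** (g ** B ** h) = - (g ** B ** h)" for B
  proof -
    have "J q ** (g ** B ** h) = g ** (J0 ** B) ** h"
    proof -
      have "J q ** g = g ** J0" using JG by (simp add: matrix_eq matrix_vector_mul_assoc[symmetric])
      then show ?thesis by (simp add: matrix_mul_assoc)
    qed
    moreover have "g ** A ** h = g ** B ** h \<longleftrightarrow> A = B" for A B
      using conj_swap[OF gh hg, of A "g ** B ** h"] conj_swap[OF gh hg, of B "g ** B ** h"] by auto
    moreover have "- (g ** B ** h) = g ** (- B) ** h" by (simp add: matrix_minus_simps)
    ultimately show "J0 ** B = B \<longleftrightarrow> J q ** (g ** B ** h) = g ** B ** h"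
      "J0 ** B = - B \<longleftrightarrow> J q ** (g ** B ** h) = - (g ** B ** h)" by simp_all
  qed
  have mem: "B \<in> G0 \<longleftrightarrow> g ** B ** h \<in> ran q" for B
  proof
    assume "g ** B ** h \<in> ran q"
    then obtain B' where B': "B' \<in> G0" "g ** B ** h = g ** B' ** h" unfolding ran[symmetric] by blast
    have "B = B'" using conj_swap[OF gh hg, of B "g ** B ** h"] conj_swap[OF gh hg, of B' "g ** B ** h"] B'(2) by simp
    then show "B \<in> G0" using B'(1) by simp
  qed (use ran in blast)
  have P: "(*v) B \<in> g0_pos S \<longleftrightarrow> (\<exists>k\<in>holK C q. B = h ** deriv_at J q k ** g)" for B
    unfolding pos_iff mem block(1) ran_pos[OF q] conj_swap[OF gh hg] ..
  have N: "(*v) B \<in> g0_neg S \<longleftrightarrow> (\<exists>k\<in>holKbar C q. B = h ** deriv_at J q k ** g)" for B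
    unfolding neg_iff mem block(2) ran_neg[OF q] conj_swap[OF gh hg] ..
  have c4: "(\<lambda>A. inv ?\<psi> \<circ> A \<circ> ?\<psi>) ` g0_pos_at C q = g0_pos S"
    unfolding frame_conj(1)[OF q gh hg]
  proof (intro subset_antisym subsetI)
    fix A assume "A \<in> g0_pos S"
    then have m: "(*v) (matrix A) \<in> g0_pos S" and A: "(*v) (matrix A) = A" using matrix_pos_iff[of A] by auto
    obtain k where k: "k \<in> holK C q" "matrix A = h ** deriv_at J q k ** g" using m P by blast
    show "A \<in> (\<lambda>k. (*v) (h ** deriv_at J q k ** g)) ` holK C q"
      by (rule image_eqI[OF _ k(1)]) (simp only: k(2)[symmetric] A)
  next
    fix A assume "A \<in> (\<lambda>k. (*v) (h ** deriv_at J q k ** g)) ` holK C q"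
    then obtain k where k: "k \<in> holK C q" "A = (*v) (h ** deriv_at J q k ** g)" by blast
    show "A \<in> g0_pos S" unfolding k(2) P using k(1) by blast
  qed
  have c5: "(\<lambda>A. inv ?\<psi> \<circ> A \<circ> ?\<psi>) ` g0_neg_at C q = g0_neg S"
    unfolding frame_conj(2)[OF q gh hg]
  proof (intro subset_antisym subsetI)
    fix A assume "A \<in> g0_neg S"
    then have m: "(*v) (matrix A) \<in> g0_neg S" and A: "(*v) (matrix A) = A" using matrix_pos_iff[of A] by auto
    obtain k where k: "k \<in> holKbar C q" "matrix A = h ** deriv_at J q k ** g" using m N by blast
    show "A \<in> (\<lambda>k. (*v) (h ** deriv_at J q k ** g)) ` holKbar C q"
      by (rule image_eqI[OF _ k(1)]) (simp only: k(2)[symmetric] A)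
  next
    fix A assume "A \<in> (\<lambda>k. (*v) (h ** deriv_at J q k ** g)) ` holKbar C q"
    then obtain k where k: "k \<in> holKbar C q" "A = (*v) (h ** deriv_at J q k ** g)" by blast
    show "A \<in> g0_neg S" unfolding k(2) N using k(1) by blast
  qed
  have "symbol_iso C S q (?f, ?\<psi>)"
    unfolding symbol_iso_def fibreD(2)[OF q] fst_conv snd_conv by (intro conjI c1 c2 c3 c4 c5)
  then show ?thesis by blast
qed

lemma frame_matrix:
  assumes q: "q \<in> fibre" and \<phi>: "symbol_iso C S q \<phi>"
  shows "snd \<phi> x = snd \<phi>\<^sub>0 (matrix (\<lambda>x. R *v snd \<phi> x) *v x)"
proof -
  have i1: "heis_iso C S \<gamma> \<phi>" using \<phi> fibreD(2)[OF q] unfolding symbol_iso_def by simp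
  then have l: "clinear (snd \<phi>)" and b: "snd \<phi> x \<in> contactD C \<gamma>" unfolding heis_iso_def bij_betw_def by blast+
  have "clinear (\<lambda>x. R *v snd \<phi> x)"
    using Vector_Spaces.linear_compose[OF l matrix_vector_mul_linear_gen[of R]] by (simp add: comp_def)
  then show ?thesis using matrix_works R(2)[OF b] by metis
qed

lemma frame_exists: "q \<in> fibre \<Longrightarrow> \<exists>g h. carries (form S) g h J0 G0 (J q) (ran q)"
proof -
  assume q: "q \<in> fibre"
  obtain \<phi> where \<phi>: "symbol_iso C S q \<phi>" using const[OF fibreD(3)[OF q]] by blast
  show ?thesis using frame_carries[OF q \<phi> frame_matrix[OF q \<phi>]] by blast
qed

text \<open>The dimension count behind nondegeneracy: \<open>holK C q\<close> and \<open>g0_pos S\<close> both have dimension \<open>r\<close>.\<close>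

lemma dJ_injective:
  assumes q: "q \<in> fibre" and v: "dproj C q v = 0" and z: "deriv_at J q v = 0"
  shows "v = 0"
proof -
  obtain k l where kl: "k \<in> holK C q" "l \<in> holKbar C q" "v = k + l"
    by (rule pos.kernel_split[OF fibreD(3)[OF q] v]) (rule that)
  have s: "deriv_at J q k + deriv_at J q l = 0" using z deriv_J_add[OF q] kl(3) by simp
  then have "J q ** (deriv_at J q k + deriv_at J q l) = 0" by (simp add: matrix_eq matrix_vector_mul_assoc[symmetric])
  then have d: "deriv_at J q k - deriv_at J q l = 0" using dJ_block[OF q] kl by (simp add: matrix_add_ldistrib)
  have zk: "deriv_at J q k = 0" using s d by (simp add: vec_eq_iff)
  then have zl: "deriv_at J q l = 0" using s by simp
  obtain \<phi> where \<phi>: "symbol_iso C S q \<phi>" using const[OF fibreD(3)[OF q]] by blast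
  define g where "g = matrix (\<lambda>x. R *v snd \<phi> x)"
  have g: "snd \<phi> x = snd \<phi>\<^sub>0 (g *v x)" for x unfolding g_def by (rule frame_matrix[OF q \<phi>])
  obtain h where h: "carries (form S) g h J0 G0 (J q) (ran q)" using frame_carries[OF q \<phi> g] by blast
  then have gh: "g ** h = mat 1" "h ** g = mat 1" unfolding carries_def by auto
  have \<psi>: "snd \<phi> = (\<lambda>x. snd \<phi>\<^sub>0 (g *v x))" using g by blast
  define T where "T k = (*v) (h ** deriv_at J q k ** g)" for k
  have P: "T ` holK C q = g0_pos S" and N: "T ` holKbar C q = g0_neg S"
    using \<phi> frame_conj[OF q gh] unfolding symbol_iso_def \<psi> T_def by auto
  have T: "Vector_Spaces.linear (*s) endo_scale T"
    unfolding Vector_Spaces.linear_iff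
  proof (intro conjI allI vec.vector_space_axioms endo_vector_space)
    show "T (x + y) = T x + T y" for x y
      unfolding T_def deriv_J_add[OF q] by (simp add: fun_eq_iff matrix_add_ldistrib matrix_add_rdistrib matrix_vector_mult_add_rdistrib)
    show "T (c *s x) = endo_scale c (T x)" for c x
    proof
      fix y show "T (c *s x) y = c *s T x y"
        unfolding T_def matrix_vector_mul_assoc[symmetric] mhol_deriv_scale[OF JV fibreD(1)[OF q]] by (rule vec.linear_scale[OF matrix_vector_mul_linear_gen])
    qed
  qed
  have T0: "T k = 0" "T l = 0" unfolding T_def zk zl by (simp_all add: fun_eq_iff flip: matrix_vector_mul_assoc)
  note sub = subbundle_subspace[OF pos.sK fibreD(3)[OF q]] subbundle_subspace[OF pos.sL fibreD(3)[OF q]]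
  have "k = 0"
    by (rule linear_kernel_trivial[OF T sub(1) _ kl(1) T0(1)])
      (simp only: P dim0 subbundle_dim[OF pos.sK fibreD(3)[OF q]])
  moreover have "l = 0"
    by (rule linear_kernel_trivial[OF T sub(2) _ kl(2) T0(2)])
      (simp only: N dim0 subbundle_dim[OF pos.sL fibreD(3)[OF q]])
  ultimately show ?thesis using kl(3) by simp
qed

end

section \<open>Curves of frames\<close>

lemma mhol_continuous_on: "mhol F U \<Longrightarrow> continuous_on U F"
  by (intro continuous_at_imp_continuous_on ballI) (meson mhol_has_derivative has_derivative_continuous)

lemma C1_bounded_linear:
  assumes L: "bounded_linear L" and f: "f C1_differentiable_on I"
  shows "(\<lambda>t. L (f t)) C1_differentiable_on I"
proof -
  obtain D where D: "\<And>t. t \<in> I \<Longrightarrow> (f has_vector_derivative D t) (at t)" "continuous_on I D"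
    using f unfolding C1_differentiable_on_def by blast
  show ?thesis unfolding C1_differentiable_on_def
  proof (intro exI[of _ "\<lambda>t. L (D t)"] conjI ballI)
    show "((\<lambda>t. L (f t)) has_vector_derivative L (D t)) (at t)" if "t \<in> I" for t
      by (rule bounded_linear.has_vector_derivative[OF L D(1)[OF that]])
    show "continuous_on I (\<lambda>t. L (D t))" by (rule bounded_linear.continuous_on[OF L D(2)])
  qed
qed

lemma vhol_clinear: "vhol F U \<Longrightarrow> p \<in> U \<Longrightarrow> clinear (deriv_at F p)"
  using linear_add[OF has_derivative_linear[OF vhol_has_derivative[of F U p]]]
  unfolding Vector_Spaces.linear_iff
  by (intro conjI allI vec.vector_space_axioms vhol_deriv_scale[of F U p]) blast+

lemma C1_vhol:
  assumes F: "vhol F U" and f: "f C1_differentiable_on I" and sub: "\<And>t. t \<in> I \<Longrightarrow> f t \<in> U"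
  shows "(\<lambda>t. F (f t)) C1_differentiable_on I"
proof -
  obtain D where D: "\<And>t. t \<in> I \<Longrightarrow> (f has_vector_derivative D t) (at t)" "continuous_on I D"
    using f unfolding C1_differentiable_on_def by blast
  have cf: "continuous_on I f"
    using D(1) by (intro continuous_at_imp_continuous_on ballI) (blast intro: has_vector_derivative_continuous)
  show ?thesis unfolding C1_differentiable_on_def
  proof (intro exI[of _ "\<lambda>t. matrix (deriv_at F (f t)) *v D t"] conjI ballI)
    fix t assume t: "t \<in> I"
    have "((\<lambda>t. F (f t)) has_vector_derivative deriv_at F (f t) (D t)) (at t)"
      using has_derivative_compose[OF D(1)[OF t, unfolded has_vector_derivative_def] vhol_has_derivative[OF F sub[OF t]]]
        linear_cmul[OF has_derivative_linear[OF vhol_has_derivative[OF F sub[OF t]]]]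
      unfolding has_vector_derivative_def by simp
    then show "((\<lambda>t. F (f t)) has_vector_derivative matrix (deriv_at F (f t)) *v D t) (at t)"
      unfolding matrix_works[OF vhol_clinear[OF F sub[OF t]]] .
  next
    show "continuous_on I (\<lambda>t. matrix (deriv_at F (f t)) *v D t)"
      by (intro continuous_on_matrix_vector_mult D continuous_on_compose2[OF mhol_continuous_on[OF mhol_jacobian[OF F]] cf])
        (use sub in auto)
  qed
qed

lemma bounded_linear_matrix_vector: "bounded_linear ((*v) (A :: complex ^ 'a ^ 'b))"
  by (rule bounded_bilinear.bounded_linear_right[OF bounded_bilinear_matrix_vector_mult])

lemma matrix_curve:
  fixes F :: "real \<Rightarrow> complex ^ 'a \<Rightarrow> complex ^ 'b"
  assumes F: "\<And>y. (\<lambda>t. F t y) C1_differentiable_on I"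
  shows "(\<lambda>t. matrix (F t)) C1_differentiable_on I"
proof -
  obtain D where D: "\<And>y t. t \<in> I \<Longrightarrow> ((\<lambda>t. F t y) has_vector_derivative D y t) (at t)" "\<And>y. continuous_on I (D y)"
    using F unfolding C1_differentiable_on_def by metis
  show ?thesis unfolding C1_differentiable_on_def
  proof (intro exI[of _ "\<lambda>t. matrix (\<lambda>y. D y t)"] conjI ballI)
    fix t assume t: "t \<in> I"
    show "((\<lambda>t. matrix (F t)) has_vector_derivative matrix (\<lambda>y. D y t)) (at t)"
      unfolding has_vector_derivative_def has_derivative_vec_iff
    proof (intro allI)
      fix i j
      have "((\<lambda>t. F t (axis j 1) $ i) has_derivative (\<lambda>x. (x *\<^sub>R D (axis j 1) t) $ i)) (at t)"
        using D(1)[OF t, of "axis j 1"] unfolding has_vector_derivative_def has_derivative_vec_iff by blast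
      then show "((\<lambda>t. matrix (F t) $ i $ j) has_derivative (\<lambda>x. (x *\<^sub>R matrix (\<lambda>y. D y t)) $ i $ j)) (at t)"
        by (simp add: matrix_def)
    qed
  next
    show "continuous_on I (\<lambda>t. matrix (\<lambda>y. D y t))"
      unfolding matrix_def by (intro continuous_on_vec_lambda continuous_on_component D(2))
  qed
qed

lemma continuous_at_open_interval:
  fixes f :: "real \<Rightarrow> 'a::topological_space"
  assumes "isCont f 0" "open W" "f 0 \<in> W"
  obtains \<delta> where "\<delta> > 0" "\<And>t. \<bar>t\<bar> < \<delta> \<Longrightarrow> f t \<in> W"
proof -
  have "(f \<longlongrightarrow> f 0) (nhds 0)" using assms(1) unfolding isCont_def tendsto_at_iff_tendsto_nhds .
  from topological_tendstoD[OF this assms(2,3)] show ?thesis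
    unfolding eventually_nhds_metric by (auto simp: dist_real_def intro: that)
qed

text \<open>The fixed space of \<open>P\<close> parametrises the leaf near \<open>p\<close>. The set
  \<open>\<Gamma>\<close> stands for the common degree 0 part of the modified symbols;
  \<open>g0_mod_eq\<close> is the form in which their constancy enters.\<close>

locale leaf_chart = leaf_flag C n r S J0 p \<phi>\<^sub>0 V R J
  for C :: "('n::finite, 'm::finite) complexified" and n r :: nat and S :: "('s::finite) symbol_data"
    and J0 p \<phi>\<^sub>0 V R J +
  fixes P :: "complex ^ 'n ^ 'n" and N W :: "(complex ^ 'n) set" and \<kappa> \<Psi> :: "complex ^ 'n \<Rightarrow> complex ^ 'n"
    and \<Gamma> :: "(complex ^ 's \<Rightarrow> complex ^ 's) set"
  assumes N: "open N" "0 \<in> N" and W: "open W" "p \<in> W" "W \<subseteq> cmfd C" and \<kappa>N: "vhol \<kappa> N" and \<Psi>W: "vhol \<Psi> W"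
    and \<kappa>0: "\<kappa> 0 = p"
    and \<Psi>\<kappa>: "\<And>x. x \<in> N \<Longrightarrow> \<kappa> x \<in> W \<and> \<Psi> (\<kappa> x) = x" and \<kappa>\<Psi>: "\<And>q. q \<in> W \<Longrightarrow> \<Psi> q \<in> N \<and> \<kappa> (\<Psi> q) = q"
    and PP: "P ** P = P"
    and \<kappa>_fibre: "\<And>x. x \<in> N \<Longrightarrow> P *v x = x \<Longrightarrow> leafproj C (\<kappa> x) = leafproj C p"
    and \<Psi>_fibre: "\<And>q. q \<in> W \<Longrightarrow> leafproj C q = leafproj C p \<Longrightarrow> P *v \<Psi> q = \<Psi> q"
    and \<Psi>_kernel: "\<And>q v. q \<in> W \<Longrightarrow> dproj C q v = 0 \<Longrightarrow> P *v deriv_at \<Psi> q v = deriv_at \<Psi> q v"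
    and \<kappa>_kernel: "\<And>x v. x \<in> N \<Longrightarrow> P *v v = v \<Longrightarrow> P *v x = x \<Longrightarrow> dproj C (\<kappa> x) (deriv_at \<kappa> x v) = 0"
    and g0_mod_eq: "\<And>\<psi>. \<psi> \<in> P0 C S \<Longrightarrow> g0_mod C S \<psi> = \<Gamma>"
begin

text \<open>Inserting \<open>P\<close> spreads the leaf over an open subset of the full coordinate
  space, where derivatives in all directions exist. Directions killed by \<open>P\<close> do not
  move the base point; the condition \<open>degenerate\<close> of \<open>moving_flag\<close>
  accounts for them.\<close>

definition base :: "complex ^ 'n \<Rightarrow> complex ^ 'n" where "base x = \<kappa> (P *v x)"
definition U :: "(complex ^ 'n) set" where "U = {x. P *v x \<in> N \<and> base x \<in> V}"
definition Jb :: "complex ^ 'n \<Rightarrow> complex ^ 's ^ 's" where "Jb x = J (base x)"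
definition e where "e \<eta> x = deriv_at Jb x \<eta>"
definition e2 where "e2 \<xi> \<eta> x = deriv_at (e \<eta>) x \<xi>"
definition e3 where "e3 \<zeta> \<xi> \<eta> x = deriv_at (e2 \<xi> \<eta>) x \<zeta>"

lemma P_idem: "P *v (P *v x) = P *v x" using PP by (simp add: matrix_vector_mul_assoc)

lemma openU: "open U" and base_U: "vhol base U" and zero_U: "0 \<in> U"
proof -
  have o: "open ((*v) P -` N)"
    by (rule open_vimage[OF N(1) linear_continuous_on[OF bounded_linear_matrix_vector]])
  have b: "vhol base ((*v) P -` N)"
    unfolding base_def[abs_def]
    by (rule vhol_compose[OF \<kappa>N vhol_matrix_vector[OF mhol_const[OF o] vhol_id[OF o]]]) auto
  have "U = (*v) P -` N \<inter> base -` V" unfolding U_def by auto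
  then show U: "open U" using continuous_open_preimage[OF vhol_continuous_on[OF b] o V(1)] by simp
  show "vhol base U" by (rule vhol_subset[OF b U]) (auto simp: U_def)
  show "0 \<in> U" using N(2) V(2) \<kappa>0 unfolding U_def base_def by simp
qed

lemma base_fibre: "x \<in> U \<Longrightarrow> base x \<in> fibre"
  using \<kappa>_fibre[OF _ P_idem] unfolding U_def fibre_def base_def by auto

lemma Jb_U: "mhol Jb U"
  unfolding Jb_def[abs_def] by (rule mhol_compose[OF JV base_U]) (auto simp: U_def)

lemma e_U: "mhol (e \<eta>) U" and e2_U: "mhol (e2 \<xi> \<eta>) U"
proof -
  have 1: "mhol (e \<eta>) U" for \<eta> unfolding e_def[abs_def] by (rule mhol_deriv[OF Jb_U])
  then show "mhol (e \<eta>) U" .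
  show "mhol (e2 \<xi> \<eta>) U" unfolding e2_def[abs_def] by (rule mhol_deriv[OF 1])
qed

lemma base_deriv:
  assumes x: "x \<in> U"
  shows "(base has_derivative (\<lambda>\<xi>. deriv_at \<kappa> (P *v x) (P *v \<xi>))) (at x)"
proof -
  have "P *v x \<in> N" using x unfolding U_def by blast
  from has_derivative_compose[OF bounded_linear_imp_has_derivative[OF bounded_linear_matrix_vector] vhol_has_derivative[OF \<kappa>N this]]
  show ?thesis unfolding base_def[abs_def] .
qed

lemma e_eq:
  assumes x: "x \<in> U"
  shows "e \<xi> x = deriv_at J (base x) (deriv_at \<kappa> (P *v x) (P *v \<xi>))"
proof -
  have "(Jb has_derivative (\<lambda>\<xi>. deriv_at J (base x) (deriv_at \<kappa> (P *v x) (P *v \<xi>)))) (at x)"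
    unfolding Jb_def[abs_def]
    by (rule has_derivative_compose[OF base_deriv[OF x] mhol_has_derivative[OF JV fibreD(1)[OF base_fibre[OF x]]]])
  from deriv_at_eq[OF this] show ?thesis unfolding e_def by simp
qed

lemma chart_inverse:
  assumes x: "x \<in> U"
  shows "deriv_at \<kappa> (P *v x) (deriv_at \<Psi> (base x) v) = v" "deriv_at \<Psi> (base x) (deriv_at \<kappa> (P *v x) w) = w"
proof -
  have xN: "P *v x \<in> N" using x unfolding U_def by blast
  have bW: "base x \<in> W" "\<Psi> (base x) = P *v x" using \<Psi>\<kappa>[OF xN] unfolding base_def by auto
  note d\<kappa> = vhol_has_derivative[OF \<kappa>N xN] and d\<Psi> = vhol_has_derivative[OF \<Psi>W bW(1)]
  have 1: "((\<lambda>q. \<kappa> (\<Psi> q)) has_derivative (\<lambda>v. deriv_at \<kappa> (P *v x) (deriv_at \<Psi> (base x) v))) (at (base x))"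
    by (rule has_derivative_compose[OF d\<Psi>]) (simp only: bW(2) d\<kappa>)
  have "((\<lambda>q. \<kappa> (\<Psi> q)) has_derivative (\<lambda>v. v)) (at (base x))"
    by (rule has_derivative_transform_within_open[OF has_derivative_ident W(1) bW(1)]) (simp add: \<kappa>\<Psi>)
  from fun_cong[OF has_derivative_unique[OF 1 this]]
  show "deriv_at \<kappa> (P *v x) (deriv_at \<Psi> (base x) v) = v" .
  have 2: "((\<lambda>q. \<Psi> (\<kappa> q)) has_derivative (\<lambda>v. deriv_at \<Psi> (base x) (deriv_at \<kappa> (P *v x) v))) (at (P *v x))"
    by (rule has_derivative_compose[OF d\<kappa>]) (simp only: d\<Psi> flip: base_def)
  have "((\<lambda>q. \<Psi> (\<kappa> q)) has_derivative (\<lambda>v. v)) (at (P *v x))"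
    by (rule has_derivative_transform_within_open[OF has_derivative_ident N(1) xN]) (simp add: \<Psi>\<kappa>)
  from fun_cong[OF has_derivative_unique[OF 2 this]]
  show "deriv_at \<Psi> (base x) (deriv_at \<kappa> (P *v x) w) = w" .
qed

lemma direction_kernel:
  assumes x: "x \<in> U"
  shows "dproj C (base x) (deriv_at \<kappa> (P *v x) (P *v \<xi>)) = 0"
  unfolding base_def by (rule \<kappa>_kernel[OF _ P_idem P_idem]) (use x in \<open>simp add: U_def\<close>)

lemma range_e:
  assumes x: "x \<in> U"
  shows "range (\<lambda>\<eta>. e \<eta> x) = ran (base x)"
proof (intro subset_antisym subsetI)
  fix M assume "M \<in> range (\<lambda>\<eta>. e \<eta> x)"
  then show "M \<in> ran (base x)" unfolding ran_def using e_eq[OF x] direction_kernel[OF x] by blast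
next
  fix M assume "M \<in> ran (base x)"
  then obtain v where v: "dproj C (base x) v = 0" "M = deriv_at J (base x) v" unfolding ran_def by blast
  have bW: "base x \<in> W" using x \<Psi>\<kappa> unfolding U_def base_def by blast
  have "M = e (deriv_at \<Psi> (base x) v) x"
    unfolding e_eq[OF x] \<Psi>_kernel[OF bW v(1)] chart_inverse(1)[OF x] by (rule v(2))
  then show "M \<in> range (\<lambda>\<eta>. e \<eta> x)" by blast
qed

text \<open>By \<open>dJ_injective\<close> every nonzero leaf direction moves \<open>J\<close>, so
  the derivative can vanish only in directions killed by \<open>P\<close>.\<close>

lemma e_zero:
  assumes x: "x \<in> U" and z: "e \<xi> x = 0"
  shows "P *v \<xi> = 0"
proof -
  have "deriv_at \<kappa> (P *v x) (P *v \<xi>) = 0"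
    using z unfolding e_eq[OF x] by (intro dJ_injective[OF base_fibre[OF x] direction_kernel[OF x]])
  then have "deriv_at \<Psi> (base x) 0 = P *v \<xi>" using chart_inverse(2)[OF x, of "P *v \<xi>"] by simp
  moreover have "base x \<in> W" using x \<Psi>\<kappa> unfolding U_def base_def by blast
  ultimately show ?thesis using linear_0[OF has_derivative_linear[OF vhol_has_derivative[OF \<Psi>W]]] by metis
qed

definition velocities :: "complex ^ 'n \<Rightarrow> complex ^ 's ^ 's \<Rightarrow> (complex ^ 's ^ 's) set"
  where "velocities x g = {A. \<exists>\<epsilon>>0. \<exists>xc gc. xc 0 = x \<and> gc 0 = g \<and>
    (\<forall>t\<in>{-\<epsilon><..<\<epsilon>}. xc t \<in> U \<and> (\<exists>h. carries (form S) (gc t) h J0 G0 (Jb (xc t)) (range (\<lambda>\<eta>. e \<eta> (xc t))))) \<and>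
    xc C1_differentiable_on {-\<epsilon><..<\<epsilon>} \<and> gc C1_differentiable_on {-\<epsilon><..<\<epsilon>} \<and>
    (gc has_vector_derivative g ** A) (at 0)}"

lemma iso_matrix: "snd \<phi>\<^sub>0 x = matrix (snd \<phi>\<^sub>0) *v x"
  using matrix_works[OF iso_linear] by simp

lemma bounded_linear_frame: "bounded_linear (\<lambda>M. snd \<phi>\<^sub>0 (M *v y))"
proof -
  have "(\<lambda>M. snd \<phi>\<^sub>0 (M *v y)) = (\<lambda>M. matrix (snd \<phi>\<^sub>0) *v (M *v y))" by (rule ext) (rule iso_matrix)
  then show ?thesis
    using bounded_linear_compose[OF bounded_linear_matrix_vector bounded_bilinear.bounded_linear_left[OF bounded_bilinear_matrix_vector_mult]]
    by simp
qed

lemma iso_contact: "snd \<phi>\<^sub>0 x \<in> contactD C \<gamma>"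
  using iso_bij unfolding bij_betw_def by blast

lemma theta0_frame:
  fixes g h A :: "complex ^ 's ^ 's" and \<psi> :: "real \<Rightarrow> (complex ^ 'n) \<times> ('m, 's) frame"
  assumes gh: "g ** h = mat 1" "h ** g = mat 1" and \<psi>0: "snd (snd (\<psi> 0)) = (\<lambda>x. snd \<phi>\<^sub>0 (g *v x))"
    and ev: "\<delta> > 0" "\<And>t y. \<bar>t\<bar> < \<delta> \<Longrightarrow> snd (snd (\<psi> t)) y = snd \<phi>\<^sub>0 (gc t *v y)"
    and gc: "(gc has_vector_derivative g ** A) (at 0)"
  shows "theta0 \<psi> = (*v) A"
proof
  fix y
  have "((\<lambda>t. snd \<phi>\<^sub>0 (gc t *v y)) has_vector_derivative snd \<phi>\<^sub>0 ((g ** A) *v y)) (at 0)"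
    by (rule bounded_linear.has_vector_derivative[OF bounded_linear_frame gc])
  then have "((\<lambda>t. snd (snd (\<psi> t)) y) has_vector_derivative snd \<phi>\<^sub>0 ((g ** A) *v y)) (at 0)"
    by (rule has_vector_derivative_transform_within_open[where S = "{-\<delta><..<\<delta>}"]) (use ev in auto)
  then have "theta0 \<psi> y = inv (\<lambda>x. snd \<phi>\<^sub>0 (g *v x)) (snd \<phi>\<^sub>0 ((g ** A) *v y))"
    unfolding theta0_def \<psi>0 by (simp add: vector_derivative_at)
  also have "\<dots> = h *v ((g ** A) *v y)" unfolding inv_frame[OF gh iso_contact] R(1) ..
  also have "\<dots> = A *v y" using gh(2) by (simp add: matrix_vector_mul_assoc matrix_mul_assoc)
  finally show "theta0 \<psi> y = A *v y" .
qed

text \<open>The curve is shortened until its base points lie in the chart and in the domain of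
  \<open>J\<close>. There it lifts to the parameter space, and its degree -1 components become a C1
  curve of matrices.\<close>

lemma curve_of_frames:
  assumes x: "x \<in> U" and c: "carries (form S) g h J0 G0 (J (base x)) (ran (base x))"
    and \<psi>: "P0_curve C S \<gamma> \<psi>" "fst (\<psi> 0) = base x" "snd (snd (\<psi> 0)) = (\<lambda>y. snd \<phi>\<^sub>0 (g *v y))"
  shows "\<exists>A\<in>velocities x g. theta0 \<psi> = (*v) A"
proof -
  obtain \<epsilon> where \<epsilon>: "\<epsilon> > 0" "\<And>t. t \<in> {-\<epsilon><..<\<epsilon>} \<Longrightarrow> \<psi> t \<in> P0_over C S \<gamma>"
    "(\<lambda>t. fst (\<psi> t)) C1_differentiable_on {-\<epsilon><..<\<epsilon>}"
    "\<And>y. (\<lambda>t. snd (snd (\<psi> t)) y) C1_differentiable_on {-\<epsilon><..<\<epsilon>}"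
    using \<psi>(1) unfolding P0_curve_def by blast
  have xW: "base x \<in> V \<inter> W" using x \<Psi>\<kappa> unfolding U_def base_def by blast
  have "isCont (\<lambda>t. fst (\<psi> t)) 0"
    using \<epsilon>(1,3) unfolding C1_differentiable_on_def by (auto intro: has_vector_derivative_continuous)
  then obtain \<delta>0 where \<delta>0: "\<delta>0 > 0" "\<And>t. \<bar>t\<bar> < \<delta>0 \<Longrightarrow> fst (\<psi> t) \<in> V \<inter> W"
    using continuous_at_open_interval[of "\<lambda>t. fst (\<psi> t)" "V \<inter> W"] V(1) W(1) xW \<psi>(2) by auto
  define \<delta> where "\<delta> = min \<epsilon> \<delta>0"
  have \<delta>: "\<delta> > 0" "{-\<delta><..<\<delta>} \<subseteq> {-\<epsilon><..<\<epsilon>}" using \<epsilon>(1) \<delta>0(1) unfolding \<delta>_def by auto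
  have qt: "fst (\<psi> t) \<in> fibre" "fst (\<psi> t) \<in> W" "symbol_iso C S (fst (\<psi> t)) (snd (\<psi> t))" if "t \<in> {-\<delta><..<\<delta>}" for t
  proof -
    have "\<bar>t\<bar> < \<delta>0" using that unfolding \<delta>_def by auto
    then show "fst (\<psi> t) \<in> W" using \<delta>0(2) by blast
    have "\<psi> t \<in> P0_over C S \<gamma>" using \<epsilon>(2) \<delta>(2) that by blast
    then show "fst (\<psi> t) \<in> fibre" "symbol_iso C S (fst (\<psi> t)) (snd (\<psi> t))"
      using \<delta>0(2)[OF \<open>\<bar>t\<bar> < \<delta>0\<close>] unfolding P0_over_def P0_def fibre_def by auto
  qed
  \<comment> \<open>The constant \<open>x - P *v x\<close> is killed by \<open>P\<close>: it makes
    the lifted curve start at \<open>x\<close> and leaves its base points unchanged.\<close>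
  define xc where "xc t = \<Psi> (fst (\<psi> t)) + (x - P *v x)" for t
  define gc where "gc t = matrix (\<lambda>y. R *v snd (snd (\<psi> t)) y)" for t
  have Pxc: "P *v xc t = \<Psi> (fst (\<psi> t))" "base (xc t) = fst (\<psi> t)" "xc t \<in> U" if t: "t \<in> {-\<delta><..<\<delta>}" for t
  proof -
    show 1: "P *v xc t = \<Psi> (fst (\<psi> t))"
      unfolding xc_def matrix_vector_right_distrib matrix_vector_mult_diff_distrib P_idem
      using \<Psi>_fibre[OF qt(2)[OF t] fibreD(2)[OF qt(1)[OF t]]] by simp
    then show 2: "base (xc t) = fst (\<psi> t)" unfolding base_def using \<kappa>\<Psi>[OF qt(2)[OF t]] by simp
    show "xc t \<in> U" unfolding U_def using 1 2 \<kappa>\<Psi>[OF qt(2)[OF t]] fibreD(1)[OF qt(1)[OF t]] by simp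
  qed
  have gc: "snd (snd (\<psi> t)) y = snd \<phi>\<^sub>0 (gc t *v y)" if "t \<in> {-\<delta><..<\<delta>}" for t y
    unfolding gc_def by (rule frame_matrix[OF qt(1,3)[OF that]])
  have "\<Psi> (base x) = P *v x" using \<Psi>\<kappa> x unfolding U_def base_def by blast
  then have xc0: "xc 0 = x" unfolding xc_def \<psi>(2) by simp
  have gc0: "gc 0 = g" unfolding gc_def \<psi>(3) R(1) by simp
  have xcC: "xc C1_differentiable_on {-\<delta><..<\<delta>}"
    unfolding xc_def[abs_def]
    by (intro C1_differentiable_on_add C1_vhol[OF \<Psi>W C1_differentiable_on_subset[OF \<epsilon>(3) \<delta>(2)] qt(2)]) auto
  have gcC: "gc C1_differentiable_on {-\<delta><..<\<delta>}"
    unfolding gc_def[abs_def]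
    by (intro matrix_curve C1_bounded_linear[OF bounded_linear_matrix_vector] C1_differentiable_on_subset[OF \<epsilon>(4) \<delta>(2)])
  then obtain D where "(gc has_vector_derivative D) (at 0)"
    using \<delta>(1) unfolding C1_differentiable_on_def by fastforce
  moreover have gh: "g ** h = mat 1" "h ** g = mat 1" using c unfolding carries_def by auto
  ultimately have gD: "(gc has_vector_derivative g ** (h ** D)) (at 0)" using matrix_cancel(2)[OF gh(1)] by simp
  have "theta0 \<psi> = (*v) (h ** D)"
    by (rule theta0_frame[where \<delta> = \<delta> and gc = gc, OF gh \<psi>(3) \<delta>(1) gc gD]) auto
  moreover have "h ** D \<in> velocities x g"
    unfolding velocities_def
  proof (intro CollectI exI[of _ \<delta>] conjI exI[of _ xc] exI[of _ gc] ballI \<delta>(1) xc0 gc0 xcC gcC gD Pxc(3))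
    fix t assume t: "t \<in> {-\<delta><..<\<delta>}"
    show "\<exists>h. carries (form S) (gc t) h J0 G0 (Jb (xc t)) (range (\<lambda>\<eta>. e \<eta> (xc t)))"
      unfolding Jb_def range_e[OF Pxc(3)[OF t]] Pxc(2)[OF t] by (rule frame_carries[OF qt(1,3)[OF t] gc[OF t]])
  qed
  ultimately show ?thesis by blast
qed

lemma frames_of_curve:
  assumes x: "x \<in> U" and c: "carries (form S) g h J0 G0 (J (base x)) (ran (base x))"
    and \<phi>: "symbol_iso C S (base x) (f, \<lambda>y. snd \<phi>\<^sub>0 (g *v y))" and A: "A \<in> velocities x g"
  shows "\<exists>\<psi>. P0_curve C S \<gamma> \<psi> \<and> \<psi> 0 = (base x, f, \<lambda>y. snd \<phi>\<^sub>0 (g *v y)) \<and> theta0 \<psi> = (*v) A"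
proof -
  obtain \<epsilon> xc gc where \<epsilon>: "\<epsilon> > 0" and xc0: "xc 0 = x" and gc0: "gc 0 = g"
    and I: "\<And>t. t \<in> {-\<epsilon><..<\<epsilon>} \<Longrightarrow> xc t \<in> U"
      "\<And>t. t \<in> {-\<epsilon><..<\<epsilon>} \<Longrightarrow> \<exists>h. carries (form S) (gc t) h J0 G0 (Jb (xc t)) (range (\<lambda>\<eta>. e \<eta> (xc t)))"
    and xcC: "xc C1_differentiable_on {-\<epsilon><..<\<epsilon>}" and gcC: "gc C1_differentiable_on {-\<epsilon><..<\<epsilon>}"
    and gD: "(gc has_vector_derivative g ** A) (at 0)"
    using A unfolding velocities_def by blast
  have "\<exists>f. symbol_iso C S (base (xc t)) (f, \<lambda>y. snd \<phi>\<^sub>0 (gc t *v y))" if "t \<in> {-\<epsilon><..<\<epsilon>}" for t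
    using I(2)[OF that] carries_frame[OF base_fibre[OF I(1)[OF that]]]
    unfolding Jb_def range_e[OF I(1)[OF that]] by blast
  then obtain F where F: "\<And>t. t \<in> {-\<epsilon><..<\<epsilon>} \<Longrightarrow> symbol_iso C S (base (xc t)) (F t, \<lambda>y. snd \<phi>\<^sub>0 (gc t *v y))" by metis
  \<comment> \<open>At time 0 the degree -2 component has to be the prescribed \<open>f\<close>; the
    chosen \<open>F 0\<close> could be a different one.\<close>
  define \<psi> where "\<psi> t = (base (xc t), (if t = 0 then f else F t), \<lambda>y. snd \<phi>\<^sub>0 (gc t *v y))" for t
  have \<psi>0: "\<psi> 0 = (base x, f, \<lambda>y. snd \<phi>\<^sub>0 (g *v y))" unfolding \<psi>_def xc0 gc0 by simp
  have "P0_curve C S \<gamma> \<psi>"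
    unfolding P0_curve_def
  proof (intro exI[of _ \<epsilon>] conjI \<epsilon> ballI allI)
    fix t assume t: "t \<in> {-\<epsilon><..<\<epsilon>}"
    have "symbol_iso C S (fst (\<psi> t)) (snd (\<psi> t))"
    proof (cases "t = 0")
      case True then show ?thesis using \<psi>0 \<phi> by simp
    next
      case False then show ?thesis using F[OF t] unfolding \<psi>_def by simp
    qed
    then show "\<psi> t \<in> P0_over C S \<gamma>"
      using fibreD(2,3)[OF base_fibre[OF I(1)[OF t]]] unfolding P0_over_def P0_def \<psi>_def by auto
  next
    show "(\<lambda>t. fst (\<psi> t)) C1_differentiable_on {-\<epsilon><..<\<epsilon>}"
      unfolding \<psi>_def fst_conv by (rule C1_vhol[OF base_U xcC I(1)])
    show "(\<lambda>t. snd (snd (\<psi> t)) y) C1_differentiable_on {-\<epsilon><..<\<epsilon>}" for y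
      unfolding \<psi>_def snd_conv by (rule C1_bounded_linear[OF bounded_linear_frame gcC])
  qed
  moreover have "theta0 \<psi> = (*v) A"
  proof (rule theta0_frame[where h = h, OF _ _ _ \<epsilon> _ gD])
    show "g ** h = mat 1" "h ** g = mat 1" using c unfolding carries_def by auto
  qed (simp_all add: \<psi>_def gc0)
  ultimately show ?thesis using \<psi>0 by blast
qed

lemma \<Gamma>_eq:
  assumes x: "x \<in> U" and c: "carries (form S) g h J0 G0 (J (base x)) (ran (base x))"
  shows "\<Gamma> = (*v) ` velocities x g"
proof -
  note q = base_fibre[OF x]
  obtain f where f: "symbol_iso C S (base x) (f, \<lambda>y. snd \<phi>\<^sub>0 (g *v y))" using carries_frame[OF q c] by blast
  let ?\<psi> = "(base x, f, \<lambda>y. snd \<phi>\<^sub>0 (g *v y))"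
  have "?\<psi> \<in> P0 C S" unfolding P0_def using f fibreD(3)[OF q] by simp
  from g0_mod_eq[OF this] have \<Gamma>: "\<Gamma> = theta0 ` {\<psi>. P0_curve C S \<gamma> \<psi> \<and> \<psi> 0 = ?\<psi>}"
    unfolding g0_mod_def fst_conv fibreD(2)[OF q] by (rule sym)
  show ?thesis
  proof (intro subset_antisym subsetI)
    fix a assume "a \<in> \<Gamma>"
    then obtain \<psi> where \<psi>: "P0_curve C S \<gamma> \<psi>" "\<psi> 0 = ?\<psi>" "a = theta0 \<psi>" unfolding \<Gamma> by blast
    show "a \<in> (*v) ` velocities x g" using curve_of_frames[OF x c \<psi>(1)] \<psi>(2,3) by auto
  next
    fix a assume "a \<in> (*v) ` velocities x g"
    then obtain A where A: "A \<in> velocities x g" "a = (*v) A" by blast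
    obtain \<psi> where "P0_curve C S \<gamma> \<psi>" "\<psi> 0 = ?\<psi>" "theta0 \<psi> = (*v) A" using frames_of_curve[OF x c f A(1)] by blast
    then show "a \<in> \<Gamma>" unfolding \<Gamma> A(2) by force
  qed
qed

section \<open>The leaf as a moving flag, and the conclusions for the symbol\<close>

sublocale flag: moving_flag "form S" J0 G0 U Jb e e2 e3 "{A. (*v) A \<in> \<Gamma>}"
proof
  show "symplectic_form (form S)" by (rule symp)
  show "J0 ** J0 = mat 1" by (rule J0sq)
  show "form S (J0 *v x) (J0 *v y) = - form S x y" for x y by (rule J0csp)
  show "subspace G0" by (rule subspace_G0)
  show "J0 ** B = - (B ** J0)" if "B \<in> G0" for B by (rule G0anti[OF that])
  show "G0 \<subseteq> csp_mat (form S)" by (rule G0csp)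
  show "open U" by (rule openU)
  fix x assume x: "x \<in> U"
  show "(Jb has_derivative (\<lambda>\<eta>. e \<eta> x)) (at x)" unfolding e_def by (rule mhol_has_derivative[OF Jb_U x])
  show "(e \<eta> has_derivative (\<lambda>\<xi>. e2 \<xi> \<eta> x)) (at x)" for \<eta> unfolding e2_def by (rule mhol_has_derivative[OF e_U x])
  show "(e2 \<xi> \<eta> has_derivative (\<lambda>\<zeta>. e3 \<zeta> \<xi> \<eta> x)) (at x)" for \<xi> \<eta> unfolding e3_def by (rule mhol_has_derivative[OF e2_U x])
  show sym: "e2 \<xi> \<eta> x = e2 \<eta> \<xi> x" for \<xi> \<eta> unfolding e2_def e_def[abs_def] by (rule mhol_deriv_symmetric[OF Jb_U x])
  show "e3 \<zeta> \<xi> \<eta> x = e3 \<xi> \<zeta> \<eta> x" for \<zeta> \<xi> \<eta> unfolding e3_def e2_def[abs_def] by (rule mhol_deriv_symmetric[OF e_U x])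
  show "Jb x ** Jb x = mat 1" unfolding Jb_def by (rule JJ[OF fibreD(1)[OF base_fibre[OF x]]])
  show "Jb x ** e \<xi> x \<in> range (\<lambda>\<eta>. e \<eta> x)" for \<xi>
  proof -
    note q = base_fibre[OF x]
    have "e \<xi> x \<in> ran (base x)" using range_e[OF x] by blast
    then obtain k l where kl: "k \<in> holK C (base x)" "l \<in> holKbar C (base x)"
      "e \<xi> x = deriv_at J (base x) k + deriv_at J (base x) l" by (rule ranE[OF q])
    have l: "- l \<in> holKbar C (base x)" using vec.subspace_neg[OF subbundle_subspace[OF pos.sL fibreD(3)[OF q]] kl(2)] .
    have "Jb x ** e \<xi> x = deriv_at J (base x) k + deriv_at J (base x) (- l)"
      unfolding Jb_def kl(3) deriv_J_minus[OF q] by (simp add: matrix_add_ldistrib dJ_block[OF q] kl)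
    then show ?thesis unfolding range_e[OF x] using ranI[OF q kl(1) l] by simp
  qed
  show "e2 \<xi> \<eta> x = 0" if z: "e \<xi> x = 0" for \<xi> \<eta>
  proof -
    \<comment> \<open>Vanishing at one point forces \<open>P *v \<xi> = 0\<close>, hence vanishing
      of \<open>e \<xi>\<close> on all of \<open>U\<close>; its derivative is then 0, and symmetry
      exchanges the two directions.\<close>
    have "P *v \<xi> = 0" by (rule e_zero[OF x z])
    then have z': "e \<xi> y = 0" if "y \<in> U" for y
      unfolding e_eq[OF that] using linear_0[OF has_derivative_linear[OF vhol_has_derivative[OF \<kappa>N]], of "P *v y"]
        deriv_J_zero[OF base_fibre[OF that]] that by (simp add: U_def)
    have "(e \<xi> has_derivative (\<lambda>_. 0)) (at x)"
      by (rule has_derivative_transform_within_open[OF has_derivative_const[of 0] openU x]) (simp add: z')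
    from deriv_at_eq[OF this] have "e2 \<eta> \<xi> x = 0" unfolding e2_def by simp
    then show ?thesis by (simp add: sym)
  qed
  show "\<exists>g h. carries (form S) g h J0 G0 (Jb x) (range (\<lambda>\<eta>. e \<eta> x))"
    unfolding Jb_def range_e[OF x] by (rule frame_exists[OF base_fibre[OF x]])
  fix g h assume "carries (form S) g h J0 G0 (Jb x) (range (\<lambda>\<eta>. e \<eta> x))"
  then have "\<Gamma> = (*v) ` velocities x g" unfolding Jb_def range_e[OF x] by (rule \<Gamma>_eq[OF x])
  then have "{A. (*v) A \<in> \<Gamma>} = velocities x g" by (auto simp: matrix_fun_inject)
  then show "{A. (*v) A \<in> \<Gamma>} = {A. \<exists>\<epsilon>>0. \<exists>xc gc. xc 0 = x \<and> gc 0 = g \<and>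
    (\<forall>t\<in>{-\<epsilon><..<\<epsilon>}. xc t \<in> U \<and> (\<exists>h. carries (form S) (gc t) h J0 G0 (Jb (xc t)) (range (\<lambda>\<eta>. e \<eta> (xc t))))) \<and>
    xc C1_differentiable_on {-\<epsilon><..<\<epsilon>} \<and> gc C1_differentiable_on {-\<epsilon><..<\<epsilon>} \<and>
    (gc has_vector_derivative g ** A) (at 0)}" unfolding velocities_def .
qed

lemma \<Gamma>_symbol: "\<Gamma> = g0_neg S + g0_pos S + g00 S"
proof -
  have U: "U \<noteq> {}" using zero_U by blast
  obtain g h where c: "carries (form S) g h J0 G0 (J (base 0)) (ran (base 0))"
    using frame_exists[OF base_fibre[OF zero_U]] by blast
  have mat: "\<exists>A. a = (*v) A" if "a \<in> \<Gamma>" for a using that \<Gamma>_eq[OF zero_U c] by blast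
  have add: "(*v) (A + B) = (*v) A + (*v) B" for A B :: "complex ^ 's ^ 's"
    by (simp add: fun_eq_iff matrix_vector_mult_add_rdistrib)
  note eq = flag.velocities_eq[OF U]
  show ?thesis
  proof (intro subset_antisym subsetI)
    fix a assume a: "a \<in> \<Gamma>"
    then obtain M where M: "a = (*v) M" using mat by blast
    then have "M \<in> {A. (*v) A \<in> \<Gamma>}" using a by simp
    then obtain B A where BA: "M = B + A" "B \<in> G0" "A \<in> stab (form S) J0 G0" unfolding eq by blast
    show "a \<in> g0_neg S + g0_pos S + g00 S"
      unfolding M BA(1) add by (intro set_plus_intro) (use BA(2,3) g00_matrix in \<open>auto simp: G0_def\<close>)
  next
    fix a assume "a \<in> g0_neg S + g0_pos S + g00 S"
    then obtain b c where bc: "b \<in> g0_neg S + g0_pos S" "c \<in> g00 S" "a = b + c" by (rule set_plus_elim)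
    obtain f k where fk: "f \<in> g0_neg S" "k \<in> g0_pos S" "b = f + k" using bc(1) by (rule set_plus_elim)
    have b: "b = (*v) (matrix f + matrix k)" unfolding add fk(3) using matrix_pos_iff fk by simp
    have "clinear c" using bc(2) unfolding g00_def csp_def by blast
    then have c: "c = (*v) (matrix c)" by (simp add: fun_eq_iff matrix_works)
    have "matrix f + matrix k \<in> G0" unfolding G0_def using bc(1) b by simp
    moreover have "matrix c \<in> stab (form S) J0 G0" using g00_matrix bc(2) c by metis
    ultimately have "matrix f + matrix k + matrix c \<in> {A. (*v) A \<in> \<Gamma>}" unfolding eq by blast
    then have "(*v) (matrix f + matrix k + matrix c) \<in> \<Gamma>" by simp
    then show "a \<in> \<Gamma>" unfolding bc(3) by (subst b, subst c) (simp only: add)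
  qed
qed

text \<open>The commutator of two elements of \<open>G0\<close> commutes with \<open>J0\<close>, as
  each factor anticommutes with it, and it stabilises \<open>G0\<close> by
  \<open>symbol_lie_triple\<close>; hence it lies in the matrix form of \<open>g00\<close>.\<close>

lemma regular: "regular_symbol S"
  unfolding regular_symbol_def
proof (intro ballI)
  fix A B assume AB: "A \<in> g0_neg S" "B \<in> g0_pos S"
  have U: "U \<noteq> {}" using zero_U by blast
  let ?a = "matrix A" and ?b = "matrix B"
  have m: "(*v) ?a = A" "(*v) ?b = B" using matrix_pos_iff AB by blast+
  have ab: "?a \<in> G0" "?b \<in> G0" using neg_iff[of ?a] pos_iff[of ?b] m AB by auto
  have "?a ** ?b - ?b ** ?a \<in> stab (form S) J0 G0"
    unfolding stab_def
  proof (intro CollectI conjI ballI)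
    show "(?a ** ?b - ?b ** ?a) ** X - X ** (?a ** ?b - ?b ** ?a) \<in> G0" if "X \<in> G0" for X
      by (rule flag.symbol_lie_triple[OF U ab that])
    have "J0 ** (X ** Y) = (X ** Y) ** J0" if "X \<in> G0" "Y \<in> G0" for X Y
    proof -
      have "J0 ** (X ** Y) = - (X ** J0) ** Y" using G0anti[OF that(1)] by (simp add: matrix_mul_assoc)
      also have "\<dots> = - (X ** (J0 ** Y))" by (simp add: matrix_minus_simps matrix_mul_assoc)
      also have "\<dots> = X ** Y ** J0" unfolding G0anti[OF that(2)] by (simp add: matrix_minus_simps matrix_mul_assoc)
      finally show ?thesis .
    qed
    from this[OF ab] this[OF ab(2,1)]
    show "(?a ** ?b - ?b ** ?a) ** J0 = J0 ** (?a ** ?b - ?b ** ?a)" by (simp add: matrix_diff_simps)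
    obtain c where c: "\<And>x y. form S (?a *v x) y + form S x (?a *v y) = c * form S x y"
      using ab(1) G0csp unfolding csp_mat_def by blast
    obtain d where d: "\<And>x y. form S (?b *v x) y + form S x (?b *v y) = d * form S x y"
      using ab(2) G0csp unfolding csp_mat_def by blast
    \<comment> \<open>The conformal factors enter as scalars, so a commutator has conformal factor
      0.\<close>
    have "form S ((?a ** ?b - ?b ** ?a) *v x) y + form S x ((?a ** ?b - ?b ** ?a) *v y) = 0 * form S x y" for x y
    proof -
      have 1: "form S (?a *v (?b *v x)) y = c * form S (?b *v x) y - form S (?b *v x) (?a *v y)"
        "form S (?b *v (?a *v x)) y = d * form S (?a *v x) y - form S (?a *v x) (?b *v y)"
        "form S x (?a *v (?b *v y)) = c * form S x (?b *v y) - form S (?a *v x) (?b *v y)"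
        "form S x (?b *v (?a *v y)) = d * form S x (?a *v y) - form S (?b *v x) (?a *v y)"
        using c[of "?b *v x" y] d[of "?a *v x" y] c[of x "?b *v y"] d[of x "?a *v y"]
        by (simp_all add: eq_diff_eq add.commute)
      have 2: "form S (?a *v x) y = c * form S x y - form S x (?a *v y)"
        "form S (?b *v x) y = d * form S x y - form S x (?b *v y)"
        using c[of x y] d[of x y] by (simp_all add: eq_diff_eq)
      show ?thesis
        unfolding matrix_vector_mult_diff_rdistrib matrix_vector_mul_assoc[symmetric] symp_diff[OF symp] 1 2
        by (simp add: algebra_simps)
    qed
    then show "?a ** ?b - ?b ** ?a \<in> csp_mat (form S)" unfolding csp_mat_def by blast
  qed
  then show "commutator A B \<in> g00 S" unfolding g00_matrix[symmetric] commutator_matrix[symmetric] m .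
qed

end

theorem theorem5p2:
  fixes n r :: nat
    and M :: "(real ^ 'n) set"
    and H :: "real ^ 'n \<Rightarrow> (complex ^ 'n) set"
    and C :: "('n::finite, 'm::finite) complexified"
    and S :: "('s::finite) symbol_data"
    and gmod :: "((complex \<times> (complex ^ 's)) \<times> (complex ^ 's \<Rightarrow> complex ^ 's)) set"
  assumes "cr_structure n M H"
    and "levi_kernel_rank r M H"
    and "two_nondegenerate M H"
    and "complexification n r M H C"
    and "levi_leaf_space C"
    and "cr_symbol n r S"
    and "constant_symbol C S"
    and "constant_modified_symbol C S gmod"
  shows "regular_symbol S \<and> gmod = symbol_algebra S"
proof -
  note pairs = leaf_pairs[OF assms(1,4,5,6,7)]
  interpret pos: leaf_pair C "holH C" "holHbar C" "holK C" "holKbar C" n r by (rule pairs)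
  have const: "\<exists>\<phi>. symbol_iso C S q \<phi>" if "q \<in> cmfd C" for q
    using assms(7) that unfolding constant_symbol_def by blast
  obtain x where "x \<in> M" using assms(1) unfolding cr_structure_def by blast
  then obtain p where p: "p \<in> cmfd C" using assms(4) unfolding complexification_def by blast
  obtain \<phi> where \<phi>: "symbol_iso C S p \<phi>" using const[OF p] by blast
  obtain J0 where "graded_symbol n r S J0" by (rule graded_symbol_ex[OF assms(6)])
  then interpret leaf_bridge C n r S J0 p \<phi>
    using pairs p \<phi> by (intro leaf_bridge.intro leaf_bridge_axioms.intro)
  obtain V and R :: "complex ^ 'm ^ 's" and J :: "complex ^ 'n \<Rightarrow> complex ^ 's ^ 's" where flag: "leaf_flag C n r S J0 p \<phi> V R J"
    by (rule moving_splitting, rule that, intro leaf_flag.intro leaf_flag_axioms.intro leaf_bridge_axioms const; assumption)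
  then interpret leaf_flag C n r S J0 p \<phi> V R J .
  have UN: "UNIV \<times> g0_mod C S \<psi> = gmod" if "\<psi> \<in> P0 C S" for \<psi>
    using assms(8) that unfolding constant_modified_symbol_def modified_symbol_def by blast
  have \<phi>P: "(p, \<phi>) \<in> P0 C S" unfolding P0_def using p \<phi> by simp
  \<comment> \<open>The negative part of every modified symbol is the same nonempty set
    \<open>UNIV\<close>, so equal modified symbols have equal degree 0 parts.\<close>
  have g0: "g0_mod C S \<psi> = g0_mod C S (p, \<phi>)" if "\<psi> \<in> P0 C S" for \<psi>
    using trans[OF UN[OF that] UN[OF \<phi>P, symmetric]] by (simp only: times_eq_iff UNIV_not_empty) auto
  obtain P :: "complex ^ 'n ^ 'n" and N W \<kappa> \<Psi> where
    "leaf_chart C n r S J0 p \<phi> V R J P N W \<kappa> \<Psi> (g0_mod C S (p, \<phi>))"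
    by (rule fibre_chart[OF pos.hol p pos.surj[OF p]], rule that,
        intro leaf_chart.intro leaf_chart_axioms.intro flag g0; assumption)
  then interpret leaf_chart C n r S J0 p \<phi> V R J P N W \<kappa> \<Psi> "g0_mod C S (p, \<phi>)" .
  show ?thesis using regular \<Gamma>_symbol UN[OF \<phi>P] unfolding symbol_algebra_def by simp
qed

end
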